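(* Let $r\ge 0$ and let $S\subseteq\{0,1,\ldots,r\}$ be a subset containing $r$. The model category $(f\mathcal{C})_S$, with the tensor product of filtered chain complexes, is a closed symmetric monoidal model category.
   Context: Fix a commutative unital ring $R$. $f\mathcal{C}$ is the category of filtered chain complexes: an object is an unbounded, cohomologically graded chain complex $A$ of $R$-modules (differential $d$ of degree $+1$) with subcomplexes $F_pA$, $p\in\mathbb{Z}$, such that $F_pA\subseteq F_{p+1}A\subseteq A$; a morphism is a chain map $f$ with $f(F_pA)\subseteq F_pB$ for all $p$. For $k\ge 0$ put $Z_k^{p,p+n}(A)=F_pA^n\cap d^{-1}F_{p-k}A^{n+1}$, $B_0^{p,p+n}(A)=F_{p-1}A^n$, and for $k\ge1$, $B_k^{p,p+n}(A)=d\,Z_{k-1}^{p+k-1,p+k-1+n-1}(A)+Z_{k-1}^{p-1,p-1+n}(A)$. The $k$-page is $E_k^{p,p+n}(A)=Z_k^{p,p+n}(A)/B_k^{p,p+n}(A)$. An $r$-quasi-isomorphism is a morphism inducing an isomorphism on $E_{r+1}$. $R_{(p)}^n$ is the filtered chain complex with a copy of $R$ in degree $n$ and $0$ elsewhere, with $F_q=0$ for $q<p$ and $F_q=R$ for $q\ge p$. Set $\mathcal{Z}_k(p,n)=\bigl(R_{(p)}^n\xrightarrow{1}R_{(p-k)}^{n+1}\bigr)$, and for $k\ge 1$, $\mathcal{B}_k(p,n)=\mathcal{Z}_{k-1}(p+k-1,n-1)\oplus\mathcal{Z}_{k-1}(p-1,n)$, with $\varphi_k\colon\mathcal{Z}_k(p,n)\to\mathcal{B}_k(p,n)$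 the diagonal $R_{(p)}^n\to R_{(p)}^n\oplus R_{(p-1)}^n$ in degree $n$ and the identity in degree $n+1$. Let $I_r=\{\varphi_{r+1}\colon\mathcal{Z}_{r+1}(p,n)\to\mathcal{B}_{r+1}(p,n)\}_{p,n\in\mathbb{Z}}$, $J_k=\{0\to\mathcal{Z}_k(p,n)\}_{p,n\in\mathbb{Z}}$, $I_S=I_r\cup\bigcup_{s\in S}J_s$, $J_S=\bigcup_{s\in S}J_s$. $(f\mathcal{C})_S$ is the cofibrantly generated model structure on $f\mathcal{C}$ with weak equivalences the $r$-quasi-isomorphisms, generating cofibrations $I_S$ and generating acyclic cofibrations $J_S$. The symmetric monoidal structure on $f\mathcal{C}$ has $A\otimes B$ the usual tensor product of chain complexes, $d(a\otimes b)=da\otimes b+(-1)^{|a|}a\otimes db$, with $F_p(A\otimes B)=\sum_i\operatorname{im}(F_iA\otimes F_{p-i}B\to A\otimes B)$, unit $R_{(0)}^0$, and internal hom the usual hom complex $\underline{\mathrm{Hom}}(A,B)$ with $F_p\underline{\mathrm{Hom}}(A,B)^n$ the families $(f_m\colon A^m\to B^{m+n})_m$ with $f_m(F_qA^m)\subseteq F_{p+q}B^{m+n}$ for all $q$. A monoidal model category is a model category with a closed symmetric monoidal structure satisfying: (pushout-product axiom) for cofibrations $f\colon A\to B$, $g\colon C\to D$ the map $f\boxtimes g\colon A\otimes D\coprod_{A\otimes C}B\otimes C\to B\otimes D$ is a cofibration, acyclic if $f$ or $g$ is a weak equivalence; (unit axiom) there is a weak equivalence $Q\mathbb{S}\to\mathbb{S}$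 to the unit $\mathbb{S}$ with $Q\mathbb{S}$ cofibrant such that $Q\mathbb{S}\otimes X\to\mathbb{S}\otimes X\cong X$ is a weak equivalence for all cofibrant $X$. *)

theory Defs
  imports "HOL-Algebra.AbelCoset" "HOL-Algebra.Module"
begin

unbundle cardinal_syntax

section \<open>Categories, limits and colimits\<close>

record ('o, 'a) cat =
  Obj :: "'o set"
  Arr :: "'a set"
  Dom :: "'a \<Rightarrow> 'o"
  Cod :: "'a \<Rightarrow> 'o"
  Idt :: "'o \<Rightarrow> 'a"
  Cmp :: "'a \<Rightarrow> 'a \<Rightarrow> 'a"  (infixl \<open>\<cdot>\<index>\<close> 70)

definition homset :: "('o, 'a, 'm) cat_scheme \<Rightarrow> 'o \<Rightarrow> 'o \<Rightarrow> 'a set" where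
  "homset C X Y = {f \<in> Arr C. Dom C f = X \<and> Cod C f = Y}"

locale category =
  fixes C :: "('o, 'a, 'm) cat_scheme" (structure)
  assumes Dom_Obj: "f \<in> Arr C \<Longrightarrow> Dom C f \<in> Obj C"
    and Cod_Obj: "f \<in> Arr C \<Longrightarrow> Cod C f \<in> Obj C"
    and Idt_hom: "X \<in> Obj C \<Longrightarrow> Idt C X \<in> homset C X X"
    and Cmp_hom: "\<lbrakk>f \<in> homset C X Y; g \<in> homset C Y Z\<rbrakk> \<Longrightarrow> g \<cdot> f \<in> homset C X Z"
    and Cmp_Idt: "f \<in> homset C X Y \<Longrightarrow> f \<cdot> Idt C X = f"
    and Idt_Cmp: "f \<in> homset C X Y \<Longrightarrow> Idt C Y \<cdot> f = f"
    and Cmp_assoc: "\<lbrakk>f \<in> homset C W X; g \<in> homset C X Y; h \<in> homset C Y Z\<rbrakk>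
      \<Longrightarrow> h \<cdot> (g \<cdot> f) = (h \<cdot> g) \<cdot> f"

definition is_iso :: "('o, 'a, 'm) cat_scheme \<Rightarrow> 'a \<Rightarrow> bool" where
  "is_iso C f \<longleftrightarrow> f \<in> Arr C \<and> (\<exists>g \<in> homset C (Cod C f) (Dom C f).
     g \<cdot>\<^bsub>C\<^esub> f = Idt C (Dom C f) \<and> f \<cdot>\<^bsub>C\<^esub> g = Idt C (Cod C f))"

definition is_initial :: "('o, 'a, 'm) cat_scheme \<Rightarrow> 'o \<Rightarrow> bool" where
  "is_initial C I \<longleftrightarrow> I \<in> Obj C \<and> (\<forall>X \<in> Obj C. \<exists>!f. f \<in> homset C I X)"

definition is_functor ::
    "('i, 'k, 'l) cat_scheme \<Rightarrow> ('o, 'a, 'm) cat_scheme \<Rightarrow> ('i \<Rightarrow> 'o) \<Rightarrow> ('k \<Rightarrow> 'a) \<Rightarrow> bool" where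
  "is_functor J C F0 F1 \<longleftrightarrow>
     (\<forall>x \<in> Obj J. F0 x \<in> Obj C \<and> F1 (Idt J x) = Idt C (F0 x)) \<and>
     (\<forall>f \<in> Arr J. F1 f \<in> homset C (F0 (Dom J f)) (F0 (Cod J f))) \<and>
     (\<forall>f \<in> Arr J. \<forall>g \<in> Arr J. Dom J g = Cod J f \<longrightarrow> F1 (g \<cdot>\<^bsub>J\<^esub> f) = F1 g \<cdot>\<^bsub>C\<^esub> F1 f)"

definition is_cone where
  "is_cone J C F0 F1 L p \<longleftrightarrow> L \<in> Obj C \<and> (\<forall>x \<in> Obj J. p x \<in> homset C L (F0 x)) \<and>
     (\<forall>f \<in> Arr J. F1 f \<cdot>\<^bsub>C\<^esub> p (Dom J f) = p (Cod J f))"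

definition is_limit where
  "is_limit J C F0 F1 L p \<longleftrightarrow> is_cone J C F0 F1 L p \<and>
     (\<forall>L' p'. is_cone J C F0 F1 L' p' \<longrightarrow>
        (\<exists>!h. h \<in> homset C L' L \<and> (\<forall>x \<in> Obj J. p x \<cdot>\<^bsub>C\<^esub> h = p' x)))"

definition is_cocone where
  "is_cocone J C F0 F1 L q \<longleftrightarrow> L \<in> Obj C \<and> (\<forall>x \<in> Obj J. q x \<in> homset C (F0 x) L) \<and>
     (\<forall>f \<in> Arr J. q (Cod J f) \<cdot>\<^bsub>C\<^esub> F1 f = q (Dom J f))"

definition is_colimit where
  "is_colimit J C F0 F1 L q \<longleftrightarrow> is_cocone J C F0 F1 L q \<and>
     (\<forall>L' q'. is_cocone J C F0 F1 L' q' \<longrightarrow>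
        (\<exists>!h. h \<in> homset C L L' \<and> (\<forall>x \<in> Obj J. h \<cdot>\<^bsub>C\<^esub> q x = q' x)))"

text \<open>
  Index categories are taken with objects and arrows in the type \<^typ>\<open>'u\<close> on which
  smallness is measured; every small category has an isomorphic copy of this kind.
\<close>

definition bicomplete :: "('u set \<Rightarrow> bool) \<Rightarrow> ('o, 'a, 'm) cat_scheme \<Rightarrow> bool" where
  "bicomplete small C \<longleftrightarrow>
     (\<forall>(J :: ('u, 'u) cat) F0 F1.
        category J \<and> small (Obj J) \<and> small (Arr J) \<and> is_functor J C F0 F1 \<longrightarrow>
        (\<exists>L p. is_limit J C F0 F1 L p) \<and> (\<exists>L q. is_colimit J C F0 F1 L q))"

definition is_pushout :: "('o, 'a, 'm) cat_scheme \<Rightarrow> 'a \<Rightarrow> 'a \<Rightarrow> 'a \<Rightarrow> 'a \<Rightarrow> bool" where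
  "is_pushout C f g i j \<longleftrightarrow>
     f \<in> Arr C \<and> g \<in> Arr C \<and> i \<in> Arr C \<and> j \<in> Arr C \<and>
     Dom C f = Dom C g \<and> Dom C i = Cod C f \<and> Dom C j = Cod C g \<and> Cod C i = Cod C j \<and>
     i \<cdot>\<^bsub>C\<^esub> f = j \<cdot>\<^bsub>C\<^esub> g \<and>
     (\<forall>X. \<forall>u \<in> homset C (Cod C f) X. \<forall>v \<in> homset C (Cod C g) X. u \<cdot>\<^bsub>C\<^esub> f = v \<cdot>\<^bsub>C\<^esub> g \<longrightarrow>
        (\<exists>!h. h \<in> homset C (Cod C i) X \<and> h \<cdot>\<^bsub>C\<^esub> i = u \<and> h \<cdot>\<^bsub>C\<^esub> j = v))"


section \<open>Model categories\<close>

definition lifts :: "('o, 'a, 'm) cat_scheme \<Rightarrow> 'a \<Rightarrow> 'a \<Rightarrow> bool" where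
  "lifts C i p \<longleftrightarrow>
     (\<forall>u \<in> homset C (Dom C i) (Dom C p). \<forall>v \<in> homset C (Cod C i) (Cod C p).
        p \<cdot>\<^bsub>C\<^esub> u = v \<cdot>\<^bsub>C\<^esub> i \<longrightarrow>
        (\<exists>h \<in> homset C (Cod C i) (Dom C p). h \<cdot>\<^bsub>C\<^esub> i = u \<and> p \<cdot>\<^bsub>C\<^esub> h = v))"

definition llp :: "('o, 'a, 'm) cat_scheme \<Rightarrow> 'a set \<Rightarrow> 'a set" where
  "llp C K = {i \<in> Arr C. \<forall>p \<in> K. lifts C i p}"

definition rlp :: "('o, 'a, 'm) cat_scheme \<Rightarrow> 'a set \<Rightarrow> 'a set" where
  "rlp C K = {p \<in> Arr C. \<forall>i \<in> K. lifts C i p}"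

definition is_retract :: "('o, 'a, 'm) cat_scheme \<Rightarrow> 'a \<Rightarrow> 'a \<Rightarrow> bool" where
  "is_retract C f g \<longleftrightarrow> f \<in> Arr C \<and> g \<in> Arr C \<and>
     (\<exists>i \<in> homset C (Dom C f) (Dom C g). \<exists>r \<in> homset C (Dom C g) (Dom C f).
      \<exists>i' \<in> homset C (Cod C f) (Cod C g). \<exists>r' \<in> homset C (Cod C g) (Cod C f).
        r \<cdot>\<^bsub>C\<^esub> i = Idt C (Dom C f) \<and> r' \<cdot>\<^bsub>C\<^esub> i' = Idt C (Cod C f) \<and>
        g \<cdot>\<^bsub>C\<^esub> i = i' \<cdot>\<^bsub>C\<^esub> f \<and> f \<cdot>\<^bsub>C\<^esub> r = r' \<cdot>\<^bsub>C\<^esub> g)"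

locale model_category = category C
  for small :: "'u set \<Rightarrow> bool"
    and C :: "('o, 'a, 'm) cat_scheme" (structure)
    and W :: "'a set" and Cof :: "'a set" and Fib :: "'a set" +
  assumes bicomplete: "bicomplete small C"
    and classes: "W \<subseteq> Arr C" "Cof \<subseteq> Arr C" "Fib \<subseteq> Arr C"
    and two_of_three:
      "\<lbrakk>f \<in> Arr C; g \<in> Arr C; Dom C g = Cod C f; f \<in> W; g \<in> W\<rbrakk> \<Longrightarrow> g \<cdot> f \<in> W"
      "\<lbrakk>f \<in> Arr C; g \<in> Arr C; Dom C g = Cod C f; f \<in> W; g \<cdot> f \<in> W\<rbrakk> \<Longrightarrow> g \<in> W"
      "\<lbrakk>f \<in> Arr C; g \<in> Arr C; Dom C g = Cod C f; g \<in> W; g \<cdot> f \<in> W\<rbrakk> \<Longrightarrow> f \<in> W"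
    and retracts:
      "\<lbrakk>is_retract C f g; g \<in> W\<rbrakk> \<Longrightarrow> f \<in> W"
      "\<lbrakk>is_retract C f g; g \<in> Cof\<rbrakk> \<Longrightarrow> f \<in> Cof"
      "\<lbrakk>is_retract C f g; g \<in> Fib\<rbrakk> \<Longrightarrow> f \<in> Fib"
    and lifting:
      "\<lbrakk>i \<in> Cof \<inter> W; p \<in> Fib\<rbrakk> \<Longrightarrow> lifts C i p"
      "\<lbrakk>i \<in> Cof; p \<in> Fib \<inter> W\<rbrakk> \<Longrightarrow> lifts C i p"
    and factorization:
      "f \<in> Arr C \<Longrightarrow> \<exists>i \<in> Cof \<inter> W. \<exists>p \<in> Fib. Dom C p = Cod C i \<and> f = p \<cdot> i"
      "f \<in> Arr C \<Longrightarrow> \<exists>i \<in> Cof. \<exists>p \<in> Fib \<inter> W. Dom C p = Cod C i \<and> f = p \<cdot> i"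

definition cofibrant :: "('o, 'a, 'm) cat_scheme \<Rightarrow> 'a set \<Rightarrow> 'o \<Rightarrow> bool" where
  "cofibrant C Cof X \<longleftrightarrow> (\<exists>I i. is_initial C I \<and> i \<in> homset C I X \<and> i \<in> Cof)"


section \<open>Closed symmetric monoidal categories and monoidal model categories\<close>

record ('o, 'a) monoidal_cat = "('o, 'a) cat" +
  tensor_obj :: "'o \<Rightarrow> 'o \<Rightarrow> 'o"  (infixl \<open>\<otimes>\<^sub>o\<index>\<close> 75)
  tensor_arr :: "'a \<Rightarrow> 'a \<Rightarrow> 'a"  (infixl \<open>\<otimes>\<^sub>a\<index>\<close> 75)
  unit_obj :: 'o  (\<open>\<I>\<index>\<close>)
  assoc :: "'o \<Rightarrow> 'o \<Rightarrow> 'o \<Rightarrow> 'a"  (\<open>\<alpha>\<index>\<close>)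
  left_unit :: "'o \<Rightarrow> 'a"  (\<open>\<l>\<index>\<close>)
  right_unit :: "'o \<Rightarrow> 'a"  (\<open>\<r>\<index>\<close>)
  braid :: "'o \<Rightarrow> 'o \<Rightarrow> 'a"  (\<open>\<sigma>\<index>\<close>)
  inner_hom :: "'o \<Rightarrow> 'o \<Rightarrow> 'o"
  inner_eval :: "'o \<Rightarrow> 'o \<Rightarrow> 'a"

locale closed_symmetric_monoidal_category = category C
  for C :: "('o, 'a, 'm) monoidal_cat_scheme" (structure) +
  assumes tensor_Obj: "\<lbrakk>X \<in> Obj C; Y \<in> Obj C\<rbrakk> \<Longrightarrow> X \<otimes>\<^sub>o Y \<in> Obj C"
    and tensor_hom: "\<lbrakk>f \<in> homset C X X'; g \<in> homset C Y Y'\<rbrakk>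
      \<Longrightarrow> f \<otimes>\<^sub>a g \<in> homset C (X \<otimes>\<^sub>o Y) (X' \<otimes>\<^sub>o Y')"
    and tensor_Idt: "\<lbrakk>X \<in> Obj C; Y \<in> Obj C\<rbrakk> \<Longrightarrow> Idt C X \<otimes>\<^sub>a Idt C Y = Idt C (X \<otimes>\<^sub>o Y)"
    and tensor_Cmp: "\<lbrakk>f \<in> homset C X X'; f' \<in> homset C X' X'';
        g \<in> homset C Y Y'; g' \<in> homset C Y' Y''\<rbrakk>
      \<Longrightarrow> (f' \<cdot> f) \<otimes>\<^sub>a (g' \<cdot> g) = (f' \<otimes>\<^sub>a g') \<cdot> (f \<otimes>\<^sub>a g)"
    and unit_Obj: "\<I> \<in> Obj C"
    and assoc_iso: "\<lbrakk>X \<in> Obj C; Y \<in> Obj C; Z \<in> Obj C\<rbrakk>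
      \<Longrightarrow> is_iso C (\<alpha> X Y Z) \<and> \<alpha> X Y Z \<in> homset C ((X \<otimes>\<^sub>o Y) \<otimes>\<^sub>o Z) (X \<otimes>\<^sub>o (Y \<otimes>\<^sub>o Z))"
    and assoc_nat: "\<lbrakk>f \<in> homset C X X'; g \<in> homset C Y Y'; h \<in> homset C Z Z'\<rbrakk>
      \<Longrightarrow> \<alpha> X' Y' Z' \<cdot> ((f \<otimes>\<^sub>a g) \<otimes>\<^sub>a h) = (f \<otimes>\<^sub>a (g \<otimes>\<^sub>a h)) \<cdot> \<alpha> X Y Z"
    and left_iso: "X \<in> Obj C \<Longrightarrow> is_iso C (\<l> X) \<and> \<l> X \<in> homset C (\<I> \<otimes>\<^sub>o X) X"
    and left_nat: "f \<in> homset C X Y \<Longrightarrow> \<l> Y \<cdot> (Idt C \<I> \<otimes>\<^sub>a f) = f \<cdot> \<l> X"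
    and right_iso: "X \<in> Obj C \<Longrightarrow> is_iso C (\<r> X) \<and> \<r> X \<in> homset C (X \<otimes>\<^sub>o \<I>) X"
    and right_nat: "f \<in> homset C X Y \<Longrightarrow> \<r> Y \<cdot> (f \<otimes>\<^sub>a Idt C \<I>) = f \<cdot> \<r> X"
    and braid_hom: "\<lbrakk>X \<in> Obj C; Y \<in> Obj C\<rbrakk> \<Longrightarrow> \<sigma> X Y \<in> homset C (X \<otimes>\<^sub>o Y) (Y \<otimes>\<^sub>o X)"
    and braid_nat: "\<lbrakk>f \<in> homset C X X'; g \<in> homset C Y Y'\<rbrakk>
      \<Longrightarrow> \<sigma> X' Y' \<cdot> (f \<otimes>\<^sub>a g) = (g \<otimes>\<^sub>a f) \<cdot> \<sigma> X Y"
    and symmetry: "\<lbrakk>X \<in> Obj C; Y \<in> Obj C\<rbrakk> \<Longrightarrow> \<sigma> Y X \<cdot> \<sigma> X Y = Idt C (X \<otimes>\<^sub>o Y)"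
    and pentagon: "\<lbrakk>V \<in> Obj C; X \<in> Obj C; Y \<in> Obj C; Z \<in> Obj C\<rbrakk>
      \<Longrightarrow> \<alpha> V X (Y \<otimes>\<^sub>o Z) \<cdot> \<alpha> (V \<otimes>\<^sub>o X) Y Z
          = (Idt C V \<otimes>\<^sub>a \<alpha> X Y Z) \<cdot> \<alpha> V (X \<otimes>\<^sub>o Y) Z \<cdot> (\<alpha> V X Y \<otimes>\<^sub>a Idt C Z)"
    and triangle: "\<lbrakk>X \<in> Obj C; Y \<in> Obj C\<rbrakk>
      \<Longrightarrow> (Idt C X \<otimes>\<^sub>a \<l> Y) \<cdot> \<alpha> X \<I> Y = \<r> X \<otimes>\<^sub>a Idt C Y"
    and hexagon: "\<lbrakk>X \<in> Obj C; Y \<in> Obj C; Z \<in> Obj C\<rbrakk>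
      \<Longrightarrow> \<alpha> Y Z X \<cdot> \<sigma> X (Y \<otimes>\<^sub>o Z) \<cdot> \<alpha> X Y Z
          = (Idt C Y \<otimes>\<^sub>a \<sigma> X Z) \<cdot> \<alpha> Y X Z \<cdot> (\<sigma> X Y \<otimes>\<^sub>a Idt C Z)"
    and closed: "\<lbrakk>X \<in> Obj C; Y \<in> Obj C\<rbrakk>
      \<Longrightarrow> inner_hom C X Y \<in> Obj C \<and> inner_eval C X Y \<in> homset C (inner_hom C X Y \<otimes>\<^sub>o X) Y"
      "\<lbrakk>X \<in> Obj C; Y \<in> Obj C; Z \<in> Obj C; f \<in> homset C (Z \<otimes>\<^sub>o X) Y\<rbrakk>
      \<Longrightarrow> \<exists>!g. g \<in> homset C Z (inner_hom C X Y) \<and> inner_eval C X Y \<cdot> (g \<otimes>\<^sub>a Idt C X) = f"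

text \<open>
  In the pushout-product axiom, \<open>h\<close> is the map out of an arbitrary pushout of
  \<open>A \<otimes>\<^sub>o D \<leftarrow> A \<otimes>\<^sub>o C \<rightarrow> B \<otimes>\<^sub>o C\<close> induced by \<open>f \<otimes>\<^sub>a D\<close> and \<open>B \<otimes>\<^sub>a g\<close>.
\<close>

locale monoidal_model_category =
  model_category small C W Cof Fib + closed_symmetric_monoidal_category C
  for small :: "'u set \<Rightarrow> bool"
    and C :: "('o, 'a, 'm) monoidal_cat_scheme" (structure)
    and W :: "'a set" and Cof :: "'a set" and Fib :: "'a set" +
  assumes pushout_product:
    "\<lbrakk>f \<in> Cof; g \<in> Cof;
      is_pushout C (Idt C (Dom C f) \<otimes>\<^sub>a g) (f \<otimes>\<^sub>a Idt C (Dom C g)) i j;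
      h \<in> homset C (Cod C i) (Cod C f \<otimes>\<^sub>o Cod C g);
      h \<cdot> i = f \<otimes>\<^sub>a Idt C (Cod C g); h \<cdot> j = Idt C (Cod C f) \<otimes>\<^sub>a g\<rbrakk>
     \<Longrightarrow> h \<in> Cof \<and> (f \<in> W \<or> g \<in> W \<longrightarrow> h \<in> W)"
    and unit_axiom:
    "\<exists>Q \<in> Obj C. \<exists>q \<in> homset C Q \<I>. cofibrant C Cof Q \<and> q \<in> W \<and>
       (\<forall>X \<in> Obj C. cofibrant C Cof X \<longrightarrow> \<l> X \<cdot> (q \<otimes>\<^sub>a Idt C X) \<in> W)"


section \<open>Modules\<close>

text \<open>
  Linear maps are extensional, so that equality of maps is equality on the carrier.
  A module record also has the fields \<^const>\<open>mult\<close> and \<^const>\<open>one\<close>, which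
  \<^locale>\<open>module\<close> leaves unconstrained; they are never used and set to
  \<^const>\<open>undefined\<close> below.
\<close>

definition lin_maps where
  "lin_maps R M N = {h \<in> carrier M \<rightarrow>\<^sub>E carrier N.
     (\<forall>x \<in> carrier M. \<forall>y \<in> carrier M. h (x \<oplus>\<^bsub>M\<^esub> y) = h x \<oplus>\<^bsub>N\<^esub> h y) \<and>
     (\<forall>a \<in> carrier R. \<forall>x \<in> carrier M. h (a \<odot>\<^bsub>M\<^esub> x) = a \<odot>\<^bsub>N\<^esub> h x)}"

definition span_of where
  "span_of R M X = \<Inter>{H. submodule H R M \<and> X \<subseteq> H}"

definition alt_sign where
  "alt_sign M (n :: int) x = (if even n then x else \<ominus>\<^bsub>M\<^esub> x)"

definition quot_module :: "('r, 'x) module \<Rightarrow> 'x set \<Rightarrow> ('r, 'x set) module" where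
  "quot_module M H = \<lparr>carrier = a_rcosets\<^bsub>M\<^esub> H, mult = undefined, one = undefined,
     zero = H, add = set_add M, smult = (\<lambda>a X. \<Union>x\<in>X. H +>\<^bsub>M\<^esub> (a \<odot>\<^bsub>M\<^esub> x))\<rparr>"

definition regular_module :: "('r, 'm) ring_scheme \<Rightarrow> ('r, 'r) module" where
  "regular_module R = \<lparr>carrier = carrier R, mult = undefined, one = undefined,
     zero = \<zero>\<^bsub>R\<^esub>, add = (\<oplus>\<^bsub>R\<^esub>), smult = (\<otimes>\<^bsub>R\<^esub>)\<rparr>"

definition prod_module :: "('r, 'x) module \<Rightarrow> ('r, 'y) module \<Rightarrow> ('r, 'x \<times> 'y) module" where
  "prod_module M N = \<lparr>carrier = carrier M \<times> carrier N, mult = undefined, one = undefined,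
     zero = (\<zero>\<^bsub>M\<^esub>, \<zero>\<^bsub>N\<^esub>), add = (\<lambda>(x, y) (x', y'). (x \<oplus>\<^bsub>M\<^esub> x', y \<oplus>\<^bsub>N\<^esub> y')),
     smult = (\<lambda>a (x, y). (a \<odot>\<^bsub>M\<^esub> x, a \<odot>\<^bsub>N\<^esub> y))\<rparr>"

definition free_module :: "('r, 'm) ring_scheme \<Rightarrow> 't set \<Rightarrow> ('r, 't \<Rightarrow> 'r) module" where
  "free_module R T = \<lparr>carrier = {c. c ` T \<subseteq> carrier R \<and> (\<forall>t. t \<notin> T \<longrightarrow> c t = \<zero>\<^bsub>R\<^esub>) \<and>
       finite {t. c t \<noteq> \<zero>\<^bsub>R\<^esub>}}, mult = undefined, one = undefined,
     zero = (\<lambda>t. \<zero>\<^bsub>R\<^esub>), add = (\<lambda>c c' t. c t \<oplus>\<^bsub>R\<^esub> c' t), smult = (\<lambda>a c t. a \<otimes>\<^bsub>R\<^esub> c t)\<rparr>"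

definition basis_elt :: "('r, 'm) ring_scheme \<Rightarrow> 't \<Rightarrow> 't \<Rightarrow> 'r" where
  "basis_elt R t = (\<lambda>s. if s = t then \<one>\<^bsub>R\<^esub> else \<zero>\<^bsub>R\<^esub>)"


section \<open>Filtered chain complexes and the pages of their spectral sequences\<close>

record ('r, 'x) fcomplex =
  Cx :: "int \<Rightarrow> ('r, 'x) module"
  Df :: "int \<Rightarrow> 'x \<Rightarrow> 'x"
  Fl :: "int \<Rightarrow> int \<Rightarrow> 'x set"
  \<comment> \<open>\<open>Fl A p n\<close> is $F_pA^n$\<close>

locale filtered_complex =
  fixes R :: "('r, 'm) ring_scheme" and A :: "('r, 'x) fcomplex"
  assumes Cx_module: "module R (Cx A n)"
    and Df_lin: "Df A n \<in> lin_maps R (Cx A n) (Cx A (n + 1))"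
    and Df_Df: "x \<in> carrier (Cx A n) \<Longrightarrow> Df A (n + 1) (Df A n x) = \<zero>\<^bsub>Cx A (n + 1 + 1)\<^esub>"
    and Fl_submodule: "submodule (Fl A p n) R (Cx A n)"
    and Df_Fl: "Df A n ` Fl A p n \<subseteq> Fl A p (n + 1)"
    and Fl_mono: "Fl A p n \<subseteq> Fl A (p + 1) n"

definition filtered_maps ::
    "('r, 'm) ring_scheme \<Rightarrow> ('r, 'x) fcomplex \<Rightarrow> ('r, 'y) fcomplex \<Rightarrow> (int \<Rightarrow> 'x \<Rightarrow> 'y) set" where
  "filtered_maps R A B = {f.
     (\<forall>n. f n \<in> lin_maps R (Cx A n) (Cx B n)) \<and>
     (\<forall>n. \<forall>x \<in> carrier (Cx A n). Df B n (f n x) = f (n + 1) (Df A n x)) \<and>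
     (\<forall>p n. f n ` Fl A p n \<subseteq> Fl B p n)}"

text \<open>
  The indices \<open>k p n\<close> stand for the bidegree $(p, p+n)$, so that \<open>n\<close> is the cohomological
  degree.
\<close>

definition cycles :: "('r, 'x) fcomplex \<Rightarrow> nat \<Rightarrow> int \<Rightarrow> int \<Rightarrow> 'x set" where
  "cycles A k p n = {x \<in> Fl A p n. Df A n x \<in> Fl A (p - int k) (n + 1)}"

fun boundaries :: "('r, 'x) fcomplex \<Rightarrow> nat \<Rightarrow> int \<Rightarrow> int \<Rightarrow> 'x set" where
  "boundaries A 0 p n = Fl A (p - 1) n"
| "boundaries A (Suc k) p n =
     Df A (n - 1) ` cycles A k (p + int k) (n - 1) <+>\<^bsub>Cx A n\<^esub> cycles A k (p - 1) n"

definition page :: "('r, 'x) fcomplex \<Rightarrow> nat \<Rightarrow> int \<Rightarrow> int \<Rightarrow> ('r, 'x set) module" where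
  "page A k p n = quot_module ((Cx A n)\<lparr>carrier := cycles A k p n\<rparr>) (boundaries A k p n)"

definition page_map :: "('r, 'x) fcomplex \<Rightarrow> ('r, 'y) fcomplex \<Rightarrow> (int \<Rightarrow> 'x \<Rightarrow> 'y) \<Rightarrow>
    nat \<Rightarrow> int \<Rightarrow> int \<Rightarrow> 'x set \<Rightarrow> 'y set" where
  "page_map A B f k p n =
     (\<lambda>X\<in>carrier (page A k p n). \<Union>x\<in>X. boundaries B k p n +>\<^bsub>Cx B n\<^esub> f n x)"

definition page_iso where
  "page_iso R A B f k \<longleftrightarrow> (\<forall>p n.
     page_map A B f k p n \<in> lin_maps R (page A k p n) (page B k p n) \<and>
     bij_betw (page_map A B f k p n) (carrier (page A k p n)) (carrier (page B k p n)))"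

definition zero_complex :: "('r, 'm) ring_scheme \<Rightarrow> ('r, 'r) fcomplex" where
  "zero_complex R = \<lparr>Cx = (\<lambda>n. (regular_module R)\<lparr>carrier := {\<zero>\<^bsub>R\<^esub>}\<rparr>),
     Df = (\<lambda>n. \<lambda>x\<in>{\<zero>\<^bsub>R\<^esub>}. \<zero>\<^bsub>R\<^esub>), Fl = (\<lambda>p n. {\<zero>\<^bsub>R\<^esub>})\<rparr>"

definition sphere :: "('r, 'm) ring_scheme \<Rightarrow> int \<Rightarrow> int \<Rightarrow> ('r, 'r) fcomplex" where
  "sphere R p n = (let K = (\<lambda>m. if m = n then carrier R else {\<zero>\<^bsub>R\<^esub>}) in
     \<lparr>Cx = (\<lambda>m. (regular_module R)\<lparr>carrier := K m\<rparr>),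
      Df = (\<lambda>m. \<lambda>x\<in>K m. \<zero>\<^bsub>R\<^esub>),
      Fl = (\<lambda>q m. if p \<le> q then K m else {\<zero>\<^bsub>R\<^esub>})\<rparr>)"

text \<open>$\mathcal{Z}_k(p,n)$\<close>

definition cell :: "('r, 'm) ring_scheme \<Rightarrow> nat \<Rightarrow> int \<Rightarrow> int \<Rightarrow> ('r, 'r) fcomplex" where
  "cell R k p n = (let K = (\<lambda>m. if m = n \<or> m = n + 1 then carrier R else {\<zero>\<^bsub>R\<^esub>}) in
     \<lparr>Cx = (\<lambda>m. (regular_module R)\<lparr>carrier := K m\<rparr>),
      Df = (\<lambda>m. \<lambda>x\<in>K m. if m = n then x else \<zero>\<^bsub>R\<^esub>),
      Fl = (\<lambda>q m. if m = n \<and> p \<le> q \<or> m = n + 1 \<and> p - int k \<le> q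
                   then carrier R else {\<zero>\<^bsub>R\<^esub>})\<rparr>)"

definition direct_sum ::
    "('r, 'x) fcomplex \<Rightarrow> ('r, 'y) fcomplex \<Rightarrow> ('r, 'x \<times> 'y) fcomplex" where
  "direct_sum A B = \<lparr>Cx = (\<lambda>n. prod_module (Cx A n) (Cx B n)),
     Df = (\<lambda>n. \<lambda>(x, y)\<in>carrier (Cx A n) \<times> carrier (Cx B n). (Df A n x, Df B n y)),
     Fl = (\<lambda>p n. Fl A p n \<times> Fl B p n)\<rparr>"

text \<open>
  \<open>cell_bd R k p n\<close> is $\mathcal{B}_{k+1}(p,n)$ and \<open>cell_incl R k p n\<close> is
  $\varphi_{k+1}\colon \mathcal{Z}_{k+1}(p,n) \to \mathcal{B}_{k+1}(p,n)$; the index is shifted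
  to avoid a predecessor.
\<close>

definition cell_bd :: "('r, 'm) ring_scheme \<Rightarrow> nat \<Rightarrow> int \<Rightarrow> int \<Rightarrow> ('r, 'r \<times> 'r) fcomplex" where
  "cell_bd R k p n = direct_sum (cell R k (p + int k) (n - 1)) (cell R k (p - 1) n)"

definition cell_incl :: "('r, 'm) ring_scheme \<Rightarrow> nat \<Rightarrow> int \<Rightarrow> int \<Rightarrow> int \<Rightarrow> 'r \<Rightarrow> 'r \<times> 'r" where
  "cell_incl R k p n = (\<lambda>m. \<lambda>x\<in>carrier (Cx (cell R (Suc k) p n) m).
     if m = n then (x, x) else (\<zero>\<^bsub>R\<^esub>, x))"


section \<open>Tensor product and internal hom\<close>

text \<open>
  $(A \otimes B)^n = \bigoplus_i A^i \otimes B^{n-i}$ is the free module on the triples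
  \<open>(i, a, b)\<close> with $a \in A^i$, $b \in B^{n-i}$, modulo bilinearity.
\<close>

definition tensor_gens ::
    "('r, 'x) fcomplex \<Rightarrow> ('r, 'y) fcomplex \<Rightarrow> int \<Rightarrow> (int \<times> 'x \<times> 'y) set" where
  "tensor_gens A B n = {(i, a, b). a \<in> carrier (Cx A i) \<and> b \<in> carrier (Cx B (n - i))}"

definition tensor_rels :: "('r, 'm) ring_scheme \<Rightarrow> ('r, 'x) fcomplex \<Rightarrow> ('r, 'y) fcomplex \<Rightarrow>
    int \<Rightarrow> (int \<times> 'x \<times> 'y \<Rightarrow> 'r) set" where
  "tensor_rels R A B n =
    (let T = free_module R (tensor_gens A B n); e = (\<lambda>i a b. basis_elt R (i, a, b)) in
     {e i (a \<oplus>\<^bsub>Cx A i\<^esub> a') b \<ominus>\<^bsub>T\<^esub> (e i a b \<oplus>\<^bsub>T\<^esub> e i a' b) | i a a' b.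
        a \<in> carrier (Cx A i) \<and> a' \<in> carrier (Cx A i) \<and> b \<in> carrier (Cx B (n - i))} \<union>
     {e i a (b \<oplus>\<^bsub>Cx B (n - i)\<^esub> b') \<ominus>\<^bsub>T\<^esub> (e i a b \<oplus>\<^bsub>T\<^esub> e i a b') | i a b b'.
        a \<in> carrier (Cx A i) \<and> b \<in> carrier (Cx B (n - i)) \<and> b' \<in> carrier (Cx B (n - i))} \<union>
     {e i (s \<odot>\<^bsub>Cx A i\<^esub> a) b \<ominus>\<^bsub>T\<^esub> (s \<odot>\<^bsub>T\<^esub> e i a b) | i s a b.
        s \<in> carrier R \<and> a \<in> carrier (Cx A i) \<and> b \<in> carrier (Cx B (n - i))} \<union>
     {e i a (s \<odot>\<^bsub>Cx B (n - i)\<^esub> b) \<ominus>\<^bsub>T\<^esub> (s \<odot>\<^bsub>T\<^esub> e i a b) | i s a b.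
        s \<in> carrier R \<and> a \<in> carrier (Cx A i) \<and> b \<in> carrier (Cx B (n - i))})"

definition tensor_module :: "('r, 'm) ring_scheme \<Rightarrow> ('r, 'x) fcomplex \<Rightarrow> ('r, 'y) fcomplex \<Rightarrow>
    int \<Rightarrow> ('r, (int \<times> 'x \<times> 'y \<Rightarrow> 'r) set) module" where
  "tensor_module R A B n = (let T = free_module R (tensor_gens A B n) in
     quot_module T (span_of R T (tensor_rels R A B n)))"

text \<open>The elementary tensor $a \otimes b$ with $|a| = i$ and $|b| = j$.\<close>

definition elem_tensor :: "('r, 'm) ring_scheme \<Rightarrow> ('r, 'x) fcomplex \<Rightarrow> ('r, 'y) fcomplex \<Rightarrow>
    int \<Rightarrow> int \<Rightarrow> 'x \<Rightarrow> 'y \<Rightarrow> (int \<times> 'x \<times> 'y \<Rightarrow> 'r) set" where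
  "elem_tensor R A B i j a b = (let T = free_module R (tensor_gens A B (i + j)) in
     span_of R T (tensor_rels R A B (i + j)) +>\<^bsub>T\<^esub> basis_elt R (i, a, b))"

definition tensor_complex :: "('r, 'm) ring_scheme \<Rightarrow> ('r, 'x) fcomplex \<Rightarrow> ('r, 'y) fcomplex \<Rightarrow>
    ('r, (int \<times> 'x \<times> 'y \<Rightarrow> 'r) set) fcomplex" where
  "tensor_complex R A B = \<lparr>Cx = tensor_module R A B,
     Df = (\<lambda>n. THE h. h \<in> lin_maps R (tensor_module R A B n) (tensor_module R A B (n + 1)) \<and>
        (\<forall>i j. \<forall>a \<in> carrier (Cx A i). \<forall>b \<in> carrier (Cx B j). i + j = n \<longrightarrow>
           h (elem_tensor R A B i j a b) =
             elem_tensor R A B (i + 1) j (Df A i a) b \<oplus>\<^bsub>tensor_module R A B (n + 1)\<^esub>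
             alt_sign (tensor_module R A B (n + 1)) i (elem_tensor R A B i (j + 1) a (Df B j b)))),
     Fl = (\<lambda>p n. span_of R (tensor_module R A B n)
        {elem_tensor R A B i j a b | i j a b. i + j = n \<and>
           (\<exists>q. a \<in> Fl A q i \<and> b \<in> Fl B (p - q) j)})\<rparr>"

definition hom_module :: "('r, 'm) ring_scheme \<Rightarrow> ('r, 'x) fcomplex \<Rightarrow> ('r, 'y) fcomplex \<Rightarrow>
    int \<Rightarrow> ('r, int \<Rightarrow> 'x \<Rightarrow> 'y) module" where
  "hom_module R A B n = \<lparr>carrier = {f. \<forall>m. f m \<in> lin_maps R (Cx A m) (Cx B (m + n))},
     mult = undefined, one = undefined,
     zero = (\<lambda>m. \<lambda>x\<in>carrier (Cx A m). \<zero>\<^bsub>Cx B (m + n)\<^esub>),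
     add = (\<lambda>f g m. \<lambda>x\<in>carrier (Cx A m). f m x \<oplus>\<^bsub>Cx B (m + n)\<^esub> g m x),
     smult = (\<lambda>s f m. \<lambda>x\<in>carrier (Cx A m). s \<odot>\<^bsub>Cx B (m + n)\<^esub> f m x)\<rparr>"

text \<open>The differential is $df = d \circ f - (-1)^{|f|} f \circ d$.\<close>

definition hom_complex :: "('r, 'm) ring_scheme \<Rightarrow> ('r, 'x) fcomplex \<Rightarrow> ('r, 'y) fcomplex \<Rightarrow>
    ('r, int \<Rightarrow> 'x \<Rightarrow> 'y) fcomplex" where
  "hom_complex R A B = \<lparr>Cx = hom_module R A B,
     Df = (\<lambda>n. \<lambda>f\<in>carrier (hom_module R A B n). \<lambda>m. \<lambda>x\<in>carrier (Cx A m).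
        Df B (m + n) (f m x) \<ominus>\<^bsub>Cx B (m + n + 1)\<^esub>
        alt_sign (Cx B (m + n + 1)) n (f (m + 1) (Df A m x))),
     Fl = (\<lambda>p n. {f \<in> carrier (hom_module R A B n).
        \<forall>q m. f m ` Fl A q m \<subseteq> Fl B (p + q) (m + n)})\<rparr>"


section \<open>The closed symmetric monoidal category of small filtered complexes\<close>

text \<open>
  All objects of one category live in one type \<^typ>\<open>'u\<close>, which plays the role of a
  Grothendieck universe.  A set is small if it has fewer elements than \<^typ>\<open>'u\<close>, and
  the cardinality of \<^typ>\<open>'u\<close> is required to be strongly inaccessible, so that limits,
  tensor products and internal homs of small complexes are again small.  (Bare HOL does not
  provide such a type; the type of ZF sets in the usual extension of HOL by ZFC is one.)
\<close>

definition small_in :: "'u itself \<Rightarrow> 'x set \<Rightarrow> bool" where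
  "small_in _ X \<longleftrightarrow> |X| <o |UNIV :: 'u set|"

definition universe :: "'u itself \<Rightarrow> bool" where
  "universe U \<longleftrightarrow> small_in U (UNIV :: nat set) \<and>
     (\<forall>X :: 'u set. small_in U X \<longrightarrow> small_in U (Pow X)) \<and> stable |UNIV :: 'u set|"

text \<open>
  A complex with small carriers in an arbitrary type is moved into the universe along
  injections chosen once and for all.
\<close>

definition code :: "'x set \<Rightarrow> 'x \<Rightarrow> 'u" where
  "code X = (SOME e. inj_on e X)"

definition decode :: "'x set \<Rightarrow> 'u \<Rightarrow> 'x" where
  "decode X = inv_into X (code X)"

definition copy_module :: "('r, 'x) module \<Rightarrow> ('r, 'u) module" where
  "copy_module M = (let e = code (carrier M); d = decode (carrier M) in
     \<lparr>carrier = e ` carrier M, mult = undefined, one = undefined, zero = e \<zero>\<^bsub>M\<^esub>,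
      add = (\<lambda>u v. e (d u \<oplus>\<^bsub>M\<^esub> d v)), smult = (\<lambda>s u. e (s \<odot>\<^bsub>M\<^esub> d u))\<rparr>)"

definition copy_map :: "'x set \<Rightarrow> 'y set \<Rightarrow> ('x \<Rightarrow> 'y) \<Rightarrow> 'u \<Rightarrow> 'u" where
  "copy_map X Y f = (\<lambda>u\<in>code X ` X. code Y (f (decode X u)))"

definition copy :: "('r, 'x) fcomplex \<Rightarrow> ('r, 'u) fcomplex" where
  "copy A = \<lparr>Cx = (\<lambda>n. copy_module (Cx A n)),
     Df = (\<lambda>n. copy_map (carrier (Cx A n)) (carrier (Cx A (n + 1))) (Df A n)),
     Fl = (\<lambda>p n. code (carrier (Cx A n)) ` Fl A p n)\<rparr>"

record ('r, 'u) farrow =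
  Src :: "('r, 'u) fcomplex"
  Tgt :: "('r, 'u) fcomplex"
  Map :: "int \<Rightarrow> 'u \<Rightarrow> 'u"

definition copy_arrow ::
    "('r, 'x) fcomplex \<Rightarrow> ('r, 'y) fcomplex \<Rightarrow> (int \<Rightarrow> 'x \<Rightarrow> 'y) \<Rightarrow> ('r, 'u) farrow" where
  "copy_arrow A B f = \<lparr>Src = copy A, Tgt = copy B,
     Map = (\<lambda>n. copy_map (carrier (Cx A n)) (carrier (Cx B n)) (f n))\<rparr>"

definition fobjects :: "('r, 'm) ring_scheme \<Rightarrow> ('r, 'u) fcomplex set" where
  "fobjects R = {A. filtered_complex R A \<and> (\<forall>n. small_in TYPE('u) (carrier (Cx A n)))}"

definition farrows :: "('r, 'm) ring_scheme \<Rightarrow> ('r, 'u) farrow set" where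
  "farrows R = {f. Src f \<in> fobjects R \<and> Tgt f \<in> fobjects R \<and>
     Map f \<in> filtered_maps R (Src f) (Tgt f)}"

definition fhom :: "('r, 'm) ring_scheme \<Rightarrow> ('r, 'u) fcomplex \<Rightarrow> ('r, 'u) fcomplex \<Rightarrow>
    ('r, 'u) farrow set" where
  "fhom R A B = {f \<in> farrows R. Src f = A \<and> Tgt f = B}"

definition ften :: "('r, 'm) ring_scheme \<Rightarrow> ('r, 'u) fcomplex \<Rightarrow> ('r, 'u) fcomplex \<Rightarrow>
    ('r, 'u) fcomplex" where
  "ften R A B = copy (tensor_complex R A B)"

definition felem :: "('r, 'm) ring_scheme \<Rightarrow> ('r, 'u) fcomplex \<Rightarrow> ('r, 'u) fcomplex \<Rightarrow>
    int \<Rightarrow> int \<Rightarrow> 'u \<Rightarrow> 'u \<Rightarrow> 'u" where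
  "felem R A B i j a b =
     code (carrier (tensor_module R A B (i + j))) (elem_tensor R A B i j a b)"

definition funit :: "('r, 'm) ring_scheme \<Rightarrow> ('r, 'u) fcomplex" where
  "funit R = copy (sphere R 0 0)"

definition finner :: "('r, 'm) ring_scheme \<Rightarrow> ('r, 'u) fcomplex \<Rightarrow> ('r, 'u) fcomplex \<Rightarrow>
    ('r, 'u) fcomplex" where
  "finner R A B = copy (hom_complex R A B)"

text \<open>
  The structure maps are the unique morphisms with the familiar values on elementary tensors:
  $(f \otimes g)(a \otimes b) = f(a) \otimes g(b)$, $(a \otimes b) \otimes c \mapsto
  a \otimes (b \otimes c)$, $s \otimes a \mapsto sa$, $a \otimes s \mapsto sa$,
  $a \otimes b \mapsto (-1)^{|a||b|} b \otimes a$ and $f \otimes a \mapsto f(a)$.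
\<close>

definition filtered_category ::
    "('r, 'm) ring_scheme \<Rightarrow> (('r, 'u) fcomplex, ('r, 'u) farrow) monoidal_cat" where
  "filtered_category R = \<lparr>
     Obj = fobjects R,
     Arr = farrows R,
     Dom = Src,
     Cod = Tgt,
     Idt = (\<lambda>A. \<lparr>Src = A, Tgt = A, Map = (\<lambda>n. \<lambda>x\<in>carrier (Cx A n). x)\<rparr>),
     Cmp = (\<lambda>g f. \<lparr>Src = Src f, Tgt = Tgt g,
       Map = (\<lambda>n. \<lambda>x\<in>carrier (Cx (Src f) n). Map g n (Map f n x))\<rparr>),
     tensor_obj = ften R,
     tensor_arr = (\<lambda>f g. THE h. h \<in> fhom R (ften R (Src f) (Src g)) (ften R (Tgt f) (Tgt g)) \<and>
       (\<forall>i j. \<forall>a \<in> carrier (Cx (Src f) i). \<forall>b \<in> carrier (Cx (Src g) j).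
          Map h (i + j) (felem R (Src f) (Src g) i j a b) =
          felem R (Tgt f) (Tgt g) i j (Map f i a) (Map g j b))),
     unit_obj = funit R,
     assoc = (\<lambda>A B C. THE h. h \<in> fhom R (ften R (ften R A B) C) (ften R A (ften R B C)) \<and>
       (\<forall>i j k. \<forall>a \<in> carrier (Cx A i). \<forall>b \<in> carrier (Cx B j). \<forall>c \<in> carrier (Cx C k).
          Map h (i + j + k) (felem R (ften R A B) C (i + j) k (felem R A B i j a b) c) =
          felem R A (ften R B C) i (j + k) a (felem R B C j k b c))),
     left_unit = (\<lambda>A. THE h. h \<in> fhom R (ften R (funit R) A) A \<and>
       (\<forall>i. \<forall>s \<in> carrier R. \<forall>a \<in> carrier (Cx A i).
          Map h i (felem R (funit R) A 0 i (code (carrier R) s) a) = s \<odot>\<^bsub>Cx A i\<^esub> a)),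
     right_unit = (\<lambda>A. THE h. h \<in> fhom R (ften R A (funit R)) A \<and>
       (\<forall>i. \<forall>s \<in> carrier R. \<forall>a \<in> carrier (Cx A i).
          Map h i (felem R A (funit R) i 0 a (code (carrier R) s)) = s \<odot>\<^bsub>Cx A i\<^esub> a)),
     braid = (\<lambda>A B. THE h. h \<in> fhom R (ften R A B) (ften R B A) \<and>
       (\<forall>i j. \<forall>a \<in> carrier (Cx A i). \<forall>b \<in> carrier (Cx B j).
          Map h (i + j) (felem R A B i j a b) =
          alt_sign (Cx (ften R B A) (i + j)) (i * j) (felem R B A j i b a))),
     inner_hom = finner R,
     inner_eval = (\<lambda>A B. THE h. h \<in> fhom R (ften R (finner R A B) A) B \<and>
       (\<forall>n m. \<forall>f \<in> carrier (hom_module R A B n). \<forall>a \<in> carrier (Cx A m).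
          Map h (n + m) (felem R (finner R A B) A n m (code (carrier (hom_module R A B n)) f) a) =
          f m a))\<rparr>"


section \<open>The model structure\<close>

definition weak_equivalences :: "('r, 'm) ring_scheme \<Rightarrow> nat \<Rightarrow> ('r, 'u) farrow set" where
  "weak_equivalences R r = {f \<in> farrows R. page_iso R (Src f) (Tgt f) (Map f) (r + 1)}"

definition gen_I :: "('r, 'm) ring_scheme \<Rightarrow> nat \<Rightarrow> ('r, 'u) farrow set" where
  "gen_I R r = {copy_arrow (cell R (r + 1) p n) (cell_bd R r p n) (cell_incl R r p n) | p n. True}"

definition gen_J :: "('r, 'm) ring_scheme \<Rightarrow> nat \<Rightarrow> ('r, 'u) farrow set" where
  "gen_J R k = {copy_arrow (zero_complex R) (cell R k p n) (\<lambda>m. \<lambda>x\<in>{\<zero>\<^bsub>R\<^esub>}. \<zero>\<^bsub>R\<^esub>) | p n. True}"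

definition gen_cof :: "('r, 'm) ring_scheme \<Rightarrow> nat \<Rightarrow> nat set \<Rightarrow> ('r, 'u) farrow set" where
  "gen_cof R r S = gen_I R r \<union> (\<Union>s\<in>S. gen_J R s)"

definition gen_acyclic_cof :: "('r, 'm) ring_scheme \<Rightarrow> nat set \<Rightarrow> ('r, 'u) farrow set" where
  "gen_acyclic_cof R S = (\<Union>s\<in>S. gen_J R s)"

definition cofibrations :: "('r, 'm) ring_scheme \<Rightarrow> nat \<Rightarrow> nat set \<Rightarrow> ('r, 'u) farrow set" where
  "cofibrations R r S = llp (filtered_category R) (rlp (filtered_category R) (gen_cof R r S))"

definition fibrations :: "('r, 'm) ring_scheme \<Rightarrow> nat set \<Rightarrow> ('r, 'u) farrow set" where
  "fibrations R S = rlp (filtered_category R) (gen_acyclic_cof R S)"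

end

theory Submission
 imports Defs
begin

text \<open>
Every filtered complex is fibrant, and the fibrations and acyclic fibrations are the maps that
lift against the cells in $J_S$ and $I_S$, so the small object argument gives the factorizations.
A map with the lifting property against all fibrations is a retract of the inclusion of its source
into the direct sum with the cone of its target, shifted in the filtration by $r$; the cone is
$r$-acyclic, so such a map is a weak equivalence, and the remaining axioms follow from this.
By adjunction the pushout-product axiom becomes a statement on pullback-homs, where only
generating cofibrations have to be tested. The internal hom out of $\mathcal Z_k(p, n)$ consists
of pairs $(a, w)$ with differential $(a, w) \mapsto (da - w, -dw)$, so its cycles and lifts are explicit.
For the unit axiom a cofibrant replacement is a telescope whose tensor product with any $X$
is compared with $X$ by an explicit contraction.
\<close>

text \<open>\<open>E_(r+1)\<close> sees an element of filtration p only modulo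
  \<open>F_(p-1)\<close>, and its differential only above \<open>F_(p-r-1)\<close>. The comparisons
  use this slack: \<open>wiso_contract\<close> accepts a section that commutes with d up to
  \<open>F_(p-r-1)\<close> and a homotopy that raises the filtration by r and is right only modulo
  \<open>F_(p-1)\<close>. These are estimates on elements, so they survive tensoring with any X.
  Among pushout-products the case of two maps \<open>phi\<close> is the obstacle, because the target
  L of the pullback-hom has no handy description. But L projects to Hom(B, F) by a base change of
  the acyclic fibration Hom(Z, p), and the composite Hom(B, p) is an acyclic fibration too, so
  two-out-of-three suffices. The unit is not cofibrant when R is nonzero. Lifting its generator
  along an acyclic fibration gives an element whose boundary drops by r + 1; each correction gains
  one filtration step, and infinitely many corrections cannot be summed. The telescope records them:
  \<open>u_0 + ... + u_k\<close> has boundary \<open>x_k\<close> in \<open>F_(-r-1-k)\<close>. Its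
  degree 0 cycles have constant coefficients of finite support, hence vanish, so its projection to
  the unit has no section.\<close>

abbreviation "FM \<equiv> free_module"
abbreviation "bas \<equiv> basis_elt"
abbreviation "alt \<equiv> alt_sign"
abbreviation "ZC \<equiv> zero_complex"
abbreviation "lin \<equiv> lin_maps"
abbreviation gr_carrier ("_$_" [1000, 1000] 999) where "A$n \<equiv> carrier (Cx A n)"
abbreviation mod_add ("_ +[_] _" [65, 0, 66] 65) where "x +[M] y \<equiv> x \<oplus>\<^bsub>M\<^esub> y"
abbreviation mod_diff ("_ -[_] _" [65, 0, 66] 65) where "x -[M] y \<equiv> x \<ominus>\<^bsub>M\<^esub> y"
abbreviation mod_neg ("-[_] _" [0, 81] 80) where "-[M] x \<equiv> \<ominus>\<^bsub>M\<^esub> x"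
abbreviation mod_smult ("_ *[_] _" [70, 0, 71] 70) where "s *[M] x \<equiv> s \<odot>\<^bsub>M\<^esub> x"
abbreviation mod_zero ("0[_]") where "0[M] \<equiv> \<zero>\<^bsub>M\<^esub>"
abbreviation gr_add ("_ +[_,_] _" [65, 0, 0, 66] 65) where "x +[A,n] y \<equiv> x \<oplus>\<^bsub>Cx A n\<^esub> y"
abbreviation gr_diff ("_ -[_,_] _" [65, 0, 0, 66] 65) where "x -[A,n] y \<equiv> x \<ominus>\<^bsub>Cx A n\<^esub> y"
abbreviation gr_neg ("-[_,_] _" [0, 0, 81] 80) where "-[A,n] x \<equiv> \<ominus>\<^bsub>Cx A n\<^esub> x"
abbreviation gr_smult ("_ *[_,_] _" [70, 0, 0, 71] 70) where "s *[A,n] x \<equiv> s \<odot>\<^bsub>Cx A n\<^esub> x"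
abbreviation gr_zero ("0[_,_]") where "0[A,n] \<equiv> \<zero>\<^bsub>Cx A n\<^esub>"

section \<open>Small sets\<close>

locale univ =
fixes U :: "'u itself"
assumes univ: "universe U"
begin

abbreviation sm :: "'x set => bool" where
"sm X \<equiv> small_in U X"

lemma small_type: "small_in TYPE('u) X \<longleftrightarrow> sm X"
unfolding small_in_def ..

lemma sm_inj: "inj_on f X ==> f ` X \<subseteq> Y ==> sm Y ==> sm X"
unfolding small_in_def by (meson card_of_ordLeqI image_subset_iff ordLeq_ordLess_trans)

lemma sm_subset: "sm Y ==> X \<subseteq> Y ==> sm X"
using sm_inj[of id X Y] by auto

lemma sm_image: "sm X ==> sm (f ` X)"
unfolding small_in_def by (meson card_of_image ordLeq_ordLess_trans)

lemma sm_nat: "sm (X :: nat set)"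
using univ sm_subset[of UNIV X] unfolding universe_def by auto

lemma sm_finite: "finite X ==> sm X"
using finite_imp_inj_to_nat_seg[of X] sm_inj[OF _ subset_UNIV sm_nat] by blast

text \<open>Stability of the cardinal of the universe is its regularity; closure under small unions
  follows.\<close>

lemma sm_Sigma: "sm A ==> (\<And>a. a : A ==> sm (F a)) ==> sm (Sigma A F)"
using univ stable_elim[of "|UNIV :: 'u set|" A F] unfolding small_in_def universe_def by auto

lemma sm_Times: "sm A ==> sm B ==> sm (A \<times> B)"
by (rule sm_Sigma)

lemma sm_UN: "sm A ==> (\<And>a. a : A ==> sm (F a)) ==> sm (\<Union>a\<in>A. F a)"
by (rule sm_subset[OF sm_image[OF sm_Sigma[of A F], of snd]]) force+

lemma sm_int: "sm (X :: int set)"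
proof (rule sm_subset[OF sm_image[OF sm_Times[OF sm_nat[of UNIV] sm_nat[of UNIV]]]])
show "X \<subseteq> (%(a, b). int a - int b) ` (UNIV \<times> UNIV)"
proof
 fix x assume "x : X"
 have "x = (%(a, b). int a - int b) (nat x, nat (- x))" by simp
 thus "x : (%(a, b). int a - int b) ` (UNIV \<times> UNIV)" by blast
qed
qed

lemma inj_code: "sm X ==> inj_on (code X :: 'x => 'u) X"
proof -
assume "sm X"
hence "|X| \<le>o |UNIV :: 'u set|" unfolding small_in_def by (rule ordLess_imp_ordLeq)
then obtain e :: "'x => 'u" where "inj_on e X" by (auto simp: card_of_ordLeq[symmetric])
thus ?thesis unfolding code_def by (rule someI[of "%e. inj_on e X"])
qed

text \<open>The universe axiom speaks of power sets of subsets of \<open>'u\<close> only, so a small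
  set of another type is first moved into \<open>'u\<close> along \<open>code\<close>.\<close>

lemma sm_Pow: assumes "sm X" shows "sm (Pow X)"
proof -
have i: "inj_on (code X :: _ => 'u) X" using assms by (rule inj_code)
have "sm (Pow (code X ` X :: 'u set))"
 using univ sm_image[OF assms] unfolding universe_def by blast
thus ?thesis
 by (rule sm_inj[of "(`) (code X)", rotated 2]) (auto simp: inj_on_image_Pow[OF i])
qed

text \<open>A function determined by its values on \<open>A\<close> is identified with its graph, an
  element of the power set of \<open>Sigma A B\<close>. Carriers of limits, internal homs and free
  modules are bounded this way.\<close>

lemma sm_fun:
assumes "sm A" "\<And>a. a : A ==> sm (B a)" "\<And>f a. f : F ==> a : A ==> f a : B a"
 "\<And>f g. f : F ==> g : F ==> (\<And>a. a : A ==> f a = g a) ==> f = g"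
shows "sm F"
proof (rule sm_inj[of "%f. (%a. (a, f a)) ` A"])
show "inj_on (%f. (%a. (a, f a)) ` A) F"
 by (rule inj_onI, rule assms(4)) blast+
show "(%f. (%a. (a, f a)) ` A) ` F \<subseteq> Pow (Sigma A B)" using assms(3) by auto
show "sm (Pow (Sigma A B))" by (intro sm_Pow sm_Sigma assms)
qed

lemma decode_code [simp]: "sm X ==> x : X ==> decode X (code X x :: 'u) = x"
unfolding decode_def using inj_code by (rule inv_into_f_f)

end

section \<open>Modules\<close>

lemma (in abelian_group) neg_zero: "\<ominus> \<zero> = \<zero>"
by (rule minus_equality) simp_all

text \<open>Registers normalization rules for additive groups with the \<open>algebra\<close>
  method, which then closes equations between elements of one degree of a complex.\<close>

lemmas (in abelian_group) ab_simprules
[algebra abelian_group "zero G" "add G" "a_inv G" "a_minus G"] =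
a_closed zero_closed a_inv_closed minus_closed a_assoc l_zero l_neg a_comm minus_eq
r_zero r_neg r_neg1 r_neg2 minus_add minus_minus a_lcomm neg_zero

lemma (in abelian_group) minus_eq_zero:
"x : carrier G ==> y : carrier G ==> x \<ominus> y = \<zero> \<longleftrightarrow> x = y"
by (metis a_minus_def add.inv_solve_right l_zero zero_closed r_neg)

lemma lin_mapsI:
assumes "\<And>x. x : carrier M ==> h x : carrier N"
 "\<And>x. x \<notin> carrier M ==> h x = undefined"
 "\<And>x y. x : carrier M ==> y : carrier M ==> h (x +[M] y) = h x +[N] h y"
 "\<And>a x. a : carrier R ==> x : carrier M ==> h (a *[M] x) = a *[N] h x"
shows "h : lin R M N"
using assms unfolding lin_maps_def by (auto simp: PiE_def extensional_def)

lemma lin_restrictI: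
assumes "module R M"
 "\<And>x. x : carrier M ==> h x : carrier N"
 "\<And>x y. x : carrier M ==> y : carrier M ==> h (x +[M] y) = h x +[N] h y"
 "\<And>a x. a : carrier R ==> x : carrier M ==> h (a *[M] x) = a *[N] h x"
shows "restrict h (carrier M) : lin R M N"
proof -
interpret module R M by fact
show ?thesis by (rule lin_mapsI) (auto simp: assms)
qed

lemma lin_in: "h : lin R M N ==> x : carrier M ==> h x : carrier N"
and lin_undef: "h : lin R M N ==> x \<notin> carrier M ==> h x = undefined"
and lin_add: "h : lin R M N ==> x : carrier M ==> y : carrier M ==>
 h (x +[M] y) = h x +[N] h y"
and lin_smult: "h : lin R M N ==> a : carrier R ==> x : carrier M ==>
 h (a *[M] x) = a *[N] h x"
unfolding lin_maps_def by (auto simp: PiE_def extensional_def)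

lemma lin_ext: "h : lin R M N ==> k : lin R M N' ==>
 (\<And>x. x : carrier M ==> h x = k x) ==> h = k"
by (rule ext) (metis lin_undef)

lemma lin_zero:
assumes "module R M" "module R N" "h : lin R M N" shows "h 0[M] = 0[N]"
proof -
interpret M: module R M by fact
interpret N: module R N by fact
have "h (\<zero>\<^bsub>R\<^esub> *[M] 0[M]) = \<zero>\<^bsub>R\<^esub> *[N] h 0[M]"
 using assms(3) by (rule lin_smult) auto
thus ?thesis using lin_in[OF assms(3), of "0[M]"] by simp
qed

lemma lin_neg:
assumes "module R M" "module R N" "h : lin R M N" "x : carrier M"
shows "h (-[M] x) = -[N] h x"
proof -
interpret M: module R M by fact
interpret N: module R N by fact
have "h x +[N] h (-[M] x) = 0[N]"
 using lin_add[OF assms(3), of x "-[M] x"] lin_zero[OF assms(1-3)] assms(4) by (simp add: M.r_neg)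
thus ?thesis using lin_in[OF assms(3)] assms(4)
 by (metis M.a_inv_closed N.a_comm N.minus_equality)
qed

lemma lin_minus:
assumes "module R M" "module R N" "h : lin R M N" "x : carrier M" "y : carrier M"
shows "h (x -[M] y) = h x -[N] h y"
proof -
interpret M: module R M by fact
show ?thesis unfolding a_minus_def using assms
 by (simp add: lin_add[OF assms(3)] lin_neg[OF assms(1-3)])
qed

lemma lin_comp:
assumes "module R M" "h : lin R M N" "k : lin R N P"
shows "(\<lambda>x\<in>carrier M. k (h x)) : lin R M P"
by (rule lin_restrictI[OF assms(1)])
 (simp_all add: lin_in[OF assms(2)] lin_in[OF assms(3)] lin_add[OF assms(2)]
  lin_add[OF assms(3)] lin_smult[OF assms(2)] lin_smult[OF assms(3)])

lemma submodule_subset: "submodule H R M ==> H \<subseteq> carrier M"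
unfolding submodule_def using subgroup.subset by fastforce

lemma submodule_mem: "submodule H R M ==> x : H ==> x : carrier M"
using submodule_subset by blast

lemma submodule_zero: "submodule H R M ==> 0[M] : H"
unfolding submodule_def using subgroup.one_closed by fastforce

lemma submodule_add: "submodule H R M ==> x : H ==> y : H ==> x +[M] y : H"
unfolding submodule_def using subgroup.m_closed by fastforce

lemma submodule_smult: "submodule H R M ==> a : carrier R ==> x : H ==> a *[M] x : H"
unfolding submodule_def submodule_axioms_def by blast

lemma submodule_neg: "submodule H R M ==> x : H ==> -[M] x : H"
unfolding submodule_def a_inv_def using subgroup.m_inv_closed by fastforce

lemma submodule_minus: "submodule H R M ==> x : H ==> y : H ==> x -[M] y : H"
unfolding a_minus_def by (intro submodule_add submodule_neg)

lemmas submodule_rules =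
submodule_zero submodule_add submodule_smult submodule_neg submodule_minus

text \<open>Closure under negation comes from scaling by -1.\<close>

lemma submoduleI':
assumes "module R M" "H \<subseteq> carrier M" "0[M] : H"
 "\<And>x y. x : H ==> y : H ==> x +[M] y : H"
 "\<And>a x. a : carrier R ==> x : H ==> a *[M] x : H"
shows "submodule H R M"
proof -
interpret module R M by fact
show ?thesis
proof (rule submoduleI)
 fix a assume "a : H"
 hence "(\<ominus>\<^bsub>R\<^esub> \<one>\<^bsub>R\<^esub>) *[M] a : H" "a : carrier M" using assms by auto
 thus "-[M] a : H" by (simp add: smult_l_minus)
qed (use assms in auto)
qed

lemma carrier_submodule: "module R M ==> submodule (carrier M) R M"
by (rule module.carrier_is_submodule)

lemma submodule_Inter:
assumes "module R M" "\<HH> \<noteq> {}" "\<And>H. H : \<HH> ==> submodule H R M"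
shows "submodule (\<Inter>\<HH>) R M"
proof (rule submoduleI'[OF assms(1)])
obtain H where "H : \<HH>" using assms(2) by auto
thus "\<Inter>\<HH> \<subseteq> carrier M" using assms(3) submodule_subset by (metis Inf_lower2)
qed (use submodule_rules[OF assms(3)] in simp_all)

lemma submodule_Int:
"module R M ==> submodule H R M ==> submodule K R M ==> submodule (H \<inter> K) R M"
using submodule_Inter[of R M "{H, K}"] by auto

lemma span_submodule: "module R M ==> X \<subseteq> carrier M ==> submodule (span_of R M X) R M"
unfolding span_of_def by (rule submodule_Inter) (auto intro: carrier_submodule)

lemma span_sup: "x : X ==> x : span_of R M X"
unfolding span_of_def by auto

lemma span_least: "submodule H R M ==> X \<subseteq> H ==> span_of R M X \<subseteq> H"
unfolding span_of_def by auto

lemma sub_preim: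
assumes "module R M" "module R N" "h : lin R M N" "submodule H R N"
shows "submodule {x : carrier M. h x : H} R M"
proof -
interpret M: module R M by fact
show ?thesis
 by (rule submoduleI'[OF assms(1)])
  (auto simp: lin_zero[OF assms(1-3)] lin_add[OF assms(3)] lin_smult[OF assms(3)]
   submodule_rules[OF assms(4)])
qed

lemma submodule_image:
assumes "module R M" "module R N" "h : lin R M N" "submodule H R M"
shows "submodule (h ` H) R N"
proof (rule submoduleI'[OF assms(2)])
note m = submodule_mem[OF assms(4)]
show "h ` H \<subseteq> carrier N" using m lin_in[OF assms(3)] by auto
show "0[N] : h ` H"
 using submodule_zero[OF assms(4)] lin_zero[OF assms(1-3)] by (metis imageI)
fix x y assume "x : h ` H" "y : h ` H"
then obtain u v where "u : H" "v : H" "x = h u" "y = h v" by auto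
thus "x +[N] y : h ` H"
 using lin_add[OF assms(3) m m, of u v] submodule_add[OF assms(4), of u v] by force
next
note m = submodule_mem[OF assms(4)]
fix a x assume "a : carrier R" "x : h ` H"
then obtain u where "u : H" "a : carrier R" "x = h u" by auto
thus "a *[N] x : h ` H"
 using lin_smult[OF assms(3) _ m, of a u] submodule_smult[OF assms(4), of a u] by force
qed

lemma submodule_sum:
assumes "module R M" "submodule H R M" "submodule K R M"
shows "submodule (H <+>\<^bsub>M\<^esub> K) R M"
proof -
interpret M: module R M by fact
note mH = submodule_mem[OF assms(2)] and mK = submodule_mem[OF assms(3)]
show ?thesis
proof (rule submoduleI'[OF assms(1)])
 show "H <+>\<^bsub>M\<^esub> K \<subseteq> carrier M" using mH mK by (auto simp: set_add_def')
 show "0[M] : H <+>\<^bsub>M\<^esub> K" unfolding set_add_def'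
  using submodule_zero[OF assms(2)] submodule_zero[OF assms(3)] M.l_zero[OF M.zero_closed]
  by force
 fix x y assume "x : H <+>\<^bsub>M\<^esub> K" "y : H <+>\<^bsub>M\<^esub> K"
 then obtain a b c d where *: "a : H" "b : K" "c : H" "d : K" "x = a +[M] b" "y = c +[M] d"
  unfolding set_add_def' by auto
 hence "x +[M] y = (a +[M] c) +[M] (b +[M] d)" using mH mK by (simp add: M.a_ac)
 moreover have "a +[M] c : H" "b +[M] d : K"
  using * submodule_add[OF assms(2)] submodule_add[OF assms(3)] by auto
 ultimately show "x +[M] y : H <+>\<^bsub>M\<^esub> K" unfolding set_add_def' by auto
next
 fix s x assume "s : carrier R" "x : H <+>\<^bsub>M\<^esub> K"
 then obtain a b where *: "a : H" "b : K" "x = a +[M] b" "s : carrier R"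
  unfolding set_add_def' by auto
 hence "s *[M] x = (s *[M] a) +[M] (s *[M] b)" using mH mK by (simp add: M.smult_r_distr)
 moreover have "s *[M] a : H" "s *[M] b : K"
  using * submodule_smult[OF assms(2)] submodule_smult[OF assms(3)] by auto
 ultimately show "s *[M] x : H <+>\<^bsub>M\<^esub> K" unfolding set_add_def' by auto
qed
qed

section \<open>Quotients\<close>

locale quot = module R M for R :: "('r, 'm) ring_scheme" and M :: "('r, 'x) module" +
fixes H
assumes sub: "submodule H R M"
begin

lemma ab_sub: "abelian_subgroup H M"
by (rule abelian_subgroupI3, rule additive_subgroup.intro)
 (use sub in \<open>simp_all add: submodule_def abelian_group_axioms\<close>)

abbreviation cl where "cl x \<equiv> H +>\<^bsub>M\<^esub> x"

lemma carrier_quot: "carrier (quot_module M H) = cl ` carrier M"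
unfolding quot_module_def A_RCOSETS_def' by auto

lemma zero_quot: "0[quot_module M H] = cl 0[M]"
unfolding quot_module_def using submodule_subset[OF sub] by simp

lemma add_quot: "x : carrier M ==> y : carrier M ==>
 cl x +[quot_module M H] cl y = cl (x +[M] y)"
unfolding quot_module_def by (simp add: abelian_subgroup.a_rcos_sum[OF ab_sub])

lemma cl_mem:
assumes x: "x : carrier M" and y: "y : cl x"
shows "y : carrier M \<and> cl y = cl x"
using abelian_subgroup.a_elemrcos_carrier[OF ab_sub x y]
 abelian_subgroup.a_repr_independence'[OF ab_sub y x] by simp

lemma cl_eq:
assumes x: "x : carrier M" and y: "y : carrier M"
shows "cl x = cl y \<longleftrightarrow> x -[M] y : H"
proof -
have "x : cl y \<longleftrightarrow> x -[M] y : H"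
 using abelian_subgroup.a_rcos_module[OF ab_sub y x] unfolding a_minus_def .
moreover have "x : cl x" using abelian_subgroup.a_rcos_self[OF ab_sub x] .
ultimately show ?thesis using cl_mem[OF y, of x] by blast
qed

text \<open>The scalar action on cosets is a union over all representatives; it collapses to a
  single coset because all members of the union coincide.\<close>

lemma smult_quot:
assumes "a : carrier R" "x : carrier M"
shows "a *[quot_module M H] cl x = cl (a *[M] x)"
proof -
have "cl (a *[M] y) = cl (a *[M] x)" if "y : cl x" for y
proof -
 from cl_mem[OF assms(2) that] have y: "y : carrier M" "cl y = cl x" by auto
 hence "y -[M] x : H" using cl_eq assms by blast
 hence "a *[M] (y -[M] x) : H" using submodule_smult[OF sub] assms by blast
 thus ?thesis using y assms by (simp add: cl_eq a_minus_def smult_r_distr smult_r_minus)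
qed
moreover have "x : cl x" using abelian_subgroup.a_rcos_self[OF ab_sub assms(2)] .
ultimately have "(\<Union>y\<in>cl x. cl (a *[M] y)) = cl (a *[M] x)"
 by (intro UN_constant_eq ballI)
thus ?thesis unfolding quot_module_def by simp
qed

lemma cl_zero: "x : carrier M ==> cl x = 0[quot_module M H] \<longleftrightarrow> x : H"
unfolding zero_quot by (simp add: cl_eq a_minus_def M.neg_zero)

lemma module_quot: "module R (quot_module M H)"
proof (rule moduleI)
let ?K = "quot_module M H"
show "cring R" by (rule is_cring)
show "abelian_group ?K"
proof (rule abelian_groupI)
 fix X assume "X : carrier ?K"
 then obtain x where "x : carrier M" "X = cl x" unfolding carrier_quot by auto
 thus "\<exists>Y\<in>carrier ?K. Y +[quot_module M H] X = 0[quot_module M H]"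
  by (intro bexI[of _ "cl (-[M] x)"]) (auto simp: add_quot zero_quot carrier_quot M.l_neg)
qed (auto simp: carrier_quot add_quot zero_quot M.a_ac)
have cl: "\<exists>x\<in>carrier M. X = cl x" if "X : carrier ?K" for X
 using that unfolding carrier_quot by auto
fix a b X assume a: "a : carrier R" and X: "X : carrier ?K"
obtain x where x: "x : carrier M" "X = cl x" using cl[OF X] by auto
show "a *[quot_module M H] X : carrier ?K"
 using x a by (simp add: smult_quot carrier_quot)
show "a *[quot_module M H] (X +[quot_module M H] Y) =
  a *[quot_module M H] X +[quot_module M H] a *[quot_module M H] Y"
 if Y: "Y : carrier ?K" for Y
proof -
 obtain y where "y : carrier M" "Y = cl y" using cl[OF Y] by auto
 thus ?thesis using x a by (simp add: smult_quot add_quot smult_r_distr)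
qed
assume b: "b : carrier R"
show "(a \<oplus>\<^bsub>R\<^esub> b) *[quot_module M H] X =
  a *[quot_module M H] X +[quot_module M H] b *[quot_module M H] X"
 using x a b by (simp add: smult_quot add_quot smult_l_distr)
show "(a \<otimes>\<^bsub>R\<^esub> b) *[quot_module M H] X =
  a *[quot_module M H] (b *[quot_module M H] X)"
 using x a b by (simp add: smult_quot smult_assoc1)
next
let ?K = "quot_module M H"
fix X assume "X : carrier ?K"
then obtain x where "x : carrier M" "X = cl x" unfolding carrier_quot by auto
thus "\<one>\<^bsub>R\<^esub> *[quot_module M H] X = X" by (simp add: smult_quot)
qed

text \<open>The induced map evaluates \<open>h\<close> at a chosen representative; \<open>h\<close>
  is constant on cosets since it kills \<open>H\<close>.\<close>

lemma quot_induce: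
assumes "module R N" "h : lin R M N" "\<And>x. x : H ==> h x = 0[N]"
shows "\<exists>k\<in>lin R (quot_module M H) N. \<forall>x\<in>carrier M. k (cl x) = h x"
proof -
define k where "k = (\<lambda>X\<in>carrier (quot_module M H). h (SOME x. x : X))"
interpret N: module R N by fact
have *: "k (cl x) = h x" if x: "x : carrier M" for x
proof -
 define y where "y = (SOME y. y : cl x)"
 have "x : cl x" using abelian_subgroup.a_rcos_self[OF ab_sub x] .
 hence "y : cl x" unfolding y_def by (rule someI)
 hence y: "y : carrier M" "cl y = cl x" using cl_mem[OF x] by auto
 hence "h (y -[M] x) = 0[N]"
  using cl_eq[OF y(1) x] assms(3) by blast
 hence "h y = h x"
  using lin_minus[OF module_axioms assms(1,2) y(1) x]
   lin_in[OF assms(2) y(1)] lin_in[OF assms(2) x] by (simp add: N.minus_eq_zero)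
 thus ?thesis unfolding k_def y_def using x by (simp add: carrier_quot)
qed
have "k : lin R (quot_module M H) N"
proof (rule lin_mapsI)
 show "\<And>x. x \<notin> carrier (quot_module M H) ==> k x = undefined" unfolding k_def by simp
qed (auto simp: carrier_quot add_quot smult_quot * lin_in[OF assms(2)] lin_add[OF assms(2)]
  lin_smult[OF assms(2)])
thus ?thesis using * by blast
qed

end

section \<open>Free and presented modules\<close>

lemma free_car: "c : carrier (FM R T) \<longleftrightarrow>
 (\<forall>t\<in>T. c t : carrier R) \<and> (\<forall>t. t \<notin> T --> c t = \<zero>\<^bsub>R\<^esub>) \<and> finite {t. c t \<noteq> \<zero>\<^bsub>R\<^esub>}"
unfolding free_module_def by auto

lemma free_ops [simp]:
"0[FM R T] = (%t. \<zero>\<^bsub>R\<^esub>)"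
"c +[FM R T] c' = (%t. c t \<oplus>\<^bsub>R\<^esub> c' t)"
"a *[FM R T] c = (%t. a \<otimes>\<^bsub>R\<^esub> c t)"
unfolding free_module_def by auto

context cring
begin

lemma free_val: "c : carrier (FM R T) ==> c t : carrier R"
unfolding free_car by (cases "t : T") auto

lemma mod_free: "module R (FM R T)"
proof (rule moduleI)
let ?K = "FM R T"
show "cring R" by (rule is_cring)
show "abelian_group ?K"
proof (rule abelian_groupI)
 fix x y assume "x : carrier ?K" "y : carrier ?K"
 thus "x +[FM R T] y : carrier ?K"
  unfolding free_car
  by (auto intro: finite_subset[of _ "{t. x t \<noteq> \<zero>} \<union> {t. y t \<noteq> \<zero>}"])
next
 fix x assume x: "x : carrier ?K"
 have "(%t. \<ominus> x t) : carrier ?K"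
  using x unfolding free_car by (auto intro: finite_subset[of _ "{t. x t \<noteq> \<zero>}"])
 moreover have "(%t. \<ominus> x t) +[FM R T] x = 0[FM R T]"
  using free_val[OF x] by (simp add: l_neg)
 ultimately show "\<exists>y\<in>carrier ?K. y +[FM R T] x = 0[FM R T]"
  by blast
qed (auto simp: free_val a_ac, auto simp: free_car)
next
let ?K = "FM R T"
fix a x assume "a : carrier R" "x : carrier ?K"
thus "a *[FM R T] x : carrier ?K"
 unfolding free_car by (auto intro: finite_subset[of _ "{t. x t \<noteq> \<zero>}"])
qed (auto simp: free_val l_distr r_distr m_assoc)

lemma bas_in: "t : T ==> bas R t : carrier (FM R T)"
unfolding free_car basis_elt_def by (auto intro: finite_subset[of _ "{t}"])

text \<open>Induction on a finite set containing the support, splitting off the coefficient at one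
  point each time.\<close>

lemma free_induct [consumes 1, case_names zero add basis]:
assumes c: "c : carrier (FM R T)"
 and z: "P (%t. \<zero>)"
 and a: "\<And>x y. x : carrier (FM R T) ==> y : carrier (FM R T) ==> P x ==> P y ==>
  P (x +[FM R T] y)"
 and b: "\<And>s t. s : carrier R ==> t : T ==> P (s *[FM R T] bas R t)"
shows "P c"
proof -
interpret F: module R "FM R T" by (rule mod_free)
have "\<forall>c \<in> carrier (FM R T). {t. c t \<noteq> \<zero>} \<subseteq> A --> P c" if "finite A" for A
 using that
proof (induction A)
 case empty
 have "P c" if "{t. c t \<noteq> \<zero>} \<subseteq> {}" for c
 proof -
  have "c = (%t. \<zero>)" using that by auto
  thus ?thesis using z by simp
 qed
 thus ?case by blast
next
 case (insert t A)
 show ?case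
 proof (intro ballI impI)
  fix c assume c: "c : carrier (FM R T)" and s: "{t. c t \<noteq> \<zero>} \<subseteq> insert t A"
  show "P c"
  proof (cases "c t = \<zero>")
   case True
   thus ?thesis using insert c s by blast
  next
   case False
   hence t: "t : T" using c unfolding free_car by blast
   let ?c = "c(t := \<zero>)"
   have c': "?c : carrier (FM R T)"
    using c unfolding free_car by (auto intro: finite_subset[of _ "{t. c t \<noteq> \<zero>}"])
   have eq: "c = ?c +[FM R T] (c t *[FM R T] bas R t)"
    using free_val[OF c] by (auto simp: basis_elt_def)
   have "{u. ?c u \<noteq> \<zero>} \<subseteq> A" using s by auto
   hence "P ?c" using insert(3) c' by blast
   thus ?thesis
    by (subst eq) (intro a b c' free_val[OF c] t F.smult_closed bas_in)
  qed
 qed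
qed
thus ?thesis using c unfolding free_car by (metis (lifting) order_refl c)
qed

lemma free_lin:
fixes T :: "'t set"
assumes "module R N" "\<And>t. t : T ==> g t : carrier N"
shows "\<exists>h\<in>lin R (FM R T) N. \<forall>t\<in>T. h (bas R t) = g t"
proof -
let ?K = "FM R T"
interpret N: module R N by fact
define S where "S c = {t. c t \<noteq> \<zero>}" for c :: "'t => 'a"
define k where "k c = finsum N (%t. c t *[N] g t) (S c)" for c
\<comment> \<open>The sum may run over any finite superset of the support, so that two elements can
  be summed over a common index set.\<close>
have ext: "k c = finsum N (%t. c t *[N] g t) A"
 if "c : carrier ?K" "finite A" "S c \<subseteq> A" "A \<subseteq> T" for c A
 unfolding k_def using that
 by (intro N.add.finprod_mono_neutral_cong_left)
  (auto simp: S_def free_val intro!: N.smult_l_null assms(2))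
have ST: "S c \<subseteq> T" "finite (S c)" if "c : carrier ?K" for c
 using that unfolding free_car S_def by auto
interpret F: module R "FM R T" by (rule mod_free)
have gT: "c t *[N] g t : carrier N"
 if "c : carrier ?K" "t : T" for c t
 using that free_val[OF that(1)] by (intro N.smult_closed assms(2)) auto
have "restrict k (carrier ?K) : lin R ?K N"
proof (rule lin_restrictI[OF mod_free])
 fix c assume c: "c : carrier ?K"
 show "k c : carrier N" unfolding k_def
  using ST[OF c] gT[OF c] by (intro N.finsum_closed) auto
next
 fix c d assume c: "c : carrier ?K" and d: "d : carrier ?K"
 let ?A = "S c \<union> S d"
 have A: "finite ?A" "?A \<subseteq> T" using ST c d by auto
 have "S (c +[FM R T] d) \<subseteq> ?A" unfolding S_def by auto
 hence "k (c +[FM R T] d) = finsum N (%t. (c t \<oplus> d t) *[N] g t) ?A"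
  using ext[OF F.a_closed[OF c d] A(1)] A(2) by simp
 also have "\<dots> = finsum N (%t. c t *[N] g t +[N] d t *[N] g t) ?A"
 proof (rule N.finsum_cong')
  show "(%t. c t *[N] g t +[N] d t *[N] g t) : ?A \<rightarrow> carrier N"
   using A(2) gT[OF c] gT[OF d] by auto
 qed (use A(2) assms(2) free_val[OF c] free_val[OF d] in \<open>auto intro!: N.smult_l_distr\<close>)
 also have "\<dots> = finsum N (%t. c t *[N] g t) ?A +[N] finsum N (%t. d t *[N] g t) ?A"
  using A(2) gT[OF c] gT[OF d] by (intro N.finsum_addf) auto
 also have "\<dots> = k c +[N] k d"
  using ext[OF c A(1) _ A(2)] ext[OF d A(1) _ A(2)] by simp
 finally show "k (c +[FM R T] d) = k c +[N] k d" .
next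
 fix a c assume a: "a : carrier R" and c: "c : carrier ?K"
 have "S (a *[FM R T] c) \<subseteq> S c" unfolding S_def using a by auto
 hence "k (a *[FM R T] c) = finsum N (%t. (a \<otimes> c t) *[N] g t) (S c)"
  using ext[OF F.smult_closed[OF a c] ST(2)[OF c]] ST(1)[OF c] by simp
 also have "\<dots> = finsum N (%t. a *[N] (c t *[N] g t)) (S c)"
 proof (rule N.finsum_cong')
  show "(%t. a *[N] (c t *[N] g t)) : S c \<rightarrow> carrier N"
   using ST(1)[OF c] gT[OF c] a by auto
 qed (use ST(1)[OF c] assms(2) free_val[OF c] a in \<open>auto intro!: N.smult_assoc1\<close>)
 also have "\<dots> = a *[N] k c" unfolding k_def
  using ST[OF c] gT[OF c] a by (intro N.finsum_smult_ldistr[symmetric]) auto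
 finally show "k (a *[FM R T] c) = a *[N] k c" .
qed
moreover have "restrict k (carrier ?K) (bas R t) = g t" if t: "t : T" for t
proof -
 have "k (bas R t) = finsum N (%s. bas R t s *[N] g s) {t}"
  using t by (intro ext bas_in) (auto simp: S_def basis_elt_def)
 also have "\<dots> = g t" using assms(2)[OF t] by (simp add: basis_elt_def)
 finally show ?thesis using bas_in[OF t] by simp
qed
ultimately show ?thesis by blast
qed

text \<open>Colimits and tensor products are both modules given by generators and relations; the
  rules below serve both constructions.\<close>

abbreviation presented where
"presented T Q \<equiv> quot_module (FM R T) (span_of R (FM R T) Q)"

definition gen_class where
"gen_class T Q t = span_of R (FM R T) Q +>\<^bsub>FM R T\<^esub> bas R t"

context
fixes T :: "'t set" and Q
assumes Q: "Q \<subseteq> carrier (FM R T)"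
begin

interpretation F: module R "FM R T" by (rule mod_free)

interpretation q: quot R "FM R T" "span_of R (FM R T) Q"
by (intro quot.intro quot_axioms.intro mod_free span_submodule Q)

lemma module_presented: "module R (presented T Q)"
by (rule q.module_quot)

lemma gen_class_carrier: "t : T ==> gen_class T Q t : carrier (presented T Q)"
unfolding gen_class_def q.carrier_quot by (intro imageI bas_in)

lemma gen_class_eq: "gen_class T Q t = q.cl (bas R t)"
unfolding gen_class_def ..

lemma presented_rel:
assumes "a : carrier (FM R T)" "b : carrier (FM R T)"
 "a -[FM R T] b : Q"
shows "q.cl a = q.cl b"
using q.cl_eq[OF assms(1,2)] span_sup[OF assms(3)] by blast

lemma gen_class_add:
assumes "t : T" "u : T" "v : T"
 "bas R t -[FM R T] (bas R u +[FM R T] bas R v) : Q"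
shows "gen_class T Q t = gen_class T Q u +[presented T Q] gen_class T Q v"
proof -
note c = bas_in[OF assms(1)] bas_in[OF assms(2)] bas_in[OF assms(3)]
show ?thesis unfolding gen_class_eq q.add_quot[OF c(2,3)]
 by (rule presented_rel[OF c(1) F.a_closed[OF c(2,3)] assms(4)])
qed

lemma gen_class_smult:
assumes "t : T" "u : T" "s : carrier R"
 "bas R t -[FM R T] (s *[FM R T] bas R u) : Q"
shows "gen_class T Q t = s *[presented T Q] gen_class T Q u"
proof -
note c = bas_in[OF assms(1)] bas_in[OF assms(2)]
show ?thesis unfolding gen_class_eq q.smult_quot[OF assms(3) c(2)]
 by (rule presented_rel[OF c(1) F.smult_closed[OF assms(3) c(2)] assms(4)])
qed

lemma gen_class_cong:
assumes "t : T" "u : T" "bas R t -[FM R T] bas R u : Q"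
shows "gen_class T Q t = gen_class T Q u"
unfolding gen_class_eq by (rule presented_rel[OF bas_in bas_in]) (use assms in auto)

lemma gen_class_zero: "t : T ==> gen_class T Q t = 0[presented T Q] \<longleftrightarrow>
 bas R t : span_of R (FM R T) Q"
unfolding gen_class_eq by (rule q.cl_zero[OF bas_in])

lemma presented_induct [consumes 1, case_names zero add smult gen]:
assumes "x : carrier (presented T Q)"
 and "P 0[presented T Q]"
 and "\<And>x y. x : carrier (presented T Q) ==> y : carrier (presented T Q) ==> P x ==> P y ==>
  P (x +[presented T Q] y)"
 and "\<And>s x. s : carrier R ==> x : carrier (presented T Q) ==> P x ==>
  P (s *[presented T Q] x)"
 and "\<And>t. t : T ==> P (gen_class T Q t)"
shows "P x"
proof -
have "P (q.cl c)" if "c : carrier (FM R T)" for c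
 using that
proof (induction rule: free_induct)
 case zero
 thus ?case using assms(2) by (simp add: q.zero_quot)
next
 case (add x y)
 thus ?case using assms(3)[of "q.cl x" "q.cl y"] by (simp add: q.add_quot q.carrier_quot del: free_ops)
next
 case (basis s t)
 thus ?case using assms(4)[of s "q.cl (bas R t)"] assms(5)[of t]
  by (simp add: q.smult_quot q.carrier_quot bas_in gen_class_def del: free_ops)
qed
thus ?thesis using assms(1) unfolding q.carrier_quot by auto
qed

text \<open>Compatibility with the relations is required of an arbitrary linear extension
  \<open>k\<close> of \<open>g\<close>, because the extension from \<open>free_lin\<close> is known
  only by its values on the basis.\<close>

lemma presented_lin:
assumes N: "module R N" and g: "\<And>t. t : T ==> g t : carrier N"
 and rel: "\<And>k x. k : lin R (FM R T) N ==>
  (\<And>t. t : T ==> k (bas R t) = g t) ==> x : Q ==> k x = 0[N]"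
shows "\<exists>h\<in>lin R (presented T Q) N. \<forall>t\<in>T. h (gen_class T Q t) = g t"
proof -
let ?K = "FM R T"
obtain k where k: "k : lin R ?K N" "\<And>t. t : T ==> k (bas R t) = g t"
 using free_lin[of N T g, OF N g] by blast
interpret N: module R N by fact
have "submodule {x : carrier ?K. k x : {0[N]}} R ?K"
 by (rule sub_preim[OF mod_free N k(1)], rule submoduleI'[OF N]) simp_all
hence "span_of R ?K Q \<subseteq> {x : carrier ?K. k x : {0[N]}}"
 by (rule span_least) (use subsetD[OF Q] rel[OF k] in blast)
then obtain h where "h : lin R (presented T Q) N"
 "\<And>x. x : carrier ?K ==> h (q.cl x) = k x"
 using q.quot_induce[OF N k(1)] by blast
thus ?thesis using k(2) unfolding gen_class_def
 by (intro bexI[of _ h] ballI) (simp_all add: bas_in)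
qed

end

end

section \<open>The category of small filtered complexes\<close>

text \<open>Filtered chain maps without extensionality: plain terms and composites qualify as they
  stand, and \<open>mk_arr\<close> restricts them when an arrow of the category is wanted.\<close>

definition fmap where
"fmap R K L m \<longleftrightarrow>
  (\<forall>n. \<forall>x\<in>K$n. m n x : L$n) \<and>
  (\<forall>n. \<forall>x\<in>K$n. \<forall>y\<in>K$n.
   m n (x +[K,n] y) = m n x +[L,n] m n y) \<and>
  (\<forall>n. \<forall>s\<in>carrier R. \<forall>x\<in>K$n. m n (s *[K,n] x) = s *[L,n] m n x) \<and>
  (\<forall>n. \<forall>x\<in>K$n. Df L n (m n x) = m (n+1) (Df K n x)) \<and>
  (\<forall>p n. \<forall>x\<in>Fl K p n. m n x : Fl L p n)"

lemma fmapI: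
assumes "\<And>n x. x : K$n ==> m n x : L$n"
 "\<And>n x y. x : K$n ==> y : K$n ==>
   m n (x +[K,n] y) = m n x +[L,n] m n y"
 "\<And>n s x. s : carrier R ==> x : K$n ==> m n (s *[K,n] x) = s *[L,n] m n x"
 "\<And>n x. x : K$n ==> Df L n (m n x) = m (n+1) (Df K n x)"
 "\<And>p n x. x : Fl K p n ==> m n x : Fl L p n"
shows "fmap R K L m"
using assms unfolding fmap_def by blast

definition mk_arr where
"mk_arr A B m = \<lparr>Src = A, Tgt = B, Map = (%n. restrict (m n) (A$n))\<rparr>"

lemma mk_arr_simps [simp]:
"Src (mk_arr A B m) = A" "Tgt (mk_arr A B m) = B"
"x : A$n ==> Map (mk_arr A B m) n x = m n x"
unfolding mk_arr_def by auto

locale fc = univ U + R?: cring R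
for U :: "'u itself" and R :: "('r, 'm) ring_scheme" (structure) +
assumes smR: "sm (carrier R)"
begin

abbreviation fcx where "fcx K \<equiv> filtered_complex R K"

abbreviation Ob :: "('r, 'u) fcomplex set" where "Ob \<equiv> fobjects R"

abbreviation hom :: "('r, 'u) fcomplex => ('r, 'u) fcomplex => ('r, 'u) farrow set" where
"hom \<equiv> fhom R"

abbreviation FC :: "(('r, 'u) fcomplex, ('r, 'u) farrow) monoidal_cat" where
"FC \<equiv> filtered_category R"

abbreviation fcmp (infixl "\<star>" 70) where "g \<star> f \<equiv> g \<cdot>\<^bsub>FC\<^esub> f"
abbreviation ftarr (infixl "\<boxtimes>" 75) where "f \<boxtimes> g \<equiv> f \<otimes>\<^sub>a\<^bsub>FC\<^esub> g"

lemma Ob_fcx [simp]: "A : Ob ==> fcx A"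
unfolding fobjects_def by blast

lemma Ob_sm: "A : Ob ==> sm (A$n)"
unfolding fobjects_def small_type by blast

lemma ObI: "fcx A ==> (\<And>n. sm (A$n)) ==> A : Ob"
unfolding fobjects_def small_type by blast

lemma cx_mod [simp]: "fcx K ==> module R (Cx K n)"
by (rule filtered_complex.Cx_module)

lemma cx_ab: "fcx K ==> abelian_group (Cx K n)"
using cx_mod module.axioms(2) by blast

lemma cx_closed [simp]:
assumes "fcx K"
shows "0[K,n] : K$n"
 "x : K$n ==> y : K$n ==> x +[K,n] y : K$n"
 "x : K$n ==> y : K$n ==> x -[K,n] y : K$n"
 "x : K$n ==> -[K,n] x : K$n"
 "s : carrier R ==> x : K$n ==> s *[K,n] x : K$n"
proof -
interpret M: module R "Cx K n" using assms by simp
show "0[K,n] : K$n"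
 "x : K$n ==> y : K$n ==> x +[K,n] y : K$n"
 "x : K$n ==> y : K$n ==> x -[K,n] y : K$n"
 "x : K$n ==> -[K,n] x : K$n"
 "s : carrier R ==> x : K$n ==> s *[K,n] x : K$n"
 by auto
qed

lemma cx_simps [simp]:
assumes "fcx K" "x : K$n"
shows "x +[K,n] 0[K,n] = x" "0[K,n] +[K,n] x = x"
 "x -[K,n] 0[K,n] = x" "x -[K,n] x = 0[K,n]"
 "-[K,n] (-[K,n] x) = x" "0[K,n] -[K,n] x = -[K,n] x"
 "\<one> *[K,n] x = x" "\<zero> *[K,n] x = 0[K,n]"
proof -
interpret M: module R "Cx K n" using assms by simp
show "x +[K,n] 0[K,n] = x" "0[K,n] +[K,n] x = x"
 "x -[K,n] 0[K,n] = x" "x -[K,n] x = 0[K,n]"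
 "-[K,n] (-[K,n] x) = x" "0[K,n] -[K,n] x = -[K,n] x"
 "\<one> *[K,n] x = x" "\<zero> *[K,n] x = 0[K,n]"
 using assms by (auto simp: a_minus_def M.neg_zero M.r_neg)
qed

lemma neg_zero_cx [simp]: "fcx K ==> -[K,n] 0[K,n] = 0[K,n]"
and smult_zero_cx [simp]: "fcx K ==> s : carrier R ==> s *[K,n] 0[K,n] = 0[K,n]"
using abelian_group.neg_zero[OF cx_ab] module.smult_r_null[OF cx_mod] by auto

lemma cx_ac:
assumes "fcx K"
shows "x : K$n ==> y : K$n ==> z : K$n ==>
  x +[K,n] y +[K,n] z = x +[K,n] (y +[K,n] z)"
 "x : K$n ==> y : K$n ==> x +[K,n] y = y +[K,n] x"
 "x : K$n ==> y : K$n ==> z : K$n ==>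
  x +[K,n] (y +[K,n] z) = y +[K,n] (x +[K,n] z)"
proof -
interpret A: abelian_group "Cx K n" by (rule cx_ab[OF assms])
show "x : K$n ==> y : K$n ==> z : K$n ==>
  x +[K,n] y +[K,n] z = x +[K,n] (y +[K,n] z)" by (rule A.a_assoc)
show "x : K$n ==> y : K$n ==> x +[K,n] y = y +[K,n] x" by (rule A.a_comm)
show "x : K$n ==> y : K$n ==> z : K$n ==>
  x +[K,n] (y +[K,n] z) = y +[K,n] (x +[K,n] z)" by (rule A.a_lcomm)
qed

lemma cx_smult:
assumes "fcx K"
shows "a : carrier R ==> b : carrier R ==> x : K$n ==>
  (a \<oplus> b) *[K,n] x = a *[K,n] x +[K,n] b *[K,n] x"
 "a : carrier R ==> x : K$n ==> y : K$n ==>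
  a *[K,n] (x +[K,n] y) = a *[K,n] x +[K,n] a *[K,n] y"
 "a : carrier R ==> b : carrier R ==> x : K$n ==>
  (a \<otimes> b) *[K,n] x = a *[K,n] (b *[K,n] x)"
 "a : carrier R ==> x : K$n ==>
  a *[K,n] (-[K,n] x) = -[K,n] (a *[K,n] x)"
using module.smult_l_distr[OF cx_mod[OF assms]] module.smult_r_distr[OF cx_mod[OF assms]]
 module.smult_assoc1[OF cx_mod[OF assms]] module.smult_r_minus[OF cx_mod[OF assms]]
by simp_all

lemma minus_zero_iff_cx: "fcx K ==> x : K$n ==> y : K$n ==>
 x -[K,n] y = 0[K,n] \<longleftrightarrow> x = y"
by (rule abelian_group.minus_eq_zero[OF cx_ab])

lemma d_lin: "fcx K ==> Df K n : lin R (Cx K n) (Cx K (n+1))"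
by (rule filtered_complex.Df_lin)

lemma d_simps [simp]:
assumes K: "fcx K" and x: "x : K$n"
shows "Df K n x : K$(n+1)"
 "y : K$n ==> Df K n (x +[K,n] y) = Df K n x +[K,n+1] Df K n y"
 "y : K$n ==> Df K n (x -[K,n] y) = Df K n x -[K,n+1] Df K n y"
 "Df K n (-[K,n] x) = -[K,n+1] Df K n x"
 "s : carrier R ==> Df K n (s *[K,n] x) = s *[K,n+1] Df K n x"
 "Df K (n+1) (Df K n x) = 0[K,n+1+1]"
proof -
note l = d_lin[OF K, of n]
note m = cx_mod[OF K]
show "Df K n x : K$(n+1)" using lin_in[OF l] x by blast
show "y : K$n ==> Df K n (x +[K,n] y) = Df K n x +[K,n+1] Df K n y"
 using lin_add[OF l x] .
show "y : K$n ==> Df K n (x -[K,n] y) = Df K n x -[K,n+1] Df K n y"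
 using lin_minus[OF m m l x] .
show "Df K n (-[K,n] x) = -[K,n+1] Df K n x" using lin_neg[OF m m l x] .
show "s : carrier R ==> Df K n (s *[K,n] x) = s *[K,n+1] Df K n x"
 using lin_smult[OF l _ x] .
show "Df K (n+1) (Df K n x) = 0[K,n+1+1]"
 using filtered_complex.Df_Df[OF K x] .
qed

lemma d_zero [simp]: "fcx K ==> Df K n 0[K,n] = 0[K,n+1]"
by (rule lin_zero) (auto intro: d_lin)

lemma Fl_sub: "fcx K ==> submodule (Fl K p n) R (Cx K n)"
by (rule filtered_complex.Fl_submodule)

lemma Fl_car: "x : Fl K p n ==> fcx K ==> x : K$n"
using submodule_mem[OF Fl_sub] .

lemma Fl_rules:
assumes "fcx K"
shows Fl_zero [simp]: "0[K,n] : Fl K p n"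
 and Fl_add: "x : Fl K p n ==> y : Fl K p n ==> x +[K,n] y : Fl K p n"
 and Fl_smult: "s : carrier R ==> x : Fl K p n ==> s *[K,n] x : Fl K p n"
 and Fl_neg: "x : Fl K p n ==> -[K,n] x : Fl K p n"
 and Fl_minus: "x : Fl K p n ==> y : Fl K p n ==> x -[K,n] y : Fl K p n"
 and Fl_d: "x : Fl K p n ==> Df K n x : Fl K p (n+1)"
using submodule_rules[OF Fl_sub[OF assms, of p n]] filtered_complex.Df_Fl[OF assms, of n p]
by auto

lemma Fl_neg_iff: "fcx K ==> x : K$n ==> -[K,n] x : Fl K p n \<longleftrightarrow> x : Fl K p n"
by (metis Fl_neg cx_simps(5))

lemma Fl_le:
assumes "x : Fl K p n" "p \<le> q" "fcx K" shows "x : Fl K q n"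
proof -
have "x : Fl K (p + int k) n" for k
proof (induction k)
 case (Suc k)
 hence "x : Fl K (p + int k+1) n" using filtered_complex.Fl_mono[OF assms(3)] by blast
 thus ?case by (simp add: ac_simps)
qed (use assms in simp)
from this[of "nat (q - p)"] show ?thesis using assms(2) by simp
qed

lemma fmap_rules:
assumes "fmap R K L m"
shows fmap_closed: "x : K$n ==> m n x : L$n"
 and fmap_add: "x : K$n ==> y : K$n ==>
   m n (x +[K,n] y) = m n x +[L,n] m n y"
 and fmap_smult: "s : carrier R ==> x : K$n ==>
   m n (s *[K,n] x) = s *[L,n] m n x"
 and fmap_d: "x : K$n ==> Df L n (m n x) = m (n+1) (Df K n x)"
 and fmap_Fl: "x : Fl K p n ==> m n x : Fl L p n"
using assms unfolding fmap_def by blast+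

lemma fmap_filtered:
assumes "fcx K" "fmap R K L m"
shows "(%n. restrict (m n) (K$n)) : filtered_maps R K L"
proof -
have "restrict (m n) (K$n) : lin R (Cx K n) (Cx L n)" for n
 using assms by (intro lin_restrictI) (auto simp: fmap_rules)
thus ?thesis unfolding filtered_maps_def
 using assms Fl_car[OF _ assms(1)] by (auto simp: fmap_rules)
qed

lemma filtered_fmap: "m : filtered_maps R K L ==> fmap R K L m"
proof -
assume m: "m : filtered_maps R K L"
hence l: "\<And>n. m n : lin R (Cx K n) (Cx L n)" unfolding filtered_maps_def by blast
have "x : Fl K p n ==> m n x : Fl L p n" for x p n
 using m unfolding filtered_maps_def by blast
thus ?thesis
 by (intro fmapI)
  (use m lin_in[OF l] lin_add[OF l] lin_smult[OF l] in \<open>auto simp: filtered_maps_def\<close>)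
qed

lemma fmap_comp: "fmap R K L m ==> fmap R L M k ==> fmap R K M (%n x. k n (m n x))"
by (rule fmapI) (simp_all add: fmap_rules)

lemma mk_arr_hom: "A : Ob ==> B : Ob ==> fmap R A B m ==> mk_arr A B m : hom A B"
unfolding fhom_def farrows_def mk_arr_def by (simp add: fmap_filtered)

lemma hom_src: "f : hom A B ==> Src f = A" and hom_tgt: "f : hom A B ==> Tgt f = B"
and hom_Ob: "f : hom A B ==> A : Ob" "f : hom A B ==> B : Ob"
and hom_arr: "f : hom A B ==> f : farrows R"
unfolding fhom_def farrows_def by auto

lemma arr_hom: "f : farrows R ==> f : hom (Src f) (Tgt f)"
unfolding fhom_def by auto

lemma hom_fmap: "f : hom A B ==> fmap R A B (Map f)"
unfolding fhom_def farrows_def using filtered_fmap by auto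

lemma hom_map_undef: "f : hom A B ==> x \<notin> A$n ==> Map f n x = undefined"
proof -
assume "f : hom A B"
hence "Map f n : lin R (Cx A n) (Cx B n)"
 unfolding fhom_def farrows_def filtered_maps_def by auto
thus "x \<notin> A$n ==> Map f n x = undefined" by (rule lin_undef)
qed

lemma hom_fcx: "f : hom A B ==> fcx A" "f : hom A B ==> fcx B"
using hom_Ob by auto

lemma map_simps [simp]:
assumes f: "f : hom A B"
shows "x : A$n ==> Map f n x : B$n"
 "x : A$n ==> y : A$n ==>
   Map f n (x +[A,n] y) = Map f n x +[B,n] Map f n y"
 "x : A$n ==> y : A$n ==>
   Map f n (x -[A,n] y) = Map f n x -[B,n] Map f n y"
 "x : A$n ==> Map f n (-[A,n] x) = -[B,n] Map f n x"
 "Map f n 0[A,n] = 0[B,n]"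
 "s : carrier R ==> x : A$n ==>
   Map f n (s *[A,n] x) = s *[B,n] Map f n x"
proof -
have l: "Map f n : lin R (Cx A n) (Cx B n)"
 using f unfolding fhom_def farrows_def filtered_maps_def by auto
have m: "module R (Cx A n)" "module R (Cx B n)" using hom_fcx[OF f] by auto
show "x : A$n ==> y : A$n ==>
   Map f n (x -[A,n] y) = Map f n x -[B,n] Map f n y"
 "x : A$n ==> Map f n (-[A,n] x) = -[B,n] Map f n x"
 "Map f n 0[A,n] = 0[B,n]"
 using lin_minus[OF m l] lin_neg[OF m l] lin_zero[OF m l] by auto
qed (use hom_fmap[OF f] in \<open>auto simp: fmap_rules\<close>)

lemma map_d: "f : hom A B ==> x : A$n ==> Map f (n+1) (Df A n x) = Df B n (Map f n x)"
using hom_fmap fmap_d by metis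

lemma map_Fl: "f : hom A B ==> x : Fl A p n ==> Map f n x : Fl B p n"
using hom_fmap fmap_Fl by metis

lemma hom_ext:
assumes "f : hom A B" "g : hom A B'" "B' = B"
 "\<And>n x. x : A$n ==> Map f n x = Map g n x"
shows "f = g"
proof -
have "Map f n x = Map g n x" for n x
 using assms(4) hom_map_undef[OF assms(1)] hom_map_undef[OF assms(2)]
 by (cases "x : A$n") auto
hence "Map f = Map g" by blast
thus ?thesis using hom_src[OF assms(1)] hom_src[OF assms(2)] hom_tgt[OF assms(1)]
  hom_tgt[OF assms(2)] assms(3) by simp
qed

lemma FC_simps [simp]:
"Obj FC = Ob" "Arr FC = farrows R" "Dom FC = Src" "Cod FC = Tgt"
"homset FC A B = hom A B"
unfolding filtered_category_def homset_def fhom_def by auto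

lemma FC_Idt: "Idt FC A = mk_arr A A (%n x. x)"
unfolding filtered_category_def mk_arr_def by simp

lemma FC_Cmp: "g \<star> f = mk_arr (Src f) (Tgt g) (%n x. Map g n (Map f n x))"
unfolding filtered_category_def mk_arr_def by simp

lemma idI [simp]: "A : Ob ==> Idt FC A : hom A A"
unfolding FC_Idt by (intro mk_arr_hom fmapI) auto

lemma Idt_map [simp]: "x : A$n ==> Map (Idt FC A) n x = x"
unfolding FC_Idt by simp

lemma cmpI [simp]: "f : hom A B ==> g : hom B C ==> g \<star> f : hom A C"
proof -
assume f: "f : hom A B" and g: "g : hom B C"
show ?thesis unfolding FC_Cmp hom_src[OF f] hom_tgt[OF g]
 by (rule mk_arr_hom[OF hom_Ob(1)[OF f] hom_Ob(2)[OF g] fmap_comp[OF hom_fmap[OF f] hom_fmap[OF g]]])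
qed

lemma cmp_map [simp]: "f : hom A B ==> x : A$n ==>
 Map (g \<star> f) n x = Map g n (Map f n x)"
unfolding FC_Cmp using hom_src by fastforce

lemma Cmp_src_tgt [simp]: "Src (g \<star> f) = Src f" "Tgt (g \<star> f) = Tgt g"
unfolding FC_Cmp by simp_all

lemma Idt_src_tgt [simp]: "Src (Idt FC A) = A" "Tgt (Idt FC A) = A"
unfolding FC_Idt by simp_all

lemma category_FC: "category FC"
proof
fix f assume "f : Arr FC"
thus "Dom FC f : Obj FC" "Cod FC f : Obj FC" unfolding FC_simps farrows_def by auto
next
fix f X Y assume f: "f : homset FC X Y"
hence f': "f : hom X Y" "X : Ob" "Y : Ob" using hom_Ob by auto
have "f \<star> Idt FC X : hom X Y" "Idt FC Y \<star> f : hom X Y"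
 using cmpI[OF idI f'(1)] cmpI[OF f'(1) idI] f' by auto
thus "f \<star> Idt FC X = f" "Idt FC Y \<star> f = f"
 using f' by (auto intro!: hom_ext[of _ X Y] simp: cmp_map[of _ X X] cmp_map[of _ X Y])
next
fix f W X g Y h Z assume "f : homset FC W X" "g : homset FC X Y" "h : homset FC Y Z"
hence f: "f : hom W X" "g : hom X Y" "h : hom Y Z" by auto
have gf: "g \<star> f : hom W Y" "h \<star> g : hom X Z"
 using cmpI f by blast+
show "h \<star> (g \<star> f) = h \<star> g \<star> f"
 by (rule hom_ext[OF cmpI[OF gf(1) f(3)] cmpI[OF f(1) gf(2)]])
  (use f gf in \<open>simp_all add: cmp_map[of _ W X] cmp_map[of _ W Y] cmp_map[of _ X Y]\<close>)
qed auto

section \<open>Copies in the universe\<close>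

abbreviation cpy :: "('r, 'x) fcomplex => ('r, 'u) fcomplex" where
"cpy \<equiv> copy"

definition cd :: "('r, 'x) fcomplex => int => 'x => 'u" where
"cd K n = code (K$n)"

text \<open>Complexes over any element type that are small enough to be copied faithfully into the
  universe; tensor products, internal homs, limits and colimits are built there and then
  copied.\<close>

definition cpx where "cpx K \<longleftrightarrow> fcx K \<and> (\<forall>n. sm (K$n))"

lemma cpxI: "fcx K ==> (\<And>n. sm (K$n)) ==> cpx K"
unfolding cpx_def by blast

lemma cpx_fcx [simp]: "cpx K ==> fcx K"
and cpx_sm: "cpx K ==> sm (K$n)"
unfolding cpx_def by auto

lemma cpx_decode [simp]: "cpx K ==> x : K$n ==> decode (K$n) (cd K n x) = x"
by (simp add: cpx_sm cd_def)

lemma cd_eq: "cpx K ==> x : K$n ==> y : K$n ==> cd K n x = cd K n y \<longleftrightarrow> x = y"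
unfolding cd_def by (rule inj_on_eq_iff[OF inj_code[OF cpx_sm]])

lemma copy_car: "(cpy K)$n = cd K n ` K$n"
unfolding copy_def copy_module_def Let_def cd_def by (simp add: cpx_sm)

lemma cd_in [simp]: "x : K$n ==> cd K n x : (cpy K)$n"
unfolding copy_car by blast

lemma copy_zero: "0[cpy K,n] = cd K n 0[K,n]"
unfolding copy_def copy_module_def Let_def cd_def by (simp add: cpx_sm)

lemma copy_add: "cpx K ==> x : K$n ==> y : K$n ==>
 cd K n x +[cpy K,n] cd K n y = cd K n (x +[K,n] y)"
unfolding copy_def copy_module_def Let_def cd_def by (simp add: cpx_sm)

lemma copy_smult: "cpx K ==> x : K$n ==>
 s *[cpy K,n] cd K n x = cd K n (s *[K,n] x)"
unfolding copy_def copy_module_def Let_def cd_def by (simp add: cpx_sm)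

lemma copy_d: "cpx K ==> x : K$n ==> Df (cpy K) n (cd K n x) = cd K (n+1) (Df K n x)"
unfolding copy_def copy_map_def cd_def by (simp add: cpx_sm)

lemma copy_Fl: "Fl (cpy K) p n = cd K n ` Fl K p n"
unfolding copy_def cd_def by simp

lemma cd_Fl: "cpx K ==> x : K$n ==> cd K n x : Fl (cpy K) p n \<longleftrightarrow> x : Fl K p n"
unfolding copy_Fl using Fl_car[of _ K p n] cd_eq[of K x n] by auto

lemma copy_module_module:
assumes K: "cpx K" shows "module R (Cx (cpy K) n)"
proof -
interpret M: module R "Cx K n" using K by simp
note [simp] = copy_zero copy_add[OF K] copy_smult[OF K]
show ?thesis
proof (rule moduleI)
 show "cring R" by (rule is_cring)
 show "abelian_group (Cx (cpy K) n)"
 proof (rule abelian_groupI)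
  fix u assume "u : (cpy K)$n"
  then obtain x where x: "x : K$n" "u = cd K n x" unfolding copy_car by auto
  thus "\<exists>v\<in>(cpy K)$n. v +[cpy K,n] u = 0[cpy K,n]"
   by (intro bexI[of _ "cd K n (-[K,n] x)"]) (auto simp: M.l_neg)
 qed (auto simp: copy_car M.a_ac)
qed (auto simp: copy_car M.smult_l_distr M.smult_r_distr M.smult_assoc1)
qed

lemma copy_Ob [simp]:
assumes K: "cpx K" shows "cpy K : Ob"
proof (rule ObI)
note m = copy_module_module[OF K]
note [simp] = copy_zero copy_add[OF K] copy_smult[OF K] copy_d[OF K]
have K': "fcx K" using K by simp
show "fcx (cpy K)"
proof (rule filtered_complex.intro)
 fix n p :: int
 show "module R (Cx (cpy K) n)" by (rule m)
 show "Df (cpy K) n : lin R (Cx (cpy K) n) (Cx (cpy K) (n+1))"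
 proof (rule lin_mapsI)
  show "\<And>x. x \<notin> (cpy K)$n ==> Df (cpy K) n x = undefined"
   unfolding copy_car by (simp add: copy_def copy_map_def cd_def)
 qed (use K' in \<open>auto simp: copy_car\<close>)
 show "submodule (Fl (cpy K) p n) R (Cx (cpy K) n)"
  by (rule submoduleI'[OF m])
   (use K' in \<open>auto simp: copy_car copy_Fl Fl_car Fl_add Fl_smult\<close>)
 show "Df (cpy K) n ` Fl (cpy K) p n \<subseteq> Fl (cpy K) p (n+1)"
  unfolding copy_Fl using K' Fl_d[OF K'] Fl_car[of _ K p n] by auto
 show "Fl (cpy K) p n \<subseteq> Fl (cpy K) (p+1) n"
  unfolding copy_Fl using K' Fl_le[of _ K p n "p+1"] by auto
 show "\<And>x. x : (cpy K)$n ==>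
   Df (cpy K) (n+1) (Df (cpy K) n x) = 0[cpy K,n+1+1]"
  using K' by (auto simp: copy_car)
qed
show "sm ((cpy K)$n)" for n
 unfolding copy_car by (rule sm_image[OF cpx_sm[OF K]])
qed

lemma fmap_cd: "cpx K ==> fmap R K (cpy K) (cd K)"
by (rule fmapI) (auto simp: copy_add copy_smult copy_d copy_Fl)

abbreviation dc :: "('r, 'x) fcomplex => int => 'u => 'x" where
"dc K n \<equiv> decode (K$n)"

lemma fmap_dc: "cpx K ==> fmap R (cpy K) K (dc K)"
by (rule fmapI) (auto simp: copy_car copy_add copy_smult copy_d copy_Fl Fl_car)

lemma copy_neg:
assumes K: "cpx K" and x: "x : K$n"
shows "-[cpy K,n] cd K n x = cd K n (-[K,n] x)"
proof -
interpret A: abelian_group "Cx (cpy K) n" using cx_ab[of "cpy K"] K by simp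
interpret B: abelian_group "Cx K n" using cx_ab[of K] K by simp
show ?thesis by (rule A.minus_equality) (use K x in \<open>auto simp: copy_add copy_zero B.l_neg\<close>)
qed

lemma copy_minus: "cpx K ==> x : K$n ==> y : K$n ==>
 cd K n x -[cpy K,n] cd K n y = cd K n (x -[K,n] y)"
unfolding a_minus_def by (simp add: copy_neg copy_add)

definition from_copy where "from_copy K B m = mk_arr (cpy K) B (%n u. m n (dc K n u))"
definition to_copy where "to_copy A K m = mk_arr A (cpy K) (%n x. cd K n (m n x))"

lemma from_copy_hom: "cpx K ==> B : Ob ==> fmap R K B m ==> from_copy K B m : hom (cpy K) B"
unfolding from_copy_def by (intro mk_arr_hom copy_Ob fmap_comp[OF fmap_dc])

lemma from_copy_map [simp]: "cpx K ==> x : K$n ==>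
 Map (from_copy K B m) n (cd K n x) = m n x"
unfolding from_copy_def by simp

lemma to_copy_hom: "cpx K ==> A : Ob ==> fmap R A K m ==> to_copy A K m : hom A (cpy K)"
unfolding to_copy_def by (intro mk_arr_hom copy_Ob fmap_comp[OF _ fmap_cd])

lemma to_copy_map [simp]: "x : A$n ==> Map (to_copy A K m) n x = cd K n (m n x)"
unfolding to_copy_def by simp

lemma hom_ext_copy:
assumes "f : hom (cpy K) B" "g : hom (cpy K) B'" "B' = B"
 "\<And>n x. x : K$n ==> Map f n (cd K n x) = Map g n (cd K n x)"
shows "f = g"
by (rule hom_ext[OF assms(1-3)]) (use assms(4) in \<open>auto simp: copy_car\<close>)

lemma copy_arrow_hom:
assumes "cpx K" "cpx L" "fmap R K L m"
shows "copy_arrow K L m : hom (cpy K) (cpy L)"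
 "x : K$n ==> Map (copy_arrow K L m) n (cd K n x) = cd L n (m n x)"
proof -
have "copy_arrow K L m = mk_arr (cpy K) (cpy L) (%n u. cd L n (m n (dc K n u)))"
 unfolding copy_arrow_def mk_arr_def copy_map_def copy_car cd_def ..
thus "copy_arrow K L m : hom (cpy K) (cpy L)"
 using mk_arr_hom[OF copy_Ob[OF assms(1)] copy_Ob[OF assms(2)]
   fmap_comp[OF fmap_comp[OF fmap_dc[OF assms(1)] assms(3)] fmap_cd[OF assms(2)]]] by simp
show "x : K$n ==> Map (copy_arrow K L m) n (cd K n x) = cd L n (m n x)"
 unfolding copy_arrow_def copy_map_def cd_def using assms(1) by (simp add: cpx_sm)
qed

end

section \<open>Limits and colimits\<close>

text \<open>Limits over a directed graph with vertices \<open>I\<close> and edges \<open>K\<close>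
  from \<open>s k\<close> to \<open>t k\<close>. Graphs instead of categories let one construction
  serve small diagrams, pullbacks, cell attachments and sequences.\<close>

definition glimit where
"glimit C I K D s t m L p \<longleftrightarrow>
  L : Obj C \<and> (\<forall>i\<in>I. p i : homset C L (D i)) \<and>
  (\<forall>k\<in>K. m k \<cdot>\<^bsub>C\<^esub> p (s k) = p (t k)) \<and>
  (\<forall>X x. X : Obj C \<and> (\<forall>i\<in>I. x i : homset C X (D i)) \<and>
   (\<forall>k\<in>K. m k \<cdot>\<^bsub>C\<^esub> x (s k) = x (t k)) -->
   (\<exists>!h. h : homset C X L \<and> (\<forall>i\<in>I. p i \<cdot>\<^bsub>C\<^esub> h = x i)))"

definition gcolimit where
"gcolimit C I K D s t m L q \<longleftrightarrow>
  L : Obj C \<and> (\<forall>i\<in>I. q i : homset C (D i) L) \<and>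
  (\<forall>k\<in>K. q (t k) \<cdot>\<^bsub>C\<^esub> m k = q (s k)) \<and>
  (\<forall>X x. X : Obj C \<and> (\<forall>i\<in>I. x i : homset C (D i) X) \<and>
   (\<forall>k\<in>K. x (t k) \<cdot>\<^bsub>C\<^esub> m k = x (s k)) -->
   (\<exists>!h. h : homset C L X \<and> (\<forall>i\<in>I. h \<cdot>\<^bsub>C\<^esub> q i = x i)))"

definition lim_module :: "'i set => 'k set => ('i => ('r, 'u) fcomplex) => ('k => 'i) =>
 ('k => 'i) => ('k => ('r, 'u) farrow) => int => ('r, 'i => 'u) module" where
"lim_module I K D s t m n = \<lparr>carrier = {c. (\<forall>i\<in>I. c i : (D i)$n) \<and>
   (\<forall>i. i \<notin> I --> c i = undefined) \<and> (\<forall>k\<in>K. Map (m k) n (c (s k)) = c (t k))},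
  mult = undefined, one = undefined, zero = (\<lambda>i\<in>I. 0[D i,n]),
  add = (%c c'. \<lambda>i\<in>I. c i +[D i,n] c' i), smult = (%a c. \<lambda>i\<in>I. a *[D i,n] c i)\<rparr>"

definition lim_complex :: "'i set => 'k set => ('i => ('r, 'u) fcomplex) => ('k => 'i) =>
 ('k => 'i) => ('k => ('r, 'u) farrow) => ('r, 'i => 'u) fcomplex" where
"lim_complex I K D s t m = \<lparr>Cx = lim_module I K D s t m,
  Df = (%n. \<lambda>c\<in>carrier (lim_module I K D s t m n). \<lambda>i\<in>I. Df (D i) n (c i)),
  Fl = (%p n. {c : carrier (lim_module I K D s t m n). \<forall>i\<in>I. c i : Fl (D i) p n})\<rparr>"

definition colim_gens :: "'i set => ('i => ('r, 'u) fcomplex) => int => ('i \<times> 'u) set" where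
"colim_gens I D n = {(i, x). i : I \<and> x : (D i)$n}"

definition colim_rels :: "('r, 'm) ring_scheme => 'i set => 'k set => ('i => ('r, 'u) fcomplex) =>
 ('k => 'i) => ('k => 'i) => ('k => ('r, 'u) farrow) => int => ('i \<times> 'u => 'r) set" where
"colim_rels R I K D s t m n =
 (let T = FM R (colim_gens I D n) in
  {bas R (i, x +[D i,n] y) -[T] (bas R (i, x) +[T] bas R (i, y)) | i x y.
   i : I \<and> x : (D i)$n \<and> y : (D i)$n} \<union>
  {bas R (i, a *[D i,n] x) -[T] (a *[T] bas R (i, x)) | i a x.
   i : I \<and> a : carrier R \<and> x : (D i)$n} \<union>
  {bas R (t k, Map (m k) n x) -[T] bas R (s k, x) | k x.
   k : K \<and> x : (D (s k))$n})"

context fc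
begin

lemma sm_presented: "sm T ==> sm (carrier (presented T Q))"
proof -
let ?K = "FM R T"
assume T: "sm T"
have "sm (carrier ?K)"
proof (rule sm_fun[OF T smR])
 fix f g assume "f : carrier ?K" "g : carrier ?K"
  "\<And>a. a : T ==> f a = g a"
 hence "f a = g a" for a by (cases "a : T") (auto simp: free_car)
 thus "f = g" by blast
qed (auto simp: free_car)
hence "sm ((%a. span_of R ?K Q +>\<^bsub>FM R T\<^esub> a) ` carrier ?K)"
 by (rule sm_image)
moreover have "carrier (presented T Q) =
  (%a. span_of R ?K Q +>\<^bsub>FM R T\<^esub> a) ` carrier ?K"
 unfolding quot_module_def A_RCOSETS_def' by auto
ultimately show ?thesis by simp
qed

end

locale diagram = fc U R for U :: "'u itself" and R :: "('r, 'm) ring_scheme" (structure) +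
fixes I :: "'i set" and K :: "'k set" and D :: "'i => ('r, 'u) fcomplex"
 and s t :: "'k => 'i" and m :: "'k => ('r, 'u) farrow"
assumes smI: "sm I" and D_Ob [simp]: "i : I ==> D i : Ob"
 and sI [simp]: "k : K ==> s k : I" and tI [simp]: "k : K ==> t k : I"
 and m_hom: "k : K ==> m k : hom (D (s k)) (D (t k))"
begin

abbreviation LM where "LM \<equiv> lim_module I K D s t m"
abbreviation LC where "LC \<equiv> lim_complex I K D s t m"

lemma LM_carrier: "c : carrier (LM n) \<longleftrightarrow> (\<forall>i\<in>I. c i : (D i)$n) \<and>
   (\<forall>i. i \<notin> I --> c i = undefined) \<and> (\<forall>k\<in>K. Map (m k) n (c (s k)) = c (t k))"
unfolding lim_module_def by simp

lemma LM_ops: "0[LM n] = (\<lambda>i\<in>I. 0[D i,n])"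
"c +[LM n] c' = (\<lambda>i\<in>I. c i +[D i,n] c' i)"
"a *[LM n] c = (\<lambda>i\<in>I. a *[D i,n] c i)"
unfolding lim_module_def by simp_all

lemma LM_mem: "c : carrier (LM n) ==> i : I ==> c i : (D i)$n"
unfolding LM_carrier by blast

lemma LM_undef: "c : carrier (LM n) ==> i \<notin> I ==> c i = undefined"
unfolding LM_carrier by blast

lemma LM_ext: "c : carrier (LM n) ==> c' : carrier (LM n) ==> (\<And>i. i : I ==> c i = c' i) ==> c = c'"
by (rule ext) (metis LM_undef)

lemma LM_closed:
shows "0[LM n] : carrier (LM n)"
 "c : carrier (LM n) ==> c' : carrier (LM n) ==> c +[LM n] c' : carrier (LM n)"
 "a : carrier R ==> c : carrier (LM n) ==> a *[LM n] c : carrier (LM n)"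
unfolding LM_carrier LM_ops by (auto simp: map_simps[OF m_hom])

lemma LM_d_closed: "c : carrier (LM n) ==> (\<lambda>i\<in>I. Df (D i) n (c i)) : carrier (LM (n+1))"
unfolding LM_carrier by (auto simp: map_d[OF m_hom])

lemma LM_module: "module R (LM n)"
proof (rule moduleI)
show "cring R" by (rule is_cring)
show "abelian_group (LM n)"
proof (rule abelian_groupI)
 show "\<And>x y. x : carrier (LM n) ==> y : carrier (LM n) ==> x +[LM n] y = y +[LM n] x"
  by (auto simp: LM_ops restrict_def LM_mem fun_eq_iff cx_ac(2))
 show "x +[LM n] y +[LM n] z = x +[LM n] (y +[LM n] z)"
  if "x : carrier (LM n)" "y : carrier (LM n)" "z : carrier (LM n)" for x y z
  using that by (auto simp: LM_ops restrict_def LM_mem fun_eq_iff cx_ac(1))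
 show "0[LM n] +[LM n] x = x" if "x : carrier (LM n)" for x
  by (rule LM_ext[OF LM_closed(2)[OF LM_closed(1) that] that])
   (use that LM_mem in \<open>auto simp: LM_ops(1,2)\<close>)
 fix x assume x: "x : carrier (LM n)"
 have "0[LM n] = (\<ominus> \<one>) *[LM n] x +[LM n] x"
 proof (rule LM_ext)
  fix i assume i: "i : I"
  interpret M: module R "Cx (D i) n" using i by simp
  show "0[LM n] i = ((\<ominus> \<one>) *[LM n] x +[LM n] x) i"
   using i LM_mem[OF x i] by (simp add: LM_ops M.smult_l_minus M.l_neg)
 qed (use x LM_closed in auto)
 thus "\<exists>y\<in>carrier (LM n). y +[LM n] x = 0[LM n]"
  using LM_closed(3)[OF _ x, of "\<ominus> \<one>"] by auto
qed (use LM_closed in auto)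
show "\<one> *[LM n] x = x" if "x : carrier (LM n)" for x
 by (rule LM_ext) (use that LM_closed LM_mem in \<open>auto simp: LM_ops(3)\<close>)
show "(a \<oplus> b) *[LM n] x = a *[LM n] x +[LM n] b *[LM n] x"
 "(a \<otimes> b) *[LM n] x = a *[LM n] (b *[LM n] x)"
 if "a : carrier R" "b : carrier R" "x : carrier (LM n)" for a b x
 using that by (auto simp: LM_ops restrict_def LM_mem fun_eq_iff cx_smult)
show "a *[LM n] (x +[LM n] y) = a *[LM n] x +[LM n] a *[LM n] y"
 if "a : carrier R" "x : carrier (LM n)" "y : carrier (LM n)" for a x y
 using that by (auto simp: LM_ops restrict_def LM_mem fun_eq_iff cx_smult)
qed (rule LM_closed)

lemma LC_sel [simp]: "Cx LC n = LM n"
"c : carrier (LM n) ==> Df LC n c = (\<lambda>i\<in>I. Df (D i) n (c i))"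
"Fl LC p n = {c : carrier (LM n). \<forall>i\<in>I. c i : Fl (D i) p n}"
unfolding lim_complex_def by simp_all

lemma LC_cpx: "cpx LC"
proof (rule cpxI)
show "fcx LC"
proof (rule filtered_complex.intro)
 fix n p :: int
 show "module R (Cx LC n)" using LM_module by simp
 show "Df LC n : lin R (Cx LC n) (Cx LC (n+1))"
 proof (rule lin_mapsI)
  show "\<And>x. x \<notin> LC$n ==> Df LC n x = undefined"
   unfolding lim_complex_def by simp
  show "x : LC$n ==> y : LC$n ==>
   Df LC n (x +[LC,n] y) = Df LC n x +[LC,n+1] Df LC n y" for x y
   using LM_closed(2)[of x n y] by (auto simp: LM_ops LM_mem restrict_def fun_eq_iff)
  show "a : carrier R ==> x : LC$n ==>
   Df LC n (a *[LC,n] x) = a *[LC,n+1] Df LC n x" for a x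
   using LM_closed(3)[of a x n] by (auto simp: LM_ops LM_mem restrict_def fun_eq_iff)
 qed (simp add: LM_d_closed)
 show "submodule (Fl LC p n) R (Cx LC n)"
 proof (rule submoduleI')
  show "x : Fl LC p n ==> y : Fl LC p n ==> x +[LC,n] y : Fl LC p n" for x y
   using LM_closed(2)[of x n y] by (auto simp: LM_ops Fl_add)
  show "a : carrier R ==> x : Fl LC p n ==> a *[LC,n] x : Fl LC p n" for a x
   using LM_closed(3)[of a x n] by (auto simp: LM_ops Fl_smult)
 qed (use LM_closed(1) in \<open>auto simp: LM_module LM_ops(1)\<close>)
 show "Df LC n ` Fl LC p n \<subseteq> Fl LC p (n+1)"
  using LM_d_closed by (auto simp: Fl_d)
 show "Fl LC p n \<subseteq> Fl LC (p+1) n"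
  by (auto intro: Fl_le[where p = p])
 show "x : LC$n ==> Df LC (n+1) (Df LC n x) = 0[LC,n+1+1]" for x
  using LM_d_closed by (auto simp: LM_ops LM_mem restrict_def fun_eq_iff)
qed
show "sm (LC$n)" for n
 by (rule sm_fun[OF smI, of "%i. (D i)$n"])
  (auto simp: Ob_sm LM_mem intro: LM_ext)
qed

lemma LC_from [simp]: "c : carrier (LM n) ==> Map (from_copy LC B f) n (cd LC n c) = f n c"
using LC_cpx by simp

lemma glimit_exists:
"glimit FC I K D s t m (cpy LC) (%i. from_copy LC (D i) (%n c. c i))"
proof -
let ?p = "%i. from_copy LC (D i) (%n c. c i)"
have pr: "fmap R LC (D i) (%n c. c i)" if i: "i : I" for i
 by (rule fmapI) (use i LM_mem in \<open>auto simp: LM_ops\<close>)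
have p: "i : I ==> ?p i : hom (cpy LC) (D i)" for i
 using from_copy_hom[OF LC_cpx] pr by simp
have comp: "m k \<star> ?p (s k) = ?p (t k)" if k: "k : K" for k
proof (rule hom_ext_copy)
 show "m k \<star> ?p (s k) : hom (cpy LC) (D (t k))" using k by (intro cmpI[OF p m_hom]) auto
 show "?p (t k) : hom (cpy LC) (D (t k))" using k p by simp
 fix n x assume x: "x : LC$n"
 hence "Map (m k) n (x (s k)) = x (t k)" using k by (simp add: LM_carrier)
 thus "Map (m k \<star> ?p (s k)) n (cd LC n x) = Map (?p (t k)) n (cd LC n x)"
  using k x by (simp add: cmp_map[OF p[OF sI[OF k]] cd_in[OF x]])
qed simp
have univ: "\<exists>!h. h : hom X (cpy LC) \<and> (\<forall>i\<in>I. ?p i \<star> h = x i)"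
 if X: "X : Ob" and x: "\<And>i. i : I ==> x i : hom X (D i)"
  and c: "\<And>k. k : K ==> m k \<star> x (s k) = x (t k)" for X x
proof -
 define h where "h = to_copy X LC (%n a. \<lambda>i\<in>I. Map (x i) n a)"
 have mem: "(\<lambda>i\<in>I. Map (x i) n a) : carrier (LM n)" if a: "a : X$n" for n a
 proof -
  have "Map (m k) n (Map (x (s k)) n a) = Map (x (t k)) n a" if "k : K" for k
   using c[OF that] cmp_map[OF x[OF sI[OF that]] a, of "m k"] by simp
  thus ?thesis using a map_simps(1)[OF x] by (auto simp: LM_carrier)
 qed
 have "fmap R X LC (%n a. \<lambda>i\<in>I. Map (x i) n a)"
 proof (rule fmapI)
  show "Df LC n (\<lambda>i\<in>I. Map (x i) n a) = (\<lambda>i\<in>I. Map (x i) (n+1) (Df X n a))"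
   if "a : X$n" for n a
   using that mem by (auto simp: map_d[OF x] restrict_def fun_eq_iff)
  show "(\<lambda>i\<in>I. Map (x i) n a) : Fl LC p n" if "a : Fl X p n" for p n a
   using that mem[OF Fl_car[OF that Ob_fcx[OF X]]] by (auto simp: map_Fl[OF x])
 qed (use mem X map_simps[OF x] in \<open>auto simp: LM_ops restrict_def fun_eq_iff\<close>)
 hence h: "h : hom X (cpy LC)" unfolding h_def using X LC_cpx by (intro to_copy_hom)
 have ph: "?p i \<star> h = x i" if i: "i : I" for i
 proof (rule hom_ext[OF cmpI[OF h p[OF i]] x[OF i] refl])
  fix n a assume a: "a : X$n"
  show "Map (?p i \<star> h) n a = Map (x i) n a"
   unfolding cmp_map[OF h a] unfolding h_def using a i mem[OF a] by simp
 qed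
 show ?thesis
 proof (rule ex1I[of _ h])
  show "h : hom X (cpy LC) \<and> (\<forall>i\<in>I. ?p i \<star> h = x i)" using h ph by blast
  fix k assume k: "k : hom X (cpy LC) \<and> (\<forall>i\<in>I. ?p i \<star> k = x i)"
  show "k = h"
  proof (rule hom_ext[OF conjunct1[OF k] h refl])
   fix n a assume a: "a : X$n"
   hence "Map k n a : (cpy LC)$n" "Map h n a : (cpy LC)$n"
    using k h map_simps(1) by blast+
   then obtain u v where u: "u : carrier (LM n)" "v : carrier (LM n)"
    "Map k n a = cd LC n u" "Map h n a = cd LC n v"
    unfolding copy_car by auto
   have "u i = v i" if i: "i : I" for i
   proof -
    have "Map (?p i \<star> k) n a = Map (?p i \<star> h) n a" using k ph i by simp
    thus ?thesis using u LC_cpx cmp_map[OF h a] cmp_map[OF conjunct1[OF k] a] by simp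
   qed
   thus "Map k n a = Map h n a" using u LM_ext by metis
  qed
 qed
qed
show ?thesis unfolding glimit_def using p comp univ LC_cpx by auto
qed

section \<open>Colimits by generators and relations\<close>

abbreviation TG where "TG n \<equiv> colim_gens I D n"
abbreviation QG where "QG n \<equiv> colim_rels R I K D s t m n"
abbreviation CM where "CM n \<equiv> presented (TG n) (QG n)"
abbreviation q where "q i n x \<equiv> gen_class (TG n) (QG n) (i, x)"

lemma TG_iff: "(i, x) : TG n \<longleftrightarrow> i : I \<and> x : (D i)$n"
unfolding colim_gens_def by simp

lemma QG_sub: "QG n \<subseteq> carrier (FM R (TG n))"
proof -
interpret F: module R "FM R (TG n)" by (rule mod_free)
have b: "i : I ==> x : (D i)$n ==>
  bas R (i, x) : carrier (FM R (TG n))" for i x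
 by (rule bas_in) (simp add: TG_iff)
show ?thesis unfolding colim_rels_def Let_def
 by (intro Un_least subsetI; elim CollectE exE conjE; hypsubst)
  (intro F.minus_closed F.a_closed F.smult_closed b; simp add: map_simps(1)[OF m_hom])+
qed

lemmas CM_module = module_presented[OF QG_sub]
and CM_gen = gen_class_carrier[OF QG_sub]

lemma q_carrier: "i : I ==> x : (D i)$n ==> q i n x : carrier (CM n)"
by (rule CM_gen) (simp add: TG_iff)

lemma q_add: "i : I ==> x : (D i)$n ==> y : (D i)$n ==>
 q i n (x +[D i,n] y) = q i n x +[CM n] q i n y"
by (rule gen_class_add[OF QG_sub]) (auto simp: TG_iff colim_rels_def Let_def)

lemma q_smult: "i : I ==> a : carrier R ==> x : (D i)$n ==>
 q i n (a *[D i,n] x) = a *[CM n] q i n x"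
by (rule gen_class_smult[OF QG_sub]) (auto simp: TG_iff colim_rels_def Let_def simp del: free_ops)

lemma q_arrow: "k : K ==> x : (D (s k))$n ==>
 q (t k) n (Map (m k) n x) = q (s k) n x"
by (rule gen_class_cong[OF QG_sub])
 (auto simp: TG_iff colim_rels_def Let_def map_simps(1)[OF m_hom])

lemma CM_induct [consumes 1, case_names zero add smult gen]:
assumes "x : carrier (CM n)" "P 0[CM n]"
 "\<And>x y. x : carrier (CM n) ==> y : carrier (CM n) ==> P x ==> P y ==> P (x +[CM n] y)"
 "\<And>a x. a : carrier R ==> x : carrier (CM n) ==> P x ==> P (a *[CM n] x)"
 "\<And>i x. i : I ==> x : (D i)$n ==> P (q i n x)"
shows "P x"
by (rule presented_induct[OF QG_sub assms(1-4)])
 (use assms(5) in \<open>auto simp: colim_gens_def\<close>)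

text \<open>Stated for a subset \<open>K'\<close> of the edges because, in a sequence, the map to
  one fixed stage respects only the edges that end at or below that stage.\<close>

lemma free_rel_zero:
assumes N: "module R N" and k: "k : lin R (FM R (TG n)) N"
 and kg: "\<And>i x. i : I ==> x : (D i)$n ==> k (bas R (i, x)) = g i x"
 and g: "\<And>i x. i : I ==> x : (D i)$n ==> g i x : carrier N"
 and add: "\<And>i x y. i : I ==> x : (D i)$n ==> y : (D i)$n ==>
  g i (x +[D i,n] y) = g i x +[N] g i y"
 and smult: "\<And>i a x. i : I ==> a : carrier R ==> x : (D i)$n ==>
  g i (a *[D i,n] x) = a *[N] g i x"
 and arrow: "\<And>j x. j : K' ==> x : (D (s j))$n ==> g (t j) (Map (m j) n x) = g (s j) x"
 and c: "c : colim_rels R I K' D s t m n" and K': "K' \<subseteq> K"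
shows "k c = 0[N]"
proof -
interpret F: module R "FM R (TG n)" by (rule mod_free)
interpret N: module R N by fact
have b: "i : I ==> x : (D i)$n ==>
  bas R (i, x) : carrier (FM R (TG n))" for i x
 by (rule bas_in) (simp add: TG_iff)
note lm = lin_minus[OF mod_free N k] lin_add[OF k] lin_smult[OF k]
note cl = F.smult_closed F.a_closed
from c show ?thesis unfolding colim_rels_def Let_def
proof (elim UnE CollectE exE conjE)
 fix i x y assume *: "c = bas R (i, x +[D i,n] y) -[FM R (TG n)]
   (bas R (i, x) +[FM R (TG n)] bas R (i, y))"
  "i : I" "x : (D i)$n" "y : (D i)$n"
 show ?thesis using *(2-) unfolding *(1)
  by (simp add: lm b cl kg add g N.minus_eq_zero del: free_ops)
next
 fix i a x assume *: "c = bas R (i, a *[D i,n] x) -[FM R (TG n)]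
   (a *[FM R (TG n)] bas R (i, x))"
  "i : I" "a : carrier R" "x : (D i)$n"
 show ?thesis using *(2-) unfolding *(1)
  by (simp add: lm b cl kg smult g N.minus_eq_zero del: free_ops)
next
 fix j x assume *: "c = bas R (t j, Map (m j) n x) -[FM R (TG n)] bas R (s j, x)"
  "j : K'" "x : (D (s j))$n"
 have "j : K" using *(2) K' by blast
 thus ?thesis using *(2-) unfolding *(1)
  by (simp add: lm b cl kg arrow g N.minus_eq_zero map_simps(1)[OF m_hom] del: free_ops)
qed
qed

lemma CM_lin:
assumes N: "module R N"
 and g: "\<And>i x. i : I ==> x : (D i)$n ==> g i x : carrier N"
 and add: "\<And>i x y. i : I ==> x : (D i)$n ==> y : (D i)$n ==>
  g i (x +[D i,n] y) = g i x +[N] g i y"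
 and smult: "\<And>i a x. i : I ==> a : carrier R ==> x : (D i)$n ==>
  g i (a *[D i,n] x) = a *[N] g i x"
 and arrow: "\<And>j x. j : K ==> x : (D (s j))$n ==> g (t j) (Map (m j) n x) = g (s j) x"
shows "\<exists>h\<in>lin R (CM n) N. \<forall>i\<in>I. \<forall>x\<in>(D i)$n. h (q i n x) = g i x"
proof -
have "\<exists>h\<in>lin R (CM n) N. \<forall>t\<in>TG n. h (gen_class (TG n) (QG n) t) = (%(i, x). g i x) t"
proof (rule presented_lin[OF QG_sub N])
 show "\<And>t. t : TG n ==> (%(i, x). g i x) t : carrier N"
  using g by (auto simp: colim_gens_def)
 fix k c assume k: "k : lin R (FM R (TG n)) N"
  "\<And>t. t : TG n ==> k (bas R t) = (%(i, x). g i x) t" and c: "c : QG n"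
 have "k (bas R (i, x)) = g i x" if "i : I" "x : (D i)$n" for i x
  using k(2)[of "(i, x)"] that by (simp add: TG_iff)
 thus "k c = 0[N]" by (rule free_rel_zero[OF N k(1) _ g add smult arrow c order_refl])
qed
then obtain h where h: "h : lin R (CM n) N"
 "\<forall>t\<in>TG n. h (gen_class (TG n) (QG n) t) = (%(i, x). g i x) t" by blast
have "h (q i n x) = g i x" if "i : I" "x : (D i)$n" for i x
 using bspec[OF h(2), of "(i, x)"] that by (simp add: TG_iff)
thus ?thesis using h(1) by blast
qed

definition cd_d where
"cd_d n = (SOME h. h : lin R (CM n) (CM (n+1)) \<and>
  (\<forall>i\<in>I. \<forall>x\<in>(D i)$n. h (q i n x) = q i (n+1) (Df (D i) n x)))"

lemma cd_d: "cd_d n : lin R (CM n) (CM (n+1))"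
"i : I ==> x : (D i)$n ==> cd_d n (q i n x) = q i (n+1) (Df (D i) n x)"
proof -
have "\<exists>h\<in>lin R (CM n) (CM (n+1)).
  \<forall>i\<in>I. \<forall>x\<in>(D i)$n. h (q i n x) = q i (n+1) (Df (D i) n x)"
 by (rule CM_lin[OF CM_module])
  (simp_all add: q_carrier q_add q_smult q_arrow map_d[OF m_hom, symmetric])
hence "\<exists>h. h : lin R (CM n) (CM (n+1)) \<and>
  (\<forall>i\<in>I. \<forall>x\<in>(D i)$n. h (q i n x) = q i (n+1) (Df (D i) n x))" by blast
from someI_ex[OF this]
show "cd_d n : lin R (CM n) (CM (n+1))"
 "i : I ==> x : (D i)$n ==> cd_d n (q i n x) = q i (n+1) (Df (D i) n x)"
 unfolding cd_d_def[symmetric] by blast+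
qed

text \<open>The filtration is spanned by the images of the \<open>F_p\<close>; the colimit of the
  modules \<open>F_p\<close> itself need not inject into the colimit of the complexes.\<close>

definition CC where
"CC = \<lparr>Cx = CM, Df = cd_d,
  Fl = (%p n. span_of R (CM n) {q i n x | i x. i : I \<and> x : Fl (D i) p n})\<rparr>"

lemma CC_sel [simp]: "Cx CC n = CM n" "Df CC n = cd_d n"
"Fl CC p n = span_of R (CM n) {q i n x | i x. i : I \<and> x : Fl (D i) p n}"
unfolding CC_def by simp_all

lemma CC_Fl_gens: "{q i n x | i x. i : I \<and> x : Fl (D i) p n} \<subseteq> carrier (CM n)"
using q_carrier Fl_car by fastforce

lemma CC_Fl_sub: "submodule (Fl CC p n) R (CM n)"
unfolding CC_sel by (rule span_submodule[OF CM_module CC_Fl_gens])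

lemma CC_Fl_gen: "i : I ==> x : Fl (D i) p n ==> q i n x : Fl CC p n"
unfolding CC_sel by (rule span_sup) blast

lemma CC_Fl_least: "submodule H R (CM n) ==> (\<And>i x. i : I ==> x : Fl (D i) p n ==> q i n x : H) ==>
 Fl CC p n \<subseteq> H"
unfolding CC_sel by (rule span_least) auto

lemma CC_cpx: "cpx CC"
proof (rule cpxI)
show "fcx CC"
proof (rule filtered_complex.intro)
 fix n p :: int
 show "module R (Cx CC n)" using CM_module by simp
 show "Df CC n : lin R (Cx CC n) (Cx CC (n+1))" using cd_d(1) by simp
 show "submodule (Fl CC p n) R (Cx CC n)" using CC_Fl_sub by simp
 have "Fl CC p n \<subseteq> {x : carrier (CM n). cd_d n x : Fl CC p (n+1)}"
 proof (rule CC_Fl_least)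
  show "submodule {x : carrier (CM n). cd_d n x : Fl CC p (n+1)} R (CM n)"
   by (rule sub_preim[OF CM_module CM_module cd_d(1) CC_Fl_sub])
  show "q i n x : {x : carrier (CM n). cd_d n x : Fl CC p (n+1)}"
   if "i : I" "x : Fl (D i) p n" for i x
   using that CC_Fl_gen[of i "Df (D i) n x" p "n+1"] Fl_car[OF that(2)]
   by (simp add: q_carrier cd_d(2) Fl_d del: CC_sel)
 qed
 thus "Df CC n ` Fl CC p n \<subseteq> Fl CC p (n+1)" by auto
 show "Fl CC p n \<subseteq> Fl CC (p+1) n"
  by (rule CC_Fl_least[OF CC_Fl_sub])
   (auto intro!: CC_Fl_gen intro: Fl_le[of _ _ p] simp del: CC_sel)
 show "x : CC$n ==> Df CC (n+1) (Df CC n x) = 0[CC,n+1+1]" for x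
  unfolding CC_sel
 proof (induction rule: CM_induct)
  case zero
  thus ?case using lin_zero[OF CM_module CM_module cd_d(1)] by simp
 next
  case (add x y)
  interpret N: module R "CM k" for k by (rule CM_module)
  from add show ?case by (simp add: lin_add[OF cd_d(1)] lin_in[OF cd_d(1)])
 next
  case (smult a x)
  interpret N: module R "CM k" for k by (rule CM_module)
  from smult show ?case by (simp add: lin_smult[OF cd_d(1)] lin_in[OF cd_d(1)])
 next
  case (gen i x)
  interpret N: module R "CM k" for k by (rule CM_module)
  have "q i (n+1+1) (\<zero> *[D i,n+1+1] 0[D i,n+1+1]) = 0[CM (n+1+1)]"
   using gen by (subst q_smult) (simp_all add: q_carrier)
  with gen show ?case by (simp add: cd_d(2))
 qed
qed
have "sm (TG n)" for n
 by (rule sm_subset[OF sm_Sigma[OF smI, of "%i. (D i)$n"]])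
  (auto simp: Ob_sm colim_gens_def)
thus "sm (CC$n)" for n by (simp add: sm_presented)
qed

lemma CC_from [simp]: "c : carrier (CM n) ==> Map (from_copy CC B f) n (cd CC n c) = f n c"
using CC_cpx by simp

lemma q_fmap: "i : I ==> fmap R (D i) CC (q i)"
by (rule fmapI) (auto simp: q_carrier q_add q_smult cd_d(2) CC_Fl_gen simp del: CC_sel(3))

abbreviation qa where "qa i \<equiv> to_copy (D i) CC (q i)"

lemma qa_hom: "i : I ==> qa i : hom (D i) (cpy CC)"
by (intro to_copy_hom CC_cpx q_fmap) auto

lemma gcolimit_exists: "gcolimit FC I K D s t m (cpy CC) qa"
proof -
have comp: "qa (t k) \<star> m k = qa (s k)" if k: "k : K" for k
 by (rule hom_ext[OF cmpI[OF m_hom[OF k] qa_hom] qa_hom refl])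
  (use k in \<open>auto simp: cmp_map[OF m_hom[OF k]] q_arrow map_simps(1)[OF m_hom[OF k]]\<close>)
have univ: "\<exists>!h. h : hom (cpy CC) X \<and> (\<forall>i\<in>I. h \<star> qa i = x i)"
 if X: "X : Ob" and x: "\<And>i. i : I ==> x i : hom (D i) X"
  and c: "\<And>k. k : K ==> x (t k) \<star> m k = x (s k)" for X x
proof -
 have arr: "Map (x (t j)) n (Map (m j) n a) = Map (x (s j)) n a"
  if "j : K" "a : (D (s j))$n" for j n a
  using c[OF that(1)] cmp_map[OF m_hom[OF that(1)] that(2), of "x (t j)"] by simp
 have "\<forall>n. \<exists>h\<in>lin R (CM n) (Cx X n).
  \<forall>i\<in>I. \<forall>a\<in>(D i)$n. h (q i n a) = Map (x i) n a"
  by (intro allI CM_lin cx_mod Ob_fcx X) (auto simp: map_simps[OF x] arr)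
 then obtain h where h: "\<And>n. h n : lin R (CM n) (Cx X n)"
  "\<And>n i a. i : I ==> a : (D i)$n ==> h n (q i n a) = Map (x i) n a"
  by metis
 have fm: "fmap R CC X h"
 proof (rule fmapI)
  fix n a assume "a : CC$n"
  hence "a : carrier (CM n)" by simp
  thus "Df X n (h n a) = h (n+1) (Df CC n a)"
  proof (induction rule: CM_induct)
   case zero
   thus ?case using lin_zero[OF CM_module CM_module cd_d(1)]
     lin_zero[OF CM_module cx_mod h(1)] X by simp
  next
   case (add a b)
   thus ?case using X by (simp add: lin_add[OF cd_d(1)] lin_in[OF cd_d(1)]
      lin_add[OF h(1)] lin_in[OF h(1)])
  next
   case (smult s a)
   thus ?case using X by (simp add: lin_smult[OF cd_d(1)] lin_in[OF cd_d(1)]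
      lin_smult[OF h(1)] lin_in[OF h(1)])
  next
   case (gen i a)
   thus ?case by (simp add: cd_d(2) h(2) map_d[OF x])
  qed
 next
  fix p n a assume "a : Fl CC p n"
  moreover have "Fl CC p n \<subseteq> {a : carrier (CM n). h n a : Fl X p n}"
  proof (rule CC_Fl_least)
   show "submodule {a : carrier (CM n). h n a : Fl X p n} R (CM n)"
    by (rule sub_preim[OF CM_module cx_mod h(1) Fl_sub]) (use X in auto)
  qed (auto simp: q_carrier h(2) Fl_car map_Fl[OF x])
  ultimately show "h n a : Fl X p n" by blast
 qed (auto simp: lin_in[OF h(1)] lin_add[OF h(1)] lin_smult[OF h(1)])
 let ?h = "from_copy CC X h"
 have hh: "?h : hom (cpy CC) X" by (intro from_copy_hom CC_cpx X fm)
 have hq: "?h \<star> qa i = x i" if i: "i : I" for i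
  by (rule hom_ext[OF cmpI[OF qa_hom[OF i] hh] x[OF i] refl])
   (use i CC_cpx in \<open>auto simp: cmp_map[OF qa_hom[OF i]] h(2) q_carrier\<close>)
 show ?thesis
 proof (rule ex1I[of _ ?h])
  show "?h : hom (cpy CC) X \<and> (\<forall>i\<in>I. ?h \<star> qa i = x i)" using hh hq by blast
  fix k assume k: "k : hom (cpy CC) X \<and> (\<forall>i\<in>I. k \<star> qa i = x i)"
  hence kh: "k : hom (cpy CC) X" by blast
  have z: "cd CC n 0[CM n] = 0[cpy CC,n]" for n unfolding copy_zero by simp
  have ad: "a : carrier (CM n) ==> b : carrier (CM n) ==>
    cd CC n (a +[CM n] b) = cd CC n a +[cpy CC,n] cd CC n b" for n a b
   using copy_add[OF CC_cpx, of a n b] by simp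
  have sc: "a : carrier (CM n) ==>
    cd CC n (b *[CM n] a) = b *[cpy CC,n] cd CC n a" for n a b
   using copy_smult[OF CC_cpx, of a n b] by simp
  have cdc: "a : carrier (CM n) ==> cd CC n a : (cpy CC)$n" for n a
   by (rule cd_in) simp
  show "k = ?h"
  proof (rule hom_ext_copy[OF kh hh refl])
   fix n a assume "a : CC$n"
   hence "a : carrier (CM n)" by simp
   thus "Map k n (cd CC n a) = Map ?h n (cd CC n a)"
   proof (induction rule: CM_induct)
    case (gen i a)
    have "Map (k \<star> qa i) n a = Map (?h \<star> qa i) n a" using gen k hq by simp
    thus ?case using gen by (simp add: cmp_map[OF qa_hom])
   qed (simp_all only: z ad sc map_simps[OF kh] map_simps[OF hh] cdc)
  qed
 qed
qed
show ?thesis unfolding gcolimit_def using qa_hom comp univ CC_cpx by auto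
qed

end

context fc
begin

lemma bicomplete_FC: "bicomplete (small_in U) FC"
unfolding bicomplete_def
proof (intro allI impI, goal_cases)
case J: (1 J F0 F1)
interpret J: category J using J by blast
have F: "is_functor J FC F0 F1" using J by blast
interpret diagram U R "Obj J" "Arr J" F0 "Dom J" "Cod J" F1
 by unfold_locales (use J F in \<open>auto simp: is_functor_def J.Dom_Obj J.Cod_Obj\<close>)
have "is_limit J FC F0 F1 L p" if "glimit FC (Obj J) (Arr J) F0 (Dom J) (Cod J) F1 L p" for L p
 using that unfolding is_limit_def is_cone_def glimit_def by blast
moreover have "is_colimit J FC F0 F1 L p"
 if "gcolimit FC (Obj J) (Arr J) F0 (Dom J) (Cod J) F1 L p" for L p
 using that unfolding is_colimit_def is_cocone_def gcolimit_def by blast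
ultimately show ?case
 using glimit_exists gcolimit_exists by blast
qed

text \<open>Makes the squares to be filled in one step of the small object argument a small set. An
  arrow with fixed ends is recorded by its values on pairs of a degree and an element.\<close>

lemma sm_hom: assumes "A : Ob" shows "sm (hom A B)"
proof (cases "B : Ob")
case True
define \<Phi> where "\<Phi> f = (%(n, x). Map f n x)" for f :: "('r, 'u) farrow"
let ?A = "Sigma UNIV (%n. A$n)"
have inj: "inj_on \<Phi> (hom A B)"
proof (rule inj_onI)
 fix f g assume f: "f : hom A B" and g: "g : hom A B" and eq: "\<Phi> f = \<Phi> g"
 show "f = g"
  by (rule hom_ext[OF f g refl]) (use fun_cong[OF eq] in \<open>auto simp: \<Phi>_def\<close>)
qed
have "sm (\<Phi> ` hom A B)"
proof (rule sm_fun[of ?A "%(n, x). B$n"])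
 show "sm ?A" using assms Ob_sm by (intro sm_Sigma sm_int)
 fix u v assume "u : \<Phi> ` hom A B" "v : \<Phi> ` hom A B" and eq: "\<And>a. a : ?A ==> u a = v a"
 then obtain f g where f: "f : hom A B" "u = \<Phi> f" and g: "g : hom A B" "v = \<Phi> g" by auto
 have "f = g" by (rule hom_ext[OF f(1) g(1) refl]) (use eq f g in \<open>auto simp: \<Phi>_def\<close>)
 thus "u = v" using f g by simp
qed (use True Ob_sm in \<open>auto simp: \<Phi>_def\<close>)
thus ?thesis using sm_inj[OF inj order_refl] by blast
next
case False
hence "hom A B = {}" using hom_Ob(2) by blast
thus ?thesis using sm_finite[of "{}"] by simp
qed

end

section \<open>Sequential colimits: elements and cycles come from a finite stage\<close>

locale sequence = fc U R for U :: "'u itself" and R :: "('r, 'm) ring_scheme" (structure) +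
fixes X :: "nat => ('r, 'u) fcomplex" and e :: "nat => ('r, 'u) farrow"
assumes e: "e i : hom (X i) (X (Suc i))"
begin

sublocale diagram U R UNIV UNIV X "%i. i" Suc e
by unfold_locales (use e hom_Ob sm_nat in auto)

text \<open>Indexed by the number of steps, so the target is \<open>X (i + j)\<close> and no
  inequality between stages has to be carried along.\<close>

primrec trs where
"trs n i 0 x = x"
| "trs n i (Suc j) x = Map (e (i + j)) n (trs n i j x)"

lemma trs_closed [simp]: "x : (X i)$n ==> trs n i j x : (X (i + j))$n"
by (induction j) (simp_all add: map_simps(1)[OF e])

lemma trs_add: "x : (X i)$n ==> y : (X i)$n ==>
 trs n i j (x +[X i,n] y) = trs n i j x +[X (i + j),n] trs n i j y"
by (induction j) (simp_all add: map_simps(2)[OF e])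

lemma trs_minus: "x : (X i)$n ==> y : (X i)$n ==>
 trs n i j (x -[X i,n] y) = trs n i j x -[X (i + j),n] trs n i j y"
by (induction j) (simp_all add: map_simps(3)[OF e])

lemma trs_smult: "a : carrier R ==> x : (X i)$n ==>
 trs n i j (a *[X i,n] x) = a *[X (i + j),n] trs n i j x"
by (induction j) (simp_all add: map_simps(6)[OF e])

lemma trs_d: "x : (X i)$n ==>
 Df (X (i + j)) n (trs n i j x) = trs (n+1) i j (Df (X i) n x)"
by (induction j) (simp_all add: map_d[OF e, symmetric])

lemma trs_Fl: "x : Fl (X i) p n ==> trs n i j x : Fl (X (i + j)) p n"
by (induction j) (simp_all add: map_Fl[OF e])

lemma trs_q: "x : (X i)$n ==> q (i + j) n (trs n i j x) = q i n x"
by (induction j) (simp_all add: q_arrow)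

lemma trs_trs: "trs n (i + j) k (trs n i j x) = trs n i (j + k) x"
by (induction k) (simp_all add: ac_simps)

lemma trs_Suc: "trs n (Suc i) j (Map (e i) n x) = trs n i (Suc j) x"
using trs_trs[of n i 1 j x] by simp

text \<open>For each k the free module on the generators maps to stage k. The elements killed by
  these maps for all large k form a submodule; it contains every relation, since a relation along
  edge j dies from stage j + 1 on, hence it contains the whole span of the relations.\<close>

lemma q_zero_eventually:
assumes a: "a : (X i)$n" and z: "q i n a = 0[CM n]"
shows "\<exists>j. trs n i j a = 0[X (i + j),n]"
proof -
\<comment> \<open>The default 0 for stages beyond k is harmless, because only large k matter for a
  given element.\<close>
define g where "g k i x = (if i \<le> k then trs n i (k - i) x else 0[X k,n])" for k i x
have gc: "g k i x : (X k)$n" if "x : (X i)$n" for k i x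
 using trs_closed[OF that, of "k - i"] by (cases "i \<le> k") (simp_all add: g_def)
have "\<exists>\<tau>\<in>lin R (FM R (TG n)) (Cx (X k) n).
  \<forall>t\<in>TG n. \<tau> (bas R t) = (%(i, x). g k i x) t" for k
 by (rule free_lin) (auto simp: colim_gens_def gc)
then obtain \<tau> where \<tau>: "\<And>k. \<tau> k : lin R (FM R (TG n)) (Cx (X k) n)"
 "\<And>k t. t : TG n ==> \<tau> k (bas R t) = (%(i, x). g k i x) t"
 by metis
have \<tau>g: "\<tau> k (bas R (i, x)) = g k i x" if "x : (X i)$n" for k i x
 using \<tau>(2)[of "(i, x)" k] that by (simp add: TG_iff)
define H where "H = {c : carrier (FM R (TG n)). \<exists>k0. \<forall>k\<ge>k0. \<tau> k c = 0[X k,n]}"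
interpret F: module R "FM R (TG n)" by (rule mod_free)
have "submodule H R (FM R (TG n))"
proof (rule submoduleI'[OF mod_free])
 show "0[FM R (TG n)] : H" unfolding H_def
  using lin_zero[OF mod_free cx_mod \<tau>(1)] by (simp del: free_ops)
 fix x y assume "x : H" "y : H"
 then obtain k0 k1 where *: "x : carrier (FM R (TG n))" "y : carrier (FM R (TG n))"
  "\<forall>k\<ge>k0. \<tau> k x = 0[X k,n]" "\<forall>k\<ge>k1. \<tau> k y = 0[X k,n]" unfolding H_def by blast
 hence "\<forall>k\<ge>max k0 k1. \<tau> k (x +[FM R (TG n)] y) = 0[X k,n]"
  by (simp add: lin_add[OF \<tau>(1)] del: free_ops)
 thus "x +[FM R (TG n)] y : H" unfolding H_def using * F.a_closed by blast
next
 fix s x assume "s : carrier R" "x : H"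
 then obtain k0 where *: "x : carrier (FM R (TG n))" "s : carrier R"
  "\<forall>k\<ge>k0. \<tau> k x = 0[X k,n]" unfolding H_def by blast
 hence "\<forall>k\<ge>k0. \<tau> k (s *[FM R (TG n)] x) = 0[X k,n]"
  by (simp add: lin_smult[OF \<tau>(1)] del: free_ops)
 thus "s *[FM R (TG n)] x : H" unfolding H_def
  using * F.smult_closed by blast
qed (auto simp: H_def)
moreover have "QG n \<subseteq> H"
proof
 fix c assume c: "c : QG n"
 then obtain j where j: "c : colim_rels R UNIV {j} X (%i. i) Suc e n"
  unfolding colim_rels_def Let_def by blast
 have "\<tau> k c = 0[X k,n]" if k: "k \<ge> Suc j" for k
 proof (rule free_rel_zero[OF cx_mod \<tau>(1) \<tau>g gc _ _ _ j])
  show "fcx (X k)" by simp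
  show "g k i (x +[X i,n] y) = g k i x +[X k,n] g k i y"
   if "x : (X i)$n" "y : (X i)$n" for i x y
   using trs_add[OF that, of "k - i"] by (cases "i \<le> k") (simp_all add: g_def)
  show "g k i (a *[X i,n] x) = a *[X k,n] g k i x"
   if "a : carrier R" "x : (X i)$n" for i a x
   using trs_smult[OF that, of "k - i"] that by (cases "i \<le> k") (simp_all add: g_def)
  show "g k (Suc j') (Map (e j') n x) = g k j' x" if "j' : {j}" for j' x
   using that k trs_Suc[of n j "k - Suc j" x] by (simp add: g_def Suc_diff_Suc)
 qed auto
 thus "c : H" unfolding H_def using c QG_sub by blast
qed
ultimately have "span_of R (FM R (TG n)) (QG n) \<subseteq> H" by (rule span_least)
moreover have "bas R (i, a) : span_of R (FM R (TG n)) (QG n)"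
 using gen_class_zero[OF QG_sub, of "(i, a)" n] z a by (simp add: TG_iff)
ultimately obtain k0 where "\<forall>k\<ge>k0. \<tau> k (bas R (i, a)) = 0[X k,n]"
 unfolding H_def by blast
hence "g (max k0 i) i a = 0[X (max k0 i),n]" using \<tau>g[OF a] by simp
thus ?thesis unfolding g_def by (intro exI[of _ "max k0 i - i"]) simp
qed

text \<open>Elements of stages i and j can both be pushed to stage i + j, so the elements coming
  from a single stage already form a submodule.\<close>

lemma colim_Fl:
assumes "x : Fl CC p n" shows "\<exists>i. \<exists>a\<in>Fl (X i) p n. x = q i n a"
proof -
let ?H = "{x : carrier (CM n). \<exists>i. \<exists>a\<in>Fl (X i) p n. x = q i n a}"
have c: "a : Fl (X i) p n ==> a : (X i)$n" for i a by (simp add: Fl_car)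
interpret N: module R "CM n" by (rule CM_module)
have "submodule ?H R (CM n)"
proof (rule submoduleI'[OF CM_module])
 have "q 0 n (\<zero> *[X 0,n] 0[X 0,n]) = 0[CM n]"
  by (subst q_smult) (simp_all add: q_carrier)
 hence "0[CM n] = q 0 n 0[X 0,n]" by simp
 thus "0[CM n] : ?H" using Fl_zero[OF Ob_fcx[OF D_Ob]] by blast
 fix x y assume "x : ?H" "y : ?H"
 then obtain i j a b where *: "a : Fl (X i) p n" "b : Fl (X j) p n" "x = q i n a" "y = q j n b"
  by blast
 let ?a = "trs n i j a" and ?b = "trs n j i b"
 have "?a : Fl (X (i + j)) p n" "?b : Fl (X (i + j)) p n"
  using trs_Fl[OF *(1), of j] trs_Fl[OF *(2), of i] by (simp_all add: add.commute)
 moreover have "x = q (i + j) n ?a" "y = q (i + j) n ?b"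
  using * trs_q[OF c[OF *(1)], of j] trs_q[OF c[OF *(2)], of i] by (simp_all add: add.commute)
 ultimately have "?a +[X (i + j),n] ?b : Fl (X (i + j)) p n"
  "x +[CM n] y = q (i + j) n (?a +[X (i + j),n] ?b)"
  by (auto simp: q_add c Fl_add)
 moreover have "x +[CM n] y : carrier (CM n)" using * c by (simp add: q_carrier)
 ultimately show "x +[CM n] y : ?H" by blast
next
 fix s x assume s: "s : carrier R" and "x : ?H"
 then obtain i a where *: "a : Fl (X i) p n" "x = q i n a" by blast
 hence "s *[CM n] x = q i n (s *[X i,n] a)" "s *[X i,n] a : Fl (X i) p n"
  using s by (auto simp: q_smult c Fl_smult)
 moreover have "s *[CM n] x : carrier (CM n)" using * s c by (simp add: q_carrier)
 ultimately show "s *[CM n] x : ?H" by blast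
qed blast
hence "Fl CC p n \<subseteq> ?H" by (rule CC_Fl_least) (use c q_carrier in blast)
thus ?thesis using assms by blast
qed

text \<open>This is the smallness of cells. A cycle and its differential are lifted separately to a
  common stage; the differential of the first lift and the second lift agree only in the colimit, so
  both are pushed further until they agree.\<close>

lemma colim_cycles:
assumes "x : cycles (cpy CC) k p n"
shows "\<exists>j. \<exists>a\<in>cycles (X j) k p n. Map (qa j) n a = x"
proof -
have c: "a : Fl (X i) p n ==> a : (X i)$n" for i p n a by (simp add: Fl_car)
from assms obtain u where u: "u : Fl CC p n" "x = cd CC n u"
 and dx: "Df (cpy CC) n x : Fl (cpy CC) (p - int k) (n+1)"
 unfolding cycles_def copy_Fl by blast
from colim_Fl[OF u(1)] obtain i a where a: "a : Fl (X i) p n" "u = q i n a" by blast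
have uc: "u : carrier (CM n)" using a c by (simp add: q_carrier)
have "cd CC (n+1) (cd_d n u) : Fl (cpy CC) (p - int k) (n+1)"
 using dx u copy_d[OF CC_cpx, of u n] uc by simp
hence "cd_d n u : Fl CC (p - int k) (n+1)"
 using cd_Fl[OF CC_cpx, of "cd_d n u" "n+1" "p - int k"] lin_in[OF cd_d(1) uc]
 by (simp del: CC_sel(3))
then obtain i' b where b: "b : Fl (X i') (p - int k) (n+1)" "cd_d n u = q i' (n+1) b"
 using colim_Fl by blast
let ?a = "trs n i i' a" and ?b = "trs (n+1) i' i b" and ?j = "i + i'"
have a': "?a : Fl (X ?j) p n" "q ?j n ?a = u" using trs_Fl[OF a(1)] trs_q c a by auto
have b': "?b : Fl (X ?j) (p - int k) (n+1)" "q ?j (n+1) ?b = cd_d n u"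
 using trs_Fl[OF b(1), of i] trs_q[OF c[OF b(1)], of i] b by (simp_all add: add.commute)
have eq: "q ?j (n+1) (Df (X ?j) n ?a) = q ?j (n+1) ?b"
 using a' b' cd_d(2)[of ?j ?a n] c by simp
interpret N: module R "CM (n+1)" by (rule CM_module)
interpret M: module R "Cx (X ?j) (n+1)" by simp
let ?z = "Df (X ?j) n ?a -[X ?j,n+1] ?b"
have cl: "Df (X ?j) n ?a : (X ?j)$(n+1)" "?b : (X ?j)$(n+1)"
 using a' b' c by auto
have "q ?j (n+1) ?z +[CM (n+1)] q ?j (n+1) ?b = q ?j (n+1) (?z +[X ?j,n+1] ?b)"
 using cl by (simp add: q_add)
also have "?z +[X ?j,n+1] ?b = Df (X ?j) n ?a"
 using cl by (simp add: M.minus_eq M.a_assoc M.l_neg)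
finally have "q ?j (n+1) ?z = 0[CM (n+1)]"
 using cl eq q_carrier by (simp add: N.add.r_cancel_one)
then obtain l where l: "trs (n+1) ?j l ?z = 0[X (?j + l),n+1]"
 using q_zero_eventually[of ?z ?j "n+1"] cl by auto
let ?a' = "trs n ?j l ?a"
have "trs (n+1) ?j l (Df (X ?j) n ?a) = trs (n+1) ?j l ?b"
 using l trs_minus[OF cl] cl trs_closed[OF cl(1)] trs_closed[OF cl(2)]
 by (simp add: minus_zero_iff_cx)
hence "Df (X (?j + l)) n ?a' : Fl (X (?j + l)) (p - int k) (n+1)"
 using trs_d[of ?a ?j n l] trs_Fl[OF b'(1), of l] c a' by simp
moreover have "?a' : Fl (X (?j + l)) p n" "q (?j + l) n ?a' = u"
 using trs_Fl[OF a'(1)] trs_q[of ?a ?j n l] c a' by auto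
ultimately have "?a' : cycles (X (?j + l)) k p n" "Map (qa (?j + l)) n ?a' = x"
 unfolding cycles_def using u c by auto
thus ?thesis by blast
qed

end

section \<open>The small object argument\<close>

context category
begin

lemma homset_arr: "f : homset C X Y ==> f : Arr C"
and homset_dom: "f : homset C X Y ==> Dom C f = X"
and homset_cod: "f : homset C X Y ==> Cod C f = Y"
and arr_homset: "f : Arr C ==> f : homset C (Dom C f) (Cod C f)"
unfolding homset_def by auto

lemma homset_Obj: "f : homset C X Y ==> X : Obj C \<and> Y : Obj C"
unfolding homset_def using Dom_Obj Cod_Obj by auto

lemma liftsD:
assumes "lifts C i p" "i : homset C A B" "p : homset C X Y" "u : homset C A X" "v : homset C B Y"
 "p \<cdot> u = v \<cdot> i"
shows "\<exists>h\<in>homset C B X. h \<cdot> i = u \<and> p \<cdot> h = v"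
using assms unfolding lifts_def homset_def by auto

lemma liftsI:
assumes "i : homset C A B" "p : homset C X Y"
 "\<And>u v. u : homset C A X ==> v : homset C B Y ==> p \<cdot> u = v \<cdot> i ==>
  \<exists>h\<in>homset C B X. h \<cdot> i = u \<and> p \<cdot> h = v"
shows "lifts C i p"
using assms unfolding lifts_def homset_def by auto

text \<open>One step of the small object argument: the squares from \<open>K\<close> to
  \<open>f\<close> acquire fillers into the new source, but new squares over \<open>f'\<close> may
  appear.\<close>

definition attaches where
"attaches K f e f' \<longleftrightarrow> e : homset C (Dom C f) (Dom C f') \<and> f' : homset C (Dom C f') (Cod C f) \<and>
  f' \<cdot> e = f \<and> e : llp C (rlp C K) \<and>
  (\<forall>g\<in>K. \<forall>a\<in>homset C (Dom C g) (Dom C f). \<forall>b\<in>homset C (Cod C g) (Cod C f). f \<cdot> a = b \<cdot> g -->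
   (\<exists>h\<in>homset C (Cod C g) (Dom C f'). h \<cdot> g = e \<cdot> a \<and> f' \<cdot> h = b))"

text \<open>All cells are attached in one colimit. Vertex \<open>None\<close> is the source of
  \<open>f\<close>; each square w contributes the source of its cell as
  \<open>Some (False, w)\<close> and the target as \<open>Some (True, w)\<close>, with one edge
  along the attaching map to \<open>None\<close> and one along the cell.\<close>

lemma attach_cells:
assumes K: "K \<subseteq> Arr C" and f: "f : Arr C"
 and Q: "Q = {(g, a, b). g : K \<and> a : homset C (Dom C g) (Dom C f) \<and>
  b : homset C (Cod C g) (Cod C f) \<and> f \<cdot> a = b \<cdot> g}"
 and L: "gcolimit C (insert None (Some ` (UNIV \<times> Q))) (UNIV \<times> Q)
  (case_option (Dom C f) (%(z, g, a, b). if z then Cod C g else Dom C g))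
  (%(z, w). Some (False, w)) (%(z, w). if z then Some (True, w) else None)
  (%(z, g, a, b). if z then g else a) L q"
shows "\<exists>e f'. attaches K f e f'"
proof -
let ?X = "Dom C f" and ?Y = "Cod C f"
have fh: "f : homset C ?X ?Y" using f by (rule arr_homset)
have L_Obj: "L : Obj C" and e: "q None : homset C ?X L"
 using L unfolding gcolimit_def by auto
have Qg: "g : homset C (Dom C g) (Cod C g)" if "(g, a, b) : Q" for g a b
 using that K by (auto simp: Q intro: arr_homset)
have qA: "q (Some (False, g, a, b)) : homset C (Dom C g) L"
 and qB: "q (Some (True, g, a, b)) : homset C (Cod C g) L"
 and qa: "q None \<cdot> a = q (Some (False, g, a, b))"
 and qg: "q (Some (True, g, a, b)) \<cdot> g = q (Some (False, g, a, b))"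
 if w: "(g, a, b) : Q" for g a b
proof -
 have I: "Some (z, g, a, b) : insert None (Some ` (UNIV \<times> Q))" for z using w by blast
 have q: "\<forall>i\<in>insert None (Some ` (UNIV \<times> Q)). q i : homset C
   (case_option (Dom C f) (%(z, g, a, b). if z then Cod C g else Dom C g) i) L"
  using L unfolding gcolimit_def by blast
 show "q (Some (False, g, a, b)) : homset C (Dom C g) L" using bspec[OF q I[of False]] by simp
 show "q (Some (True, g, a, b)) : homset C (Cod C g) L" using bspec[OF q I[of True]] by simp
 have k: "\<forall>k\<in>UNIV \<times> Q. q ((%(z, w). if z then Some (True, w) else None) k) \<cdot>
   (%(z, g, a, b). if z then g else a) k = q ((%(z, w). Some (False, w)) k)"
  using L unfolding gcolimit_def by blast
 show "q None \<cdot> a = q (Some (False, g, a, b))" using bspec[OF k, of "(False, g, a, b)"] w by simp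
 show "q (Some (True, g, a, b)) \<cdot> g = q (Some (False, g, a, b))"
  using bspec[OF k, of "(True, g, a, b)"] w by simp
qed
\<comment> \<open>The universal property with the redundant vertices removed: the values on sources
  of cells are forced by the attaching maps.\<close>
have univ: "\<exists>!h. h : homset C L Z \<and> h \<cdot> q None = x \<and> (\<forall>(g, a, b)\<in>Q. h \<cdot> q (Some (True, g, a, b)) = y g a b)"
 if x: "x : homset C ?X Z"
  and y: "\<And>g a b. (g, a, b) : Q ==> y g a b : homset C (Cod C g) Z \<and> y g a b \<cdot> g = x \<cdot> a"
 for Z x y
proof -
 define c where "c = case_option x (%(z, g, a, b). if z then y g a b else x \<cdot> a)"
 have ah: "(g, a, b) : Q ==> x \<cdot> a : homset C (Dom C g) Z" for g a b
  using Cmp_hom[OF _ x] by (auto simp: Q)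
 have "Z : Obj C" using homset_Obj[OF x] by blast
 moreover have "\<forall>i\<in>insert None (Some ` (UNIV \<times> Q)). c i : homset C
   (case_option (Dom C f) (%(z, g, a, b). if z then Cod C g else Dom C g) i) Z"
  using x y ah by (auto simp: c_def)
 moreover have "\<forall>k\<in>UNIV \<times> Q. c ((%(z, w). if z then Some (True, w) else None) k) \<cdot>
   (%(z, g, a, b). if z then g else a) k = c ((%(z, w). Some (False, w)) k)"
  using y by (auto simp: c_def)
 ultimately have ex: "\<exists>!h. h : homset C L Z \<and> (\<forall>i\<in>insert None (Some ` (UNIV \<times> Q)). h \<cdot> q i = c i)"
  using L unfolding gcolimit_def by blast
 have eq: "(\<forall>i\<in>insert None (Some ` (UNIV \<times> Q)). h \<cdot> q i = c i) \<longleftrightarrow>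
   h \<cdot> q None = x \<and> (\<forall>(g, a, b)\<in>Q. h \<cdot> q (Some (True, g, a, b)) = y g a b)"
  if h: "h : homset C L Z" for h
 proof
  assume *: "\<forall>i\<in>insert None (Some ` (UNIV \<times> Q)). h \<cdot> q i = c i"
  have "h \<cdot> q (Some (True, g, a, b)) = y g a b" if "(g, a, b) : Q" for g a b
   using bspec[OF *, of "Some (True, g, a, b)"] that by (simp add: c_def)
  moreover have "h \<cdot> q None = x" using bspec[OF *, of None] by (simp add: c_def)
  ultimately show "h \<cdot> q None = x \<and> (\<forall>(g, a, b)\<in>Q. h \<cdot> q (Some (True, g, a, b)) = y g a b)"
   by blast
 next
  assume *: "h \<cdot> q None = x \<and> (\<forall>(g, a, b)\<in>Q. h \<cdot> q (Some (True, g, a, b)) = y g a b)"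
  have "h \<cdot> q (Some (False, g, a, b)) = x \<cdot> a" if w: "(g, a, b) : Q" for g a b
  proof -
   have "a : homset C (Dom C g) ?X" using w by (auto simp: Q)
   thus ?thesis using Cmp_assoc[OF _ e h, of a] qa[OF w] * by simp
  qed
  thus "\<forall>i\<in>insert None (Some ` (UNIV \<times> Q)). h \<cdot> q i = c i"
   using * by (auto simp: c_def)
 qed
 show ?thesis
  using ex eq by (smt (verit, ccfv_threshold))
qed
have "\<exists>!h. h : homset C L ?Y \<and> h \<cdot> q None = f \<and> (\<forall>(g, a, b)\<in>Q. h \<cdot> q (Some (True, g, a, b)) = b)"
 by (rule univ[OF fh]) (auto simp: Q)
then obtain f' where f': "f' : homset C L ?Y" "f' \<cdot> q None = f"
 "\<And>g a b. (g, a, b) : Q ==> f' \<cdot> q (Some (True, g, a, b)) = b" by blast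
have dL: "Dom C f' = L" using f'(1) by (rule homset_dom)
have "q None : llp C (rlp C K)" unfolding llp_def
proof (intro CollectI conjI ballI)
 show "q None : Arr C" using e by (rule homset_arr)
 fix p assume p: "p : rlp C K"
 hence ph: "p : homset C (Dom C p) (Cod C p)" unfolding rlp_def using arr_homset by blast
 show "lifts C (q None) p"
 proof (rule liftsI[OF e ph])
  fix u v assume u: "u : homset C ?X (Dom C p)" and v: "v : homset C L (Cod C p)"
   and uv: "p \<cdot> u = v \<cdot> q None"
  have "\<exists>h\<in>homset C (Cod C g) (Dom C p). h \<cdot> g = u \<cdot> a \<and> p \<cdot> h = v \<cdot> q (Some (True, g, a, b))"
   if w: "(g, a, b) : Q" for g a b
  proof -
   have ah: "a : homset C (Dom C g) ?X" using w by (auto simp: Q)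
   have "lifts C g p" using p w unfolding rlp_def by (auto simp: Q)
   moreover have "p \<cdot> (u \<cdot> a) = (v \<cdot> q (Some (True, g, a, b))) \<cdot> g"
    using Cmp_assoc[OF ah u ph] Cmp_assoc[OF ah e v] Cmp_assoc[OF Qg[OF w] qB[OF w] v]
     uv qa[OF w] qg[OF w] by simp
   ultimately show ?thesis
    by (rule liftsD[OF _ Qg[OF w] ph Cmp_hom[OF ah u] Cmp_hom[OF qB[OF w] v]])
  qed
  then obtain y where y: "\<And>g a b. (g, a, b) : Q ==> y g a b : homset C (Cod C g) (Dom C p) \<and>
    y g a b \<cdot> g = u \<cdot> a \<and> p \<cdot> y g a b = v \<cdot> q (Some (True, g, a, b))"
   by metis
  hence "\<exists>!h. h : homset C L (Dom C p) \<and> h \<cdot> q None = u \<and>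
    (\<forall>(g, a, b)\<in>Q. h \<cdot> q (Some (True, g, a, b)) = y g a b)"
   by (intro univ[OF u]) blast
  then obtain h where h: "h : homset C L (Dom C p)" "h \<cdot> q None = u"
   "\<And>g a b. (g, a, b) : Q ==> h \<cdot> q (Some (True, g, a, b)) = y g a b" by blast
  have "\<exists>!k. k : homset C L (Cod C p) \<and> k \<cdot> q None = v \<cdot> q None \<and>
    (\<forall>(g, a, b)\<in>Q. k \<cdot> q (Some (True, g, a, b)) = v \<cdot> q (Some (True, g, a, b)))"
  proof (rule univ[OF Cmp_hom[OF e v]])
   fix g a b assume w: "(g, a, b) : Q"
   hence ah: "a : homset C (Dom C g) ?X" by (auto simp: Q)
   show "v \<cdot> q (Some (True, g, a, b)) : homset C (Cod C g) (Cod C p) \<and>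
    v \<cdot> q (Some (True, g, a, b)) \<cdot> g = v \<cdot> q None \<cdot> a"
    using Cmp_hom[OF qB[OF w] v] Cmp_assoc[OF ah e v] Cmp_assoc[OF Qg[OF w] qB[OF w] v]
     qa[OF w] qg[OF w] by simp
  qed
  moreover have "p \<cdot> h : homset C L (Cod C p) \<and> p \<cdot> h \<cdot> q None = v \<cdot> q None \<and>
    (\<forall>(g, a, b)\<in>Q. p \<cdot> h \<cdot> q (Some (True, g, a, b)) = v \<cdot> q (Some (True, g, a, b)))"
   using Cmp_hom[OF h(1) ph] Cmp_assoc[OF e h(1) ph] h(2) uv
    Cmp_assoc[OF qB h(1) ph] h(3) y by auto
  ultimately have "p \<cdot> h = v" using v by blast
  thus "\<exists>h\<in>homset C L (Dom C p). h \<cdot> q None = u \<and> p \<cdot> h = v" using h by blast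
 qed
qed
moreover have "\<exists>h\<in>homset C (Cod C g) L. h \<cdot> g = q None \<cdot> a \<and> f' \<cdot> h = b"
 if "g : K" "a : homset C (Dom C g) ?X" "b : homset C (Cod C g) ?Y" "f \<cdot> a = b \<cdot> g" for g a b
proof -
 have w: "(g, a, b) : Q" using that by (simp add: Q)
 show ?thesis using qB[OF w] qa[OF w] qg[OF w] f'(3)[OF w] by (intro bexI[of _ "q (Some (True, g, a, b))"]) auto
qed
ultimately have "attaches K f (q None) f'" unfolding attaches_def dL using e f' by blast
thus ?thesis by blast
qed

text \<open>A sequence of countable length suffices because maps from sources of \<open>K\<close>
  into its colimit factor through a stage, where the next step provides the filler.\<close>

lemma small_object_argument:
assumes K: "K \<subseteq> Arr C"
 and att: "\<And>f. f : Arr C ==> \<exists>e f'. attaches K f e f'"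
 and seq: "\<And>X e. (\<And>i. e i : homset C (X i) (X (Suc i))) ==>
  \<exists>L q. gcolimit C UNIV UNIV X (%i. i) Suc e L q \<and>
   (\<forall>g\<in>K. \<forall>a\<in>homset C (Dom C g) L. \<exists>i. \<exists>a'\<in>homset C (Dom C g) (X i). q i \<cdot> a' = a)"
 and f: "f : Arr C"
shows "\<exists>i\<in>llp C (rlp C K). \<exists>p\<in>rlp C K. Dom C p = Cod C i \<and> f = p \<cdot> i"
proof -
define nx where "nx f = (SOME ef. attaches K f (fst ef) (snd ef))" for f
have nx: "attaches K f (fst (nx f)) (snd (nx f))" if f: "f : Arr C" for f
proof -
 have "\<exists>ef. attaches K f (fst ef) (snd ef)" using att[OF f] by (metis fst_conv snd_conv)
 thus ?thesis unfolding nx_def by (rule someI_ex)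
qed
define F where "F i = rec_nat f (%_ g. snd (nx g)) i" for i
define e where "e i = fst (nx (F i))" for i
let ?Y = "Cod C f" and ?X = "%i. Dom C (F i)"
have F0: "F 0 = f" and FS: "F (Suc i) = snd (nx (F i))" for i unfolding F_def by auto
have Fi: "F i : Arr C \<and> Cod C (F i) = ?Y" for i
proof (induction i)
 case (Suc i)
 thus ?case using nx[of "F i"] unfolding FS attaches_def homset_def by auto
qed (use f F0 in auto)
hence A: "attaches K (F i) (e i) (F (Suc i))" for i unfolding FS e_def using nx by blast
have Fh: "F i : homset C (?X i) ?Y" for i using Fi[of i] unfolding homset_def by simp
have eh: "e i : homset C (?X i) (?X (Suc i))" and Fe: "F (Suc i) \<cdot> e i = F i"
 and el: "e i : llp C (rlp C K)" for i using A[of i] unfolding attaches_def by auto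
obtain L q where L: "gcolimit C UNIV UNIV ?X (%i. i) Suc e L q"
 and fac: "\<And>g a. g : K ==> a : homset C (Dom C g) L ==>
  \<exists>i. \<exists>a'\<in>homset C (Dom C g) (?X i). q i \<cdot> a' = a"
 using seq[of e ?X, OF eh] by blast
have qh: "q i : homset C (?X i) L" and qe: "q (Suc i) \<cdot> e i = q i" for i
 using L unfolding gcolimit_def by auto
have univ: "\<exists>!h. h : homset C L Z \<and> (\<forall>i. h \<cdot> q i = x i)"
 if "\<And>i. x i : homset C (?X i) Z" "\<And>i. x (Suc i) \<cdot> e i = x i" for Z x
 using L that homset_Obj[OF that(1)] unfolding gcolimit_def by simp
obtain p where p: "p : homset C L ?Y" "\<And>i. p \<cdot> q i = F i"
 using univ[OF Fh Fe] by blast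
have p_rlp: "p : rlp C K" unfolding rlp_def
proof (intro CollectI conjI ballI)
 show "p : Arr C" using p(1) by (rule homset_arr)
 fix g assume g: "g : K"
 hence gh: "g : homset C (Dom C g) (Cod C g)" using K arr_homset by blast
 show "lifts C g p"
 proof (rule liftsI[OF gh p(1)])
  fix a b assume a: "a : homset C (Dom C g) L" and b: "b : homset C (Cod C g) ?Y"
   and ab: "p \<cdot> a = b \<cdot> g"
  obtain i a' where a': "a' : homset C (Dom C g) (?X i)" "q i \<cdot> a' = a" using fac[OF g a] by blast
  have "F i \<cdot> a' = b \<cdot> g" using Cmp_assoc[OF a'(1) qh p(1)] p(2) a'(2) ab by simp
  then obtain h where h: "h : homset C (Cod C g) (?X (Suc i))" "h \<cdot> g = e i \<cdot> a'" "F (Suc i) \<cdot> h = b"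
   using A[of i] g a' b Fi[of i] unfolding attaches_def by metis
  have "(q (Suc i) \<cdot> h) \<cdot> g = a"
   using Cmp_assoc[OF gh h(1) qh] h(2) Cmp_assoc[OF a'(1) eh qh] qe a'(2) by simp
  moreover have "p \<cdot> (q (Suc i) \<cdot> h) = b" using Cmp_assoc[OF h(1) qh p(1)] p(2) h(3) by simp
  ultimately show "\<exists>h\<in>homset C (Cod C g) L. h \<cdot> g = a \<and> p \<cdot> h = b" using Cmp_hom[OF h(1) qh] by blast
 qed
qed
have q_llp: "q 0 : llp C (rlp C K)" unfolding llp_def
proof (intro CollectI conjI ballI)
 show "q 0 : Arr C" using qh by (rule homset_arr)
 fix \<pi> assume \<pi>: "\<pi> : rlp C K"
 hence \<pi>h: "\<pi> : homset C (Dom C \<pi>) (Cod C \<pi>)" unfolding rlp_def using arr_homset by blast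
 show "lifts C (q 0) \<pi>"
 proof (rule liftsI[OF qh \<pi>h])
  fix u v assume u: "u : homset C (?X 0) (Dom C \<pi>)" and v: "v : homset C L (Cod C \<pi>)"
   and uv: "\<pi> \<cdot> u = v \<cdot> q 0"
  \<comment> \<open>Lifts on the stages are chosen successively, each extending the previous one
    along \<open>e i\<close>; the colimit glues them.\<close>
  have "\<exists>w. \<forall>i. (w i : homset C (?X i) (Dom C \<pi>) \<and> \<pi> \<cdot> w i = v \<cdot> q i \<and> (i = 0 --> w i = u)) \<and>
    w (Suc i) \<cdot> e i = w i"
  proof (rule dependent_nat_choice)
   show "\<exists>x. x : homset C (?X 0) (Dom C \<pi>) \<and> \<pi> \<cdot> x = v \<cdot> q 0 \<and> (0 = 0 --> x = u)"
    using u uv by blast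
   fix x i assume x: "x : homset C (?X i) (Dom C \<pi>) \<and> \<pi> \<cdot> x = v \<cdot> q i \<and> (i = 0 --> x = u)"
   have "lifts C (e i) \<pi>" using el[of i] \<pi> unfolding llp_def by blast
   moreover have "\<pi> \<cdot> x = (v \<cdot> q (Suc i)) \<cdot> e i"
    unfolding Cmp_assoc[OF eh qh v, symmetric] qe using x by blast
   ultimately have "\<exists>h\<in>homset C (?X (Suc i)) (Dom C \<pi>). h \<cdot> e i = x \<and> \<pi> \<cdot> h = v \<cdot> q (Suc i)"
    using liftsD[OF _ eh \<pi>h _ Cmp_hom[OF qh v]] x by blast
   thus "\<exists>y. (y : homset C (?X (Suc i)) (Dom C \<pi>) \<and> \<pi> \<cdot> y = v \<cdot> q (Suc i) \<and>
     (Suc i = 0 --> y = u)) \<and> y \<cdot> e i = x" by blast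
  qed
  then obtain w where w: "\<And>i. w i : homset C (?X i) (Dom C \<pi>)" "\<And>i. \<pi> \<cdot> w i = v \<cdot> q i"
   "w 0 = u" "\<And>i. w (Suc i) \<cdot> e i = w i" by blast
  obtain h where h: "h : homset C L (Dom C \<pi>)" "\<And>i. h \<cdot> q i = w i" using univ[OF w(1,4)] by blast
  have vq: "v \<cdot> q (Suc i) \<cdot> e i = v \<cdot> q i" for i
   unfolding Cmp_assoc[OF eh qh v, symmetric] qe ..
  have "\<pi> \<cdot> h \<cdot> q i = v \<cdot> q i" for i
   using Cmp_assoc[OF qh h(1) \<pi>h] h(2) w(2) by simp
  hence "\<pi> \<cdot> h = v"
   using univ[OF Cmp_hom[OF qh v] vq] v Cmp_hom[OF h(1) \<pi>h] by blast
  thus "\<exists>h\<in>homset C L (Dom C \<pi>). h \<cdot> q 0 = u \<and> \<pi> \<cdot> h = v" using h w(3) by blast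
 qed
qed
show ?thesis
 by (intro bexI[OF _ q_llp] bexI[OF _ p_rlp])
  (simp add: homset_dom[OF p(1)] homset_cod[OF qh] p(2) F0)
qed

end

section \<open>Pages\<close>

text \<open>Page r + 1 is addressed through r, so that \<open>boundaries\<close> unfolds by its
  successor clause.\<close>

abbreviation cyc where "cyc A k p n \<equiv> cycles A (Suc k) p n"
abbreviation bnd where "bnd A k p n \<equiv> boundaries A (Suc k) p n"

context fc
begin

lemma d_closed2 [simp]: "fcx K ==> x : K$(n+1) ==> Df K (n+1) x : K$(2 + n)"
using d_simps(1)[of K x "n+1"] by simp

lemma cycles_sub:
assumes "fcx A" shows "submodule (cycles A k p n) R (Cx A n)"
proof -
have "submodule {x : A$n. Df A n x : Fl A (p - int k) (n+1)} R (Cx A n)"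
 by (rule sub_preim[OF _ _ d_lin Fl_sub]) (use assms in auto)
hence "submodule (Fl A p n \<inter> {x : A$n. Df A n x : Fl A (p - int k) (n+1)}) R (Cx A n)"
 using assms by (intro submodule_Int Fl_sub) auto
moreover have "Fl A p n \<inter> {x : A$n. Df A n x : Fl A (p - int k) (n+1)} = cycles A k p n"
 unfolding cycles_def using Fl_car[OF _ assms] by auto
ultimately show ?thesis by simp
qed

lemma cyclesI: "x : Fl A p n ==> Df A n x : Fl A (p - int k) (n+1) ==> x : cycles A k p n"
and cyclesD: "x : cycles A k p n ==> x : Fl A p n"
 "x : cycles A k p n ==> Df A n x : Fl A (p - int k) (n+1)"
unfolding cycles_def by auto

lemma cyc_in: "x : cycles A k p n ==> fcx A ==> x : A$n"
by (rule Fl_car[OF cyclesD(1)])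

lemma cycles_map: "f : hom A B ==> x : cycles A k p n ==> Map f n x : cycles B k p n"
using map_Fl[of f A B x p n] map_Fl[of f A B "Df A n x" "p - int k" "n+1"] map_d[of f A B x n]
 cyc_in[of x A k p n] hom_fcx[of f A B]
unfolding cycles_def by simp

lemma bnd_iff:
assumes A: "fcx A"
shows "x : bnd A k p (n+1) \<longleftrightarrow>
 (\<exists>u\<in>cycles A k (p + int k) n. \<exists>v\<in>cycles A k (p - 1) (n+1). x = Df A n u +[A,n+1] v)"
by (auto simp: set_add_def')

lemma bnd_sub:
assumes A: "fcx A" shows "submodule (bnd A k p n) R (Cx A n)"
proof -
have "Df A (n - 1) : lin R (Cx A (n - 1)) (Cx A n)" using d_lin[OF A, of "n - 1"] by simp
hence "submodule (Df A (n - 1) ` cycles A k (p + int k) (n - 1)) R (Cx A n)"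
 by (intro submodule_image[OF _ _ _ cycles_sub]) (use A in auto)
thus ?thesis using A by (simp add: submodule_sum cycles_sub)
qed

declare boundaries.simps [simp del]

text \<open>Replaces a degree n by n + 1, so that boundaries out of the preceding degree are written
  without subtraction.\<close>

lemma int_Suc_cases: "(\<And>n. P (n+1)) ==> P (n :: int)"
by (metis diff_add_cancel)

lemma bnd_cyc:
assumes A: "fcx A" shows "bnd A k p n \<subseteq> cyc A k p n"
proof (rule int_Suc_cases[of _ n], rule subsetI)
fix n x assume "x : bnd A k p (n+1)"
then obtain u v where u: "u : cycles A k (p + int k) n" and v: "v : cycles A k (p - 1) (n+1)"
 and x: "x = Df A n u +[A,n+1] v" unfolding bnd_iff[OF A] by blast
have c: "u : A$n" "v : A$(n+1)" using cyc_in[OF u A] cyc_in[OF v A] .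
have "Df A n u : Fl A p (n+1)" using cyclesD(2)[OF u] by simp
moreover have "v : Fl A p (n+1)" using Fl_le[OF cyclesD(1)[OF v], of p] A by simp
moreover have "Df A (n+1) v : Fl A (p - int (Suc k)) (n+1+1)"
 using cyclesD(2)[OF v] by (simp add: algebra_simps)
ultimately show "x : cyc A k p (n+1)"
 unfolding x using A c by (intro cyclesI Fl_add) simp_all
qed

lemma bnd_map:
assumes f: "f : hom A B" and x: "x : bnd A k p n"
shows "Map f n x : bnd B k p n"
proof -
have *: "\<forall>x\<in>bnd A k p n. Map f n x : bnd B k p n" for n
proof (rule int_Suc_cases[of _ n], rule ballI)
 fix n x assume "x : bnd A k p (n+1)"
 then obtain u v where u: "u : cycles A k (p + int k) n" and v: "v : cycles A k (p - 1) (n+1)"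
  and x: "x = Df A n u +[A,n+1] v" unfolding bnd_iff[OF hom_fcx(1)[OF f]] by blast
 have c: "u : A$n" "v : A$(n+1)"
  using cyc_in[OF u hom_fcx(1)[OF f]] cyc_in[OF v hom_fcx(1)[OF f]] .
 hence "Map f (n+1) x = Df B n (Map f n u) +[B,n+1] Map f (n+1) v"
  using f hom_fcx(1)[OF f] unfolding x by (simp add: map_simps[OF f] map_d[OF f])
 thus "Map f (n+1) x : bnd B k p (n+1)"
  unfolding bnd_iff[OF hom_fcx(2)[OF f]] using cycles_map[OF f] u v by blast
qed
thus ?thesis using x by blast
qed

text \<open>Inverses are defined by a description over the carrier, so it has to be checked that
  restricting the carrier to a submodule does not change them.\<close>

lemma sub_minus:
assumes "module R M" "submodule Z R M" "x : Z" "y : Z"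
shows "x -[M\<lparr>carrier := Z\<rparr>] y = x -[M] y"
proof -
interpret M: module R M by fact
have "subgroup Z (add_monoid M)" using assms(2) unfolding submodule_def by blast
hence "inv\<^bsub>(add_monoid M)\<lparr>carrier := Z\<rparr>\<^esub> y = inv\<^bsub>add_monoid M\<^esub> y"
 using group.m_inv_consistent[OF M.a_group] assms(4) by blast
thus ?thesis unfolding a_minus_def a_inv_def by simp
qed

lemma page_quot:
assumes A: "fcx A"
shows "quot R ((Cx A n)\<lparr>carrier := cyc A k p n\<rparr>) (bnd A k p n)"
proof -
note Z = cycles_sub[OF A, of "Suc k" p n] and M = cx_mod[OF A, of n]
have MZ: "module R ((Cx A n)\<lparr>carrier := cyc A k p n\<rparr>)"
 using submodule.submodule_is_module[OF Z M] .
note B = bnd_sub[OF A, of k p n]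
show ?thesis
proof (intro quot.intro MZ quot_axioms.intro)
 show "submodule (bnd A k p n) R ((Cx A n)\<lparr>carrier := cyc A k p n\<rparr>)"
  by (rule submoduleI'[OF MZ])
   (use bnd_cyc[OF A] submodule_rules[OF B] in \<open>auto\<close>)
qed
qed

text \<open>Injectivity and surjectivity on page k + 1, said on representatives; most later
  arguments can then avoid cosets. Linearity of the induced map is automatic by
  \<open>page_lin\<close>.\<close>

definition wiso where
"wiso A B f k \<longleftrightarrow> (\<forall>p n. (\<forall>x\<in>cyc A k p n. Map f n x : bnd B k p n --> x : bnd A k p n) \<and>
  (\<forall>y\<in>cyc B k p n. \<exists>x\<in>cyc A k p n. y -[B,n] Map f n x : bnd B k p n))"

abbreviation pc where "pc A k p n \<equiv> carrier (page A (Suc k) p n)"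
abbreviation pm where "pm f k p n \<equiv> page_map (Src f) (Tgt f) (Map f) (Suc k) p n"
abbreviation pcl where "pcl A k p n x \<equiv> bnd A k p n +>\<^bsub>Cx A n\<^esub> x"

lemma pc_eq: "fcx A ==> pc A k p n = pcl A k p n ` cyc A k p n"
using quot.carrier_quot[OF page_quot[of A k p n]] unfolding page_def by (simp add: a_r_coset_def')

lemma pcl_eq:
assumes A: "fcx A" and x: "x : cyc A k p n" and y: "y : cyc A k p n"
shows "pcl A k p n x = pcl A k p n y \<longleftrightarrow> x -[A,n] y : bnd A k p n"
using quot.cl_eq[OF page_quot[OF A], of x k p n y] x y sub_minus[OF cx_mod[OF A] cycles_sub[OF A] x y]
by (simp add: a_r_coset_def')

lemma pm_cl:
assumes f: "f : hom A B" and x: "x : cyc A k p n"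
shows "pm f k p n (pcl A k p n x) = pcl B k p n (Map f n x)"
proof -
note A = hom_fcx(1)[OF f] and B = hom_fcx(2)[OF f]
interpret a: quot R "(Cx A n)\<lparr>carrier := cyc A k p n\<rparr>" "bnd A k p n" by (rule page_quot[OF A])
have cl: "a.cl y = pcl A k p n y" for y by (simp add: a_r_coset_def')
have "pcl B k p n (Map f n y) = pcl B k p n (Map f n x)" if y: "y : pcl A k p n x" for y
proof -
 have y: "y : cyc A k p n" "pcl A k p n y = pcl A k p n x" using a.cl_mem[of x y] x that unfolding cl by auto
 hence "y -[A,n] x : bnd A k p n" using pcl_eq[OF A _ x] by blast
 from bnd_map[OF f this] show ?thesis
  using pcl_eq[OF B cycles_map[OF f y(1)] cycles_map[OF f x]] cyc_in[OF y(1) A] cyc_in[OF x A] f by simp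
qed
moreover have "x : pcl A k p n x" using abelian_subgroup.a_rcos_self[OF a.ab_sub] x unfolding cl by simp
ultimately have "(\<Union>y\<in>pcl A k p n x. pcl B k p n (Map f n y)) = pcl B k p n (Map f n x)"
 by (intro UN_constant_eq ballI) blast+
moreover have "pcl A k p n x : pc A k p n" unfolding pc_eq[OF A] using x by blast
ultimately show ?thesis unfolding page_map_def hom_src[OF f] hom_tgt[OF f] by simp
qed

lemma page_lin:
assumes f: "f : hom A B"
shows "pm f k p n : lin R (page A (Suc k) p n) (page B (Suc k) p n)"
proof -
note A = hom_fcx(1)[OF f] and B = hom_fcx(2)[OF f]
interpret a: quot R "(Cx A n)\<lparr>carrier := cyc A k p n\<rparr>" "bnd A k p n" by (rule page_quot[OF A])
interpret b: quot R "(Cx B n)\<lparr>carrier := cyc B k p n\<rparr>" "bnd B k p n" by (rule page_quot[OF B])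
note q = page_def a_r_coset_def'[symmetric]
note v = pm_cl[OF f, of _ k p n] and fZ = cycles_map[OF f, of _ "Suc k" p n] and cc = cyc_in[OF _ A, of _ "Suc k" p n]
have cl: "a.cl y = pcl A k p n y" "b.cl z = pcl B k p n z" for y z by (simp_all add: a_r_coset_def')
note ops = a.add_quot a.smult_quot b.add_quot b.smult_quot
show ?thesis
proof (rule lin_mapsI)
 show "X \<notin> pc A k p n ==> pm f k p n X = undefined" for X unfolding page_map_def hom_src[OF f] by simp
 fix X assume "X : pc A k p n"
 then obtain x where x: "x : cyc A k p n" "X = pcl A k p n x" unfolding pc_eq[OF A] by blast
 show "pm f k p n X : pc B k p n" unfolding x v[OF x(1)] pc_eq[OF B] using fZ[OF x(1)] by blast
 show "pm f k p n (s *[page A (Suc k) p n] X) = s *[page B (Suc k) p n] pm f k p n X" if s: "s : carrier R" for s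
  using a.smult_quot[OF s, of x] b.smult_quot[OF s, of "Map f n x"] v[OF submodule_smult[OF cycles_sub[OF A] s x(1)]]
   v[OF x(1)] x fZ[OF x(1)] cc[OF x(1)] s f unfolding page_def cl by simp
 fix Y assume "Y : pc A k p n"
 then obtain y where y: "y : cyc A k p n" "Y = pcl A k p n y" unfolding pc_eq[OF A] by blast
 show "pm f k p n (X +[page A (Suc k) p n] Y) = pm f k p n X +[page B (Suc k) p n] pm f k p n Y"
  using a.add_quot[of x y] b.add_quot[of "Map f n x" "Map f n y"] v[OF submodule_add[OF cycles_sub[OF A] x(1) y(1)]]
   v[OF x(1)] v[OF y(1)] x y fZ[OF x(1)] fZ[OF y(1)] cc[OF x(1)] cc[OF y(1)] f unfolding page_def cl by simp
qed
qed

lemma wiso_bij: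
assumes f: "f : hom A B"
shows "wiso A B f k \<longleftrightarrow> (\<forall>p n. bij_betw (pm f k p n) (pc A k p n) (pc B k p n))"
proof -
note A = hom_fcx(1)[OF f] and B = hom_fcx(2)[OF f]
have "bij_betw (pm f k p n) (pc A k p n) (pc B k p n) \<longleftrightarrow>
  (\<forall>x\<in>cyc A k p n. Map f n x : bnd B k p n --> x : bnd A k p n) \<and>
  (\<forall>y\<in>cyc B k p n. \<exists>x\<in>cyc A k p n. y -[B,n] Map f n x : bnd B k p n)" (is "_ \<longleftrightarrow> ?I \<and> ?S") for p n
proof -
 have fZ: "Map f n x : cyc B k p n" if "x : cyc A k p n" for x using cycles_map[OF f that] .
 have z: "0[A,n] : cyc A k p n" using submodule_zero[OF cycles_sub[OF A]] .
 have d: "x -[A,n] y : cyc A k p n" "Map f n (x -[A,n] y) = Map f n x -[B,n] Map f n y" "x -[A,n] 0[A,n] = x"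
  if "x : cyc A k p n" "y : cyc A k p n" for x y
  using submodule_minus[OF cycles_sub[OF A] that] cyc_in[OF that(1) A] cyc_in[OF that(2) A] A f by auto
 have "inj_on (pm f k p n) (pc A k p n) \<longleftrightarrow>
   (\<forall>x\<in>cyc A k p n. \<forall>y\<in>cyc A k p n. Map f n (x -[A,n] y) : bnd B k p n --> x -[A,n] y : bnd A k p n)"
  unfolding inj_on_def pc_eq[OF A] ball_simps(9) by (simp add: pm_cl[OF f] pcl_eq[OF A] pcl_eq[OF B] fZ d(2))
 also have "\<dots> \<longleftrightarrow> ?I" using d z by metis
 finally have 1: "inj_on (pm f k p n) (pc A k p n) \<longleftrightarrow> ?I" .
 have "pm f k p n ` pc A k p n = pc B k p n \<longleftrightarrow> pc B k p n \<subseteq> pm f k p n ` pc A k p n"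
  using lin_in[OF page_lin[OF f]] by blast
 also have "\<dots> \<longleftrightarrow> (\<forall>y\<in>cyc B k p n. \<exists>x\<in>cyc A k p n. pcl B k p n y = pm f k p n (pcl A k p n x))"
  unfolding pc_eq[OF A] pc_eq[OF B] by blast
 also have "\<dots> \<longleftrightarrow> ?S" by (simp add: pm_cl[OF f] pcl_eq[OF B] fZ)
 finally show ?thesis using 1 unfolding bij_betw_def by blast
qed
thus ?thesis unfolding wiso_def by blast
qed

lemma weak_iff: "f : hom A B ==> f : weak_equivalences R r \<longleftrightarrow> wiso A B f r"
unfolding weak_equivalences_def page_iso_def wiso_bij using page_lin[of f A B r] hom_arr[of f A B]
by (simp add: hom_src hom_tgt)

lemma wisoD:
assumes "wiso A B f k"
shows "x : cyc A k p n ==> Map f n x : bnd B k p n ==> x : bnd A k p n"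
 and "y : cyc B k p n ==> \<exists>x\<in>cyc A k p n. y -[B,n] Map f n x : bnd B k p n"
using assms unfolding wiso_def by blast+

lemma wisoI:
assumes "\<And>p n x. x : cyc A k p n ==> Map f n x : bnd B k p n ==> x : bnd A k p n"
 and "\<And>p n y. y : cyc B k p n ==> \<exists>x\<in>cyc A k p n. y -[B,n] Map f n x : bnd B k p n"
shows "wiso A B f k"
using assms unfolding wiso_def by blast

lemma ab_ids:
assumes "fcx A"
 and "x : A$n" "y : A$n"
shows "(x -[A,n] y) +[A,n] y = x" "(x +[A,n] y) -[A,n] y = x"
 "x -[A,n] (x -[A,n] y) = y"
 "z : A$n ==> (x -[A,n] y) +[A,n] (y -[A,n] z) = x -[A,n] z"
proof -
interpret abelian_group "Cx A n" by (rule cx_ab[OF assms(1)])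
show "(x -[A,n] y) +[A,n] y = x" "(x +[A,n] y) -[A,n] y = x"
 "x -[A,n] (x -[A,n] y) = y"
 using assms(2,3) by algebra+
show "z : A$n ==> (x -[A,n] y) +[A,n] (y -[A,n] z) = x -[A,n] z"
 using assms(2,3) by algebra
qed

lemma wiso_2_of_3:
assumes f: "f : hom A B" and g: "g : hom B D"
shows wiso_comp: "wiso A B f k ==> wiso B D g k ==> wiso A D (g \<star> f) k"
 and wiso_cancel_left: "wiso A B f k ==> wiso A D (g \<star> f) k ==> wiso B D g k"
 and wiso_cancel_right: "wiso B D g k ==> wiso A D (g \<star> f) k ==> wiso A B f k"
proof -
note A = hom_fcx(1)[OF f] and gf = cmpI[OF f g]
have "pm (g \<star> f) k p n X = (pm g k p n \<circ> pm f k p n) X" if X: "X : pc A k p n" for p n X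
proof -
 obtain x where x: "x : cyc A k p n" "X = pcl A k p n x" using X unfolding pc_eq[OF A] by blast
 show ?thesis unfolding x o_apply pm_cl[OF f x(1)] pm_cl[OF gf x(1)] pm_cl[OF g cycles_map[OF f x(1)]] cmp_map[OF f cyc_in[OF x(1) A]] ..
qed
hence c: "bij_betw (pm (g \<star> f) k p n) (pc A k p n) (pc D k p n) \<longleftrightarrow> bij_betw (pm g k p n \<circ> pm f k p n) (pc A k p n) (pc D k p n)"
 for p n by (rule bij_betw_cong)
have i: "pm f k p n ` pc A k p n \<subseteq> pc B k p n" for p n using lin_in[OF page_lin[OF f]] by blast
note w = wiso_bij[OF f] wiso_bij[OF g] wiso_bij[OF gf]
show "wiso A B f k ==> wiso B D g k ==> wiso A D (g \<star> f) k" unfolding w c by (blast intro: bij_betw_trans)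
show "wiso A B f k ==> wiso A D (g \<star> f) k ==> wiso B D g k" unfolding w c by (metis bij_betw_comp_iff)
show "wiso B D g k ==> wiso A D (g \<star> f) k ==> wiso A B f k" unfolding w c using bij_betw_comp_iff2[OF _ i] by blast
qed

lemma wiso_retract:
assumes f: "f : hom A B" and g: "g : hom A' B'" and i: "i : hom A A'" and s: "s : hom A' A"
 and i': "i' : hom B B'" and s': "s' : hom B' B"
 and si: "s \<star> i = Idt FC A" and si': "s' \<star> i' = Idt FC B"
 and gi: "g \<star> i = i' \<star> f" and fs: "f \<star> s = s' \<star> g" and w: "wiso A' B' g k"
shows "wiso A B f k"
proof -
note A = hom_fcx(1)[OF f] and B = hom_fcx(2)[OF f] and A' = hom_fcx(1)[OF g] and B' = hom_fcx(2)[OF g]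
have esi: "Map s n (Map i n x) = x" if "x : A$n" for n x
 using cmp_map[OF i that, of s] si Idt_map[OF that] by simp
have esi': "Map s' n (Map i' n x) = x" if "x : B$n" for n x
 using cmp_map[OF i' that, of s'] si' Idt_map[OF that] by simp
have egi: "Map g n (Map i n x) = Map i' n (Map f n x)" if "x : A$n" for n x
 using cmp_map[OF i that, of g] cmp_map[OF f that, of i'] gi by simp
have efs: "Map f n (Map s n x) = Map s' n (Map g n x)" if "x : A'$n" for n x
 using cmp_map[OF s that, of f] cmp_map[OF g that, of s'] fs by simp
show ?thesis
proof (rule wisoI)
 fix p n x assume x: "x : cyc A k p n" and fx: "Map f n x : bnd B k p n"
 have xc: "x : A$n" using cyc_in[OF x A] .
 have "Map g n (Map i n x) : bnd B' k p n"
  unfolding egi[OF xc] by (rule bnd_map[OF i' fx])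
 hence "Map i n x : bnd A' k p n" by (rule wisoD(1)[OF w cycles_map[OF i x]])
 from bnd_map[OF s this] show "x : bnd A k p n" unfolding esi[OF xc] .
next
 fix p n y assume y: "y : cyc B k p n"
 obtain x where x: "x : cyc A' k p n" "Map i' n y -[B',n] Map g n x : bnd B' k p n"
  using wisoD(2)[OF w cycles_map[OF i' y]] by blast
 have c: "x : A'$n" "y : B$n" using cyc_in[OF x(1) A'] cyc_in[OF y B] .
 have "y -[B,n] Map f n (Map s n x) : bnd B k p n"
  using bnd_map[OF s' x(2)] c
  by (simp add: map_simps[OF s'] map_simps[OF i'] map_simps[OF g] esi' efs)
 thus "\<exists>x\<in>cyc A k p n. y -[B,n] Map f n x : bnd B k p n"
  using cycles_map[OF s x(1)] by blast
qed
qed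

section \<open>Cells\<close>

lemma ab_add_diff:
assumes "fcx A" "x : A$n" "y : A$n"
shows "y +[A,n] (x -[A,n] y) = x"
proof -
interpret abelian_group "Cx A n" by (rule cx_ab[OF assms(1)])
show ?thesis using assms(2,3) by algebra
qed

lemma reg_ops [simp]:
"0[regular_module R] = \<zero>" "x +[regular_module R] y = x \<oplus> y" "s *[regular_module R] x = s \<otimes> x"
unfolding regular_module_def by simp_all

lemma reg_module:
assumes "K = carrier R \<or> K = {\<zero>}" shows "module R ((regular_module R)\<lparr>carrier := K\<rparr>)"
proof -
let ?K = "(regular_module R)\<lparr>carrier := K\<rparr>"
have K: "K \<subseteq> carrier R" "\<zero> : K" "\<And>x y. x : K ==> y : K ==> x \<oplus> y : K"
 "\<And>x. x : K ==> \<ominus> x : K" "\<And>s x. s : carrier R ==> x : K ==> s \<otimes> x : K"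
 using assms by (auto simp: neg_zero)
have ab: "abelian_group ?K"
proof (rule abelian_groupI)
 fix x assume x: "x : carrier ?K"
 thus "\<exists>y\<in>carrier ?K.
   y +[(regular_module R)\<lparr>carrier := K\<rparr>] x = 0[(regular_module R)\<lparr>carrier := K\<rparr>]"
  using K by (intro bexI[of _ "\<ominus> x"]) (auto simp: l_neg)
qed (use K in \<open>auto simp: a_ac subset_iff\<close>)
show ?thesis
 by (rule moduleI[OF is_cring ab]) (use K in \<open>auto simp: l_distr r_distr m_assoc subset_iff\<close>)
qed

lemma zero_sel [simp]:
"Cx (ZC R) n = (regular_module R)\<lparr>carrier := {\<zero>}\<rparr>"
"Df (ZC R) n = (\<lambda>x\<in>{\<zero>}. \<zero>)" "Fl (ZC R) p n = {\<zero>}"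
unfolding zero_complex_def by simp_all

lemma zero_cpx: "cpx (ZC R)"
proof (rule cpxI)
show "fcx (ZC R)"
 by (rule filtered_complex.intro)
  (auto intro!: lin_mapsI submoduleI' reg_module)
qed (simp add: sm_finite)

lemma zero_hom: "X : Ob ==> from_copy (ZC R) X (%m c. 0[X,m]) : hom (cpy (ZC R)) X"
by (intro from_copy_hom zero_cpx fmapI) auto

lemma zero_ext:
assumes f: "f : hom (cpy (ZC R)) X" and g: "g : hom (cpy (ZC R)) X"
shows "f = g"
proof (rule hom_ext_copy[OF f g refl])
fix n x assume "x : (ZC R)$n"
hence x: "cd (ZC R) n x = 0[cpy (ZC R),n]" unfolding copy_zero by simp
show "Map f n (cd (ZC R) n x) = Map g n (cd (ZC R) n x)"
 unfolding x map_simps(5)[OF f] map_simps(5)[OF g] ..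
qed

lemma zero_initial: "is_initial FC (cpy (ZC R))"
unfolding is_initial_def using zero_cpx zero_hom zero_ext by fastforce

definition cellK where "cellK n m = (if m = n \<or> m = n+1 then carrier R else {\<zero>})"

lemma cell_sel [simp]:
"Cx (cell R k p n) m = (regular_module R)\<lparr>carrier := cellK n m\<rparr>"
"x : cellK n m ==> Df (cell R k p n) m x = (if m = n then x else \<zero>)"
"Fl (cell R k p n) q m = (if m = n \<and> p \<le> q \<or> m = n+1 \<and> p - int k \<le> q then carrier R else {\<zero>})"
unfolding cell_def cellK_def Let_def by simp_all

lemma cellK: "cellK n m = carrier R \<or> cellK n m = {\<zero>}" "\<zero> : cellK n m" "cellK n m \<subseteq> carrier R"
unfolding cellK_def by auto

lemma cell_cpx: "cpx (cell R k p n)"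
proof (rule cpxI)
let ?K = "cell R k p n"
show "fcx ?K"
proof (rule filtered_complex.intro)
 fix m q :: int
 show "module R (Cx ?K m)" using reg_module[OF cellK(1)] by simp
 show "submodule (Fl ?K q m) R (Cx ?K m)"
  by (rule submoduleI') (simp add: reg_module[OF cellK(1)], auto simp: cellK_def split: if_splits)
 show "Df ?K m : lin R (Cx ?K m) (Cx ?K (m+1))"
 proof (rule lin_mapsI)
  show "x \<notin> ?K$m ==> Df ?K m x = undefined" for x
   unfolding cell_def Let_def by simp
 qed (auto simp: cellK_def cell_def Let_def split: if_splits)
 show "Df ?K m ` Fl ?K q m \<subseteq> Fl ?K q (m+1)"
  by (auto simp: cell_def Let_def)
 show "Fl ?K q m \<subseteq> Fl ?K (q+1) m" by auto
 show "x : ?K$m ==>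
   Df ?K (m+1) (Df ?K m x) = 0[cell R k p n,m+1+1]" for x
  by (auto simp: cell_def Let_def)
qed
show "sm (?K$m)" for m
 using sm_subset[OF smR cellK(3)] by simp
qed

abbreviation gen where "gen k p n \<equiv> cd (cell R k p n) n \<one>"

lemma one_cellK [simp]: "\<one> : cellK n n" "\<one> : cellK n (n+1)"
unfolding cellK_def by simp_all

lemma gen_cycles: "gen k p n : cycles (cpy (cell R k p n)) k p n"
proof (rule cyclesI)
let ?K = "cell R k p n"
show "gen k p n : Fl (cpy ?K) p n" by (subst cd_Fl[OF cell_cpx]) simp_all
have "Df (cpy ?K) n (gen k p n) = cd ?K (n+1) \<one>"
 by (subst copy_d[OF cell_cpx]) simp_all
moreover have "cd ?K (n+1) \<one> : Fl (cpy ?K) (p - int k) (n+1)"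
 by (subst cd_Fl[OF cell_cpx]) simp_all
ultimately show "Df (cpy ?K) n (gen k p n) : Fl (cpy ?K) (p - int k) (n+1)" by simp
qed

lemma cell_map_cycles: "f : hom (cpy (cell R k p n)) X ==> Map f n (gen k p n) : cycles X k p n"
by (rule cycles_map[OF _ gen_cycles])

text \<open>The boundary of the generator generates degree n + 1, so the image of the generator
  decides. Together with \<open>cell_map_cycles\<close> and \<open>cell_hom\<close> this says that
  the cell represents \<open>cycles X k p n\<close>.\<close>

lemma cell_ext:
assumes f: "f : hom (cpy (cell R k p n)) X" and g: "g : hom (cpy (cell R k p n)) X"
 and eq: "Map f n (gen k p n) = Map g n (gen k p n)"
shows "f = g"
proof (rule hom_ext_copy[OF f g refl])
let ?K = "cell R k p n"
let ?C = "cpy ?K"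
fix m x assume x: "x : ?K$m"
have d: "cd ?K (n+1) \<one> = Df ?C n (gen k p n)" by (subst copy_d[OF cell_cpx]) simp_all
have gc: "gen k p n : ?C$n" by (rule cd_in) simp
hence dc: "Df ?C n (gen k p n) : ?C$(n+1)" using hom_fcx[OF f] by simp
have eqd: "Map f (n+1) (Df ?C n (gen k p n)) = Map g (n+1) (Df ?C n (gen k p n))"
 using map_d[OF f gc] map_d[OF g gc] eq by simp
consider "m = n" | "m = n+1" | "m \<noteq> n" "m \<noteq> n+1" by blast
thus "Map f m (cd ?K m x) = Map g m (cd ?K m x)"
proof cases
 case 1
 hence xR: "x : carrier R" using x by (simp add: cellK_def)
 have "cd ?K n x = x *[?C,n] gen k p n"
  using xR by (subst copy_smult[OF cell_cpx]) simp_all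
 thus ?thesis using 1 xR gc eq map_simps(6)[OF f] map_simps(6)[OF g] by simp
next
 case 2
 hence xR: "x : carrier R" using x by (simp add: cellK_def)
 have "cd ?K (n+1) x = x *[?C,n+1] cd ?K (n+1) \<one>"
  using xR by (subst copy_smult[OF cell_cpx]) simp_all
 thus ?thesis using 2 xR dc eqd map_simps(6)[OF f] map_simps(6)[OF g] unfolding d by simp
next
 case 3
 hence "x = 0[cell R k p n,m]" using x by (simp add: cellK_def)
 hence "cd ?K m x = 0[?C,m]" unfolding copy_zero by simp
 thus ?thesis using map_simps(5)[OF f, of m] map_simps(5)[OF g, of m] by simp
qed
qed

definition cell_fun where
"cell_fun X n x m c = (if m = n then c *[X,m] x else if m = n+1 then c *[X,m] Df X n x else 0[X,m])"

lemma cell_fun_fmap: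
assumes X: "fcx X" and x: "x : cycles X k p n"
shows "fmap R (cell R k p n) X (cell_fun X n x)"
proof (rule fmapI)
let ?K = "cell R k p n"
have xc: "x : X$n" using cyc_in[OF x X] .
show "cell_fun X n x m c : X$m" if "c : ?K$m" for m c
 using that X xc by (auto simp: cell_fun_def cellK_def)
show "cell_fun X n x m (c +[cell R k p n,m] c') = cell_fun X n x m c +[X,m] cell_fun X n x m c'"
 if "c : ?K$m" "c' : ?K$m" for m c c'
 using that X xc by (auto simp: cell_fun_def cellK_def cx_smult)
show "cell_fun X n x m (s *[cell R k p n,m] c) = s *[X,m] cell_fun X n x m c"
 if "s : carrier R" "c : ?K$m" for m s c
 using that X xc by (auto simp: cell_fun_def cellK_def cx_smult)
show "Df X m (cell_fun X n x m c) = cell_fun X n x (m+1) (Df ?K m c)"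
 if "c : ?K$m" for m c
 using that X xc by (auto simp: cell_fun_def cellK_def)
show "cell_fun X n x m c : Fl X q m" if "c : Fl ?K q m" for q m c
proof -
 have "p \<le> q ==> x : Fl X q n" using Fl_le[OF cyclesD(1)[OF x] _ X] by blast
 moreover have "p - int k \<le> q ==> Df X n x : Fl X q (n+1)" using Fl_le[OF cyclesD(2)[OF x] _ X] by blast
 ultimately show ?thesis using that X xc by (auto simp: cell_fun_def Fl_smult split: if_splits)
qed
qed

lemma cell_hom:
assumes X: "X : Ob" and x: "x : cycles X k p n"
shows "\<exists>f\<in>hom (cpy (cell R k p n)) X. Map f n (gen k p n) = x"
proof (rule bexI)
show "from_copy (cell R k p n) X (cell_fun X n x) : hom (cpy (cell R k p n)) X"
 by (rule from_copy_hom[OF cell_cpx X cell_fun_fmap[OF Ob_fcx[OF X] x]])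
show "Map (from_copy (cell R k p n) X (cell_fun X n x)) n (gen k p n) = x"
 using cyc_in[OF x Ob_fcx[OF X]] X by (subst from_copy_map[OF cell_cpx]) (simp_all add: cell_fun_def)
qed

section \<open>Direct sums and the complexes \<open>B_(r+1)(p, n)\<close>\<close>

lemma prod_ops [simp]:
"carrier (prod_module M N) = carrier M \<times> carrier N" "0[prod_module M N] = (0[M], 0[N])"
"(x, y) +[prod_module M N] (x', y') = (x +[M] x', y +[N] y')"
"a *[prod_module M N] (x, y) = (a *[M] x, a *[N] y)"
unfolding prod_module_def by simp_all

lemma prod_module_module:
assumes "module R M" "module R N" shows "module R (prod_module M N)"
proof -
interpret M: module R M by fact
interpret N: module R N by fact
have ab: "abelian_group (prod_module M N)"
proof (rule abelian_groupI)
 fix z assume z: "z : carrier (prod_module M N)"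
 then obtain x y where "z = (x, y)" "x : carrier M" "y : carrier N" by auto
 thus "\<exists>w\<in>carrier (prod_module M N). w +[prod_module M N] z = 0[prod_module M N]"
  by (intro bexI[of _ "(-[M] x, -[N] y)"]) (simp_all add: M.l_neg N.l_neg)
qed (auto simp: M.a_ac N.a_ac)
show ?thesis
 by (rule moduleI[OF is_cring ab])
  (auto simp: M.smult_l_distr M.smult_r_distr M.smult_assoc1 N.smult_l_distr N.smult_r_distr N.smult_assoc1)
qed

lemma direct_sum_sel [simp]:
"Cx (direct_sum K L) n = prod_module (Cx K n) (Cx L n)"
"x : K$n ==> y : L$n ==> Df (direct_sum K L) n (x, y) = (Df K n x, Df L n y)"
"Fl (direct_sum K L) p n = Fl K p n \<times> Fl L p n"
unfolding direct_sum_def by simp_all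

lemma direct_sum_cpx:
assumes "cpx K" "cpx L" shows "cpx (direct_sum K L)"
proof (rule cpxI)
let ?K = "direct_sum K L"
have K: "fcx K" and L: "fcx L" using assms by auto
show "fcx ?K"
proof (rule filtered_complex.intro)
 fix n p :: int
 show M: "module R (Cx ?K n)" using K L by (simp add: prod_module_module)
 show "Df ?K n : lin R (Cx ?K n) (Cx ?K (n+1))"
  by (rule lin_mapsI) (use K L in \<open>auto simp: direct_sum_def\<close>)
 show "submodule (Fl ?K p n) R (Cx ?K n)"
  by (rule submoduleI'[OF M]) (use K L Fl_car[of _ K p n] Fl_car[of _ L p n] in
    \<open>auto simp: Fl_add Fl_smult\<close>)
 show "Df ?K n ` Fl ?K p n \<subseteq> Fl ?K p (n+1)"
  using K L Fl_car[of _ K p n] Fl_car[of _ L p n] by (auto simp: Fl_d)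
 show "Fl ?K p n \<subseteq> Fl ?K (p+1) n"
  using Fl_le[of _ K p n "p+1"] Fl_le[of _ L p n "p+1"] K L by auto
qed (use K L in auto)
show "sm (?K$n)" for n
 using sm_Times[OF cpx_sm[OF assms(1)] cpx_sm[OF assms(2)]] by simp
qed

lemma fmap_sum:
assumes X: "fcx X" and a: "fmap R K X a" and b: "fmap R L X b"
shows "fmap R (direct_sum K L) X (%m (x, y). a m x +[X,m] b m y)"
proof (rule fmapI)
show "(case x of (x, y) => a n x +[X,n] b n y) : Fl X p n" if "x : Fl (direct_sum K L) p n" for p n x
 using that Fl_add[OF X] fmap_Fl[OF a] fmap_Fl[OF b] by auto
qed (use X in \<open>auto simp: fmap_closed[OF a] fmap_closed[OF b] fmap_add[OF a] fmap_add[OF b] cx_ac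
 fmap_smult[OF a] fmap_smult[OF b] cx_smult fmap_d[OF a] fmap_d[OF b]\<close>)

lemma fmap_inl: "fcx K ==> fcx L ==> fmap R K (direct_sum K L) (%n x. (x, 0[L,n]))"
and fmap_inr: "fcx K ==> fcx L ==> fmap R L (direct_sum K L) (%n y. (0[K,n], y))"
by (auto intro!: fmapI)

text \<open>The degree is written \<open>n + 1\<close> to keep the generator of degree \<open>n\<close> free of subtraction.\<close>

abbreviation bdc where "bdc r p n \<equiv> cell_bd R r p (n+1)"

lemma bdc_eq: "bdc r p n = direct_sum (cell R r (p + int r) n) (cell R r (p - 1) (n+1))"
unfolding cell_bd_def by simp

lemma bdc_cpx: "cpx (bdc r p n)"
unfolding bdc_eq by (intro direct_sum_cpx cell_cpx)

abbreviation g1 where "g1 r p n \<equiv> cd (bdc r p n) n (\<one>, \<zero>)"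
abbreviation g2 where "g2 r p n \<equiv> cd (bdc r p n) (n+1) (\<zero>, \<one>)"

definition inl where "inl r p n = copy_arrow (cell R r (p + int r) n) (bdc r p n) (%m c. (c, \<zero>))"
definition inr where "inr r p n = copy_arrow (cell R r (p - 1) (n+1)) (bdc r p n) (%m c. (\<zero>, c))"

lemma inl: "inl r p n : hom (cpy (cell R r (p + int r) n)) (cpy (bdc r p n))"
"c : cellK n m ==> Map (inl r p n) m (cd (cell R r (p + int r) n) m c) = cd (bdc r p n) m (c, \<zero>)"
proof -
have "fmap R (cell R r (p + int r) n) (bdc r p n) (%m c. (c, \<zero>))"
 using fmap_inl[of "cell R r (p + int r) n" "cell R r (p - 1) (n+1)"] cell_cpx
 unfolding bdc_eq by simp
from copy_arrow_hom[OF cell_cpx bdc_cpx this]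
show "inl r p n : hom (cpy (cell R r (p + int r) n)) (cpy (bdc r p n))"
 "c : cellK n m ==> Map (inl r p n) m (cd (cell R r (p + int r) n) m c) = cd (bdc r p n) m (c, \<zero>)"
 unfolding inl_def by simp_all
qed

lemma inr: "inr r p n : hom (cpy (cell R r (p - 1) (n+1))) (cpy (bdc r p n))"
"c : cellK (n+1) m ==> Map (inr r p n) m (cd (cell R r (p - 1) (n+1)) m c) = cd (bdc r p n) m (\<zero>, c)"
proof -
have "fmap R (cell R r (p - 1) (n+1)) (bdc r p n) (%m c. (\<zero>, c))"
 using fmap_inr[of "cell R r (p + int r) n" "cell R r (p - 1) (n+1)"] cell_cpx
 unfolding bdc_eq by simp
from copy_arrow_hom[OF cell_cpx bdc_cpx this]
show "inr r p n : hom (cpy (cell R r (p - 1) (n+1))) (cpy (bdc r p n))"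
 "c : cellK (n+1) m ==> Map (inr r p n) m (cd (cell R r (p - 1) (n+1)) m c) = cd (bdc r p n) m (\<zero>, c)"
 unfolding inr_def by simp_all
qed

lemma inl_gen: "Map (inl r p n) n (gen r (p + int r) n) = g1 r p n"
and inr_gen: "Map (inr r p n) (n+1) (gen r (p - 1) (n+1)) = g2 r p n"
by (simp_all add: inl(2) inr(2))

lemma g1_cycles: "g1 r p n : cycles (cpy (bdc r p n)) r (p + int r) n"
and g2_cycles: "g2 r p n : cycles (cpy (bdc r p n)) r (p - 1) (n+1)"
using cell_map_cycles[OF inl(1)] cell_map_cycles[OF inr(1)] unfolding inl_gen inr_gen .

lemma bdc_ext:
assumes f: "f : hom (cpy (bdc r p n)) X" and g: "g : hom (cpy (bdc r p n)) X"
 and eq: "Map f n (g1 r p n) = Map g n (g1 r p n)" "Map f (n+1) (g2 r p n) = Map g (n+1) (g2 r p n)"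
shows "f = g"
proof (rule hom_ext_copy[OF f g refl])
let ?K = "bdc r p n"
have l: "f \<star> inl r p n = g \<star> inl r p n"
 by (rule cell_ext[OF cmpI[OF inl(1) f] cmpI[OF inl(1) g]])
  (use eq in \<open>simp add: cmp_map[OF inl(1)] inl(2)\<close>)
have r: "f \<star> inr r p n = g \<star> inr r p n"
 by (rule cell_ext[OF cmpI[OF inr(1) f] cmpI[OF inr(1) g]])
  (use eq in \<open>simp add: cmp_map[OF inr(1)] inr(2)\<close>)
fix m z assume "z : ?K$m"
then obtain x y where z: "z = (x, y)" "x : cellK n m" "y : cellK (n+1) m" unfolding bdc_eq by auto
have c: "(x, \<zero>) : ?K$m" "(\<zero>, y) : ?K$m"
 using z cellK(2) unfolding bdc_eq by auto
have "(x, \<zero>) +[bdc r p n,m] (\<zero>, y) = z"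
 using z cellK(3)[of n m] cellK(3)[of "n+1" m] unfolding bdc_eq by (auto simp: subset_iff)
hence eqz: "cd ?K m z = cd ?K m (x, \<zero>) +[cpy ?K,m] cd ?K m (\<zero>, y)"
 using copy_add[OF bdc_cpx c] by simp
have "Map f m (cd ?K m (x, \<zero>)) = Map g m (cd ?K m (x, \<zero>))"
 using arg_cong[OF l, of "%h. Map h m (cd (cell R r (p + int r) n) m x)"] z
 by (simp add: cmp_map[OF inl(1)] inl(2))
moreover have "Map f m (cd ?K m (\<zero>, y)) = Map g m (cd ?K m (\<zero>, y))"
 using arg_cong[OF r, of "%h. Map h m (cd (cell R r (p - 1) (n+1)) m y)"] z
 by (simp add: cmp_map[OF inr(1)] inr(2))
ultimately show "Map f m (cd ?K m z) = Map g m (cd ?K m z)"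
 unfolding eqz using cd_in[OF c(1)] cd_in[OF c(2)] by (simp add: map_simps[OF f] map_simps[OF g])
qed

lemma bdc_hom:
assumes X: "X : Ob" and u: "u : cycles X r (p + int r) n" and v: "v : cycles X r (p - 1) (n+1)"
shows "\<exists>h\<in>hom (cpy (bdc r p n)) X. Map h n (g1 r p n) = u \<and> Map h (n+1) (g2 r p n) = v"
proof -
have X': "fcx X" using X by simp
define a where "a = (%m (x, y). cell_fun X n u m x +[X,m] cell_fun X (n+1) v m y)"
have fm: "fmap R (bdc r p n) X a" unfolding a_def bdc_eq
 by (rule fmap_sum[OF X' cell_fun_fmap[OF X' u] cell_fun_fmap[OF X' v]])
have uc: "u : X$n" and vc: "v : X$(n+1)"
 using cyc_in[OF u X'] cyc_in[OF v X'] .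
have "a n (\<one>, \<zero>) = u" "a (n+1) (\<zero>, \<one>) = v"
 using uc vc X' by (auto simp: a_def cell_fun_def)
moreover have "(\<one>, \<zero>) : (bdc r p n)$n" "(\<zero>, \<one>) : (bdc r p n)$(n+1)"
 unfolding bdc_eq by (auto simp: cellK(2))
ultimately show ?thesis
 by (intro bexI[OF _ from_copy_hom[OF bdc_cpx X fm]]) (simp add: from_copy_map[OF bdc_cpx])
qed

definition phi where
"phi r p n = copy_arrow (cell R (r+1) p (n+1)) (bdc r p n) (cell_incl R r p (n+1))"

lemma phi: "phi r p n : hom (cpy (cell R (Suc r) p (n+1))) (cpy (bdc r p n))"
"Map (phi r p n) (n+1) (gen (Suc r) p (n+1)) =
 Df (cpy (bdc r p n)) n (g1 r p n) +[cpy (bdc r p n),n+1] g2 r p n"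
proof -
let ?K = "bdc r p n"
have fm: "fmap R (cell R (Suc r) p (n+1)) ?K (cell_incl R r p (n+1))"
 unfolding bdc_eq by (rule fmapI) (auto simp: cell_incl_def cellK_def split: if_splits)
note c = copy_arrow_hom[OF cell_cpx bdc_cpx fm]
show "phi r p n : hom (cpy (cell R (Suc r) p (n+1))) (cpy ?K)"
 unfolding phi_def using c(1) by simp
have one: "(\<one>, \<zero>) : ?K$n" "(\<one>, \<zero>) : ?K$(n+1)"
 "(\<zero>, \<one>) : ?K$(n+1)"
 unfolding bdc_eq by (auto simp: cellK_def)
have "Df (cpy ?K) n (g1 r p n) +[cpy ?K,n+1] g2 r p n =
  cd ?K (n+1) (\<one>, \<zero>) +[cpy ?K,n+1] g2 r p n"
 using one by (subst copy_d[OF bdc_cpx]) (simp_all add: bdc_eq cellK_def)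
also have "\<dots> = cd ?K (n+1) (\<one>, \<one>)"
 using one by (subst copy_add[OF bdc_cpx]) (simp_all add: bdc_eq)
finally show "Map (phi r p n) (n+1) (gen (Suc r) p (n+1)) =
 Df (cpy ?K) n (g1 r p n) +[cpy ?K,n+1] g2 r p n"
 unfolding phi_def using c(2)[of \<one> "n+1"] by (simp add: cell_incl_def)
qed

text \<open>A map out of \<open>B_(r+1)\<close> is a pair of r-cycles (u, v), and restriction along
  \<open>phi\<close> is (u, v) -> du + v. By \<open>bnd_iff\<close> these are exactly the boundaries
  of page r + 1.\<close>

lemma phi_map:
assumes h: "h : hom (cpy (bdc r p n)) X"
shows "Map (h \<star> phi r p n) (n+1) (gen (Suc r) p (n+1)) =
 Df X n (Map h n (g1 r p n)) +[X,n+1] Map h (n+1) (g2 r p n)"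
proof -
have f: "fcx (cpy (bdc r p n))" by (rule hom_fcx(1)[OF h])
have c: "g1 r p n : (cpy (bdc r p n))$n" "g2 r p n : (cpy (bdc r p n))$(n+1)"
 using cyc_in[OF g1_cycles f] cyc_in[OF g2_cycles f] .
have "gen (Suc r) p (n+1) : (cpy (cell R (Suc r) p (n+1)))$(n+1)"
 by (rule cd_in) simp
from cmp_map[OF phi(1) this, of h] show ?thesis using c f
 by (simp add: phi(2) map_simps[OF h] map_d[OF h])
qed

definition zc where
"zc k p n = copy_arrow (ZC R) (cell R k p n) (%m. \<lambda>x\<in>{\<zero>}. \<zero>)"

lemma zc: "zc k p n : hom (cpy (ZC R)) (cpy (cell R k p n))"
unfolding zc_def by (rule copy_arrow_hom(1)[OF zero_cpx cell_cpx], rule fmapI) (auto simp: cellK(2))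

lemma gen_J_eq: "gen_J R k = {zc k p n | p n. True}"
unfolding gen_J_def zc_def ..

lemma gen_I_eq: "gen_I R r = {phi r p n | p n. True}"
proof -
let ?F = "%p n. copy_arrow (cell R (r+1) p n) (cell_bd R r p n) (cell_incl R r p n)"
have "?F p n = phi r p (n - 1)" "phi r p n = ?F p (n+1)" for p n
 unfolding phi_def by simp_all
thus ?thesis unfolding gen_I_def by blast
qed

subsection \<open>Lifting against cells\<close>

interpretation FC: category FC by (rule category_FC)

text \<open>The triangle at the initial object commutes automatically, and a map out of the cell is
  a k-cycle.\<close>

lemma lifts_zc:
assumes f: "f : hom X Y"
shows "lifts FC (zc k p n) f \<longleftrightarrow> (\<forall>y\<in>cycles Y k p n. \<exists>x\<in>cycles X k p n. Map f n x = y)"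
proof
note X = hom_Ob(1)[OF f] and Y = hom_Ob(2)[OF f]
assume l: "lifts FC (zc k p n) f"
show "\<forall>y\<in>cycles Y k p n. \<exists>x\<in>cycles X k p n. Map f n x = y"
proof
 fix y assume "y : cycles Y k p n"
 then obtain v where v: "v : hom (cpy (cell R k p n)) Y" "Map v n (gen k p n) = y" using cell_hom[OF Y] by blast
 have "f \<star> from_copy (ZC R) X (%m c. 0[X,m]) = v \<star> zc k p n"
  by (rule zero_ext[OF cmpI[OF zero_hom[OF X] f] cmpI[OF zc v(1)]])
 then obtain h where h: "h : hom (cpy (cell R k p n)) X" "f \<star> h = v"
  using FC.liftsD[OF l, unfolded FC_simps, OF zc f zero_hom[OF X] v(1)] by blast
 have "Map f n (Map h n (gen k p n)) = y"
  using cmp_map[OF h(1), of "gen k p n" n f] v(2) h(2) by simp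
 thus "\<exists>x\<in>cycles X k p n. Map f n x = y" using cell_map_cycles[OF h(1)] by blast
qed
next
note X = hom_Ob(1)[OF f] and Y = hom_Ob(2)[OF f]
assume *: "\<forall>y\<in>cycles Y k p n. \<exists>x\<in>cycles X k p n. Map f n x = y"
show "lifts FC (zc k p n) f"
proof (rule FC.liftsI, unfold FC_simps, rule zc, rule f)
 fix u v assume u: "u : hom (cpy (ZC R)) X" and v: "v : hom (cpy (cell R k p n)) Y"
 obtain x where x: "x : cycles X k p n" "Map f n x = Map v n (gen k p n)"
  using * cell_map_cycles[OF v] by blast
 obtain h where h: "h : hom (cpy (cell R k p n)) X" "Map h n (gen k p n) = x" using cell_hom[OF X x(1)] by blast
 have "h \<star> zc k p n = u" by (rule zero_ext[OF cmpI[OF zc h(1)] u])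
 moreover have "f \<star> h = v"
  by (rule cell_ext[OF cmpI[OF h(1) f] v]) (use h x in \<open>simp add: cmp_map[OF h(1)]\<close>)
 ultimately show "\<exists>h\<in>hom (cpy (cell R k p n)) X. h \<star> zc k p n = u \<and> f \<star> h = v" using h(1) by blast
qed
qed

text \<open>Lifting against all \<open>phi r p n\<close>, on elements: a square is a cycle x with a
  splitting f x = dy + y', and a lift is a splitting x = du + u' above it. The remainders y' and u'
  are differences, so only y and u are quantified; that they are r-cycles is automatic by
  \<open>ilift_cycles\<close>.\<close>

definition ilift where
"ilift X Y f r \<longleftrightarrow> (\<forall>p n. \<forall>x\<in>cyc X r p (n+1). \<forall>y\<in>Fl Y (p + int r) n.
  Map f (n+1) x -[Y,n+1] Df Y n y : Fl Y (p - 1) (n+1) -->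
  (\<exists>u\<in>Fl X (p + int r) n. Map f n u = y \<and> x -[X,n+1] Df X n u : Fl X (p - 1) (n+1)))"

text \<open>Since x lies in \<open>F_p\<close> and x - du in \<open>F_(p-1)\<close>, du lies in
  \<open>F_p\<close>; and x - du has the same differential as x.\<close>

lemma ilift_cycles:
assumes X: "fcx X" and x: "x : cyc X r p (n+1)" and u: "u : Fl X (p + int r) n"
 and xu: "x -[X,n+1] Df X n u : Fl X (p - 1) (n+1)"
shows "u : cycles X r (p + int r) n" "x -[X,n+1] Df X n u : cycles X r (p - 1) (n+1)"
proof -
have c: "x : X$(n+1)" "u : X$n" using cyc_in[OF x X] Fl_car[OF u X] .
have "x -[X,n+1] (x -[X,n+1] Df X n u) : Fl X p (n+1)"
 by (rule Fl_minus[OF X cyclesD(1)[OF x] Fl_le[OF xu _ X]]) simp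
thus "u : cycles X r (p + int r) n" using u c X by (intro cyclesI) (simp_all add: ab_ids)
have "Df X (n+1) (x -[X,n+1] Df X n u) = Df X (n+1) x" using c X by simp
thus "x -[X,n+1] Df X n u : cycles X r (p - 1) (n+1)"
 using xu cyclesD(2)[OF x] by (intro cyclesI) (simp_all add: algebra_simps)
qed

lemma lifts_phi:
assumes f: "f : hom X Y"
shows "(\<forall>p n. lifts FC (phi r p n) f) \<longleftrightarrow> ilift X Y f r"
proof
note X = hom_Ob(1)[OF f] and Y = hom_Ob(2)[OF f]
have X': "fcx X" and Y': "fcx Y" using X Y by auto
assume l: "\<forall>p n. lifts FC (phi r p n) f"
show "ilift X Y f r" unfolding ilift_def
proof (intro allI ballI impI)
 fix p n x y assume x: "x : cyc X r p (n+1)" and y: "y : Fl Y (p + int r) n"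
  and xy: "Map f (n+1) x -[Y,n+1] Df Y n y : Fl Y (p - 1) (n+1)"
 note yc = ilift_cycles[OF Y' cycles_map[OF f x] y xy]
 have xc: "x : X$(n+1)" and ycar: "y : Y$n" using cyc_in[OF x X'] Fl_car[OF y Y'] .
 obtain u where u: "u : hom (cpy (cell R (Suc r) p (n+1))) X" "Map u (n+1) (gen (Suc r) p (n+1)) = x"
  using cell_hom[OF X x] by blast
 obtain v where v: "v : hom (cpy (bdc r p n)) Y" "Map v n (g1 r p n) = y"
  "Map v (n+1) (g2 r p n) = Map f (n+1) x -[Y,n+1] Df Y n y"
  using bdc_hom[OF Y yc] by blast
 have "f \<star> u = v \<star> phi r p n"
 proof (rule cell_ext[OF cmpI[OF u(1) f] cmpI[OF phi(1) v(1)]])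
  show "Map (f \<star> u) (n+1) (gen (Suc r) p (n+1)) = Map (v \<star> phi r p n) (n+1) (gen (Suc r) p (n+1))"
   unfolding phi_map[OF v(1)] v using u xc ycar Y' f
    by (simp add: cmp_map[OF u(1)] ab_add_diff[OF Y'])
 qed
 then obtain h where h: "h : hom (cpy (bdc r p n)) X" "h \<star> phi r p n = u" "f \<star> h = v"
  using FC.liftsD[OF l[rule_format], unfolded FC_simps, OF phi(1) f u(1) v(1)] by blast
 have gc: "g1 r p n : (cpy (bdc r p n))$n" using cyc_in[OF g1_cycles hom_fcx(1)[OF h(1)]] .
 let ?u = "Map h n (g1 r p n)" and ?w = "Map h (n+1) (g2 r p n)"
 have uF: "?u : cycles X r (p + int r) n" "?w : cycles X r (p - 1) (n+1)"
  using cycles_map[OF h(1) g1_cycles] cycles_map[OF h(1) g2_cycles] .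
 have "Map f n ?u = y" using cmp_map[OF h(1) gc, of f] h(3) v(2) by simp
 moreover have "x = Df X n ?u +[X,n+1] ?w" using phi_map[OF h(1)] h(2) u(2) by simp
 hence "x -[X,n+1] Df X n ?u = ?w"
  using cyc_in[OF uF(1) X'] cyc_in[OF uF(2) X'] X' by (simp add: cx_ac(2)[of _ "Df X n ?u"] ab_ids)
 ultimately show "\<exists>u\<in>Fl X (p + int r) n. Map f n u = y \<and> x -[X,n+1] Df X n u : Fl X (p - 1) (n+1)"
  using cyclesD(1)[OF uF(1)] cyclesD(1)[OF uF(2)] by auto
qed
next
note X = hom_Ob(1)[OF f] and Y = hom_Ob(2)[OF f]
have X': "fcx X" and Y': "fcx Y" using X Y by auto
assume *: "ilift X Y f r"
show "\<forall>p n. lifts FC (phi r p n) f"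
proof (intro allI)
 fix p n
 show "lifts FC (phi r p n) f"
 proof (rule FC.liftsI, unfold FC_simps, rule phi(1), rule f)
  fix u v assume u: "u : hom (cpy (cell R (Suc r) p (n+1))) X" and v: "v : hom (cpy (bdc r p n)) Y"
   and e: "f \<star> u = v \<star> phi r p n"
  let ?x = "Map u (n+1) (gen (Suc r) p (n+1))" and ?y = "Map v n (g1 r p n)" and ?y' = "Map v (n+1) (g2 r p n)"
  have x: "?x : cyc X r p (n+1)" by (rule cell_map_cycles[OF u])
  have y: "?y : cycles Y r (p + int r) n" "?y' : cycles Y r (p - 1) (n+1)"
   using cycles_map[OF v g1_cycles] cycles_map[OF v g2_cycles] .
  have c: "?x : X$(n+1)" "?y : Y$n" "?y' : Y$(n+1)"
   using cyc_in[OF x X'] cyc_in[OF y(1) Y'] cyc_in[OF y(2) Y'] .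
  have "Map f (n+1) ?x = Df Y n ?y +[Y,n+1] ?y'"
   using arg_cong[OF e, of "%h. Map h (n+1) (gen (Suc r) p (n+1))"]
   by (simp add: cmp_map[OF u] phi_map[OF v])
  hence fx: "Map f (n+1) ?x -[Y,n+1] Df Y n ?y = ?y'"
   using c Y' by (simp add: cx_ac(2)[of _ "Df Y n ?y"] ab_ids)
  then obtain w where w: "w : Fl X (p + int r) n" "Map f n w = ?y"
    "?x -[X,n+1] Df X n w : Fl X (p - 1) (n+1)"
   using * x cyclesD(1)[OF y(1)] cyclesD(1)[OF y(2)] unfolding ilift_def by metis
  note wc = ilift_cycles[OF X' x w(1,3)]
  obtain h where h: "h : hom (cpy (bdc r p n)) X" "Map h n (g1 r p n) = w"
    "Map h (n+1) (g2 r p n) = ?x -[X,n+1] Df X n w"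
   using bdc_hom[OF X wc] by blast
  have wcar: "w : X$n" using Fl_car[OF w(1) X'] .
  have "h \<star> phi r p n = u"
  proof (rule cell_ext[OF cmpI[OF phi(1) h(1)] u])
   show "Map (h \<star> phi r p n) (n+1) (gen (Suc r) p (n+1)) = ?x"
    unfolding phi_map[OF h(1)] h using c wcar X' by (simp add: ab_add_diff[OF X'])
  qed
  moreover have "f \<star> h = v"
  proof (rule bdc_ext[OF cmpI[OF h(1) f] v])
   have gc: "g1 r p n : (cpy (bdc r p n))$n" "g2 r p n : (cpy (bdc r p n))$(n+1)"
    using cyc_in[OF g1_cycles hom_fcx(1)[OF h(1)]] cyc_in[OF g2_cycles hom_fcx(1)[OF h(1)]] .
   show "Map (f \<star> h) n (g1 r p n) = ?y" using cmp_map[OF h(1) gc(1)] h w by simp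
   show "Map (f \<star> h) (n+1) (g2 r p n) = ?y'"
    using cmp_map[OF h(1) gc(2)] h w c wcar X' fx by (simp add: map_simps[OF f] map_d[OF f])
  qed
  ultimately show "\<exists>h\<in>hom (cpy (bdc r p n)) X. h \<star> phi r p n = u \<and> f \<star> h = v" using h(1) by blast
 qed
qed
qed

end

section \<open>The model structure\<close>

context category
begin

lemma retract_llp:
assumes r: "is_retract C f g" and g: "g : llp C K" and K: "K \<subseteq> Arr C"
shows "f : llp C K"
proof -
obtain i s i' s' where i: "i : homset C (Dom C f) (Dom C g)" and s: "s : homset C (Dom C g) (Dom C f)"
 and i': "i' : homset C (Cod C f) (Cod C g)" and s': "s' : homset C (Cod C g) (Cod C f)"
 and e: "s \<cdot> i = Idt C (Dom C f)" "s' \<cdot> i' = Idt C (Cod C f)" "g \<cdot> i = i' \<cdot> f" "f \<cdot> s = s' \<cdot> g"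
 and fA: "f : Arr C" and gA: "g : Arr C"
 using r unfolding is_retract_def by blast
note f = arr_homset[OF fA] and g' = arr_homset[OF gA]
show ?thesis unfolding llp_def
proof (intro CollectI conjI ballI fA)
 fix p assume p: "p : K"
 hence ph: "p : homset C (Dom C p) (Cod C p)" using K arr_homset by blast
 have l: "lifts C g p" using g p unfolding llp_def by blast
 show "lifts C f p"
 proof (rule liftsI[OF f ph])
  fix u v assume u: "u : homset C (Dom C f) (Dom C p)" and v: "v : homset C (Cod C f) (Cod C p)"
   and uv: "p \<cdot> u = v \<cdot> f"
  have "p \<cdot> (u \<cdot> s) = (v \<cdot> s') \<cdot> g"
   using Cmp_assoc[OF s u ph] Cmp_assoc[OF s f v] Cmp_assoc[OF g' s' v] uv e(4) by simp
  then obtain h where h: "h : homset C (Cod C g) (Dom C p)" "h \<cdot> g = u \<cdot> s" "p \<cdot> h = v \<cdot> s'"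
   using liftsD[OF l g' ph Cmp_hom[OF s u] Cmp_hom[OF s' v]] by blast
  have "(h \<cdot> i') \<cdot> f = u"
   using Cmp_assoc[OF f i' h(1)] Cmp_assoc[OF i g' h(1)] Cmp_assoc[OF i s u] h(2) e Cmp_Idt[OF u] by simp
  moreover have "p \<cdot> (h \<cdot> i') = v"
   using Cmp_assoc[OF i' h(1) ph] Cmp_assoc[OF i' s' v] h(3) e Cmp_Idt[OF v] by simp
  ultimately show "\<exists>h\<in>homset C (Cod C f) (Dom C p). h \<cdot> f = u \<and> p \<cdot> h = v"
   using Cmp_hom[OF i' h(1)] by blast
 qed
qed
qed

lemma retract_rlp:
assumes r: "is_retract C f g" and g: "g : rlp C K" and K: "K \<subseteq> Arr C"
shows "f : rlp C K"
proof -
obtain i s i' s' where i: "i : homset C (Dom C f) (Dom C g)" and s: "s : homset C (Dom C g) (Dom C f)"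
 and i': "i' : homset C (Cod C f) (Cod C g)" and s': "s' : homset C (Cod C g) (Cod C f)"
 and e: "s \<cdot> i = Idt C (Dom C f)" "s' \<cdot> i' = Idt C (Cod C f)" "g \<cdot> i = i' \<cdot> f" "f \<cdot> s = s' \<cdot> g"
 and fA: "f : Arr C" and gA: "g : Arr C"
 using r unfolding is_retract_def by blast
note f = arr_homset[OF fA] and g' = arr_homset[OF gA]
show ?thesis unfolding rlp_def
proof (intro CollectI conjI ballI fA)
 fix j assume j: "j : K"
 hence jh: "j : homset C (Dom C j) (Cod C j)" using K arr_homset by blast
 have l: "lifts C j g" using g j unfolding rlp_def by blast
 show "lifts C j f"
 proof (rule liftsI[OF jh f])
  fix u v assume u: "u : homset C (Dom C j) (Dom C f)" and v: "v : homset C (Cod C j) (Cod C f)"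
   and uv: "f \<cdot> u = v \<cdot> j"
  have "g \<cdot> (i \<cdot> u) = (i' \<cdot> v) \<cdot> j"
   using Cmp_assoc[OF u i g'] Cmp_assoc[OF u f i'] Cmp_assoc[OF jh v i'] uv e(3) by simp
  then obtain h where h: "h : homset C (Cod C j) (Dom C g)" "h \<cdot> j = i \<cdot> u" "g \<cdot> h = i' \<cdot> v"
   using liftsD[OF l jh g' Cmp_hom[OF u i] Cmp_hom[OF v i']] by blast
  have "(s \<cdot> h) \<cdot> j = u"
   using Cmp_assoc[OF jh h(1) s] Cmp_assoc[OF u i s] h(2) e Idt_Cmp[OF u] by simp
  moreover have "f \<cdot> (s \<cdot> h) = v"
   using Cmp_assoc[OF h(1) s f] Cmp_assoc[OF h(1) g' s'] Cmp_assoc[OF v i' s'] h(3) e Idt_Cmp[OF v] by simp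
  ultimately show "\<exists>h\<in>homset C (Cod C j) (Dom C f). h \<cdot> j = u \<and> f \<cdot> h = v"
   using Cmp_hom[OF h(1) s] by blast
 qed
qed
qed

lemma retract_argument:
assumes i: "i : Arr C" and j: "j : llp C K" and K: "K \<subseteq> Arr C" and p: "p : homset C (Cod C j) (Cod C i)"
 and eq: "i = p \<cdot> j" and dom: "Dom C j = Dom C i" and l: "lifts C i p"
shows "i : llp C K"
proof -
have jA: "j : Arr C" using j unfolding llp_def by blast
have ih: "i : homset C (Dom C i) (Cod C i)" using i by (rule arr_homset)
have jh: "j : homset C (Dom C i) (Cod C j)" using arr_homset[OF jA] dom by simp
have Y: "Cod C i : Obj C" "Dom C i : Obj C" using Cod_Obj Dom_Obj i by auto
have "p \<cdot> j = Idt C (Cod C i) \<cdot> i" using eq Idt_Cmp[OF ih] by simp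
then obtain h where h: "h : homset C (Cod C i) (Cod C j)" "h \<cdot> i = j" "p \<cdot> h = Idt C (Cod C i)"
 using liftsD[OF l ih p jh Idt_hom[OF Y(1)]] by blast
have "is_retract C i j" unfolding is_retract_def
proof (intro conjI i jA bexI)
 show "Idt C (Dom C i) : homset C (Dom C i) (Dom C j)" "Idt C (Dom C i) : homset C (Dom C j) (Dom C i)"
  using Idt_hom[OF Y(2)] dom by auto
 show "h : homset C (Cod C i) (Cod C j)" "p : homset C (Cod C j) (Cod C i)" by fact+
 show "Idt C (Dom C i) \<cdot> Idt C (Dom C i) = Idt C (Dom C i)" using Idt_Cmp[OF Idt_hom[OF Y(2)]] .
 show "p \<cdot> h = Idt C (Cod C i)" by fact
 show "j \<cdot> Idt C (Dom C i) = h \<cdot> i" using Cmp_Idt[OF jh] h by simp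
 show "i \<cdot> Idt C (Dom C i) = p \<cdot> j" using Cmp_Idt[OF ih] eq by simp
qed
thus ?thesis using retract_llp j K by blast
qed

end

text \<open>The differential and filtration make $(b, c) \mapsto (c, 0)$ a contraction that raises the filtration by $r$.\<close>

definition cone_complex where
"cone_complex Y r = \<lparr>Cx = (%n. prod_module (Cx Y n) (Cx Y (n - 1))),
  Df = (%n. \<lambda>(b, c)\<in>Y$n \<times> Y$(n - 1). (Df Y n b, b -[Y,n] Df Y (n - 1) c)),
  Fl = (%p n. Fl Y p n \<times> Fl Y (p + int r) (n - 1))\<rparr>"

context fc
begin

lemma d_pred [simp]:
assumes K: "fcx K" and x: "x : K$(n - 1)"
shows "Df K (n - 1) x : K$n" "Df K n (Df K (n - 1) x) = 0[K,n+1]"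
using d_simps(1)[OF K x] d_simps(6)[OF K x] by simp_all

lemma Fl_d_pred: "fcx K ==> x : Fl K p (n - 1) ==> Df K (n - 1) x : Fl K p n"
using Fl_d[of K x p "n - 1"] by simp

lemma smult_minus: "fcx A ==> s : carrier R ==> x : A$n ==> y : A$n ==>
 s *[A,n] (x -[A,n] y) = s *[A,n] x -[A,n] s *[A,n] y"
unfolding a_minus_def by (simp add: cx_smult)

lemma ab_diff_add:
assumes "fcx A" and "a : A$n" "a' : A$n" "b : A$n" "b' : A$n"
shows "(a +[A,n] a') -[A,n] (b +[A,n] b') = (a -[A,n] b) +[A,n] (a' -[A,n] b')"
proof -
interpret abelian_group "Cx A n" by (rule cx_ab[OF assms(1)])
show ?thesis using assms(2-) by algebra
qed

lemma cone_sel [simp]: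
"Cx (cone_complex Y r) n = prod_module (Cx Y n) (Cx Y (n - 1))"
"b : Y$n ==> c : Y$(n - 1) ==>
 Df (cone_complex Y r) n (b, c) = (Df Y n b, b -[Y,n] Df Y (n - 1) c)"
"Fl (cone_complex Y r) p n = Fl Y p n \<times> Fl Y (p + int r) (n - 1)"
unfolding cone_complex_def by simp_all

lemma cone_cpx:
assumes Y: "Y : Ob" shows "cpx (cone_complex Y r)"
proof (rule cpxI)
let ?K = "cone_complex Y r"
have Y': "fcx Y" using Y by simp
show "fcx ?K"
proof (rule filtered_complex.intro)
 fix n p :: int
 note c = Fl_car[of _ Y, OF _ Y']
 show M: "module R (Cx ?K n)" using Y' by (simp add: prod_module_module)
 show "Df ?K n : lin R (Cx ?K n) (Cx ?K (n+1))"
 proof (rule lin_mapsI)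
  show "x \<notin> ?K$n ==> Df ?K n x = undefined" for x unfolding cone_complex_def by auto
 qed (use Y' in \<open>auto simp: ab_diff_add smult_minus\<close>)
 show "submodule (Fl ?K p n) R (Cx ?K n)"
  by (rule submoduleI'[OF M]) (use Y' c in \<open>auto simp: Fl_add Fl_smult\<close>)
 show "Df ?K n ` Fl ?K p n \<subseteq> Fl ?K p (n+1)"
 proof
  fix z assume "z : Df ?K n ` Fl ?K p n"
  then obtain b e where *: "b : Fl Y p n" "e : Fl Y (p + int r) (n - 1)" "z = Df ?K n (b, e)" by auto
  hence "b -[Y,n] Df Y (n - 1) e : Fl Y (p + int r) n"
   by (intro Fl_minus[OF Y'] Fl_d_pred[OF Y'] Fl_le[OF *(1) _ Y']) simp
  thus "z : Fl ?K p (n+1)" using * c[OF *(1)] c[OF *(2)] Y' by (simp add: Fl_d)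
 qed
 show "Fl ?K p n \<subseteq> Fl ?K (p+1) n"
  using Fl_le[OF _ _ Y', of _ p n "p+1"] Fl_le[OF _ _ Y', of _ "p + int r" "n - 1" "p+1 + int r"] by auto
qed (use Y' in \<open>auto simp: add.commute\<close>)
show "sm (?K$n)" for n using Ob_sm[OF Y] by (auto intro!: sm_Times)
qed

lemma wiso_Idt: "X : Ob ==> wiso X X (Idt FC X) k"
by (rule wisoI) (auto simp: cyc_in[of _ X] submodule_zero[OF bnd_sub] intro!: bexI)

text \<open>The errors allowed are those that page r + 1 ignores. If f t = dy + z is a boundary,
  then t agrees with d(h t + e y) modulo \<open>F_(p-1)\<close>; and e sends (r+1)-cycles to
  (r+1)-cycles since its defect has filtration p - r - 1. For the unit, e is not a chain map, so
  this generality is used.\<close>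

lemma wiso_contract:
assumes f: "f : hom A X"
 and eF: "\<And>p n y. y : Fl X p n ==> e n y : Fl A p n"
 and ea: "\<And>n y z. y : X$n ==> z : X$n ==> e n (y +[X,n] z) = e n y +[A,n] e n z"
 and fe: "\<And>n y. y : X$n ==> Map f n (e n y) = y"
 and de: "\<And>p n y. y : Fl X p n ==> Df A n (e n y) -[A,n+1] e (n+1) (Df X n y) : Fl A (p - int (Suc r)) (n+1)"
 and hF: "\<And>p n t. t : Fl A p (n+1) ==> h n t : Fl A (p + int r) n"
 and c: "\<And>p n t. t : Fl A p (n+1) ==> t -[A,n+1] ((Df A n (h n t) +[A,n+1] h (n+1) (Df A (n+1) t))
  +[A,n+1] e (n+1) (Map f (n+1) t)) : Fl A (p - 1) (n+1)"
shows "wiso A X f r"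
proof (rule wisoI)
note A = hom_fcx(1)[OF f] and X = hom_fcx(2)[OF f]
have "\<forall>t\<in>cyc A r p n. Map f n t : bnd X r p n --> t : bnd A r p n" for p n
proof (rule int_Suc_cases[of _ n], intro ballI impI)
 fix n t assume t: "t : cyc A r p (n+1)" and "Map f (n+1) t : bnd X r p (n+1)"
 then obtain y z where y: "y : cycles X r (p + int r) n" and z: "z : cycles X r (p - 1) (n+1)"
  and ft: "Map f (n+1) t = Df X n y +[X,n+1] z" unfolding bnd_iff[OF X] by blast
 let ?M = "Cx A (n+1)"
 interpret M: abelian_group ?M by (rule cx_ab[OF A])
 let ?g = "Df A n (h n t)" and ?k = "h (n+1) (Df A (n+1) t)" and ?x = "e (n+1) (Df X n y)"
  and ?z = "e (n+1) z" and ?w = "Df A n (e n y)" and ?V = "h n t +[A,n] e n y"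
 have yc: "y : X$n" "z : X$(n+1)" using cyc_in[OF y X] cyc_in[OF z X] .
 note tc = cyc_in[OF t A]
 have V: "h n t : Fl A (p + int r) n" "e n y : Fl A (p + int r) n" using hF[OF cyclesD(1)[OF t]] eF[OF cyclesD(1)[OF y]] .
 note Vc = Fl_car[OF V(1) A] Fl_car[OF V(2) A]
 have k: "?k : Fl A (p - 1) (n+1)" using hF[OF cyclesD(2)[OF t]] by simp
 have zF: "?z : Fl A (p - 1) (n+1)" by (rule eF[OF cyclesD(1)[OF z]])
 have D: "?w -[?M] ?x : Fl A (p - 1) (n+1)" using de[OF cyclesD(1)[OF y]] by simp
 have xc: "?x : carrier ?M" using Fl_car[OF eF[OF Fl_d[OF X cyclesD(1)[OF y]]] A] .
 have gw: "?g : carrier ?M" "?w : carrier ?M" "?k : carrier ?M" "?z : carrier ?M" using Vc A Fl_car[OF k A] Fl_car[OF zF A] by auto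
 \<comment> \<open>The homotopy formula for t and d(h t + e y) differ by h(dt), e z and the defect
   of e at y. Each lies in \<open>F_(p-1)\<close>: dt has filtration p - r - 1 and h raises it by r,
   while y has filtration p + r and the defect lowers it by r + 1.\<close>
 have "(?g +[?M] ?k) +[?M] (?x +[?M] ?z) -[?M] (?g +[?M] ?w) = (?k +[?M] (?x +[?M] ?z)) -[?M] ?w"
  using gw xc by (simp add: a_minus_def M.minus_add M.a_assoc M.a_lcomm[of _ "-[?M] ?g"] M.r_neg1)
 also have "\<dots> = (?k +[?M] ?z) -[?M] (?w -[?M] ?x)" using gw xc by algebra
 finally have e: "(?g +[?M] ?k) +[?M] (?x +[?M] ?z) -[?M] (?g +[?M] ?w) : Fl A (p - 1) (n+1)"
  using Fl_minus[OF A Fl_add[OF A k zF] D] by simp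
 have "t -[?M] ((?g +[?M] ?k) +[?M] (?x +[?M] ?z)) : Fl A (p - 1) (n+1)"
  using c[OF cyclesD(1)[OF t]] yc X unfolding ft by (simp add: ea)
 from Fl_add[OF A this e] have "t -[?M] (?g +[?M] ?w) : Fl A (p - 1) (n+1)"
  using tc gw xc by (simp add: ab_ids(4)[OF A])
 hence v: "t -[?M] Df A n ?V : Fl A (p - 1) (n+1)" using Vc A by simp
 note Z = ilift_cycles[OF A t Fl_add[OF A V] v]
 have "t = Df A n ?V +[?M] (t -[?M] Df A n ?V)" using tc Vc A by (intro ab_add_diff[symmetric]) auto
 thus "t : bnd A r p (n+1)" unfolding bnd_iff[OF A] using Z by blast
qed
thus "t : cyc A r p n ==> Map f n t : bnd X r p n ==> t : bnd A r p n" for p n t by blast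
fix p n y assume y: "y : cyc X r p n"
note yc = cyc_in[OF y X]
have "(Df A n (e n y) -[A,n+1] e (n+1) (Df X n y)) +[A,n+1] e (n+1) (Df X n y) : Fl A (p - int (Suc r)) (n+1)"
 by (rule Fl_add[OF A de[OF cyclesD(1)[OF y]] eF[OF cyclesD(2)[OF y]]])
hence "e n y : cyc A r p n"
 using eF[OF cyclesD(1)[OF y]] Fl_car[OF eF[OF cyclesD(1)[OF y]] A] Fl_car[OF eF[OF cyclesD(2)[OF y]] A] A
 by (intro cyclesI) (simp_all add: ab_ids(1))
thus "\<exists>x\<in>cyc A r p n. y -[X,n] Map f n x : bnd X r p n"
 using fe[OF yc] yc X submodule_zero[OF bnd_sub[OF X]] by (intro bexI[of _ "e n y"]) simp_all
qed

end

section \<open>Fibrations, acyclic fibrations and weak equivalences\<close>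

locale fcm = fc U R for U :: "'u itself" and R :: "('r, 'm) ring_scheme" (structure) +
fixes r :: nat and S :: "nat set"
assumes S: "S \<subseteq> {0..r}" and rS: "r : S"
begin

sublocale FC: category FC by (rule category_FC)

abbreviation W :: "('r, 'u) farrow set" where "W \<equiv> weak_equivalences R r"
abbreviation Cof :: "('r, 'u) farrow set" where "Cof \<equiv> cofibrations R r S"
abbreviation Fib :: "('r, 'u) farrow set" where "Fib \<equiv> fibrations R S"
abbreviation TF :: "('r, 'u) farrow set" where "TF \<equiv> rlp FC (gen_cof R r S)"

definition fibE where
"fibE X Y f \<longleftrightarrow> (\<forall>s\<in>S. \<forall>p n. \<forall>y\<in>cycles Y s p n. \<exists>x\<in>cycles X s p n. Map f n x = y)"

lemma Fib_iff: "f : hom X Y ==> f : Fib \<longleftrightarrow> fibE X Y f"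
unfolding fibrations_def gen_acyclic_cof_def rlp_def gen_J_eq fibE_def
using lifts_zc[of f X Y] hom_arr[of f X Y] by auto blast+

lemma TF_iff: "f : hom X Y ==> f : TF \<longleftrightarrow> fibE X Y f \<and> ilift X Y f r"
proof -
assume f: "f : hom X Y"
have "f : TF \<longleftrightarrow> (\<forall>p n. lifts FC (phi r p n) f) \<and> f : Fib"
 using hom_arr[OF f] unfolding fibrations_def gen_acyclic_cof_def gen_cof_def rlp_def gen_I_eq by auto
thus ?thesis using lifts_phi[OF f] Fib_iff[OF f] by blast
qed

lemma sr: "s : S ==> s \<le> r" using S by auto

text \<open>Surjectivity on the page solves the problem up to a boundary dv + v' with v and v'
  r-cycles; these lift exactly because r belongs to \<open>S\<close>.\<close>

lemma fib_wiso_surj: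
assumes f: "f : hom X Y" and fe: "fibE X Y f" and w: "wiso X Y f r" and y: "y : cyc Y r p n"
shows "\<exists>x\<in>cyc X r p n. Map f n x = y"
proof -
have X: "fcx X" and Y: "fcx Y" using hom_fcx[OF f] .
have "\<forall>y\<in>cyc Y r p n. \<exists>x\<in>cyc X r p n. Map f n x = y" for n
proof (rule int_Suc_cases[of _ n], rule ballI)
 fix n y assume y: "y : cyc Y r p (n+1)"
 obtain x where x: "x : cyc X r p (n+1)"
  "y -[Y,n+1] Map f (n+1) x : bnd Y r p (n+1)"
  using wisoD(2)[OF w y] by blast
 then obtain v v' where v: "v : cycles Y r (p + int r) n" "v' : cycles Y r (p - 1) (n+1)"
  "y -[Y,n+1] Map f (n+1) x = Df Y n v +[Y,n+1] v'"
  unfolding bnd_iff[OF Y] by blast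
 obtain u u' where u: "u : cycles X r (p + int r) n" "u' : cycles X r (p - 1) (n+1)"
  "Map f n u = v" "Map f (n+1) u' = v'"
  using fe v rS unfolding fibE_def by metis
 let ?b = "Df X n u +[X,n+1] u'"
 have b: "?b : bnd X r p (n+1)" unfolding bnd_iff[OF X] using u by blast
 have xb: "x +[X,n+1] ?b : cyc X r p (n+1)"
  using submodule_add[OF cycles_sub[OF X] x(1) subsetD[OF bnd_cyc[OF X] b]] .
 have c: "x : X$(n+1)" "u : X$n" "u' : X$(n+1)"
   "y : Y$(n+1)"
  using cyc_in[OF x(1) X] cyc_in[OF u(1) X] cyc_in[OF u(2) X] cyc_in[OF y Y] .
 have "Map f (n+1) (x +[X,n+1] ?b) = Map f (n+1) x +[Y,n+1] (Df Y n v +[Y,n+1] v')"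
  using c X u by (simp add: map_simps[OF f] map_d[OF f])
 also have "\<dots> = y" unfolding v(3)[symmetric] using c Y by (simp add: ab_add_diff map_simps[OF f])
 finally show "\<exists>x\<in>cyc X r p (n+1). Map f (n+1) x = y" using xb by blast
qed
thus ?thesis using y by blast
qed

text \<open>Injectivity on the page splits x as du + u', but f u need not be y. The difference y - f
  u has its boundary in \<open>F_(p-1)\<close>, so it is an (r+1)-cycle of filtration p + r and
  lifts to some v by \<open>fib_wiso_surj\<close>; then u + v is the required element.\<close>

lemma fib_wiso_ilift:
assumes f: "f : hom X Y" and fe: "fibE X Y f" and w: "wiso X Y f r"
shows "ilift X Y f r"
unfolding ilift_def
proof (intro allI ballI impI)
have X: "fcx X" and Y: "fcx Y" using hom_fcx[OF f] .
fix p n x y assume x: "x : cyc X r p (n+1)" and y: "y : Fl Y (p + int r) n"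
 and xy: "Map f (n+1) x -[Y,n+1] Df Y n y : Fl Y (p - 1) (n+1)"
note yc = ilift_cycles[OF Y cycles_map[OF f x] y xy]
let ?y' = "Map f (n+1) x -[Y,n+1] Df Y n y"
have c: "x : X$(n+1)" "y : Y$n" using cyc_in[OF x X] Fl_car[OF y Y] .
have "Map f (n+1) x = Df Y n y +[Y,n+1] ?y'"
 using c Y by (simp add: ab_add_diff map_simps[OF f])
hence "Map f (n+1) x : bnd Y r p (n+1)"
 unfolding bnd_iff[OF Y] using yc by blast
from wisoD(1)[OF w x this] obtain u u' where u: "u : cycles X r (p + int r) n" "u' : cycles X r (p - 1) (n+1)"
 "x = Df X n u +[X,n+1] u'" unfolding bnd_iff[OF X] by blast
have uc: "u : X$n" "u' : X$(n+1)"
 using cyc_in[OF u(1) X] cyc_in[OF u(2) X] .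
let ?z = "y -[Y,n] Map f n u"
have zF: "?z : Fl Y (p + int r) n" by (rule Fl_minus[OF Y y map_Fl[OF f cyclesD(1)[OF u(1)]]])
interpret M: abelian_group "Cx Y (n+1)" by (rule cx_ab[OF Y])
have "Df Y n ?z = Df Y n y -[Y,n+1] Df Y n (Map f n u)"
 using c uc Y by (simp add: map_simps[OF f])
also have "\<dots> = Map f (n+1) u' -[Y,n+1] ?y'"
proof -
 have "Map f (n+1) x = Df Y n (Map f n u) +[Y,n+1] Map f (n+1) u'"
  unfolding u(3) using uc X by (simp add: map_simps[OF f] map_d[OF f])
 moreover have "Df Y n (Map f n u) : Y$(n+1)" "Map f (n+1) u' : Y$(n+1)"
  "Df Y n y : Y$(n+1)"
  using c uc X Y by (simp_all add: map_simps[OF f])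
 ultimately show ?thesis by (simp only:) algebra
qed
also have "\<dots> : Fl Y (p - 1) (n+1)" by (rule Fl_minus[OF Y map_Fl[OF f cyclesD(1)[OF u(2)]] xy])
finally have "?z : cyc Y r (p + int r) n" using zF by (intro cyclesI) simp_all
from fib_wiso_surj[OF f fe w this] obtain v where v: "v : cyc X r (p + int r) n" "Map f n v = ?z" by blast
have vc: "v : X$n" using cyc_in[OF v(1) X] .
have "u +[X,n] v : Fl X (p + int r) n" by (rule Fl_add[OF X cyclesD(1)[OF u(1)] cyclesD(1)[OF v(1)]])
moreover have "Map f n (u +[X,n] v) = y" using uc vc c v Y by (simp add: map_simps[OF f] ab_add_diff)
moreover have "x -[X,n+1] Df X n (u +[X,n] v) : Fl X (p - 1) (n+1)"
proof -
 interpret N: abelian_group "Cx X (n+1)" by (rule cx_ab[OF X])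
 have "Df X n u : X$(n+1)" "Df X n v : X$(n+1)" using uc vc X by simp_all
 hence "x -[X,n+1] Df X n (u +[X,n] v) = u' -[X,n+1] Df X n v"
  unfolding u(3) d_simps(2)[OF X uc(1) vc] using uc(2) by algebra
 moreover have "Df X n v : Fl X (p - 1) (n+1)" using cyclesD(2)[OF v(1)] by simp
 ultimately show ?thesis using Fl_minus[OF X cyclesD(1)[OF u(2)]] by simp
qed
ultimately show "\<exists>u\<in>Fl X (p + int r) n. Map f n u = y \<and> x -[X,n+1] Df X n u : Fl X (p - 1) (n+1)"
 by blast
qed

text \<open>Surjectivity is the lifting property over x = 0 at filtration p - r, where an
  (r+1)-cycle y of filtration p is a legitimate second datum; it yields an exact preimage.\<close>

lemma ilift_wiso:
assumes f: "f : hom X Y" and l: "ilift X Y f r" shows "wiso X Y f r"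
proof (rule wisoI)
have X: "fcx X" and Y: "fcx Y" using hom_fcx[OF f] .
have "\<forall>x\<in>cyc X r p n. Map f n x : bnd Y r p n --> x : bnd X r p n" for p n
proof (rule int_Suc_cases[of _ n], intro ballI impI)
 fix n x assume x: "x : cyc X r p (n+1)" and "Map f (n+1) x : bnd Y r p (n+1)"
 then obtain y y' where y: "y : cycles Y r (p + int r) n" "y' : cycles Y r (p - 1) (n+1)"
  "Map f (n+1) x = Df Y n y +[Y,n+1] y'" unfolding bnd_iff[OF Y] by blast
 have "Map f (n+1) x -[Y,n+1] Df Y n y = y'"
  unfolding y(3) using cyc_in[OF y(1) Y] cyc_in[OF y(2) Y] Y
  by (simp add: cx_ac(2)[of _ "Df Y n y"] ab_ids)
 hence "Map f (n+1) x -[Y,n+1] Df Y n y : Fl Y (p - 1) (n+1)"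
  using cyclesD(1)[OF y(2)] by simp
 then obtain u where u: "u : Fl X (p + int r) n" "x -[X,n+1] Df X n u : Fl X (p - 1) (n+1)"
  using l x cyclesD(1)[OF y(1)] unfolding ilift_def by blast
 have "x = Df X n u +[X,n+1] (x -[X,n+1] Df X n u)"
  using cyc_in[OF x X] Fl_car[OF u(1) X] X by (simp add: ab_add_diff)
 thus "x : bnd X r p (n+1)"
  unfolding bnd_iff[OF X] using ilift_cycles[OF X x u] by blast
qed
thus "x : cyc X r p n ==> Map f n x : bnd Y r p n ==> x : bnd X r p n"
 for p n x by blast
fix p n y assume y: "y : cyc Y r p n"
have yc: "y : Y$n" using cyc_in[OF y Y] .
have z: "0[X,n+1] : cyc X r (p - int r) (n+1)" using submodule_zero[OF cycles_sub[OF X]] .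
have "Map f (n+1) 0[X,n+1] -[Y,n+1] Df Y n y : Fl Y (p - int r - 1) (n+1)"
proof -
 have "Map f (n+1) 0[X,n+1] -[Y,n+1] Df Y n y = -[Y,n+1] Df Y n y"
  using yc Y by (simp add: map_simps[OF f])
 moreover have e: "p - int (Suc r) = p - int r - 1" by simp
 ultimately show ?thesis using Fl_neg[OF Y cyclesD(2)[OF y]] unfolding e by simp
qed
moreover have "y : Fl Y (p - int r + int r) n" using cyclesD(1)[OF y] by simp
ultimately obtain u where u: "u : Fl X (p - int r + int r) n" "Map f n u = y"
  "0[X,n+1] -[X,n+1] Df X n u : Fl X (p - int r - 1) (n+1)"
 using l z unfolding ilift_def by blast
have uc: "u : X$n" using Fl_car[OF u(1) X] .
have "Df X n u : Fl X (p - int (Suc r)) (n+1)"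
proof -
 have "0[X,n+1] -[X,n+1] Df X n u = -[X,n+1] Df X n u" using uc X by simp
 moreover have e: "p - int (Suc r) = p - int r - 1" by simp
 ultimately show ?thesis using u(3) uc X unfolding e by (simp add: Fl_neg_iff)
qed
hence "u : cyc X r p n" using u(1) by (intro cyclesI) simp_all
moreover have "y -[Y,n] Map f n u : bnd Y r p n"
 using u(2) yc Y submodule_zero[OF bnd_sub[OF Y]] by simp
ultimately show "\<exists>x\<in>cyc X r p n. y -[Y,n] Map f n x : bnd Y r p n" by blast
qed

lemma TF_eq: "TF = Fib \<inter> W"
proof -
have "f : TF \<longleftrightarrow> f : Fib \<inter> W" if "f : farrows R" for f :: "('r, 'u) farrow"
 using arr_hom[OF that] TF_iff Fib_iff weak_iff fib_wiso_ilift ilift_wiso by (metis IntE IntI)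
moreover have "TF \<subseteq> farrows R" "Fib \<subseteq> farrows R"
 unfolding fibrations_def rlp_def by auto
ultimately show ?thesis by blast
qed

lemma gens_arr: "gen_cof R r S \<subseteq> (farrows R :: ('r, 'u) farrow set)"
"gen_acyclic_cof R S \<subseteq> (gen_cof R r S :: ('r, 'u) farrow set)"
unfolding gen_cof_def gen_acyclic_cof_def gen_I_eq gen_J_eq
by (auto intro: hom_arr[OF zc] hom_arr[OF phi(1)])

lemma sm_Un: "sm A ==> sm B ==> sm (A \<union> B)"
proof -
assume "sm A" "sm B"
hence "sm (\<Union>X\<in>{A, B}. X)" by (intro sm_UN) (auto intro: sm_finite)
thus ?thesis by simp
qed

lemma sm_gens: "sm (gen_cof R r S :: ('r, 'u) farrow set)" "sm (gen_acyclic_cof R S :: ('r, 'u) farrow set)"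
proof -
have J: "sm (\<Union>s\<in>S. gen_J R s :: ('r, 'u) farrow set)"
proof (rule sm_UN[OF sm_nat])
 fix s
 have "(gen_J R s :: ('r, 'u) farrow set) = (%(p, n). zc s p n) ` (UNIV \<times> UNIV)"
  unfolding gen_J_eq by auto
 thus "sm (gen_J R s :: ('r, 'u) farrow set)" using sm_image[OF sm_Times[OF sm_int sm_int]] by metis
qed
have "(gen_I R r :: ('r, 'u) farrow set) = (%(p, n). phi r p n) ` (UNIV \<times> UNIV)"
 unfolding gen_I_eq by auto
hence I: "sm (gen_I R r :: ('r, 'u) farrow set)" using sm_image[OF sm_Times[OF sm_int sm_int]] by metis
show "sm (gen_acyclic_cof R S :: ('r, 'u) farrow set)" unfolding gen_acyclic_cof_def by (rule J)
show "sm (gen_cof R r S :: ('r, 'u) farrow set)" unfolding gen_cof_def by (rule sm_Un[OF I J])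
qed

lemma factor_gens:
assumes K: "K \<subseteq> gen_cof R r S" and smK: "sm K" and f: "f : farrows R"
shows "\<exists>i\<in>llp FC (rlp FC K). \<exists>p\<in>rlp FC K. Src p = Tgt i \<and> f = p \<star> i"
proof -
have KA: "K \<subseteq> Arr FC" using K gens_arr by auto
have "\<exists>i\<in>llp FC (rlp FC K). \<exists>p\<in>rlp FC K. Dom FC p = Cod FC i \<and> f = p \<star> i"
proof (rule FC.small_object_argument[OF KA])
 show "f : Arr FC" using f by simp
 fix f assume fA: "f : Arr FC"
 hence fh: "f : hom (Src f) (Tgt f)" using arr_hom by simp
 define Q where "Q = {(g, a, b). g : K \<and> a : homset FC (Dom FC g) (Dom FC f) \<and>
  b : homset FC (Cod FC g) (Cod FC f) \<and> f \<star> a = b \<star> g}"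
 let ?I = "insert None (Some ` ((UNIV :: bool set) \<times> Q))"
 let ?D = "case_option (Dom FC f) (%(z, g, a, b). if z then Cod FC g else Dom FC g)"
 have gh: "g : hom (Src g) (Tgt g)" if "g : K" for g using that KA arr_hom by auto
 have "Q \<subseteq> (SIGMA g:K. hom (Src g) (Src f) \<times> hom (Tgt g) (Tgt f))" unfolding Q_def by auto
 moreover have "sm (SIGMA g:K. hom (Src g) (Src f) \<times> hom (Tgt g) (Tgt f))"
  using hom_Ob[OF gh] by (intro sm_Sigma smK sm_Times sm_hom) auto
 ultimately have "sm Q" by (rule sm_subset[rotated])
 hence "sm ({None} \<union> Some ` ((UNIV :: bool set) \<times> Q))"
  by (intro sm_Un sm_image sm_Times) (simp_all add: sm_finite)
 hence smI: "sm ?I" by simp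
 interpret dg: diagram U R ?I "UNIV \<times> Q" ?D "%(z, w). Some (False, w)"
  "%(z, w). if z then Some (True, w) else None" "%(z, g, a, b). if z then g else a"
  by unfold_locales (use smI hom_Ob[OF fh] gh hom_Ob[OF gh] in \<open>auto simp: Q_def\<close>)
 show "\<exists>e f'. FC.attaches K f e f'"
  by (rule FC.attach_cells[OF KA fA Q_def dg.gcolimit_exists])
next
 fix X e assume e: "\<And>i. e i : homset FC (X i) (X (Suc i))"
 then interpret sq: sequence U R X e by unfold_locales simp
 \<comment> \<open>Sources of generators are cells \<open>Z_(r+1)\<close> or zero. A map out of a
   cell is a cycle, which lives at a finite stage by \<open>colim_cycles\<close>.\<close>
 have "\<exists>i. \<exists>a'\<in>hom (Src g) (X i). sq.qa i \<star> a' = a"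
  if g: "g : K" and a: "a : hom (Src g) (cpy sq.CC)" for g a
 proof -
  have "(\<exists>p n. g = phi r p n) \<or> (\<exists>s p n. g = zc s p n)"
   using g K unfolding gen_cof_def gen_I_eq gen_J_eq by blast
  thus ?thesis
  proof (elim disjE exE)
   fix p n assume "g = phi r p n"
   hence s: "Src g = cpy (cell R (Suc r) p (n+1))" using hom_src[OF phi(1)] by simp
   note a' = a[unfolded s]
   from sq.colim_cycles[OF cell_map_cycles[OF a']] obtain j x where
    x: "x : cyc (X j) r p (n+1)"
    "Map (sq.qa j) (n+1) x = Map a (n+1) (gen (Suc r) p (n+1))" by blast
   obtain h where h: "h : hom (Src g) (X j)" "Map h (n+1) (gen (Suc r) p (n+1)) = x"
    using cell_hom[OF sq.D_Ob x(1)] unfolding s by blast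
   have "sq.qa j \<star> h = a"
    by (rule cell_ext[OF cmpI[OF h(1)[unfolded s] sq.qa_hom] a'])
     (use h(2) x in \<open>simp_all add: cmp_map[OF h(1)[unfolded s]]\<close>)
   thus ?thesis using h(1) by blast
  next
   fix k p n assume "g = zc k p n"
   hence s: "Src g = cpy (ZC R)" using hom_src[OF zc] by simp
   have z: "from_copy (ZC R) (X 0) (%m c. 0[X 0,m]) : hom (Src g) (X 0)"
    unfolding s by (rule zero_hom) simp
   have "sq.qa 0 \<star> from_copy (ZC R) (X 0) (%m c. 0[X 0,m]) = a"
    by (rule zero_ext[OF cmpI[OF z[unfolded s] sq.qa_hom] a[unfolded s]]) simp
   thus ?thesis using z by blast
  qed
 qed
 hence "\<forall>g\<in>K. \<forall>a\<in>homset FC (Dom FC g) (cpy sq.CC).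
   \<exists>i. \<exists>a'\<in>homset FC (Dom FC g) (X i). sq.qa i \<star> a' = a" by simp
 thus "\<exists>L q. gcolimit FC UNIV UNIV X (%i. i) Suc e L q \<and>
   (\<forall>g\<in>K. \<forall>a\<in>homset FC (Dom FC g) L. \<exists>i. \<exists>a'\<in>homset FC (Dom FC g) (X i). q i \<star> a' = a)"
  using sq.gcolimit_exists by blast
qed
thus ?thesis by simp
qed

text \<open>A map \<open>j\<close> with the lifting property is a retract of the inclusion of its source into the direct
sum with the cone of its target.\<close>

lemma llp_Fib_W: "llp FC Fib \<subseteq> W"
proof
fix j assume j: "j : llp FC Fib"
define X Y where "X = Src j" and "Y = Tgt j"
have jh: "j : hom X Y" using j arr_hom unfolding llp_def X_def Y_def by simp
have X: "X : Ob" and Y: "Y : Ob" using hom_Ob[OF jh] .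
have Y': "fcx Y" and X': "fcx X" using X Y by auto
have C: "cpx (cone_complex Y r)" by (rule cone_cpx[OF Y])
let ?K = "direct_sum X (cone_complex Y r)"
have K: "cpx ?K" by (rule direct_sum_cpx[OF cpxI[OF X' Ob_sm[OF X]] C])
have d0: "Df Y (n - 1) 0[Y,n - 1] = 0[Y,n]" for n using d_zero[OF Y', of "n - 1"] by simp
define p where "p = from_copy ?K Y (%n (x, w). Map j n x +[Y,n] fst w)"
define i where "i = to_copy X ?K (%n x. (x, 0[cone_complex Y r,n]))"
define q where "q = from_copy ?K X (%n. fst)"
have "fmap R (cone_complex Y r) Y (%n. fst)" by (rule fmapI) (use Y' in auto)
hence p: "p : hom (cpy ?K) Y" unfolding p_def by (intro from_copy_hom[OF K Y] fmap_sum[OF Y' hom_fmap[OF jh]])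
have i: "i : hom X (cpy ?K)" unfolding i_def by (rule to_copy_hom[OF K X fmap_inl[OF X' cpx_fcx[OF C]]])
have q: "q : hom (cpy ?K) X" unfolding q_def by (rule from_copy_hom[OF K X], rule fmapI) (use X' Y' in auto)
have pm: "Map p n (cd ?K n (x, b, c)) = Map j n x +[Y,n] b"
 and qm: "Map q n (cd ?K n (x, b, c)) = x" if "(x, b, c) : ?K$n" for x b c n
 unfolding p_def q_def from_copy_map[OF K that] by simp_all
have im: "Map i n x = cd ?K n (x, 0[Y,n], 0[Y,n - 1])" if "x : X$n" for x n
 unfolding i_def to_copy_map[OF that] by simp
have t: "(x, 0[Y,n], 0[Y,n - 1]) : ?K$n" if "x : X$n" for x n using that Y' by simp
define h where "h n u = cd ?K n (0[X,n], snd (snd (dc ?K (n+1) u)), 0[Y,n - 1])" for n u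
have hm: "h n (cd ?K (n+1) (x, b, c)) = cd ?K n (0[X,n], c, 0[Y,n - 1])" if "(x, b, c) : ?K$(n+1)" for x b c n
 unfolding h_def cpx_decode[OF K that] by simp
\<comment> \<open>The inclusion \<open>i\<close> is handled through its retraction \<open>q\<close>:
  the cone is contracted, and two-out-of-three applied to q i = id transfers the result to
  \<open>i\<close>.\<close>
have "wiso (cpy ?K) X q r"
proof (rule wiso_contract[OF q, where e = "Map i" and h = h])
 show "Map i n (y +[X,n] z) = Map i n y +[cpy ?K,n] Map i n z"
  if "y : X$n" "z : X$n" for n y z using i that by simp
 show "Map q n (Map i n y) = y" if "y : X$n" for n y unfolding im[OF that] qm[OF t[OF that]] ..
 show "Df (cpy ?K) n (Map i n y) -[cpy ?K,n+1] Map i (n+1) (Df X n y) : Fl (cpy ?K) (p - int (Suc r)) (n+1)"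
  if "y : Fl X p n" for p n y
  using Fl_car[OF that X'] map_d[OF i, of y n] d_simps(1)[OF hom_fcx(2)[OF i] map_simps(1)[OF i], of y n] hom_fcx(2)[OF i] by simp
 fix p n u assume "u : Fl (cpy ?K) p (n+1)"
 then obtain x b c where u: "u = cd ?K (n+1) (x, b, c)" and F: "x : Fl X p (n+1)" "b : Fl Y p (n+1)" "c : Fl Y (p + int r) n"
  unfolding copy_Fl by auto
 note cc = Fl_car[OF F(1) X'] Fl_car[OF F(2) Y'] Fl_car[OF F(3) Y']
 have m: "(x, b, c) : ?K$(n+1)" using cc by simp
 have hu: "h n u = cd ?K n (0[X,n], c, 0[Y,n - 1])" unfolding u hm[OF m] ..
 show "h n u : Fl (cpy ?K) (p + int r) n" unfolding hu copy_Fl using F X' Y' by auto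
 have m0: "(0[X,n], c, 0[Y,n - 1]) : ?K$n" using cc X' Y' by simp
 have dm: "Df ?K (n+1) (x, b, c) = (Df X (n+1) x, Df Y (n+1) b, b -[Y,n+1] Df Y n c)" using cc by simp
 have hd: "h (n+1) (Df (cpy ?K) (n+1) u) = cd ?K (n+1) (0[X,n+1], b -[Y,n+1] Df Y n c, 0[Y,n])"
  unfolding u copy_d[OF K m] using hm[of _ _ _ "n+1", OF d_simps(1)[OF cpx_fcx[OF K] m, unfolded dm]] unfolding dm by simp
 have dh: "Df (cpy ?K) n (h n u) = cd ?K (n+1) (0[X,n+1], Df Y n c, c)"
  unfolding hu copy_d[OF K m0] using cc X' Y' d0[of n] by simp
 have e: "Map i (n+1) (Map q (n+1) u) = cd ?K (n+1) (x, 0[Y,n+1], 0[Y,n])"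
  unfolding u qm[OF m] im[OF cc(1)] by simp
 have ms: "(0[X,n+1], b -[Y,n+1] Df Y n c, 0[Y,n]) : ?K$(n+1)"
  "(0[X,n+1], Df Y n c, c) : ?K$(n+1)" "(0[X,n+1], b, c) : ?K$(n+1)"
  "(x, 0[Y,n+1], 0[Y,n]) : ?K$(n+1)" using cc X' Y' by simp_all
 have "(Df (cpy ?K) n (h n u) +[cpy ?K,n+1] h (n+1) (Df (cpy ?K) (n+1) u)) +[cpy ?K,n+1] Map i (n+1) (Map q (n+1) u) = u"
 proof -
  have "cd ?K (n+1) (0[X,n+1], Df Y n c, c) +[cpy ?K,n+1] cd ?K (n+1) (0[X,n+1], b -[Y,n+1] Df Y n c, 0[Y,n])
   = cd ?K (n+1) (0[X,n+1], b, c)"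
   unfolding copy_add[OF K ms(2,1)] using cc X' Y' by (simp add: ab_add_diff)
  thus ?thesis unfolding dh hd e unfolding u using copy_add[OF K ms(3,4)] cc X' Y' by simp
 qed
 thus "u -[cpy ?K,n+1] ((Df (cpy ?K) n (h n u) +[cpy ?K,n+1] h (n+1) (Df (cpy ?K) (n+1) u))
   +[cpy ?K,n+1] Map i (n+1) (Map q (n+1) u)) : Fl (cpy ?K) (p - 1) (n+1)"
  using cd_in[OF m] hom_fcx(2)[OF i] unfolding u by simp
qed (rule map_Fl[OF i])
moreover have "q \<star> i = Idt FC X"
 by (rule hom_ext[OF cmpI[OF i q] idI[OF X] refl]) (simp add: cmp_map[OF i] im qm[OF t])
ultimately have w: "wiso X (cpy ?K) i r" using wiso_cancel_right[OF i q] wiso_Idt[OF X] by simp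
have "fibE (cpy ?K) Y p" unfolding fibE_def
proof (intro ballI allI)
 fix s q n y assume s: "s : S" and y: "y : cycles Y s q n"
 note yc = cyc_in[OF y Y']
 let ?t = "(0[X,n], y, 0[Y,n - 1])"
 have m: "?t : ?K$n" using yc X' Y' by simp
 \<comment> \<open>The lift (0, y, 0) has differential (0, dy, y). Its last entry must have
   filtration q - s + r, which holds because s is at most r.\<close>
 have "y : Fl Y (q - int s + int r) n" by (rule Fl_le[OF cyclesD(1)[OF y] _ Y']) (use sr[OF s] in simp)
 hence "Df ?K n ?t : Fl ?K (q - int s) (n+1)" using yc X' Y' d0[of n] cyclesD(2)[OF y] by simp
 hence "cd ?K n ?t : cycles (cpy ?K) s q n"
  using cyclesD(1)[OF y] X' Y' unfolding cycles_def copy_Fl by (auto simp: copy_d[OF K m])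
 thus "\<exists>x\<in>cycles (cpy ?K) s q n. Map p n x = y" using pm[OF m] map_simps(5)[OF jh] yc Y' by (intro bexI) simp_all
qed
hence "p : Fib" using Fib_iff[OF p] by blast
hence l: "lifts FC j p" using j unfolding llp_def by blast
have pi: "p \<star> i = j"
 by (rule hom_ext[OF cmpI[OF i p] jh refl]) (use jh Y' in \<open>simp add: cmp_map[OF i] im pm[OF t]\<close>)
have "p \<star> i = Idt FC Y \<star> j" unfolding pi using FC.Idt_Cmp[unfolded FC_simps, OF jh] by simp
then obtain h where h: "h : hom Y (cpy ?K)" "h \<star> j = i" "p \<star> h = Idt FC Y"
 using FC.liftsD[OF l, unfolded FC_simps, OF jh p i idI[OF Y]] by blast
note I = idI[OF X] and c = FC.Cmp_Idt[unfolded FC_simps]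
have "wiso X Y j r" by (rule wiso_retract[OF jh i I I h(1) p c[OF I] h(3) _ _ w]) (simp_all add: c[OF i] c[OF jh] h(2) pi)
thus "j : W" using weak_iff[OF jh] by blast
qed

lemma Fib_arr: "Fib \<subseteq> Arr FC" "TF \<subseteq> Arr FC"
unfolding fibrations_def rlp_def by auto

lemma llp_Fib_Cof: "llp FC Fib \<subseteq> Cof"
unfolding cofibrations_def using TF_eq unfolding llp_def by blast

text \<open>Factor i as p j with j lifting against all fibrations and p a fibration. Both i and j
  are weak equivalences, so p is an acyclic fibration, i lifts against it, and i is a retract of
  j.\<close>

lemma Cof_W: "Cof \<inter> W = llp FC Fib"
proof (intro equalityI subsetI)
fix i assume "i : Cof \<inter> W"
hence i: "i : llp FC TF" "i : W" unfolding cofibrations_def by auto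
hence iA: "i : farrows R" unfolding llp_def by simp
obtain j p where j: "j : llp FC Fib" and p: "p : Fib" and jp: "Src p = Tgt j" "i = p \<star> j"
 using factor_gens[OF gens_arr(2) sm_gens(2) iA] unfolding fibrations_def by blast
have jh: "j : hom (Src j) (Tgt j)" using j arr_hom unfolding llp_def by simp
have ph: "p : hom (Tgt j) (Tgt p)" using p Fib_arr arr_hom jp(1) by fastforce
have e: "Src i = Src j" "Tgt i = Tgt p" unfolding jp(2) by simp_all
have "wiso (Src j) (Tgt j) j r" using weak_iff[OF jh] llp_Fib_W j by blast
moreover have "wiso (Src j) (Tgt p) (p \<star> j) r"
 using weak_iff[OF cmpI[OF jh ph]] i(2) jp(2) by simp
ultimately have "wiso (Tgt j) (Tgt p) p r" by (rule wiso_cancel_left[OF jh ph])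
hence "p : TF" using p weak_iff[OF ph] TF_eq by blast
hence "lifts FC i p" using i(1) unfolding llp_def by blast
thus "i : llp FC Fib"
 using FC.retract_argument[of i j Fib p] iA j Fib_arr ph jp e by simp
qed (use llp_Fib_W llp_Fib_Cof in blast)

lemma model_category_FC: "model_category (small_in U) FC W Cof Fib"
proof (unfold_locales)
show "bicomplete (small_in U) FC" by (rule bicomplete_FC)
show "W \<subseteq> Arr FC" "Cof \<subseteq> Arr FC" "Fib \<subseteq> Arr FC"
 using Fib_arr unfolding weak_equivalences_def cofibrations_def llp_def by auto
next
fix f g :: "('r, 'u) farrow" assume f: "f : Arr FC" and g: "g : Arr FC" and d: "Dom FC g = Cod FC f"
have fh: "f : hom (Src f) (Tgt f)" and gh: "g : hom (Tgt f) (Tgt g)" using f g d arr_hom[of f] arr_hom[of g] by auto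
note w = weak_iff[OF fh] weak_iff[OF gh] weak_iff[OF cmpI[OF fh gh]]
show "f : W ==> g : W ==> g \<star> f : W" unfolding w by (rule wiso_comp[OF fh gh])
show "f : W ==> g \<star> f : W ==> g : W" unfolding w by (rule wiso_cancel_left[OF fh gh])
show "g : W ==> g \<star> f : W ==> f : W" unfolding w by (rule wiso_cancel_right[OF fh gh])
next
fix f g :: "('r, 'u) farrow" assume rt: "is_retract FC f g"
show "g : Cof ==> f : Cof" unfolding cofibrations_def by (rule FC.retract_llp[OF rt _ Fib_arr(2)])
show "g : Fib ==> f : Fib" unfolding fibrations_def
 by (rule FC.retract_rlp[OF rt]) (use gens_arr in auto)
assume g: "g : W"
obtain i s i' s' where *: "i : hom (Src f) (Src g)" "s : hom (Src g) (Src f)"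
  "i' : hom (Tgt f) (Tgt g)" "s' : hom (Tgt g) (Tgt f)"
  "s \<star> i = Idt FC (Src f)" "s' \<star> i' = Idt FC (Tgt f)" "g \<star> i = i' \<star> f" "f \<star> s = s' \<star> g"
  "f : farrows R" "g : farrows R"
 using rt unfolding is_retract_def FC_simps by blast
show "f : W" using wiso_retract[OF arr_hom[OF *(9)] arr_hom[OF *(10)] *(1-8)] g
 weak_iff[OF arr_hom[OF *(9)]] weak_iff[OF arr_hom[OF *(10)]] by blast
next
fix i p :: "('r, 'u) farrow"
show "i : Cof \<inter> W ==> p : Fib ==> lifts FC i p" unfolding Cof_W llp_def by blast
show "i : Cof ==> p : Fib \<inter> W ==> lifts FC i p" unfolding cofibrations_def TF_eq llp_def by blast
next
fix f :: "('r, 'u) farrow" assume "f : Arr FC"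
hence f: "f : farrows R" by simp
show "\<exists>i\<in>Cof \<inter> W. \<exists>p\<in>Fib. Dom FC p = Cod FC i \<and> f = p \<star> i"
 unfolding Cof_W using factor_gens[OF gens_arr(2) sm_gens(2) f] unfolding fibrations_def FC_simps .
show "\<exists>i\<in>Cof. \<exists>p\<in>Fib \<inter> W. Dom FC p = Cod FC i \<and> f = p \<star> i"
 using factor_gens[OF order_refl sm_gens(1) f] unfolding cofibrations_def TF_eq[symmetric] FC_simps .
qed

end

section \<open>The tensor product\<close>

lemma alt_sign_rules:
assumes "module R M" "x : carrier M"
shows alt_closed: "alt M i x : carrier M"
 and alt_add: "y : carrier M ==> alt M i (x +[M] y) = alt M i x +[M] alt M i y"
 and alt_minus: "y : carrier M ==> alt M i (x -[M] y) = alt M i x -[M] alt M i y"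
 and alt_smult: "s : carrier R ==> alt M i (s *[M] x) = s *[M] alt M i x"
 and alt_alt: "alt M i (alt M j x) = alt M (i + j) x"
 and alt_twice: "alt M i (alt M i x) = x"
 and alt_suc: "alt M (i+1) x = -[M] alt M i x"
proof -
interpret module R M by fact
show "alt M i x : carrier M" "alt M i (alt M j x) = alt M (i + j) x"
 "alt M i (alt M i x) = x" "alt M (i+1) x = -[M] alt M i x"
 using assms(2) by (auto simp: alt_sign_def)
show "y : carrier M ==> alt M i (x +[M] y) = alt M i x +[M] alt M i y"
 using assms(2) by (simp add: alt_sign_def M.minus_add)
show "y : carrier M ==> alt M i (x -[M] y) = alt M i x -[M] alt M i y"
 using assms(2) by (simp add: alt_sign_def M.minus_add M.minus_eq)
show "s : carrier R ==> alt M i (s *[M] x) = s *[M] alt M i x"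
 using assms(2) by (simp add: alt_sign_def smult_r_minus)
qed

lemma alt_zero: "module R M ==> alt M i 0[M] = 0[M]"
unfolding alt_sign_def using abelian_group.neg_zero[OF module.axioms(2)] by auto

lemma alt_even [simp]: "even i ==> alt M i x = x"
unfolding alt_sign_def by simp

lemma alt_mem: "submodule H R M ==> x : H ==> alt M i x : H"
unfolding alt_sign_def by (simp add: submodule_neg)

lemma alt_lin: "module R M ==> module R N ==> h : lin R M N ==> x : carrier M ==>
 h (alt M i x) = alt N i (h x)"
unfolding alt_sign_def by (simp add: lin_neg)

locale tensor = fc U R for U :: "'u itself" and R :: "('r, 'm) ring_scheme" (structure) +
fixes A B :: "('r, 'u) fcomplex"
assumes A [simp]: "A : Ob" and B [simp]: "B : Ob"
begin

abbreviation T where "T n \<equiv> tensor_gens A B n"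
abbreviation Q where "Q n \<equiv> tensor_rels R A B n"
abbreviation TM where "TM n \<equiv> tensor_module R A B n"
abbreviation TC where "TC \<equiv> tensor_complex R A B"
abbreviation et where "et \<equiv> elem_tensor R A B"

lemma TM_eq: "TM n = presented (T n) (Q n)"
unfolding tensor_module_def Let_def ..

lemma T_iff: "(i, a, b) : T n \<longleftrightarrow> a : A$i \<and> b : B$(n - i)"
unfolding tensor_gens_def by simp

lemma et_eq: "i + j = n ==> et i j a b = gen_class (T n) (Q n) (i, a, b)"
unfolding elem_tensor_def gen_class_def Let_def by simp

lemma Q_sub: "Q n \<subseteq> carrier (FM R (T n))"
proof -
interpret F: module R "FM R (T n)" by (rule mod_free)
have b: "a : A$i ==> b : B$(n - i) ==>
  bas R (i, a, b) : carrier (FM R (T n))" for i a b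
 by (rule bas_in) (simp add: T_iff)
show ?thesis unfolding tensor_rels_def Let_def
 by (intro Un_least subsetI; elim CollectE exE conjE; hypsubst)
  (intro F.minus_closed F.a_closed F.smult_closed b; simp)+
qed

lemma TM_mod: "module R (TM n)"
unfolding TM_eq by (rule module_presented[OF Q_sub])

text \<open>Degrees of tensors are passed with an equation \<open>i + j = n\<close> throughout, so
  that a reindexing such as (i + 1) + j = n + 1 is an instance and not a rewriting inside
  carriers.\<close>

lemma et_closed: "i + j = n ==> a : A$i ==> b : B$j ==> et i j a b : carrier (TM n)"
unfolding TM_eq by (subst et_eq, assumption, rule gen_class_carrier[OF Q_sub]) (auto simp: T_iff)

lemma et_addl:
assumes n: "i + j = n" and m: "a : A$i" "a' : A$i" "b : B$j"
shows "et i j (a +[A,i] a') b = et i j a b +[TM n] et i j a' b"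
proof -
have b: "b : B$(n - i)" using n m by auto
have "bas R (i, a +[A,i] a', b) -[FM R (T n)]
  (bas R (i, a, b) +[FM R (T n)] bas R (i, a', b)) : Q n"
 unfolding tensor_rels_def Let_def using m(1,2) b by blast
thus ?thesis unfolding et_eq[OF n] TM_eq
 by (intro gen_class_add[OF Q_sub]) (use m b in \<open>simp_all add: T_iff\<close>)
qed

lemma et_addr:
assumes n: "i + j = n" and m: "a : A$i" "b : B$j" "b' : B$j"
shows "et i j a (b +[B,j] b') = et i j a b +[TM n] et i j a b'"
proof -
have j: "j = n - i" using n by simp
have "bas R (i, a, b +[B,j] b') -[FM R (T n)]
  (bas R (i, a, b) +[FM R (T n)] bas R (i, a, b')) : Q n"
 unfolding tensor_rels_def Let_def using m unfolding j by blast
thus ?thesis unfolding et_eq[OF n] TM_eq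
 by (intro gen_class_add[OF Q_sub]) (use m in \<open>simp_all add: T_iff j\<close>)
qed

lemma et_smultl:
assumes n: "i + j = n" and m: "s : carrier R" "a : A$i" "b : B$j"
shows "et i j (s *[A,i] a) b = s *[TM n] et i j a b"
proof -
have b: "b : B$(n - i)" using n m by auto
have "bas R (i, s *[A,i] a, b) -[FM R (T n)]
  (s *[FM R (T n)] bas R (i, a, b)) : Q n"
 unfolding tensor_rels_def Let_def using m(1,2) b by blast
thus ?thesis unfolding et_eq[OF n] TM_eq
 by (intro gen_class_smult[OF Q_sub]) (use m b in \<open>simp_all add: T_iff\<close>)
qed

lemma et_smultr:
assumes n: "i + j = n" and m: "s : carrier R" "a : A$i" "b : B$j"
shows "et i j a (s *[B,j] b) = s *[TM n] et i j a b"
proof -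
have j: "j = n - i" using n by simp
have "bas R (i, a, s *[B,j] b) -[FM R (T n)]
  (s *[FM R (T n)] bas R (i, a, b)) : Q n"
 unfolding tensor_rels_def Let_def using m unfolding j by blast
thus ?thesis unfolding et_eq[OF n] TM_eq
 by (intro gen_class_smult[OF Q_sub]) (use m in \<open>simp_all add: T_iff j\<close>)
qed

lemma TM_induct [consumes 1, case_names zero add smult elem]:
assumes "x : carrier (TM n)" "P 0[TM n]"
 "\<And>x y. x : carrier (TM n) ==> y : carrier (TM n) ==> P x ==> P y ==> P (x +[TM n] y)"
 "\<And>a x. a : carrier R ==> x : carrier (TM n) ==> P x ==> P (a *[TM n] x)"
 "\<And>i j a b. i + j = n ==> a : A$i ==> b : B$j ==> P (et i j a b)"
shows "P x"
proof (rule presented_induct[OF Q_sub assms(1-4)[unfolded TM_eq]])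
fix t assume "t : T n"
then obtain i a b where t: "t = (i, a, b)" "a : A$i" "b : B$(n - i)"
 unfolding tensor_gens_def by blast
thus "P (gen_class (T n) (Q n) t)" using assms(5)[of i "n - i" a b] et_eq[of i "n - i" n a b] by simp
qed

lemma TM_lin:
assumes N: "module R N"
 and g: "\<And>i j a b. i + j = n ==> a : A$i ==> b : B$j ==> g i j a b : carrier N"
 and addl: "\<And>i j a a' b. i + j = n ==> a : A$i ==> a' : A$i ==> b : B$j ==>
  g i j (a +[A,i] a') b = g i j a b +[N] g i j a' b"
 and addr: "\<And>i j a b b'. i + j = n ==> a : A$i ==> b : B$j ==> b' : B$j ==>
  g i j a (b +[B,j] b') = g i j a b +[N] g i j a b'"
 and smultl: "\<And>i j s a b. i + j = n ==> s : carrier R ==> a : A$i ==> b : B$j ==>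
  g i j (s *[A,i] a) b = s *[N] g i j a b"
 and smultr: "\<And>i j s a b. i + j = n ==> s : carrier R ==> a : A$i ==> b : B$j ==>
  g i j a (s *[B,j] b) = s *[N] g i j a b"
shows "\<exists>h\<in>lin R (TM n) N. \<forall>i j. \<forall>a\<in>A$i. \<forall>b\<in>B$j. i + j = n --> h (et i j a b) = g i j a b"
proof -
interpret F: module R "FM R (T n)" by (rule mod_free)
interpret N: module R N by fact
have b: "a : A$i ==> b : B$(n - i) ==>
  bas R (i, a, b) : carrier (FM R (T n))" for i a b
 by (rule bas_in) (simp add: T_iff)
note cl = F.smult_closed F.a_closed
have "\<exists>h\<in>lin R (presented (T n) (Q n)) N. \<forall>t\<in>T n.
  h (gen_class (T n) (Q n) t) = (%(i, a, b). g i (n - i) a b) t"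
proof (rule presented_lin[OF Q_sub N])
 show "\<And>t. t : T n ==> (%(i, a, b). g i (n - i) a b) t : carrier N"
  using g by (auto simp: tensor_gens_def)
 fix k c assume k: "k : lin R (FM R (T n)) N"
  "\<And>t. t : T n ==> k (bas R t) = (%(i, a, b). g i (n - i) a b) t" and c: "c : Q n"
 have kb: "k (bas R (i, a, b)) = g i (n - i) a b" if "a : A$i" "b : B$(n - i)" for i a b
  using k(2)[of "(i, a, b)"] that by (simp add: T_iff)
 note lm = lin_minus[OF mod_free N k(1)] lin_add[OF k(1)] lin_smult[OF k(1)]
 have e: "i + (n - i) = n" for i by simp
 note gs = addl[OF e] addr[OF e] smultl[OF e] smultr[OF e] g[OF e]
 from c show "k c = 0[N]" unfolding tensor_rels_def Let_def
  by (elim UnE CollectE exE conjE; hypsubst)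
   (simp_all add: lm b cl kb gs N.minus_eq_zero del: free_ops)
qed
then obtain h where h: "h : lin R (presented (T n) (Q n)) N"
 "\<forall>t\<in>T n. h (gen_class (T n) (Q n) t) = (%(i, a, b). g i (n - i) a b) t" by blast
have "h (et i j a b) = g i j a b" if "a : A$i" "b : B$j" "i + j = n" for i j a b
proof -
 have "j = n - i" using that by simp
 thus ?thesis unfolding et_eq[OF that(3)] using bspec[OF h(2), of "(i, a, b)"] that(1,2)
  by (simp add: T_iff)
qed
thus ?thesis using h(1) unfolding TM_eq[symmetric] by blast
qed

lemma TM_lin_eq:
assumes N: "module R N" and h: "h : lin R (TM n) N" and k: "k : lin R (TM n) N"
 and eq: "\<And>i j a b. i + j = n ==> a : A$i ==> b : B$j ==> h (et i j a b) = k (et i j a b)"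
shows "h = k"
proof (rule lin_ext[OF h k])
fix x assume "x : carrier (TM n)"
thus "h x = k x"
proof (induction rule: TM_induct)
 case zero
 thus ?case using lin_zero[OF TM_mod N h] lin_zero[OF TM_mod N k] by simp
qed (simp_all add: lin_add[OF h] lin_add[OF k] lin_smult[OF h] lin_smult[OF k] eq)
qed

lemma TC_sel [simp]: "Cx TC n = TM n"
"Fl TC p n = span_of R (TM n) {et i j a b | i j a b. i + j = n \<and> (\<exists>q. a : Fl A q i \<and> b : Fl B (p - q) j)}"
unfolding tensor_complex_def by simp_all

abbreviation dval where
"dval n i j a b \<equiv> et (i+1) j (Df A i a) b +[TM (n+1)] alt (TM (n+1)) i (et i (j+1) a (Df B j b))"

lemma dval_closed:
assumes n: "i + j = n" and a: "a : A$i" and b: "b : B$j"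
shows "et (i+1) j (Df A i a) b : carrier (TM (n+1))" "et i (j+1) a (Df B j b) : carrier (TM (n+1))"
 "alt (TM (n+1)) i (et i (j+1) a (Df B j b)) : carrier (TM (n+1))" "dval n i j a b : carrier (TM (n+1))"
proof -
interpret M: module R "TM (n+1)" by (rule TM_mod)
show 1: "et (i+1) j (Df A i a) b : carrier (TM (n+1))" using n a b by (intro et_closed) auto
show 2: "et i (j+1) a (Df B j b) : carrier (TM (n+1))" using n a b by (intro et_closed) auto
show 3: "alt (TM (n+1)) i (et i (j+1) a (Df B j b)) : carrier (TM (n+1))"
 by (rule alt_closed[OF TM_mod 2])
show "dval n i j a b : carrier (TM (n+1))" using 1 3 by (rule M.a_closed)
qed

text \<open>Discharges the description that defines the differential: bilinearity of
  \<open>dval\<close> gives existence, agreement on elementary tensors gives uniqueness.\<close>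

lemma TC_d:
shows "Df TC n : lin R (TM n) (TM (n+1))"
 and "i + j = n ==> a : A$i ==> b : B$j ==> Df TC n (et i j a b) = dval n i j a b"
proof -
let ?P = "%h. h : lin R (TM n) (TM (n+1)) \<and>
 (\<forall>i j. \<forall>a\<in>A$i. \<forall>b\<in>B$j. i + j = n --> h (et i j a b) = dval n i j a b)"
interpret M: module R "TM (n+1)" by (rule TM_mod)
note alt = alt_closed[OF TM_mod] alt_add[OF TM_mod] alt_smult[OF TM_mod]
have ex: "\<exists>h\<in>lin R (TM n) (TM (n+1)).
  \<forall>i j. \<forall>a\<in>A$i. \<forall>b\<in>B$j. i + j = n --> h (et i j a b) = dval n i j a b"
proof (rule TM_lin[OF TM_mod])
 fix i j a b assume n: "i + j = n" and a: "a : A$i" and b: "b : B$j"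
 have n1: "i+1 + j = n+1" and n2: "i + (j+1) = n+1" using n by auto
 note c = dval_closed[OF n]
 show "dval n i j a b : carrier (TM (n+1))" by (rule c[OF a b])
 show "dval n i j (a +[A,i] a') b = dval n i j a b +[TM (n+1)] dval n i j a' b"
  if a': "a' : A$i" for a'
  using a b a' c[OF a b] c[OF a' b] by (simp add: et_addl[OF n1] et_addl[OF n2] alt M.a_ac)
 show "dval n i j a (b +[B,j] b') = dval n i j a b +[TM (n+1)] dval n i j a b'"
  if b': "b' : B$j" for b'
  using a b b' c[OF a b] c[OF a b'] by (simp add: et_addr[OF n1] et_addr[OF n2] alt M.a_ac)
 show "dval n i j (s *[A,i] a) b = s *[TM (n+1)] dval n i j a b"
  "dval n i j a (s *[B,j] b) = s *[TM (n+1)] dval n i j a b" if s: "s : carrier R" for s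
  using a b s c[OF a b]
  by (simp_all add: et_smultl[OF n1] et_smultl[OF n2] et_smultr[OF n1] et_smultr[OF n2] alt M.smult_r_distr)
qed
have "\<exists>!h. ?P h"
proof (rule ex_ex1I)
 show "\<exists>h. ?P h" using ex by blast
 fix h k assume "?P h" "?P k"
 thus "h = k" by (intro TM_lin_eq[OF TM_mod]) auto
qed
hence "?P (THE h. ?P h)" by (rule theI')
moreover have "Df TC n = (THE h. ?P h)" unfolding tensor_complex_def by simp
ultimately have "?P (Df TC n)" by simp
thus "Df TC n : lin R (TM n) (TM (n+1))"
 "i + j = n ==> a : A$i ==> b : B$j ==> Df TC n (et i j a b) = dval n i j a b"
 by blast+
qed

lemma TC_Fl_gens: "{et i j a b | i j a b. i + j = n \<and> (\<exists>q. a : Fl A q i \<and> b : Fl B (p - q) j)} \<subseteq> carrier (TM n)"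
using et_closed Fl_car[OF _ Ob_fcx[OF A]] Fl_car[OF _ Ob_fcx[OF B]] by blast

lemma TC_Fl_sub: "submodule (Fl TC p n) R (TM n)"
unfolding TC_sel by (rule span_submodule[OF TM_mod TC_Fl_gens])

lemma TC_Fl_gen: "i + j = n ==> a : Fl A q i ==> b : Fl B q' j ==> q + q' = p ==> et i j a b : Fl TC p n"
unfolding TC_sel
proof (rule span_sup, intro CollectI exI conjI)
show "i + j = n ==> i + j = n" "et i j a b = et i j a b" "a : Fl A q i ==> a : Fl A q i" by auto
show "b : Fl B q' j ==> q + q' = p ==> b : Fl B (p - q) j" by auto
qed

lemma TC_Fl_least:
assumes "submodule H R (TM n)"
 "\<And>i j a b q. i + j = n ==> a : Fl A q i ==> b : Fl B (p - q) j ==> et i j a b : H"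
shows "Fl TC p n \<subseteq> H"
unfolding TC_sel by (rule span_least[OF assms(1)]) (use assms(2) in blast)

lemma TC_cpx: "cpx TC"
proof (rule cpxI)
have cA: "a : Fl A q i ==> a : A$i" and cB: "b : Fl B q i ==> b : B$i" for a b q i
 by (simp_all add: Fl_car)
show "fcx TC"
proof (rule filtered_complex.intro)
 fix n p :: int
 show "module R (Cx TC n)" using TM_mod by simp
 show "Df TC n : lin R (Cx TC n) (Cx TC (n+1))" using TC_d(1) by simp
 show "submodule (Fl TC p n) R (Cx TC n)" using TC_Fl_sub by simp
 have "Fl TC p n \<subseteq> {x : carrier (TM n). Df TC n x : Fl TC p (n+1)}"
 proof (rule TC_Fl_least)
  show "submodule {x : carrier (TM n). Df TC n x : Fl TC p (n+1)} R (TM n)"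
   by (rule sub_preim[OF TM_mod TM_mod TC_d(1) TC_Fl_sub])
  fix i j a b q assume *: "i + j = n" "a : Fl A q i" "b : Fl B (p - q) j"
  have "et (i+1) j (Df A i a) b : Fl TC p (n+1)"
   using * by (intro TC_Fl_gen[of _ _ _ _ q _ "p - q"] Fl_d) auto
  moreover have "et i (j+1) a (Df B j b) : Fl TC p (n+1)"
   using * by (intro TC_Fl_gen[of _ _ _ _ q _ "p - q"] Fl_d) auto
  ultimately show "et i j a b : {x : carrier (TM n). Df TC n x : Fl TC p (n+1)}"
   using * cA cB by (simp add: et_closed TC_d(2) submodule_add[OF TC_Fl_sub] alt_mem[OF TC_Fl_sub] del: TC_sel(2))
 qed
 thus "Df TC n ` Fl TC p n \<subseteq> Fl TC p (n+1)" by auto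
 show "Fl TC p n \<subseteq> Fl TC (p+1) n"
 proof (rule TC_Fl_least[OF TC_Fl_sub])
  fix i j a b q assume *: "i + j = n" "a : Fl A q i" "b : Fl B (p - q) j"
  thus "et i j a b : Fl TC (p+1) n"
   by (intro TC_Fl_gen[of _ _ _ _ "q+1" _ "p - q"]) (auto intro: Fl_le)
 qed
 show "x : TC$n ==> Df TC (n+1) (Df TC n x) = 0[TC,n+1+1]" for x
  unfolding TC_sel
 proof (induction rule: TM_induct)
  case zero
  thus ?case using lin_zero[OF TM_mod TM_mod TC_d(1)] by simp
 next
  case (add x y)
  interpret N: module R "TM k" for k by (rule TM_mod)
  from add show ?case by (simp add: lin_add[OF TC_d(1)] lin_in[OF TC_d(1)])
 next
  case (smult a x)
  interpret N: module R "TM k" for k by (rule TM_mod)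
  from smult show ?case by (simp add: lin_smult[OF TC_d(1)] lin_in[OF TC_d(1)])
 next
  case (elem i j a b)
  note n = elem(1) and a = elem(2) and b = elem(3)
  have n1: "i+1 + j = n+1" and n2: "i + (j+1) = n+1" using n by auto
  have da: "Df A i a : A$(i+1)" and db: "Df B j b : B$(j+1)" using a b by auto
  let ?N = "TM (n+1+1)"
  interpret N: module R ?N by (rule TM_mod)
  note c = dval_closed[OF n a b] and c1 = dval_closed[OF n1 da b]
  let ?w = "et (i+1) (j+1) (Df A i a) (Df B j b)"
  have w: "?w : carrier ?N" using c1(2) .
  have z1: "et (i+1+1) j (Df A (i+1) (Df A i a)) b = 0[?N]"
  proof -
   have "et (i+1+1) j (\<zero> *[A,i+1+1] 0[A,i+1+1]) b =
     \<zero> *[?N] et (i+1+1) j 0[A,i+1+1] b"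
    using n b by (intro et_smultl) auto
   also have "\<dots> = 0[?N]" using n b by (intro N.smult_l_null et_closed) auto
   finally show ?thesis using a by simp
  qed
  have z2: "et i (j+1+1) a (Df B (j+1) (Df B j b)) = 0[?N]"
  proof -
   have "et i (j+1+1) a (\<zero> *[B,j+1+1] 0[B,j+1+1]) =
     \<zero> *[?N] et i (j+1+1) a 0[B,j+1+1]"
    using n a by (intro et_smultr) auto
   also have "\<dots> = 0[?N]" using n a by (intro N.smult_l_null et_closed) auto
   finally show ?thesis using b by simp
  qed
  have "Df TC (n+1) (Df TC n (et i j a b)) = Df TC (n+1) (et (i+1) j (Df A i a) b) +[?N]
    alt ?N i (Df TC (n+1) (et i (j+1) a (Df B j b)))"
   using c by (simp add: TC_d(2)[OF n a b] lin_add[OF TC_d(1)] alt_lin[OF TM_mod TM_mod TC_d(1)])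
  \<comment> \<open>The two mixed terms carry the signs (-1)^(i+1) and (-1)^i and cancel.\<close>
  also have "\<dots> = (0[?N] +[?N] alt ?N (i+1) ?w) +[?N] alt ?N i (?w +[?N] alt ?N i 0[?N])"
   unfolding TC_d(2)[OF n1 da b] TC_d(2)[OF n2 a db] z1 z2 ..
  also have "\<dots> = 0[?N]"
   unfolding alt_zero[OF TM_mod] alt_suc[OF TM_mod w]
   using w alt_closed[OF TM_mod w, of i] by (simp only: N.r_zero N.l_zero N.a_inv_closed N.l_neg)
  finally show ?case .
 qed
qed
have "sm (T n)" for n
 by (rule sm_subset[OF sm_Sigma[OF sm_int[of UNIV] sm_Times[OF Ob_sm[OF A] Ob_sm[OF B]]],
   of _ "%i. i" "%i. n - i"]) (auto simp: tensor_gens_def)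
thus "sm (TC$n)" for n by (simp add: TM_eq sm_presented)
qed

end

context fc
begin

abbreviation tn :: "('r, 'u) fcomplex => ('r, 'u) fcomplex => ('r, 'u) fcomplex" where
"tn \<equiv> ften R"

abbreviation fe :: "('r, 'u) fcomplex => ('r, 'u) fcomplex => int => int => 'u => 'u => 'u" where
"fe \<equiv> felem R"

lemma tensorI: "A : Ob ==> B : Ob ==> tensor U R A B"
by (intro tensor.intro tensor_axioms.intro fc_axioms)

lemma fe_eq:
assumes "A : Ob" "B : Ob" "i + j = n"
shows "fe A B i j a b = cd (tensor_complex R A B) n (elem_tensor R A B i j a b)"
unfolding felem_def cd_def tensor.TC_sel[OF tensorI[OF assms(1,2)]] assms(3) ..

lemma tn_Ob [simp]: "A : Ob ==> B : Ob ==> tn A B : Ob"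
unfolding ften_def by (intro copy_Ob tensor.TC_cpx tensorI)

lemma fe_rules:
assumes A: "A : Ob" and B: "B : Ob" and n: "i + j = n"
 and a: "a : A$i" and b: "b : B$j"
shows fe_in: "fe A B i j a b : (tn A B)$n"
 and fe_addl: "a' : A$i ==>
  fe A B i j (a +[A,i] a') b = fe A B i j a b +[tn A B,n] fe A B i j a' b"
 and fe_addr: "b' : B$j ==>
  fe A B i j a (b +[B,j] b') = fe A B i j a b +[tn A B,n] fe A B i j a b'"
 and fe_smultl: "s : carrier R ==>
  fe A B i j (s *[A,i] a) b = s *[tn A B,n] fe A B i j a b"
 and fe_smultr: "s : carrier R ==>
  fe A B i j a (s *[B,j] b) = s *[tn A B,n] fe A B i j a b"
 and fe_d: "Df (tn A B) n (fe A B i j a b) = fe A B (i+1) j (Df A i a) b +[tn A B,n+1]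
  alt (Cx (tn A B) (n+1)) i (fe A B i (j+1) a (Df B j b))"
proof -
interpret T: tensor U R A B by (rule tensorI[OF A B])
note K = T.TC_cpx
have n1: "i+1 + j = n+1" and n2: "i + (j+1) = n+1" using n by auto
note e = fe_eq[OF A B n] fe_eq[OF A B n1] fe_eq[OF A B n2]
have c: "elem_tensor R A B i j x y : T.TC$n"
 if "x : A$i" "y : B$j" for x y using T.et_closed[OF n that] by simp
show "fe A B i j a b : (tn A B)$n" unfolding e ften_def by (rule cd_in[OF c[OF a b]])
show "a' : A$i ==>
  fe A B i j (a +[A,i] a') b = fe A B i j a b +[tn A B,n] fe A B i j a' b"
 "b' : B$j ==>
  fe A B i j a (b +[B,j] b') = fe A B i j a b +[tn A B,n] fe A B i j a b'"
 "s : carrier R ==>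
  fe A B i j (s *[A,i] a) b = s *[tn A B,n] fe A B i j a b"
 "s : carrier R ==>
  fe A B i j a (s *[B,j] b) = s *[tn A B,n] fe A B i j a b"
 unfolding e ften_def using c a b
 by (simp_all add: copy_add[OF K] copy_smult[OF K] T.et_addl[OF n] T.et_addr[OF n]
   T.et_smultl[OF n] T.et_smultr[OF n])
have alt: "alt (Cx (cpy T.TC) k) i (cd T.TC k x) = cd T.TC k (alt (Cx T.TC k) i x)"
 if "x : T.TC$k" for k x
 unfolding alt_sign_def using copy_neg[OF K that] by simp
show "Df (tn A B) n (fe A B i j a b) = fe A B (i+1) j (Df A i a) b +[tn A B,n+1]
  alt (Cx (tn A B) (n+1)) i (fe A B i (j+1) a (Df B j b))"
 unfolding e ften_def using c[OF a b] T.dval_closed[OF n a b] T.TC_d(2)[OF n a b]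
 by (simp add: alt copy_add[OF K] copy_d[OF K])
qed

lemma fe_Fl:
assumes A: "A : Ob" and B: "B : Ob" and n: "i + j = n"
 and a: "a : Fl A p i" and b: "b : Fl B q j" and pq: "p + q = t"
shows "fe A B i j a b : Fl (tn A B) t n"
proof -
interpret T: tensor U R A B by (rule tensorI[OF A B])
show ?thesis unfolding fe_eq[OF A B n] ften_def copy_Fl
 by (rule imageI, rule T.TC_Fl_gen[OF n a b pq])
qed

lemma fe_lin:
assumes A: "A : Ob" and B: "B : Ob" and n: "i + j = n"
shows "b : B$j ==> (\<lambda>a\<in>A$i. fe A B i j a b) : lin R (Cx A i) (Cx (tn A B) n)"
 and "a : A$i ==> (\<lambda>b\<in>B$j. fe A B i j a b) : lin R (Cx B j) (Cx (tn A B) n)"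
using A B by (auto intro!: lin_restrictI simp: fe_rules[OF A B n])

lemma fe_zero:
assumes A: "A : Ob" and B: "B : Ob" and n: "i + j = n"
shows "b : B$j ==> fe A B i j 0[A,i] b = 0[tn A B,n]"
 and "a : A$i ==> fe A B i j a 0[B,j] = 0[tn A B,n]"
using lin_zero[OF _ _ fe_lin(1)[OF A B n, of b]] lin_zero[OF _ _ fe_lin(2)[OF A B n, of a]] A B by simp_all

lemma fe_neg:
assumes A: "A : Ob" and B: "B : Ob" and n: "i + j = n"
 and a: "a : A$i" and b: "b : B$j"
shows "fe A B i j (-[A,i] a) b = -[tn A B,n] fe A B i j a b"
 and "fe A B i j a (-[B,j] b) = -[tn A B,n] fe A B i j a b"
using lin_neg[OF _ _ fe_lin(1)[OF A B n b] a] lin_neg[OF _ _ fe_lin(2)[OF A B n a] b] A B a b by simp_all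

lemma fe_minus:
assumes A: "A : Ob" and B: "B : Ob" and n: "i + j = n"
 and a: "a : A$i" and b: "b : B$j"
shows "a' : A$i ==>
  fe A B i j (a -[A,i] a') b = fe A B i j a b -[tn A B,n] fe A B i j a' b"
 and "b' : B$j ==>
  fe A B i j a (b -[B,j] b') = fe A B i j a b -[tn A B,n] fe A B i j a b'"
using A B a b by (simp_all add: a_minus_def fe_addl[OF A B n] fe_addr[OF A B n] fe_neg[OF A B n])

lemma fe_alt:
assumes A: "A : Ob" and B: "B : Ob" and n: "i + j = n"
 and a: "a : A$i" and b: "b : B$j"
shows "fe A B i j (alt (Cx A i) k a) b = alt (Cx (tn A B) n) k (fe A B i j a b)"
 and "fe A B i j a (alt (Cx B j) k b) = alt (Cx (tn A B) n) k (fe A B i j a b)"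
unfolding alt_sign_def using fe_neg[OF A B n a b] by simp_all

lemma tn_induct [consumes 3, case_names zero add smult elem]:
assumes A: "A : Ob" and B: "B : Ob" and x: "x : (tn A B)$n"
 and zero: "P 0[tn A B,n]"
 and add: "\<And>x y. x : (tn A B)$n ==> y : (tn A B)$n ==> P x ==> P y ==>
  P (x +[tn A B,n] y)"
 and smult: "\<And>s x. s : carrier R ==> x : (tn A B)$n ==> P x ==> P (s *[tn A B,n] x)"
 and elem: "\<And>i j a b. i + j = n ==> a : A$i ==> b : B$j ==> P (fe A B i j a b)"
shows "P x"
proof -
interpret T: tensor U R A B by (rule tensorI[OF A B])
note K = T.TC_cpx
obtain y where y: "y : carrier (T.TM n)" "x = cd T.TC n y" using x unfolding ften_def copy_car by auto
have c: "z : carrier (T.TM n) ==> cd T.TC n z : (tn A B)$n" for z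
 unfolding ften_def by (rule cd_in) simp
from y(1) have "P (cd T.TC n y)"
proof (induction rule: T.TM_induct)
 case zero
 show ?case using assms(4) unfolding ften_def copy_zero by simp
next
 case (add x y)
 thus ?case using assms(5)[OF c c, of x y] unfolding ften_def by (simp add: copy_add[OF K])
next
 case (smult s x)
 thus ?case using assms(6)[OF _ c, of s x] unfolding ften_def by (simp add: copy_smult[OF K])
next
 case (elem i j a b)
 thus ?case using assms(7)[of i j a b] fe_eq[OF A B elem(1)] by simp
qed
thus ?thesis using y(2) by simp
qed

lemma tn_ext:
assumes A: "A : Ob" and B: "B : Ob" and f: "f : hom (tn A B) X" and g: "g : hom (tn A B) X'" and X: "X' = X"
 and eq: "\<And>i j n a b. i + j = n ==> a : A$i ==> b : B$j ==>
  Map f n (fe A B i j a b) = Map g n (fe A B i j a b)"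
shows "f = g"
proof (rule hom_ext[OF f g X])
fix n x assume "x : (tn A B)$n"
with A B show "Map f n x = Map g n x"
 by (induction rule: tn_induct) (use f g X in \<open>simp_all add: eq\<close>)
qed

lemma tn_Fl_least:
assumes A: "A : Ob" and B: "B : Ob" and H: "submodule H R (Cx (tn A B) n)"
 and fe: "\<And>i j a b q. i + j = n ==> a : Fl A q i ==> b : Fl B (p - q) j ==> fe A B i j a b : H"
shows "Fl (tn A B) p n \<subseteq> H"
proof -
interpret T: tensor U R A B by (rule tensorI[OF A B])
note K = T.TC_cpx
have l: "restrict (cd T.TC n) (carrier (T.TM n)) : lin R (T.TM n) (Cx (tn A B) n)"
 using fmap_cd[OF K] unfolding ften_def
 by (intro lin_restrictI T.TM_mod) (auto simp: fmap_def)
have "Fl T.TC p n \<subseteq> {x : carrier (T.TM n). restrict (cd T.TC n) (carrier (T.TM n)) x : H}"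
proof (rule T.TC_Fl_least[OF sub_preim[OF T.TM_mod _ l H]])
 show "module R (Cx (tn A B) n)" using A B by simp
 fix i j a b q assume *: "i + j = n" "a : Fl A q i" "b : Fl B (p - q) j"
 hence "elem_tensor R A B i j a b : carrier (T.TM n)"
  using A B Fl_car[of a A] Fl_car[of b B] by (intro T.et_closed) auto
 thus "elem_tensor R A B i j a b : {x : carrier (T.TM n). restrict (cd T.TC n) (carrier (T.TM n)) x : H}"
  using fe[OF *] fe_eq[OF A B *(1)] by simp
qed
thus ?thesis unfolding ften_def copy_Fl by (auto split: if_splits simp del: T.TC_sel(2))
qed

lemma tn_lift:
assumes A: "A : Ob" and B: "B : Ob" and X: "X : Ob"
 and cl: "\<And>i j n a b. i + j = n ==> a : A$i ==> b : B$j ==> g i j a b : X$n"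
 and addl: "\<And>i j n a a' b. i + j = n ==> a : A$i ==> a' : A$i ==> b : B$j ==>
  g i j (a +[A,i] a') b = g i j a b +[X,n] g i j a' b"
 and addr: "\<And>i j n a b b'. i + j = n ==> a : A$i ==> b : B$j ==> b' : B$j ==>
  g i j a (b +[B,j] b') = g i j a b +[X,n] g i j a b'"
 and smultl: "\<And>i j n s a b. i + j = n ==> s : carrier R ==> a : A$i ==> b : B$j ==>
  g i j (s *[A,i] a) b = s *[X,n] g i j a b"
 and smultr: "\<And>i j n s a b. i + j = n ==> s : carrier R ==> a : A$i ==> b : B$j ==>
  g i j a (s *[B,j] b) = s *[X,n] g i j a b"
 and d: "\<And>i j n a b. i + j = n ==> a : A$i ==> b : B$j ==>
  Df X n (g i j a b) = g (i+1) j (Df A i a) b +[X,n+1]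
   alt (Cx X (n+1)) i (g i (j+1) a (Df B j b))"
 and Fl: "\<And>i j n a b p q. i + j = n ==> a : Fl A p i ==> b : Fl B q j ==> g i j a b : Fl X (p + q) n"
shows "\<exists>h\<in>hom (tn A B) X. \<forall>i j. \<forall>a\<in>A$i. \<forall>b\<in>B$j. Map h (i + j) (fe A B i j a b) = g i j a b"
proof -
interpret T: tensor U R A B by (rule tensorI[OF A B])
note K = T.TC_cpx
let ?e = "elem_tensor R A B"
have X': "fcx X" and mX: "module R (Cx X k)" for k using X by auto
have "\<exists>h\<in>lin R (T.TM n) (Cx X n). \<forall>i j. \<forall>a\<in>A$i. \<forall>b\<in>B$j.
  i + j = n --> h (?e i j a b) = g i j a b" for n
 by (rule T.TM_lin[OF mX]) (fact cl addl addr smultl smultr)+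
then obtain h where h: "\<And>n. h n : lin R (T.TM n) (Cx X n)"
 and he: "\<And>n i j a b. i + j = n ==> a : A$i ==> b : B$j ==> h n (?e i j a b) = g i j a b"
 by metis
note hl = lin_in[OF h] lin_add[OF h] lin_smult[OF h] lin_zero[OF T.TM_mod mX h]
note dl = lin_in[OF T.TC_d(1)] lin_add[OF T.TC_d(1)] lin_smult[OF T.TC_d(1)] lin_zero[OF T.TM_mod T.TM_mod T.TC_d(1)]
have "fmap R T.TC X h"
proof (rule fmapI)
 fix n x assume "x : T.TC$n"
 hence "x : carrier (T.TM n)" by simp
 thus "Df X n (h n x) = h (n+1) (Df T.TC n x)"
 proof (induction rule: T.TM_induct)
  case (elem i j a b)
  note n = elem(1) and ab = elem(2,3)
  have n1: "i+1 + j = n+1" and n2: "i + (j+1) = n+1" using n by auto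
  note c = T.dval_closed[OF n ab]
  have "h (n+1) (Df T.TC n (?e i j a b)) = h (n+1) (?e (i+1) j (Df A i a) b) +[X,n+1]
    alt (Cx X (n+1)) i (h (n+1) (?e i (j+1) a (Df B j b)))"
   unfolding T.TC_d(2)[OF n ab] hl(2)[OF c(1) c(3)] alt_lin[OF T.TM_mod mX h c(2)] ..
  also have "\<dots> = g (i+1) j (Df A i a) b +[X,n+1] alt (Cx X (n+1)) i (g i (j+1) a (Df B j b))"
   using he[OF n1 _ ab(2), of "Df A i a"] he[OF n2 ab(1), of "Df B j b"] ab A B by simp
  finally show ?case unfolding he[OF n ab] d[OF n ab] by simp
 qed (simp_all add: hl dl X')
next
 fix n p x assume "x : Fl T.TC p n"
 moreover have "Fl T.TC p n \<subseteq> {x : carrier (T.TM n). h n x : Fl X p n}"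
 proof (rule T.TC_Fl_least[OF sub_preim[OF T.TM_mod mX h Fl_sub[OF X']]])
  fix i j a b q assume *: "i + j = n" "a : Fl A q i" "b : Fl B (p - q) j"
  hence ab: "a : A$i" "b : B$j" using A B by (auto intro: Fl_car)
  show "?e i j a b : {x : carrier (T.TM n). h n x : Fl X p n}"
   using Fl[OF *] he[OF *(1) ab] T.et_closed[OF *(1) ab] by simp
 qed
 ultimately show "h n x : Fl X p n" by blast
qed (simp_all add: hl)
hence hom: "from_copy T.TC X h : hom (tn A B) X" unfolding ften_def by (rule from_copy_hom[OF K X])
have "Map (from_copy T.TC X h) (i + j) (fe A B i j a b) = g i j a b"
 if ab: "a : A$i" "b : B$j" for i j a b
 unfolding fe_eq[OF A B refl] using T.et_closed[OF refl ab] he[OF refl ab] K by simp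
thus ?thesis using hom by blast
qed

text \<open>Several structure maps are descriptions of this shape; existence from
  \<open>tn_lift\<close> is turned here into their type and their values at once.\<close>

lemma tn_the:
assumes A: "A : Ob" and B: "B : Ob"
 and ex: "\<exists>h\<in>hom (tn A B) X. \<forall>i j. \<forall>a\<in>A$i. \<forall>b\<in>B$j. Map h (i + j) (fe A B i j a b) = g i j a b"
defines "t \<equiv> THE h. h : hom (tn A B) X \<and>
 (\<forall>i j. \<forall>a\<in>A$i. \<forall>b\<in>B$j. Map h (i + j) (fe A B i j a b) = g i j a b)"
shows "t : hom (tn A B) X"
 and "i + j = n ==> a : A$i ==> b : B$j ==> Map t n (fe A B i j a b) = g i j a b"
proof -
let ?P = "%h. h : hom (tn A B) X \<and>
 (\<forall>i j. \<forall>a\<in>A$i. \<forall>b\<in>B$j. Map h (i + j) (fe A B i j a b) = g i j a b)"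
have "\<exists>!h. ?P h"
proof (rule ex_ex1I)
 show "\<exists>h. ?P h" using ex by blast
 fix h k assume h: "?P h" and k: "?P k"
 show "h = k" by (rule tn_ext[OF A B conjunct1[OF h] conjunct1[OF k] refl]) (use h k in auto)
qed
hence t: "?P t" unfolding t_def by (rule theI')
show "t : hom (tn A B) X" using t by blast
show "i + j = n ==> a : A$i ==> b : B$j ==> Map t n (fe A B i j a b) = g i j a b"
 using t by auto
qed

lemma tarr:
assumes f: "f : hom A A'" and g: "g : hom B B'"
shows tarrI: "f \<boxtimes> g : hom (tn A B) (tn A' B')"
 and tarr_fe: "i + j = n ==> a : A$i ==> b : B$j ==>
  Map (f \<boxtimes> g) n (fe A B i j a b) = fe A' B' i j (Map f i a) (Map g j b)"
proof -
note O = hom_Ob[OF f] hom_Ob[OF g]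
have ex: "\<exists>h\<in>hom (tn A B) (tn A' B'). \<forall>i j. \<forall>a\<in>A$i. \<forall>b\<in>B$j.
  Map h (i + j) (fe A B i j a b) = fe A' B' i j (Map f i a) (Map g j b)"
proof (rule tn_lift[OF O(1,3) tn_Ob[OF O(2,4)]])
 fix i j n a b p q assume n: "i + j = n" and "a : Fl A p i" "b : Fl B q j"
 thus "fe A' B' i j (Map f i a) (Map g j b) : Fl (tn A' B') (p + q) n"
  using fe_Fl[OF O(2,4) n map_Fl[OF f] map_Fl[OF g]] by blast
qed (use f g O in \<open>simp_all add: fe_rules map_d[symmetric]\<close>)
have "f \<boxtimes> g = (THE h. h : hom (tn A B) (tn A' B') \<and> (\<forall>i j. \<forall>a\<in>A$i. \<forall>b\<in>B$j.
  Map h (i + j) (fe A B i j a b) = fe A' B' i j (Map f i a) (Map g j b)))"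
 unfolding filtered_category_def hom_src[OF f, symmetric] hom_src[OF g, symmetric]
  hom_tgt[OF f, symmetric] hom_tgt[OF g, symmetric] by simp
thus "f \<boxtimes> g : hom (tn A B) (tn A' B')"
 "i + j = n ==> a : A$i ==> b : B$j ==>
  Map (f \<boxtimes> g) n (fe A B i j a b) = fe A' B' i j (Map f i a) (Map g j b)"
 using tn_the[OF O(1,3) ex] by simp_all
qed

lemma FC_tensor [simp]: "A \<otimes>\<^sub>o\<^bsub>FC\<^esub> B = tn A B" "\<I>\<^bsub>FC\<^esub> = funit R" "inner_hom FC = finner R"
unfolding filtered_category_def by simp_all

section \<open>The internal hom\<close>

abbreviation HM where "HM \<equiv> hom_module R"
abbreviation HC where "HC \<equiv> hom_complex R"

lemma HM_ops: "0[HM A B n] = (%m. \<lambda>x\<in>A$m. 0[B,m + n])"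
"f +[HM A B n] g = (%m. \<lambda>x\<in>A$m. f m x +[B,m + n] g m x)"
"s *[HM A B n] f = (%m. \<lambda>x\<in>A$m. s *[B,m + n] f m x)"
unfolding hom_module_def by simp_all

lemma HC_Cx [simp]: "Cx (HC A B) n = HM A B n"
unfolding hom_complex_def by simp

lemma HC_d: "f : carrier (HM A B n) ==> Df (HC A B) n f = (%m. \<lambda>x\<in>A$m.
 Df B (m + n) (f m x) -[B,m + n+1]
 alt (Cx B (m + n+1)) n (f (m+1) (Df A m x)))"
unfolding hom_complex_def by simp

lemma HC_Fl: "f : Fl (HC A B) p n \<longleftrightarrow>
 f : carrier (HM A B n) \<and> (\<forall>q m. \<forall>x\<in>Fl A q m. f m x : Fl B (p + q) (m + n))"
unfolding hom_complex_def by (simp add: image_subset_iff)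

lemma HM_lin: "f : carrier (HM A B n) ==> f m : lin R (Cx A m) (Cx B (m + n))"
unfolding hom_module_def by simp

lemma HM_val:
assumes f: "f : carrier (HM A B n)"
shows HM_in: "x : A$m ==> f m x : B$(m + n)"
 and HM_add: "x : A$m ==> y : A$m ==>
  f m (x +[A,m] y) = f m x +[B,m + n] f m y"
 and HM_smult: "s : carrier R ==> x : A$m ==>
  f m (s *[A,m] x) = s *[B,m + n] f m x"
using lin_in[OF HM_lin[OF f]] lin_add[OF HM_lin[OF f]] lin_smult[OF HM_lin[OF f]] by auto

lemma HM_I:
assumes A: "fcx A"
 and "\<And>m x. x : A$m ==> k m x : B$(m + n)"
 "\<And>m x y. x : A$m ==> y : A$m ==>
  k m (x +[A,m] y) = k m x +[B,m + n] k m y"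
 "\<And>m s x. s : carrier R ==> x : A$m ==> k m (s *[A,m] x) = s *[B,m + n] k m x"
shows "(%m. \<lambda>x\<in>A$m. k m x) : carrier (HM A B n)"
proof -
have "(\<lambda>x\<in>A$m. k m x) : lin R (Cx A m) (Cx B (m + n))" for m
 by (rule lin_restrictI) (use assms in simp_all)
thus ?thesis unfolding hom_module_def by simp
qed

lemma HM_ext:
assumes "f : carrier (HM A B n)" "g : carrier (HM A B n)"
 "\<And>m x. x : A$m ==> f m x = g m x"
shows "f = g"
proof
fix m show "f m = g m" by (rule lin_ext[OF HM_lin[OF assms(1)] HM_lin[OF assms(2)] assms(3)])
qed

lemma HM_mod:
assumes A: "fcx A" and B: "fcx B" shows "module R (HM A B n)"
proof (rule moduleI)
let ?K = "HM A B n"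
have z: "0[HM A B n] : carrier ?K"
 unfolding HM_ops by (rule HM_I[OF A]) (use B in simp_all)
have a: "f +[HM A B n] g : carrier ?K" if "f : carrier ?K" "g : carrier ?K" for f g
 unfolding HM_ops by (rule HM_I[OF A]) (use that B in \<open>simp_all add: HM_val cx_ac[OF B] cx_smult[OF B]\<close>)
have s: "s *[HM A B n] f : carrier ?K" if "s : carrier R" "f : carrier ?K" for f s
 unfolding HM_ops
proof (rule HM_I[OF A])
 fix m t x assume "t : carrier R" "x : A$m"
 thus "s *[B,m + n] f m (t *[A,m] x) = t *[B,m + n] (s *[B,m + n] f m x)"
  using that HM_in[OF that(2)] by (simp add: HM_smult[OF that(2)] cx_smult(3)[OF B, symmetric] m_comm[of s])
qed (use that B in \<open>simp_all add: HM_val cx_smult(2)\<close>)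
note clo = z a s
note op = HM_ops HM_in
show "cring R" by (rule is_cring)
show "abelian_group ?K"
proof (rule abelian_groupI)
 fix f assume f: "f : carrier ?K"
 have n: "(\<ominus> \<one>) *[HM A B n] f : carrier ?K" using s[OF _ f] by simp
 have "(\<ominus> \<one>) *[HM A B n] f +[HM A B n] f = 0[HM A B n]"
 proof (rule HM_ext[OF a[OF n f] z])
  fix m x assume x: "x : A$m"
  interpret M: module R "Cx B (m + n)" using B by simp
  show "((\<ominus> \<one>) *[HM A B n] f +[HM A B n] f) m x = 0[HM A B n] m x"
   using HM_in[OF f x] x by (simp add: op M.smult_l_minus M.l_neg)
 qed
 thus "\<exists>g\<in>carrier ?K. g +[HM A B n] f = 0[HM A B n]" using n by blast
next
 fix f g h assume f: "f : carrier ?K" and g: "g : carrier ?K" and h: "h : carrier ?K"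
 show "f +[HM A B n] g +[HM A B n] h = f +[HM A B n] (g +[HM A B n] h)"
  by (rule HM_ext[OF a[OF a[OF f g] h] a[OF f a[OF g h]]]) (use f g h in \<open>simp add: op cx_ac[OF B]\<close>)
 show "f +[HM A B n] g = g +[HM A B n] f"
  by (rule HM_ext[OF a[OF f g] a[OF g f]]) (use f g in \<open>simp add: op cx_ac[OF B]\<close>)
 show "0[HM A B n] +[HM A B n] f = f"
  by (rule HM_ext[OF a[OF z f] f]) (use f B in \<open>simp add: op\<close>)
qed (rule a, assumption+, rule z)
fix f assume f: "f : carrier ?K"
show "\<one> *[HM A B n] f = f"
 by (rule HM_ext[OF s[OF one_closed f] f]) (use f B in \<open>simp add: op\<close>)
show "(s \<oplus> t) *[HM A B n] f = s *[HM A B n] f +[HM A B n] t *[HM A B n] f"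
 "(s \<otimes> t) *[HM A B n] f = s *[HM A B n] (t *[HM A B n] f)"
 if "s : carrier R" "t : carrier R" "f : carrier ?K" for s t f
 by (rule HM_ext[of _ A B n], (intro clo; simp add: that)+, use that in \<open>simp add: op cx_smult[OF B]\<close>)+
show "s *[HM A B n] (f +[HM A B n] g) = s *[HM A B n] f +[HM A B n] s *[HM A B n] g"
 if "s : carrier R" "f : carrier ?K" "g : carrier ?K" for s f g
 by (rule HM_ext[of _ A B n], (intro clo; simp add: that)+, use that in \<open>simp add: op cx_smult[OF B]\<close>)
show "s : carrier R ==> f : carrier ?K ==> s *[HM A B n] f : carrier ?K" for s f by (rule s)
qed

lemma dHM:
assumes A: "fcx A" and B: "fcx B" and f: "f : carrier (HM A B n)"
shows "Df (HC A B) n f : carrier (HM A B (n+1))"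
 and "x : A$m ==> Df (HC A B) n f m x = Df B (m + n) (f m x) -[B,m + n+1]
  alt (Cx B (m + n+1)) n (f (m+1) (Df A m x))"
proof -
have v: "f (m+1) (Df A m x) : B$(m + n+1)" if "x : A$m" for m x
 using HM_in[OF f d_simps(1)[OF A that]] by (simp only: add.commute add.left_commute)
have va: "f (m+1) (x +[A,m+1] y) = f (m+1) x +[B,m + n+1] f (m+1) y"
 if "x : A$(m+1)" "y : A$(m+1)" for m x y
 using HM_add[OF f that] by (simp only: add.commute add.left_commute)
have vs: "f (m+1) (s *[A,m+1] x) = s *[B,m + n+1] f (m+1) x"
 if "s : carrier R" "x : A$(m+1)" for m x s
 using HM_smult[OF f that] by (simp only: add.commute add.left_commute)
note alt = alt_closed[OF cx_mod[OF B]] alt_add[OF cx_mod[OF B]] alt_smult[OF cx_mod[OF B]]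
show "Df (HC A B) n f : carrier (HM A B (n+1))" unfolding HC_d[OF f]
proof (rule HM_I[OF A])
 fix m x assume x: "x : A$m"
 note e = HM_in[OF f x] v[OF x] alt(1)[OF v[OF x], of n]
 have k: "m + (n+1) = m + n+1" by simp
 interpret M: module R "Cx B (m + n+1)" using B by simp
 show "Df B (m + n) (f m x) -[B,m + n+1] alt (Cx B (m + n+1)) n (f (m+1) (Df A m x))
   : B$(m + (n+1))" unfolding k using e B by simp
 fix s assume s: "s : carrier R"
 show "Df B (m + n) (f m (s *[A,m] x)) -[B,m + n+1]
   alt (Cx B (m + n+1)) n (f (m+1) (Df A m (s *[A,m] x))) = s *[B,m + (n+1)]
   (Df B (m + n) (f m x) -[B,m + n+1] alt (Cx B (m + n+1)) n (f (m+1) (Df A m x)))"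
  unfolding k using e s x A B
  by (simp add: HM_smult[OF f s x] vs alt a_minus_def M.smult_r_distr M.smult_r_minus)
next
 fix m x y assume x: "x : A$m" and y: "y : A$m"
 note e = HM_in[OF f x] v[OF x] alt(1)[OF v[OF x], of n] HM_in[OF f y] v[OF y] alt(1)[OF v[OF y], of n]
 have k: "m + (n+1) = m + n+1" by simp
 interpret M: module R "Cx B (m + n+1)" using B by simp
 show "Df B (m + n) (f m (x +[A,m] y)) -[B,m + n+1]
   alt (Cx B (m + n+1)) n (f (m+1) (Df A m (x +[A,m] y))) =
   (Df B (m + n) (f m x) -[B,m + n+1] alt (Cx B (m + n+1)) n (f (m+1) (Df A m x)))
   +[B,m + (n+1)]
   (Df B (m + n) (f m y) -[B,m + n+1] alt (Cx B (m + n+1)) n (f (m+1) (Df A m y)))"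
  unfolding k using e x y A B
  by (simp add: HM_add[OF f x y] va alt a_minus_def M.minus_add M.a_ac)
qed
show "x : A$m ==> Df (HC A B) n f m x = Df B (m + n) (f m x) -[B,m + n+1]
  alt (Cx B (m + n+1)) n (f (m+1) (Df A m x))" unfolding HC_d[OF f] by simp
qed

lemma HC_cpx:
assumes A: "A : Ob" and B: "B : Ob" shows "cpx (HC A B)"
proof (rule cpxI)
have A': "fcx A" and B': "fcx B" using A B by auto
note alt = alt_closed[OF cx_mod[OF B']] alt_add[OF cx_mod[OF B']] alt_smult[OF cx_mod[OF B']]
have v: "f (m+1) (Df A m x) : B$(m + n+1)"
 if "f : carrier (HM A B n)" "x : A$m" for f n m x
 using HM_in[OF that(1) d_simps(1)[OF A' that(2)]] by (simp only: add.commute add.left_commute)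
show "fcx (HC A B)"
proof (rule filtered_complex.intro; (unfold HC_Cx)?)
 fix n p :: int
 note mm = HM_mod[OF A' B', of n] and mm1 = HM_mod[OF A' B', of "n+1"]
 interpret N: module R "HM A B n" by (rule mm)
 interpret N1: module R "HM A B (n+1)" by (rule mm1)
 show "module R (HM A B n)" by fact
 show "Df (HC A B) n : lin R (HM A B n) (HM A B (n+1))"
 proof (rule lin_mapsI)
  fix f assume f: "f : carrier (HM A B n)"
  note df = dHM[OF A' B' f]
  show "Df (HC A B) n f : carrier (HM A B (n+1))" by (rule df)
  show "Df (HC A B) n (s *[HM A B n] f) = s *[HM A B (n+1)] Df (HC A B) n f"
   if s: "s : carrier R" for s
  proof (rule HM_ext[OF dHM(1)[OF A' B' N.smult_closed[OF s f]] N1.smult_closed[OF s df(1)]])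
   fix m x assume x: "x : A$m"
   interpret M: module R "Cx B (n + m+1)" using B' by simp
   show "Df (HC A B) n (s *[HM A B n] f) m x = (s *[HM A B (n+1)] Df (HC A B) n f) m x"
    unfolding dHM(2)[OF A' B' N.smult_closed[OF s f] x]
    using x v[OF f x] HM_in[OF f x] s A' B'
    by (simp add: HM_ops df(2) a_minus_def alt M.smult_r_distr M.smult_r_minus
      add.assoc[symmetric] add.commute[of _ n])
  qed
 next
  fix f g assume f: "f : carrier (HM A B n)" and g: "g : carrier (HM A B n)"
  note df = dHM[OF A' B' f] and dg = dHM[OF A' B' g]
  show "Df (HC A B) n (f +[HM A B n] g) = Df (HC A B) n f +[HM A B (n+1)] Df (HC A B) n g"
  proof (rule HM_ext[OF dHM(1)[OF A' B' N.a_closed[OF f g]] N1.a_closed[OF df(1) dg(1)]])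
   fix m x assume x: "x : A$m"
   interpret M: module R "Cx B (n + m+1)" using B' by simp
   show "Df (HC A B) n (f +[HM A B n] g) m x = (Df (HC A B) n f +[HM A B (n+1)] Df (HC A B) n g) m x"
    unfolding dHM(2)[OF A' B' N.a_closed[OF f g] x]
    using x v[OF f x] v[OF g x] HM_in[OF f x] HM_in[OF g x] A' B'
    by (simp add: HM_ops df(2) dg(2) a_minus_def alt M.minus_add M.a_ac
      add.assoc[symmetric] add.commute[of _ n])
  qed
 qed (simp add: hom_complex_def)
 show "submodule (Fl (HC A B) p n) R (HM A B n)"
  by (rule submoduleI'[OF mm])
   (auto simp: HC_Fl, auto simp: HM_ops Fl_car[OF _ A'] Fl_add[OF B'] Fl_smult[OF B'] B')
 show "Df (HC A B) n ` Fl (HC A B) p n \<subseteq> Fl (HC A B) p (n+1)"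
 proof safe
  fix f assume "f : Fl (HC A B) p n"
  hence f: "f : carrier (HM A B n)" and Ff: "\<And>q m x. x : Fl A q m ==> f m x : Fl B (p + q) (m + n)"
   unfolding HC_Fl by auto
  show "Df (HC A B) n f : Fl (HC A B) p (n+1)" unfolding HC_Fl
  proof (intro conjI allI ballI dHM(1)[OF A' B' f])
   fix q m x assume x: "x : Fl A q m"
   have "f (m+1) (Df A m x) : Fl B (p + q) (m + n+1)"
    using Ff[OF Fl_d[OF A' x]] by (simp add: ac_simps)
   hence "Df B (m + n) (f m x) -[B,m + n+1] alt (Cx B (m + n+1)) n (f (m+1) (Df A m x))
     : Fl B (p + q) (m + n+1)"
    by (intro Fl_minus[OF B'] Fl_d[OF B'] Ff[OF x] alt_mem[OF Fl_sub[OF B']])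
   thus "Df (HC A B) n f m x : Fl B (p + q) (m + (n+1))"
    unfolding dHM(2)[OF A' B' f Fl_car[OF x A']] by (simp add: ac_simps)
  qed
 qed
 show "Fl (HC A B) p n \<subseteq> Fl (HC A B) (p+1) n"
 proof
  fix f assume "f : Fl (HC A B) p n"
  hence f: "f : carrier (HM A B n)" "x : Fl A q m ==> f m x : Fl B (p + q) (m + n)" for x q m
   unfolding HC_Fl by auto
  show "f : Fl (HC A B) (p+1) n" unfolding HC_Fl
   by (intro conjI allI ballI f(1), rule Fl_le[OF f(2) _ B']) auto
 qed
 show "Df (HC A B) (n+1) (Df (HC A B) n f) = 0[HM A B (n+1+1)]" if f: "f : carrier (HM A B n)" for f
 proof (rule HM_ext[OF dHM(1)[OF A' B' dHM(1)[OF A' B' f]]])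
  interpret N2: module R "HM A B (n+1+1)" by (rule HM_mod[OF A' B'])
  show "0[HM A B (n+1+1)] : carrier (HM A B (n+1+1))" by (rule N2.zero_closed)
  fix m x assume x: "x : A$m"
  note df = dHM[OF A' B' f]
  let ?y = "f (m+1) (Df A m x)"
  have y: "?y : B$(m + n+1)" by (rule v[OF f x])
  have dx: "Df A m x : A$(m+1)" using x A' by simp
  have f0: "f (m+1+1) 0[A,m+1+1] = 0[B,m+1+1 + n]"
   by (rule lin_zero[OF _ _ HM_lin[OF f]]) (use A' B' in auto)
  let ?M = "Cx B (m + n+1+1)"
  have k: "m+1 + n = m + n+1" "m + (n+1) = m + n+1" "m+1 + n+1 = m + n+1+1" "m+1+1 + n = m + n+1+1" by auto
  note fx = HM_in[OF f x]
  have e1: "Df (HC A B) n f (m+1) (Df A m x) = Df B (m + n+1) ?y"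
   using df(2)[OF dx, unfolded k] x A' B' y f0[unfolded k] by (simp add: alt_zero[OF cx_mod[OF B']])
  have "Df (HC A B) (n+1) (Df (HC A B) n f) m x =
    Df B (m + n+1) (Df (HC A B) n f m x) -[?M] alt ?M (n+1) (Df B (m + n+1) ?y)"
   using dHM(2)[OF A' B' df(1) x] unfolding k e1 .
  also have "Df B (m + n+1) (Df (HC A B) n f m x) = -[?M] alt ?M n (Df B (m + n+1) ?y)"
   using x y fx B' alt(1)[OF y, of n] alt_lin[OF cx_mod[OF B'] cx_mod[OF B'] d_lin[OF B'] y]
    alt(1)[OF d_simps(1)[OF B' y], of n]
   by (simp add: df(2))
  also have "alt ?M (n+1) (Df B (m + n+1) ?y) = -[?M] alt ?M n (Df B (m + n+1) ?y)"
   by (rule alt_suc[OF cx_mod[OF B']]) (use y B' in simp)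
  also have "-[?M] alt ?M n (Df B (m + n+1) ?y) -[?M] (-[?M] alt ?M n (Df B (m + n+1) ?y)) = 0[?M]"
   using alt(1)[of "Df B (m + n+1) ?y"] y B' by simp
  finally show "Df (HC A B) (n+1) (Df (HC A B) n f) m x = 0[HM A B (n+1+1)] m x"
   using x by (simp add: HM_ops ac_simps)
 qed
qed
have "sm (lin R (Cx A m) (Cx B k))" for m k
 by (rule sm_fun[of "A$m" "%_. B$k"]) (auto simp: Ob_sm A B intro: lin_in lin_ext)
thus "sm ((HC A B)$n)" for n unfolding HC_Cx
 by (intro sm_fun[of UNIV "%m. lin R (Cx A m) (Cx B (m + n))"]) (auto simp: sm_int HM_lin)
qed

abbreviation inn :: "('r, 'u) fcomplex => ('r, 'u) fcomplex => ('r, 'u) fcomplex" where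
"inn \<equiv> finner R"

lemma inn_Ob [simp]: "A : Ob ==> B : Ob ==> inn A B : Ob"
unfolding finner_def by (intro copy_Ob HC_cpx)

abbreviation ev where "ev \<equiv> inner_eval FC"

lemma eval:
assumes A: "A : Ob" and B: "B : Ob"
shows ev_hom: "ev A B : hom (tn (inn A B) A) B"
 and ev_fe: "n + m = k ==> f : carrier (HM A B n) ==> a : A$m ==>
  Map (ev A B) k (fe (inn A B) A n m (cd (HC A B) n f) a) = f m a"
proof -
have A': "fcx A" and B': "fcx B" using A B by auto
note K = HC_cpx[OF A B]
let ?g = "%n m u a. dc (HC A B) n u m a"
have I: "u : (inn A B)$n \<longleftrightarrow> (\<exists>f\<in>carrier (HM A B n). u = cd (HC A B) n f)" for u n
 unfolding finner_def copy_car by auto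
have dcd: "dc (HC A B) n (cd (HC A B) n f) = f" if "f : carrier (HM A B n)" for f n
 using cpx_decode[OF K, of f n] that by simp
note dcd' = dcd[unfolded HC_Cx]
have cA: "cd (HC A B) n f +[inn A B,n] cd (HC A B) n g = cd (HC A B) n (f +[HM A B n] g)"
 "f +[HM A B n] g : carrier (HM A B n)"
 if "f : carrier (HM A B n)" "g : carrier (HM A B n)" for f g n
 unfolding finner_def using copy_add[OF K, of f n g] cx_closed(2)[OF cpx_fcx[OF K], of f n g] that by simp_all
have cS: "s *[inn A B,n] cd (HC A B) n f = cd (HC A B) n (s *[HM A B n] f)"
 "s *[HM A B n] f : carrier (HM A B n)"
 if "s : carrier R" "f : carrier (HM A B n)" for f s n
 unfolding finner_def using copy_smult[OF K, of f n s] cx_closed(5)[OF cpx_fcx[OF K], of s f n] that by simp_all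
have cD: "Df (inn A B) n (cd (HC A B) n f) = cd (HC A B) (n+1) (Df (HC A B) n f)"
 if "f : carrier (HM A B n)" for f n
 unfolding finner_def using copy_d[OF K, of f n] that by simp
have ex: "\<exists>h\<in>hom (tn (inn A B) A) B. \<forall>i j. \<forall>a\<in>(inn A B)$i. \<forall>b\<in>A$j.
  Map h (i + j) (fe (inn A B) A i j a b) = ?g i j a b"
proof (rule tn_lift[OF inn_Ob[OF A B] A B])
 fix n m k u a assume k: "n + m = k" and u: "u : (inn A B)$n" and a: "a : A$m"
 obtain f where f: "f : carrier (HM A B n)" and uf: "u = cd (HC A B) n f" using u unfolding I by blast
 have k': "k = m + n" using k by simp
 note fa = HM_in[OF f a]
 show "?g n m u a : B$k" unfolding uf dcd[OF f] k' by (rule fa)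
 show "?g n m (u +[inn A B,n] v) a = ?g n m u a +[B,k] ?g n m v a"
  if "v : (inn A B)$n" for v
  using that f a unfolding I uf k' by (elim bexE) (simp add: cA dcd', simp add: HM_ops)
 show "?g n m u (a +[A,m] b) = ?g n m u a +[B,k] ?g n m u b" if "b : A$m" for b
  unfolding uf dcd[OF f] k' by (rule HM_add[OF f a that])
 show "?g n m (s *[inn A B,n] u) a = s *[B,k] ?g n m u a"
  "?g n m u (s *[A,m] a) = s *[B,k] ?g n m u a" if "s : carrier R" for s
  using that f a unfolding uf k' by (simp_all add: cS dcd') (simp_all add: HM_ops HM_smult)
 have y: "f (m+1) (Df A m a) : B$(m + n+1)"
  using HM_in[OF f d_simps(1)[OF A' a]] by (simp only: add.commute add.left_commute)
 interpret M: abelian_group "Cx B (m + n+1)" by (rule cx_ab[OF B'])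
 \<comment> \<open>The Leibniz rule for evaluation is the definition of the hom differential, solved
   for d(f a).\<close>
 have "Df B k (?g n m u a) = Df B (m + n) (f m a)" unfolding uf dcd[OF f] k' ..
 also have "\<dots> = Df (HC A B) n f m a +[B,m + n+1] alt (Cx B (m + n+1)) n (f (m+1) (Df A m a))"
  unfolding dHM(2)[OF A' B' f a] using alt_closed[OF cx_mod[OF B'] y, of n] d_simps(1)[OF B' fa]
  by (simp add: a_minus_def M.a_assoc M.l_neg)
 finally show "Df B k (?g n m u a) = ?g (n+1) m (Df (inn A B) n u) a +[B,k+1]
   alt (Cx B (k+1)) n (?g n (m+1) u (Df A m a))"
  unfolding uf cD[OF f] dcd[OF f] dcd[OF dHM(1)[OF A' B' f]] k' .
next
 fix n m k u a p q assume k: "n + m = k" and u: "u : Fl (inn A B) p n" and a: "a : Fl A q m"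
 hence k': "k = m + n" by simp
 obtain f where f: "f : Fl (HC A B) p n" and uf: "u = cd (HC A B) n f"
  using u unfolding finner_def copy_Fl by blast
 show "?g n m u a : Fl B (p + q) k"
  using f a unfolding uf k' HC_Fl by (simp add: dcd')
qed
have cI: "(inn A B)$n = cd (HC A B) n ` carrier (HM A B n)"
 and cde: "code (carrier (HM A B n)) = cd (HC A B) n" for n
 unfolding finner_def copy_car cd_def by simp_all
have t: "ev A B = (THE h. h : hom (tn (inn A B) A) B \<and> (\<forall>i j. \<forall>a\<in>(inn A B)$i. \<forall>b\<in>A$j.
  Map h (i + j) (fe (inn A B) A i j a b) = ?g i j a b))"
 unfolding filtered_category_def by (simp add: cI cde dcd')
show "ev A B : hom (tn (inn A B) A) B" using tn_the(1)[OF inn_Ob[OF A B] A ex] unfolding t .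
assume k: "n + m = k" and f: "f : carrier (HM A B n)" and a: "a : A$m"
have "cd (HC A B) n f : (inn A B)$n" using f unfolding I by blast
thus "Map (ev A B) k (fe (inn A B) A n m (cd (HC A B) n f) a) = f m a"
 using tn_the(2)[OF inn_Ob[OF A B] A ex k _ a] dcd[OF f] unfolding t by simp
qed

definition curry_map where
"curry_map Z A f = (%n z m. \<lambda>x\<in>A$m. Map f (n + m) (fe Z A n m z x))"

lemma curry_fmap:
assumes Z: "Z : Ob" and A: "A : Ob" and B: "B : Ob" and f: "f : hom (tn Z A) B"
shows "fmap R Z (HC A B) (curry_map Z A f)"
proof -
have A': "fcx A" and B': "fcx B" and Z': "fcx Z" using A B Z by auto
have val: "curry_map Z A f n z m x = Map f (m + n) (fe Z A n m z x)" if "x : A$m" for n z m x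
 unfolding curry_map_def using that by (simp add: add.commute)
note c = fe_rules[OF Z A add.commute[of n m for n m]]
have cl: "curry_map Z A f n z : carrier (HM A B n)" if z: "z : Z$n" for n z
 unfolding curry_map_def
 by (rule HM_I[OF A'], unfold add.commute[of n]) (use z f A' in \<open>simp_all add: c\<close>)
show ?thesis
proof (rule fmapI; (unfold HC_Cx)?)
fix n z assume z: "z : Z$n"
show "curry_map Z A f n z : carrier (HM A B n)" by (rule cl[OF z])
interpret N: module R "HM A B n" by (rule HM_mod[OF A' B'])
show "curry_map Z A f n (z +[Z,n] w) = curry_map Z A f n z +[HM A B n] curry_map Z A f n w"
 if w: "w : Z$n" for w
 by (rule HM_ext[OF cl N.a_closed[OF cl cl]]) (use z w f Z' in \<open>simp_all add: val c HM_ops\<close>)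
show "curry_map Z A f n (s *[Z,n] z) = s *[HM A B n] curry_map Z A f n z" if s: "s : carrier R" for s
 by (rule HM_ext[OF cl N.smult_closed[OF s cl]]) (use z s f Z' in \<open>simp_all add: val c HM_ops\<close>)
show "Df (HC A B) n (curry_map Z A f n z) = curry_map Z A f (n+1) (Df Z n z)"
proof (rule HM_ext[OF dHM(1)[OF A' B' cl[OF z]] cl[OF d_simps(1)[OF Z' z]]])
 fix m x assume x: "x : A$m"
 have k: "m+1 + n = m + n+1" "m + (n+1) = m + n+1" and nm: "n + m = m + n"
  and n1: "n+1 + m = m + n+1" and n2: "n + (m+1) = m + n+1" by auto
 note fz = fe_in[OF Z A nm z x] and f1 = fe_in[OF Z A n1 d_simps(1)[OF Z' z] x]
  and f2 = fe_in[OF Z A n2 z d_simps(1)[OF A' x]]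
 interpret M: abelian_group "Cx B (m + n+1)" by (rule cx_ab[OF B'])
 have T': "fcx (tn Z A)" using Z A by simp
 have l: "Map f k : lin R (Cx (tn Z A) k) (Cx B k)" for k
  using f unfolding fhom_def farrows_def filtered_maps_def by auto
 have "Df (HC A B) n (curry_map Z A f n z) m x = Map f (m + n+1) (Df (tn Z A) (m + n) (fe Z A n m z x))
   -[B,m + n+1] alt (Cx B (m + n+1)) n (Map f (m + n+1) (fe Z A n (m+1) z (Df A m x)))"
  using x A' fz unfolding dHM(2)[OF A' B' cl[OF z] x] by (simp add: val map_d[OF f] k del: One_nat_def)
 also have "\<dots> = Map f (m + n+1) (fe Z A (n+1) m (Df Z n z) x)"
  unfolding fe_d[OF Z A nm z x] alt_lin[OF cx_mod[OF T'] cx_mod[OF B'] l f2, symmetric]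
  using f f1 alt_closed[OF cx_mod[OF T'] f2, of n] T'
  by (simp add: a_minus_def M.a_assoc M.r_neg)
 finally show "Df (HC A B) n (curry_map Z A f n z) m x = curry_map Z A f (n+1) (Df Z n z) m x"
  unfolding val[OF x] k .
qed
next
fix n p z assume z: "z : Fl Z p n"
show "curry_map Z A f n z : Fl (HC A B) p n" unfolding HC_Fl
proof (intro conjI allI ballI cl Fl_car[OF z Z'])
 fix q m x assume x: "x : Fl A q m"
 show "curry_map Z A f n z m x : Fl B (p + q) (m + n)"
  unfolding val[OF Fl_car[OF x A']] by (rule map_Fl[OF f fe_Fl[OF Z A add.commute z x refl]])
qed
qed
qed

definition transpose where "transpose Z A B f = to_copy Z (HC A B) (curry_map Z A f)"

lemma transpose:
assumes Z: "Z : Ob" and A: "A : Ob" and B: "B : Ob" and f: "f : hom (tn Z A) B"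
shows transpose_hom: "transpose Z A B f : hom Z (inn A B)"
 and ev_transpose: "ev A B \<star> (transpose Z A B f \<boxtimes> Idt FC A) = f"
 and transpose_unique: "g : hom Z (inn A B) ==> ev A B \<star> (g \<boxtimes> Idt FC A) = f ==> g = transpose Z A B f"
proof -
have A': "fcx A" and B': "fcx B" using A B by auto
note K = HC_cpx[OF A B] and fm = curry_fmap[OF assms]
show t: "transpose Z A B f : hom Z (inn A B)"
 unfolding transpose_def finner_def by (rule to_copy_hom[OF K Z fm])
have tI: "g \<boxtimes> Idt FC A : hom (tn Z A) (tn (inn A B) A)" if "g : hom Z (inn A B)" for g
 by (rule tarrI[OF that]) (simp add: A)
have cv: "curry_map Z A f n z : carrier (HM A B n)" if "z : Z$n" for n z
 using fmap_closed[OF fm that] by simp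
have val: "Map (ev A B \<star> (g \<boxtimes> Idt FC A)) k (fe Z A n m z x) =
  Map (ev A B) k (fe (inn A B) A n m (Map g n z) x)"
 if g: "g : hom Z (inn A B)" and k: "n + m = k" "z : Z$n" "x : A$m" for g n m k z x
 using cmp_map[OF tI[OF g] fe_in[OF Z A k]] tarr_fe[OF g idI[OF A] k] k(3) by simp
show "ev A B \<star> (transpose Z A B f \<boxtimes> Idt FC A) = f"
proof (rule tn_ext[OF Z A cmpI[OF tI[OF t] ev_hom[OF A B]] f refl])
 fix n m k z x assume k: "n + m = k" and z: "z : Z$n" and x: "x : A$m"
 show "Map (ev A B \<star> (transpose Z A B f \<boxtimes> Idt FC A)) k (fe Z A n m z x) = Map f k (fe Z A n m z x)"
  unfolding val[OF t k z x] using ev_fe[OF A B k cv[OF z] x] z x k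
  by (simp add: transpose_def curry_map_def)
qed
assume g: "g : hom Z (inn A B)" and e: "ev A B \<star> (g \<boxtimes> Idt FC A) = f"
show "g = transpose Z A B f"
proof (rule hom_ext[OF g t refl])
 fix n z assume z: "z : Z$n"
 obtain h where h: "h : carrier (HM A B n)" "Map g n z = cd (HC A B) n h"
  using map_simps(1)[OF g z] unfolding finner_def copy_car by auto
 have "h = curry_map Z A f n z"
 proof (rule HM_ext[OF h(1) cv[OF z]])
  fix m x assume x: "x : A$m"
  show "h m x = curry_map Z A f n z m x"
   using val[OF g refl z x] ev_fe[OF A B refl h(1) x] x unfolding e h(2) curry_map_def by simp
 qed
 thus "Map g n z = Map (transpose Z A B f) n z" using z h(2) by (simp add: transpose_def)
qed
qed

section \<open>The symmetric monoidal structure\<close>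

lemma alt_par: "(even k \<longleftrightarrow> even l) ==> alt M k x = alt M l x"
unfolding alt_sign_def by simp

lemma map_alt: "f : hom A B ==> x : A$n ==>
 Map f n (alt (Cx A n) k x) = alt (Cx B n) k (Map f n x)"
unfolding alt_sign_def by simp

lemma cx_alt [simp]: "fcx A ==> x : A$n ==> alt (Cx A n) k x : A$n"
by (rule alt_closed[OF cx_mod])

lemma cx_alt_alt: "fcx A ==> x : A$n ==>
 alt (Cx A n) k (alt (Cx A n) l x) = alt (Cx A n) (k + l) x"
by (rule alt_alt[OF cx_mod])

lemma cx_alt_rules:
assumes "fcx A" "x : A$n"
shows "y : A$n ==>
  alt (Cx A n) k (x +[A,n] y) = alt (Cx A n) k x +[A,n] alt (Cx A n) k y"
 "s : carrier R ==> alt (Cx A n) k (s *[A,n] x) = s *[A,n] alt (Cx A n) k x"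
using alt_add[OF cx_mod[OF assms(1)] assms(2)] alt_smult[OF cx_mod[OF assms(1)] assms(2)] by auto

lemma cx_alt_Fl: "fcx A ==> x : Fl A p n ==> alt (Cx A n) k x : Fl A p n"
by (rule alt_mem[OF Fl_sub])

lemma isoI:
assumes f: "f : hom A B" and g: "g : hom B A" and "g \<star> f = Idt FC A" "f \<star> g = Idt FC B"
shows "is_iso FC f"
unfolding is_iso_def FC_simps hom_src[OF f] hom_tgt[OF f] using hom_arr[OF f] assms by blast

abbreviation br where "br \<equiv> braid FC"
abbreviation asc where "asc \<equiv> assoc FC"

lemma braid:
assumes A: "A : Ob" and B: "B : Ob"
shows br_hom: "br A B : hom (tn A B) (tn B A)"
 and br_fe: "i + j = n ==> a : A$i ==> b : B$j ==>
  Map (br A B) n (fe A B i j a b) = alt (Cx (tn B A) n) (i * j) (fe B A j i b a)"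
proof -
let ?g = "%i j a b. alt (Cx (tn B A) (i + j)) (i * j) (fe B A j i b a)"
have A': "fcx A" and B': "fcx B" and T': "fcx (tn B A)" using A B by auto
have ex: "\<exists>h\<in>hom (tn A B) (tn B A). \<forall>i j. \<forall>a\<in>A$i. \<forall>b\<in>B$j.
  Map h (i + j) (fe A B i j a b) = ?g i j a b"
proof (rule tn_lift[OF A B tn_Ob[OF B A]])
 fix i j n a b assume n: "i + j = n" and a: "a : A$i" and b: "b : B$j"
 have n': "j + i = n" and n1: "i+1 + j = n+1" "j + (i+1) = n+1" and n2: "i + (j+1) = n+1" "j+1 + i = n+1"
  using n by auto
 note r = fe_rules[OF B A n' b]
 note [simp] = r(1)
 show "?g i j a b : (tn B A)$n" unfolding n using a T' by simp
 show "?g i j (a +[A,i] a') b = ?g i j a b +[tn B A,n] ?g i j a' b"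
  if "a' : A$i" for a'
  unfolding n using a that T' by (simp add: r cx_alt_rules)
 show "?g i j a (b +[B,j] b') = ?g i j a b +[tn B A,n] ?g i j a b'"
  if b': "b' : B$j" for b'
  unfolding n using a b' fe_in[OF B A n' b'] T' by (simp add: r cx_alt_rules)
 show "?g i j (s *[A,i] a) b = s *[tn B A,n] ?g i j a b"
  "?g i j a (s *[B,j] b) = s *[tn B A,n] ?g i j a b" if "s : carrier R" for s
  unfolding n using a that T' by (simp_all add: r cx_alt_rules)
 let ?M = "Cx (tn B A) (n+1)"
 let ?x = "fe B A (j+1) i (Df B j b) a" and ?y = "fe B A j (i+1) b (Df A i a)"
 have x: "?x : carrier ?M" using fe_in[OF B A n2(2) _ a] b B' by simp
 have y: "?y : carrier ?M" using fe_in[OF B A n1(2) b] a A' by simp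
 have "Df (tn B A) n (?g i j a b) = alt ?M (i * j) (?x +[?M] alt ?M j ?y)"
  unfolding n using alt_lin[OF cx_mod[OF T'] cx_mod[OF T'] d_lin[OF T'] r(1)[OF a]] fe_d[OF B A n' b a] by simp
 also have "\<dots> = alt ?M (i * j) ?x +[?M] alt ?M (i * j + j) ?y"
  using x y T' by (simp add: cx_alt_rules(1) cx_alt_alt)
 also have "\<dots> = alt ?M (i * j + j) ?y +[?M] alt ?M (i * j) ?x"
  using x y T' by (intro cx_ac) auto
 \<comment> \<open>Only parities matter: ij + j = (i + 1)j, and i + i(j + 1) has the parity of
   ij.\<close>
 also have "alt ?M (i * j + j) ?y = alt ?M ((i+1) * j) ?y" by (rule alt_par) (simp add: algebra_simps)
 also have "alt ?M (i * j) ?x = alt ?M i (alt ?M (i * (j+1)) ?x)"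
  unfolding cx_alt_alt[OF T' x] by (rule alt_par) (simp add: algebra_simps)
 finally show "Df (tn B A) n (?g i j a b) = ?g (i+1) j (Df A i a) b +[?M] alt ?M i (?g i (j+1) a (Df B j b))"
  unfolding n1 n2 .
next
 fix i j n a b p q assume n: "i + j = n" and a: "a : Fl A p i" and b: "b : Fl B q j"
 have n': "j + i = n" using n by simp
 show "?g i j a b : Fl (tn B A) (p + q) n"
  unfolding n by (rule cx_alt_Fl[OF T' fe_Fl[OF B A n' b a add.commute]])
qed
have t: "br A B = (THE h. h : hom (tn A B) (tn B A) \<and>
  (\<forall>i j. \<forall>a\<in>A$i. \<forall>b\<in>B$j. Map h (i + j) (fe A B i j a b) = ?g i j a b))"
 unfolding filtered_category_def by simp
show "br A B : hom (tn A B) (tn B A)"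
 "i + j = n ==> a : A$i ==> b : B$j ==>
  Map (br A B) n (fe A B i j a b) = alt (Cx (tn B A) n) (i * j) (fe B A j i b a)"
 using tn_the[OF A B ex] unfolding t by auto
qed

lemma br_br:
assumes A: "A : Ob" and B: "B : Ob" shows "br B A \<star> br A B = Idt FC (tn A B)"
proof (rule tn_ext[OF A B cmpI[OF br_hom[OF A B] br_hom[OF B A]] idI[OF tn_Ob[OF A B]] refl])
fix i j n a b assume n: "i + j = n" and a: "a : A$i" and b: "b : B$j"
have n': "j + i = n" using n by simp
note c = fe_in[OF A B n a b] and c' = fe_in[OF B A n' b a]
have "Map (br B A \<star> br A B) n (fe A B i j a b) =
  alt (Cx (tn A B) n) (i * j + j * i) (fe A B i j a b)"
 using c A B by (simp add: cmp_map[OF br_hom[OF A B]] br_fe[OF A B n a b] map_alt[OF br_hom[OF B A] c']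
  br_fe[OF B A n' b a] cx_alt_alt)
thus "Map (br B A \<star> br A B) n (fe A B i j a b) = Map (Idt FC (tn A B)) n (fe A B i j a b)"
 using c by (simp add: mult.commute)
qed

text \<open>Maps out of \<open>Z \<otimes> A\<close> agree if their transposes do, which removes one tensor factor.\<close>

lemma tri_ext:
assumes A: "A : Ob" and B: "B : Ob" and C: "C : Ob" and f: "f : hom (tn (tn A B) C) X" and g: "g : hom (tn (tn A B) C) X"
 and eq: "\<And>i j k p n a b c. i + j = p ==> p + k = n ==> a : A$i ==> b : B$j ==> c : C$k ==>
  Map f n (fe (tn A B) C p k (fe A B i j a b) c) = Map g n (fe (tn A B) C p k (fe A B i j a b) c)"
shows "f = g"
proof -
note T = tn_Ob[OF A B] and X = hom_Ob(2)[OF f]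
have "transpose (tn A B) C X f = transpose (tn A B) C X g"
proof (rule tn_ext[OF A B transpose_hom[OF T C X f] transpose_hom[OF T C X g] refl])
 fix i j n a b assume n: "i + j = n" and a: "a : A$i" and b: "b : B$j"
 have "curry_map (tn A B) C f n (fe A B i j a b) = curry_map (tn A B) C g n (fe A B i j a b)"
  unfolding curry_map_def using eq[OF n refl a b] by (intro ext) simp
 thus "Map (transpose (tn A B) C X f) n (fe A B i j a b) = Map (transpose (tn A B) C X g) n (fe A B i j a b)"
  using fe_in[OF A B n a b] by (simp add: transpose_def)
qed
thus ?thesis using ev_transpose[OF T C X f] ev_transpose[OF T C X g] by metis
qed

lemma quad_ext:
assumes A: "A : Ob" and B: "B : Ob" and C: "C : Ob" and D: "D : Ob"
 and f: "f : hom (tn (tn (tn A B) C) D) X" and g: "g : hom (tn (tn (tn A B) C) D) X"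
 and eq: "\<And>i j k l p q n a b c d. i + j = p ==> p + k = q ==> q + l = n ==>
  a : A$i ==> b : B$j ==> c : C$k ==> d : D$l ==>
  Map f n (fe (tn (tn A B) C) D q l (fe (tn A B) C p k (fe A B i j a b) c) d) =
  Map g n (fe (tn (tn A B) C) D q l (fe (tn A B) C p k (fe A B i j a b) c) d)"
shows "f = g"
proof -
let ?T = "tn (tn A B) C"
note T = tn_Ob[OF tn_Ob[OF A B] C] and X = hom_Ob(2)[OF f]
have "transpose ?T D X f = transpose ?T D X g"
proof (rule tri_ext[OF A B C transpose_hom[OF T D X f] transpose_hom[OF T D X g]])
 fix i j k p n a b c assume p: "i + j = p" and n: "p + k = n"
  and a: "a : A$i" and b: "b : B$j" and c: "c : C$k"
 let ?t = "fe (tn A B) C p k (fe A B i j a b) c"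
 have "curry_map ?T D f n ?t = curry_map ?T D g n ?t"
  unfolding curry_map_def using eq[OF p n refl a b c] by (intro ext) simp
 thus "Map (transpose ?T D X f) n ?t = Map (transpose ?T D X g) n ?t"
  using fe_in[OF tn_Ob[OF A B] C n fe_in[OF A B p a b] c] by (simp add: transpose_def)
qed
thus ?thesis using ev_transpose[OF T D X f] ev_transpose[OF T D X g] by metis
qed

text \<open>The braiding moves the inner product to the left, where \<open>tri_ext\<close> applies;
  signs are the same on both sides.\<close>

lemma tri_ext_right:
assumes A: "A : Ob" and B: "B : Ob" and C: "C : Ob" and f: "f : hom (tn A (tn B C)) X" and g: "g : hom (tn A (tn B C)) X"
 and eq: "\<And>i j k q n a b c. j + k = q ==> i + q = n ==> a : A$i ==> b : B$j ==> c : C$k ==>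
  Map f n (fe A (tn B C) i q a (fe B C j k b c)) = Map g n (fe A (tn B C) i q a (fe B C j k b c))"
shows "f = g"
proof -
note T = tn_Ob[OF B C]
note s = br_hom[OF T A] and s' = br_hom[OF A T]
have *: "f \<star> br (tn B C) A = g \<star> br (tn B C) A"
proof (rule tri_ext[OF B C A cmpI[OF s f] cmpI[OF s g]])
 fix j k i q n b c a assume q: "j + k = q" and n: "q + i = n"
  and b: "b : B$j" and c: "c : C$k" and a: "a : A$i"
 have n': "i + q = n" using n by simp
 note bc = fe_in[OF B C q b c]
 note x = fe_in[OF T A n bc a] and y = fe_in[OF A T n' a bc]
 show "Map (f \<star> br (tn B C) A) n (fe (tn B C) A q i (fe B C j k b c) a) =
   Map (g \<star> br (tn B C) A) n (fe (tn B C) A q i (fe B C j k b c) a)"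
  unfolding cmp_map[OF s x] br_fe[OF T A n bc a] map_alt[OF f y] map_alt[OF g y] eq[OF q n' a b c] ..
qed
interpret category FC by (rule category_FC)
have "h = (h \<star> br (tn B C) A) \<star> br A (tn B C)" if "h : hom (tn A (tn B C)) X" for h
 using Cmp_assoc[of _ _ _ _ _ h X, unfolded FC_simps, OF s' s that] br_br[OF A T] Cmp_Idt[of h] that by simp
from this[OF f] this[OF g] show ?thesis using * by simp
qed

text \<open>The associator is the transpose of a map from A (x) B to Hom(C, A (x) (B (x) C)). The
  closed structure thus replaces a universal property for trilinear maps by two uses of the bilinear
  one.\<close>

lemma assoc:
assumes A: "A : Ob" and B: "B : Ob" and C: "C : Ob"
shows asc_hom: "asc A B C : hom (tn (tn A B) C) (tn A (tn B C))"
 and asc_fe: "i + j = p ==> p + k = n ==> j + k = q ==> a : A$i ==> b : B$j ==> c : C$k ==>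
  Map (asc A B C) n (fe (tn A B) C p k (fe A B i j a b) c) = fe A (tn B C) i q a (fe B C j k b c)"
proof -
let ?X = "tn A (tn B C)"
note BC = tn_Ob[OF B C] and AB = tn_Ob[OF A B] and X = tn_Ob[OF A tn_Ob[OF B C]]
have A': "fcx A" and B': "fcx B" and C': "fcx C" and X': "fcx ?X" and BC': "fcx (tn B C)" using A B C by auto
note K = HC_cpx[OF C X]
let ?h = "%i j a b m. \<lambda>c\<in>C$m. fe A (tn B C) i (j + m) a (fe B C j m b c)"
have e: "m + n = i + (j + m)" if "i + j = n" for i j m n :: int using that by simp
have hc: "?h i j a b : carrier (HM C ?X n)" if n: "i + j = n" and a: "a : A$i" and b: "b : B$j" for i j n a b
 by (rule HM_I[OF C']; unfold e[OF n])
  (simp_all add: fe_rules[OF B C refl] b fe_rules[OF A BC refl a])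
have "\<exists>h\<in>hom (tn A B) (inn C ?X). \<forall>i j. \<forall>a\<in>A$i. \<forall>b\<in>B$j.
  Map h (i + j) (fe A B i j a b) = cd (HC C ?X) (i + j) (?h i j a b)"
proof (rule tn_lift[OF A B inn_Ob[OF C X]])
 fix i j n a b assume n: "i + j = n" and a: "a : A$i" and b: "b : B$j"
 interpret N: module R "HM C ?X n" by (rule HM_mod[OF C' X'])
 note h = hc[OF n a b]
 show "cd (HC C ?X) (i + j) (?h i j a b) : (inn C ?X)$n" unfolding n finner_def using h by simp
 note op = copy_add[OF K, unfolded HC_Cx] copy_smult[OF K, unfolded HC_Cx]
 show "cd (HC C ?X) (i + j) (?h i j (a +[A,i] a') b) =
   cd (HC C ?X) (i + j) (?h i j a b) +[inn C ?X,n] cd (HC C ?X) (i + j) (?h i j a' b)" if a': "a' : A$i" for a'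
  unfolding n finner_def op(1)[OF h hc[OF n a' b]]
  by (rule arg_cong[where f = "cd _ _"], rule HM_ext[OF hc[OF n _ b] N.a_closed[OF h hc[OF n a' b]]])
   (use a a' A' in \<open>simp_all add: HM_ops e[OF n] fe_rules[OF B C refl] b fe_rules[OF A BC refl]\<close>)
 show "cd (HC C ?X) (i + j) (?h i j a (b +[B,j] b')) =
   cd (HC C ?X) (i + j) (?h i j a b) +[inn C ?X,n] cd (HC C ?X) (i + j) (?h i j a b')" if b': "b' : B$j" for b'
  unfolding n finner_def op(1)[OF h hc[OF n a b']]
  by (rule arg_cong[where f = "cd _ _"], rule HM_ext[OF hc[OF n a] N.a_closed[OF h hc[OF n a b']]])
   (use a b' B' in \<open>simp_all add: HM_ops e[OF n] fe_rules[OF B C refl] b fe_rules[OF A BC refl]\<close>)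
 show "cd (HC C ?X) (i + j) (?h i j (s *[A,i] a) b) = s *[inn C ?X,n] cd (HC C ?X) (i + j) (?h i j a b)"
  if s: "s : carrier R" for s
  unfolding n finner_def op(2)[OF h]
  by (rule arg_cong[where f = "cd _ _"], rule HM_ext[OF hc[OF n] N.smult_closed[OF s h]])
   (use a s A' B' b in \<open>simp_all add: HM_ops e[OF n] fe_rules[OF B C refl] fe_rules[OF A BC refl]\<close>)
 show "cd (HC C ?X) (i + j) (?h i j a (s *[B,j] b)) = s *[inn C ?X,n] cd (HC C ?X) (i + j) (?h i j a b)"
  if s: "s : carrier R" for s
  unfolding n finner_def op(2)[OF h]
  by (rule arg_cong[where f = "cd _ _"], rule HM_ext[OF hc[OF n] N.smult_closed[OF s h]])
   (use a s A' B' b in \<open>simp_all add: HM_ops e[OF n] fe_rules[OF B C refl] fe_rules[OF A BC refl]\<close>)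
 have n1: "i+1 + j = n+1" and n2: "i + (j+1) = n+1" using n by auto
 interpret N1: module R "HM C ?X (n+1)" by (rule HM_mod[OF C' X'])
 note h1 = hc[OF n1 d_simps(1)[OF A' a] b] and h2 = hc[OF n2 a d_simps(1)[OF B' b]]
 note h2' = alt_closed[OF N1.module_axioms h2, of i]
 have "Df (HC C ?X) n (?h i j a b) =
   ?h (i+1) j (Df A i a) b +[HM C ?X (n+1)] alt (HM C ?X (n+1)) i (?h i (j+1) a (Df B j b))"
 proof (rule HM_ext[OF dHM(1)[OF C' X' h] N1.a_closed[OF h1 h2']])
  fix m c assume c: "c : C$m"
  have k: "m + (n+1) = m + n+1" and k1: "i + (j + m) = m + n" and k2: "i+1 + (j + m) = m + n+1"
   and k3: "j + m+1 = j+1 + m" and k4: "i + (j+1 + m) = m + n+1" and k5: "j + (m+1) = j+1 + m" using n by auto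
  let ?M = "Cx ?X (m + n+1)"
  interpret M: module R ?M using X' by simp
  note bc = fe_in[OF B C refl b c]
  let ?x = "fe A (tn B C) (i+1) (j + m) (Df A i a) (fe B C j m b c)"
  let ?y = "fe A (tn B C) i (j+1 + m) a (fe B C (j+1) m (Df B j b) c)"
  let ?z = "fe A (tn B C) i (j+1 + m) a (fe B C j (m+1) b (Df C m c))"
  have b1: "fe B C (j+1) m (Df B j b) c : (tn B C)$(j+1 + m)"
   using fe_in[OF B C refl d_simps(1)[OF B' b] c] .
  have b2: "fe B C j (m+1) b (Df C m c) : (tn B C)$(j+1 + m)"
   using fe_in[OF B C k5 b d_simps(1)[OF C' c]] .
  have x: "?x : carrier ?M" by (rule fe_in[OF A BC k2 d_simps(1)[OF A' a] bc])
  have y: "?y : carrier ?M" by (rule fe_in[OF A BC k4 a b1])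
  have z: "?z : carrier ?M" by (rule fe_in[OF A BC k4 a b2])
  have alt: "alt (HM C ?X (n+1)) i f m c = alt (Cx ?X (m + n+1)) i (f m c)" if "f : carrier (HM C ?X (n+1))" for f
  proof -
   have "(-[HM C ?X (n+1)] f) = (\<ominus> \<one>) *[HM C ?X (n+1)] f"
    using that by (simp add: N1.smult_l_minus)
   thus ?thesis unfolding alt_sign_def
    using c HM_in[OF that c] by (simp add: HM_ops k M.smult_l_minus)
  qed
  \<comment> \<open>The Leibniz term that differentiates c carries the sign (-1)^(i+j) and cancels
    against the correction term of the hom differential.\<close>
  have "Df (HC C ?X) n (?h i j a b) m c = Df ?X (m + n) (fe A (tn B C) i (j + m) a (fe B C j m b c)) -[?M] alt ?M n ?z"
   unfolding dHM(2)[OF C' X' h c] using c C' by (simp add: k5)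
  also have "Df ?X (m + n) (fe A (tn B C) i (j + m) a (fe B C j m b c)) =
    ?x +[?M] alt ?M i (?y +[?M] alt ?M j ?z)"
   using fe_d[OF A BC k1 a bc] fe_addr[OF A BC k4 a b1, of "alt (Cx (tn B C) (j+1 + m)) j (fe B C j (m+1) b (Df C m c))"]
    fe_alt(2)[OF A BC k4 a b2, of j] BC' b2 unfolding fe_d[OF B C refl b c] k3 by simp
  also have "\<dots> -[?M] alt ?M n ?z = ?x +[?M] alt ?M i ?y"
  proof -
   have "alt ?M i (?y +[?M] alt ?M j ?z) = alt ?M i ?y +[?M] alt ?M n ?z"
    using y z X' n by (simp add: cx_alt_rules(1) cx_alt_alt)
   thus ?thesis using x y z X' cx_alt[OF X' y, of i] cx_alt[OF X' z, of n]
    by (simp add: a_minus_def M.a_assoc M.r_neg)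
  qed
  also have "\<dots> = (?h (i+1) j (Df A i a) b +[HM C ?X (n+1)]
    alt (HM C ?X (n+1)) i (?h i (j+1) a (Df B j b))) m c"
   using c unfolding HM_ops k by (simp add: alt[OF h2])
  finally show "Df (HC C ?X) n (?h i j a b) m c = (?h (i+1) j (Df A i a) b +[HM C ?X (n+1)]
    alt (HM C ?X (n+1)) i (?h i (j+1) a (Df B j b))) m c" .
 qed
 moreover have "alt (Cx (cpy (HC C ?X)) (n+1)) i (cd (HC C ?X) (n+1) f) = cd (HC C ?X) (n+1) (alt (HM C ?X (n+1)) i f)"
  if "f : carrier (HM C ?X (n+1))" for f
  unfolding alt_sign_def using copy_neg[OF K, of f "n+1"] that by simp
 ultimately show "Df (inn C ?X) n (cd (HC C ?X) (i + j) (?h i j a b)) =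
   cd (HC C ?X) (i+1 + j) (?h (i+1) j (Df A i a) b) +[inn C ?X,n+1]
   alt (Cx (inn C ?X) (n+1)) i (cd (HC C ?X) (i + (j+1)) (?h i (j+1) a (Df B j b)))"
  unfolding n n1 n2 finner_def using op(1)[OF h1 h2'] copy_d[OF K, of _ n] h h2 by simp
next
 fix i j n a b p q assume n: "i + j = n" and a: "a : Fl A p i" and b: "b : Fl B q j"
 have "?h i j a b : Fl (HC C ?X) (p + q) n" unfolding HC_Fl
 proof (intro conjI allI ballI hc[OF n Fl_car[OF a A'] Fl_car[OF b B']])
  fix t m c assume c: "c : Fl C t m"
  have "fe A (tn B C) i (j + m) a (fe B C j m b c) : Fl ?X (p + q + t) (m + n)"
   by (rule fe_Fl[OF A BC e[OF n, symmetric] a fe_Fl[OF B C refl b c refl]]) simp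
  thus "?h i j a b m c : Fl ?X (p + q + t) (m + n)" using Fl_car[OF c C'] by simp
 qed
 thus "cd (HC C ?X) (i + j) (?h i j a b) : Fl (inn C ?X) (p + q) n" unfolding n finner_def copy_Fl by blast
qed
then obtain h where h: "h : hom (tn A B) (inn C ?X)"
 and he: "\<And>i j a b. a : A$i ==> b : B$j ==> Map h (i + j) (fe A B i j a b) = cd (HC C ?X) (i + j) (?h i j a b)"
 by blast
let ?f = "ev C ?X \<star> (h \<boxtimes> Idt FC C)"
let ?P = "%h. h : hom (tn (tn A B) C) ?X \<and> (\<forall>i j k. \<forall>a\<in>A$i. \<forall>b\<in>B$j. \<forall>c\<in>C$k.
  Map h (i + j + k) (fe (tn A B) C (i + j) k (fe A B i j a b) c) = fe A (tn B C) i (j + k) a (fe B C j k b c))"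
note hI = tarrI[OF h idI[OF C]]
have P: "?P ?f"
proof (intro conjI allI ballI)
 show "?f : hom (tn (tn A B) C) ?X" by (rule cmpI[OF hI ev_hom[OF C X]])
 fix i j k a b c assume a: "a : A$i" and b: "b : B$j" and c: "c : C$k"
 note ab = fe_in[OF A B refl a b]
 show "Map ?f (i + j + k) (fe (tn A B) C (i + j) k (fe A B i j a b) c) = fe A (tn B C) i (j + k) a (fe B C j k b c)"
  unfolding cmp_map[OF hI fe_in[OF AB C refl ab c]] tarr_fe[OF h idI[OF C] refl ab c] he[OF a b] Idt_map[OF c]
   ev_fe[OF C X refl hc[OF refl a b] c] using c by simp
qed
have U: "h1 = h2" if "?P h1" "?P h2" for h1 h2
 by (rule tri_ext[OF A B C conjunct1[OF that(1)] conjunct1[OF that(2)]]) (use that in auto)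
have "\<exists>!h. ?P h" by (rule ex1I[of ?P, OF P U[OF _ P]])
hence "?P (THE h. ?P h)" by (rule theI')
moreover have "asc A B C = (THE h. ?P h)" unfolding filtered_category_def by simp
ultimately have P: "?P (asc A B C)" by simp
thus "asc A B C : hom (tn (tn A B) C) (tn A (tn B C))" by blast
show "i + j = p ==> p + k = n ==> j + k = q ==> a : A$i ==> b : B$j ==> c : C$k ==>
  Map (asc A B C) n (fe (tn A B) C p k (fe A B i j a b) c) = fe A (tn B C) i q a (fe B C j k b c)" using P by auto
qed

section \<open>The unit and the unit constraints\<close>

abbreviation I0 :: "('r, 'u) fcomplex" where "I0 \<equiv> funit R"
abbreviation un :: "'r => 'u" where "un \<equiv> cd (sphere R 0 0) 0"

lemma sphere_sel [simp]:
"Cx (sphere R p n) m = (regular_module R)\<lparr>carrier := if m = n then carrier R else {\<zero>}\<rparr>"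
"Fl (sphere R p n) q m = (if p \<le> q then if m = n then carrier R else {\<zero>} else {\<zero>})"
"x : (if m = n then carrier R else {\<zero>}) ==> Df (sphere R p n) m x = \<zero>"
unfolding sphere_def Let_def by simp_all

lemma sphere_cpx: "cpx (sphere R p n)"
proof (rule cpxI)
let ?K = "sphere R p n"
have m: "module R ((regular_module R)\<lparr>carrier := if m = n then carrier R else {\<zero>}\<rparr>)" for m :: int
 by (rule reg_module) auto
show "fcx ?K"
proof (rule filtered_complex.intro)
 fix m q :: int
 show "module R (Cx ?K m)" using m by simp
 show "Df ?K m : lin R (Cx ?K m) (Cx ?K (m+1))"
  by (rule lin_mapsI) (auto simp: sphere_def Let_def split: if_splits)
 show "submodule (Fl ?K q m) R (Cx ?K m)"
  by (rule submoduleI') (simp add: m, auto split: if_splits)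
 show "Df ?K m ` Fl ?K q m \<subseteq> Fl ?K q (m+1)"
  by (auto split: if_splits)
qed (auto split: if_splits)
show "sm (?K$m)" for m using smR by (simp add: sm_finite)
qed

lemma I0_Ob [simp]: "I0 : Ob"
unfolding funit_def by (rule copy_Ob[OF sphere_cpx])

lemma I0_carrier: "I0$0 = un ` carrier R" "n \<noteq> 0 ==> I0$n = {0[I0,n]}"
unfolding funit_def copy_car copy_zero by simp_all

lemma un_rules:
assumes s: "s : carrier R"
shows un_in: "un s : I0$0"
 and un_add: "t : carrier R ==> un s +[I0,0] un t = un (s \<oplus> t)"
 and un_smult: "t : carrier R ==> t *[I0,0] un s = un (t \<otimes> s)"
 and un_d: "Df I0 0 (un s) = 0[I0,1]"
 and un_Fl: "0 \<le> q ==> un s : Fl I0 q 0"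
 and un_decode: "decode (carrier R) (un s) = s"
using s copy_add[OF sphere_cpx, of s 0 0 0 t] copy_smult[OF sphere_cpx, of s 0 0 0 t]
 copy_d[OF sphere_cpx, of s 0 0 0] cpx_decode[OF sphere_cpx, of s 0 0 0]
unfolding funit_def copy_zero copy_Fl by (simp_all add: copy_car)

lemma I0_Fl: "u : Fl I0 q n ==> u = 0[I0,n] \<or> 0 \<le> q"
unfolding funit_def copy_zero copy_Fl by (auto split: if_splits)

text \<open>The unit vanishes outside degree 0, so only tensors with a scalar on the left
  contribute.\<close>

lemma unit_ext:
assumes A: "A : Ob" and f: "f : hom (tn I0 A) X" and g: "g : hom (tn I0 A) X"
 and eq: "\<And>n s a. s : carrier R ==> a : A$n ==> Map f n (fe I0 A 0 n (un s) a) = Map g n (fe I0 A 0 n (un s) a)"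
shows "f = g"
proof (rule tn_ext[OF I0_Ob A f g refl])
fix i j n u a assume n: "i + j = n" and u: "u : I0$i" and a: "a : A$j"
show "Map f n (fe I0 A i j u a) = Map g n (fe I0 A i j u a)"
proof (cases "i = 0")
 case True
 thus ?thesis using u eq[of _ a n] a n by (auto simp: I0_carrier)
next
 case False
 hence "fe I0 A i j u a = 0[tn I0 A,n]" using u fe_zero(1)[OF I0_Ob A n a] by (simp add: I0_carrier)
 thus ?thesis using f g by simp
qed
qed

abbreviation lu where "lu \<equiv> left_unit FC"
abbreviation ru where "ru \<equiv> right_unit FC"

lemma left_unit:
assumes A: "A : Ob"
shows lu_hom: "lu A : hom (tn I0 A) A"
 and lu_fe: "s : carrier R ==> a : A$n ==> Map (lu A) n (fe I0 A 0 n (un s) a) = s *[A,n] a"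
proof -
have A': "fcx A" using A by simp
let ?g = "%i j u a. if i = 0 then decode (carrier R) u *[A,j] a else 0[A,i + j]"
have I: "u : I0$i ==> (i = 0 --> (\<exists>s\<in>carrier R. u = un s)) \<and> (i \<noteq> 0 --> u = 0[I0,i])" for u i
 by (auto simp: I0_carrier)
note un = un_rules
have z: "0[I0,0] = un \<zero>" unfolding funit_def copy_zero by simp
have "\<exists>h\<in>hom (tn I0 A) A. \<forall>i j. \<forall>u\<in>I0$i. \<forall>a\<in>A$j. Map h (i + j) (fe I0 A i j u a) = ?g i j u a"
proof (rule tn_lift[OF I0_Ob A A])
 fix i j n u a assume n: "i + j = n" and u: "u : I0$i" and a: "a : A$j"
 consider (0) s where "i = 0" "j = n" "s : carrier R" "u = un s" | (1) "i \<noteq> 0" "u = 0[I0,i]"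
  using I[OF u] n by (metis add_0)
 note c = this
 show "?g i j u a : A$n" using c by cases (use a A' n un in auto)
 show "?g i j (u +[I0,i] v) a = ?g i j u a +[A,n] ?g i j v a" if "v : I0$i" for v
  using c I[OF that] by cases (use a A' n un in \<open>auto simp: cx_smult\<close>)
 show "?g i j u (a +[A,j] b) = ?g i j u a +[A,n] ?g i j u b" if "b : A$j" for b
  using c that by cases (use a A' n un in \<open>auto simp: cx_smult\<close>)
 show "?g i j (s *[I0,i] u) a = s *[A,n] ?g i j u a" "?g i j u (s *[A,j] a) = s *[A,n] ?g i j u a"
  if s: "s : carrier R" for s
 proof -
  show "?g i j (s *[I0,i] u) a = s *[A,n] ?g i j u a"
   using c s by cases (use a A' n un in \<open>auto simp: cx_smult\<close>)
  show "?g i j u (s *[A,j] a) = s *[A,n] ?g i j u a"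
   using c s by cases (use a A' n un in \<open>auto simp: cx_smult(3)[symmetric] m_comm\<close>)
 qed
 show "Df A n (?g i j u a) = ?g (i+1) j (Df I0 i u) a +[A,n+1]
   alt (Cx A (n+1)) i (?g i (j+1) u (Df A j a))"
 proof (cases "i = 0")
  case True
  then obtain s where "s : carrier R" "u = un s" using I[OF u] by auto
  thus ?thesis using True n a A' un d_simps(1)[OF A' a] by (auto simp: ac_simps)
 next
  case False
  hence u: "Df I0 i u = 0[I0,i+1]" using I[OF u] by simp
  have e: "i + (j+1) = n+1" "i+1 + j = n+1" using n by auto
  have "(if i+1 = 0 then decode (carrier R) (Df I0 i u) *[A,j] a else 0[A,n+1]) = 0[A,n+1]"
  proof (cases "i+1 = 0")
   case True
   hence "j = n+1" using n by simp
   thus ?thesis using True a A' un(6)[of \<zero>] unfolding u z[symmetric] True by simp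
  qed simp
  thus ?thesis unfolding n e using False A' alt_zero[OF cx_mod[OF A'], of "n+1" i] by simp
 qed
next
 fix i j n u a p q assume n: "i + j = n" and u: "u : Fl I0 p i" and a: "a : Fl A q j"
 have ac: "a : A$j" by (rule Fl_car[OF a A'])
 show "?g i j u a : Fl A (p + q) n"
 proof (cases "i = 0")
  case True
  then obtain s where s: "s : carrier R" "u = un s" using I[OF Fl_car[OF u]] by auto
  show ?thesis
  proof (cases "0 \<le> p")
   case True
   hence "a : Fl A (p + q) j" using Fl_le[OF a _ A'] by simp
   thus ?thesis using \<open>i = 0\<close> n s un(6)[OF s(1)] Fl_smult[OF A'] by simp
  next
   case False
   hence "decode (carrier R) u = \<zero>" using I0_Fl[OF u] \<open>i = 0\<close> un(6)[of \<zero>] z by auto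
   thus ?thesis using \<open>i = 0\<close> n ac A' by simp
  qed
 qed (use A' n in auto)
qed
then obtain h where h: "h : hom (tn I0 A) A" "\<And>i j u a. u : I0$i ==> a : A$j ==>
  Map h (i + j) (fe I0 A i j u a) = ?g i j u a" by blast
let ?P = "%h. h : hom (tn I0 A) A \<and> (\<forall>i. \<forall>s\<in>carrier R. \<forall>a\<in>A$i. Map h i (fe I0 A 0 i (un s) a) = s *[A,i] a)"
have P: "?P h" using h(1) h(2)[OF un(1), of _ _] un(6) by fastforce
have U: "h1 = h2" if "?P h1" "?P h2" for h1 h2
 by (rule unit_ext[OF A conjunct1[OF that(1)] conjunct1[OF that(2)]]) (use that in auto)
have "\<exists>!h. ?P h" by (rule ex1I[of ?P, OF P U[OF _ P]])
hence "?P (THE h. ?P h)" by (rule theI')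
moreover have "lu A = (THE h. ?P h)" unfolding filtered_category_def cd_def by simp
ultimately have "?P (lu A)" by simp
thus "lu A : hom (tn I0 A) A"
 "s : carrier R ==> a : A$n ==> Map (lu A) n (fe I0 A 0 n (un s) a) = s *[A,n] a" by blast+
qed

text \<open>Obtained from the left unit through the braiding; the scalar has degree 0, so no sign
  appears.\<close>

lemma right_unit:
assumes A: "A : Ob"
shows ru_eq: "ru A = lu A \<star> br A I0"
 and ru_fe: "s : carrier R ==> a : A$n ==> Map (ru A) n (fe A I0 n 0 a (un s)) = s *[A,n] a"
proof -
let ?h = "lu A \<star> br A I0"
note b = br_hom[OF A I0_Ob] and b' = br_hom[OF I0_Ob A]
note h = cmpI[OF b lu_hom[OF A]]
have n: "n + 0 = n" "0 + n = n" for n :: int by auto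
let ?P = "%h. h : hom (tn A I0) A \<and> (\<forall>i. \<forall>s\<in>carrier R. \<forall>a\<in>A$i. Map h i (fe A I0 i 0 a (un s)) = s *[A,i] a)"
have P: "?P ?h"
proof (intro conjI h allI ballI)
 fix i s a assume s: "s : carrier R" and a: "a : A$i"
 show "Map ?h i (fe A I0 i 0 a (un s)) = s *[A,i] a"
  using lu_fe[OF A s a] by (simp add: cmp_map[OF b fe_in[OF A I0_Ob n(1) a un_in[OF s]]]
    br_fe[OF A I0_Ob n(1) a un_in[OF s]])
qed
have eq: "h1 = ?h" if h1: "?P h1" for h1
proof -
 interpret category FC by (rule category_FC)
 have "h1 \<star> br I0 A = lu A"
 proof (rule unit_ext[OF A cmpI[OF b' conjunct1[OF h1]] lu_hom[OF A]])
  fix n s a assume s: "s : carrier R" and a: "a : A$n"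
  show "Map (h1 \<star> br I0 A) n (fe I0 A 0 n (un s) a) = Map (lu A) n (fe I0 A 0 n (un s) a)"
   using h1 s a lu_fe[OF A s a] by (simp add: cmp_map[OF b' fe_in[OF I0_Ob A n(2) un_in[OF s] a]]
    br_fe[OF I0_Ob A n(2) un_in[OF s] a])
 qed
 hence "?h = (h1 \<star> br I0 A) \<star> br A I0" by simp
 also have "\<dots> = h1 \<star> (br I0 A \<star> br A I0)"
  using Cmp_assoc[unfolded FC_simps, OF b b'] h1 by metis
 also have "\<dots> = h1" unfolding br_br[OF A I0_Ob] using Cmp_Idt[of h1 "tn A I0" A] h1 by simp
 finally show "h1 = ?h" by simp
qed
have "(THE h. ?P h) = ?h" by (rule the_equality[of ?P, OF P eq])
thus e: "ru A = ?h" unfolding filtered_category_def cd_def by simp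
show "s : carrier R ==> a : A$n ==> Map (ru A) n (fe A I0 n 0 a (un s)) = s *[A,n] a"
 unfolding e using P by blast
qed

lemma ru_hom: "A : Ob ==> ru A : hom (tn A I0) A"
unfolding ru_eq by (rule cmpI[OF br_hom lu_hom]) auto

lemma tarr_Cmp:
assumes f: "f : hom A A'" "f' : hom A' A''" and g: "g : hom B B'" "g' : hom B' B''"
shows "(f' \<star> f) \<boxtimes> (g' \<star> g) = (f' \<boxtimes> g') \<star> (f \<boxtimes> g)"
proof -
note A = hom_Ob[OF f(1)] and B = hom_Ob[OF g(1)]
note ff = cmpI[OF f] and gg = cmpI[OF g]
note t = tarrI[OF f(1) g(1)] and t' = tarrI[OF f(2) g(2)]
show ?thesis
proof (rule tn_ext[OF A(1) B(1) tarrI[OF ff gg] cmpI[OF t t'] refl])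
 fix i j n a b assume n: "i + j = n" and a: "a : A$i" and b: "b : B$j"
 show "Map ((f' \<star> f) \<boxtimes> (g' \<star> g)) n (fe A B i j a b) =
   Map ((f' \<boxtimes> g') \<star> (f \<boxtimes> g)) n (fe A B i j a b)"
  using a b f g by (simp add: tarr_fe[OF ff gg n] tarr_fe[OF f(1) g(1) n] tarr_fe[OF f(2) g(2) n]
    cmp_map[OF t fe_in[OF A(1) B(1) n a b]] cmp_map[OF f(1)] cmp_map[OF g(1)])
qed
qed

lemma tarr_Idt: "A : Ob ==> B : Ob ==> Idt FC A \<boxtimes> Idt FC B = Idt FC (tn A B)"
by (rule tn_ext[OF _ _ tarrI idI])
 (auto simp: tarr_fe[OF idI idI] fe_in)

text \<open>The inverse is an associator conjugated by braidings: A(BC) -> (BC)A -> (CB)A -> C(BA)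
  -> (BA)C -> (AB)C. The Koszul signs have total exponent iq + jk + kp + ji, which is even for q = j
  + k and p = i + j.\<close>

lemma asc_inverse:
assumes A: "A : Ob" and B: "B : Ob" and C: "C : Ob"
shows "\<exists>g\<in>hom (tn A (tn B C)) (tn (tn A B) C). \<forall>i j k q p n. \<forall>a\<in>A$i. \<forall>b\<in>B$j. \<forall>c\<in>C$k.
 j + k = q --> i + q = n --> i + j = p -->
 Map g n (fe A (tn B C) i q a (fe B C j k b c)) = fe (tn A B) C p k (fe A B i j a b) c"
proof (intro bexI ballI allI impI)
let ?g1 = "br A (tn B C)" and ?g2 = "br B C \<boxtimes> Idt FC A" and ?g3 = "asc C B A" and ?g4 = "br C (tn B A)"
 and ?g5 = "br B A \<boxtimes> Idt FC C"
note O = A B C tn_Ob[OF B C] tn_Ob[OF C B] tn_Ob[OF B A] tn_Ob[OF A B]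
note h1 = br_hom[OF A O(4)] and h2 = tarrI[OF br_hom[OF B C] idI[OF A]] and h3 = asc_hom[OF C B A]
 and h4 = br_hom[OF C O(6)] and h5 = tarrI[OF br_hom[OF B A] idI[OF C]]
let ?g = "?g5 \<star> (?g4 \<star> (?g3 \<star> (?g2 \<star> ?g1)))"
note c2 = cmpI[OF h1 h2] note c3 = cmpI[OF c2 h3] note c4 = cmpI[OF c3 h4]
show "?g : hom (tn A (tn B C)) (tn (tn A B) C)" by (rule cmpI[OF c4 h5])
fix i j k q p n a b c
assume a: "a : A$i" and b: "b : B$j" and c: "c : C$k"
 and q: "j + k = q" and n: "i + q = n" and p: "i + j = p"
have q': "k + j = q" and n': "q + i = n" and p': "j + i = p" and kp: "k + p = n" and pk: "p + k = n" using q n p by auto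
note bc = fe_in[OF B C q b c] and cb = fe_in[OF C B q' c b] and ba = fe_in[OF B A p' b a] and ab = fe_in[OF A B p a b]
note x0 = fe_in[OF A O(4) n a bc] and x1 = fe_in[OF O(4) A n' bc a] and x2 = fe_in[OF O(5) A n' cb a]
 and x3 = fe_in[OF C O(6) kp c ba] and x4 = fe_in[OF O(6) C pk ba c] and x5 = fe_in[OF O(7) C pk ab c]
note FF = Ob_fcx[OF tn_Ob[OF O(4) A]] Ob_fcx[OF tn_Ob[OF O(5) A]] Ob_fcx[OF tn_Ob[OF C O(6)]] Ob_fcx[OF tn_Ob[OF O(6) C]] Ob_fcx[OF tn_Ob[OF O(7) C]]
have "Map ?g n (fe A (tn B C) i q a (fe B C j k b c)) =
  alt (Cx (tn (tn A B) C) n) (i * q + j * k + k * p + j * i) (fe (tn A B) C p k (fe A B i j a b) c)"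
 using x1 x2 x3 x4 x5 FF
 by (simp add: cmp_map[OF c4 x0] cmp_map[OF c3 x0] cmp_map[OF c2 x0] cmp_map[OF h1 x0] br_fe[OF A O(4) n a bc]
   map_alt[OF h2] map_alt[OF h3] map_alt[OF h4] map_alt[OF h5]
   tarr_fe[OF br_hom[OF B C] idI[OF A] n' bc a] br_fe[OF B C q b c] a c
   fe_alt(1)[OF O(5) A n' cb a] asc_fe[OF C B A q' n' p' c b a] br_fe[OF C O(6) kp c ba]
   tarr_fe[OF br_hom[OF B A] idI[OF C] pk ba c] br_fe[OF B A p' b a] fe_alt(1)[OF O(7) C pk ab c]
   cx_alt_alt)
also have "\<dots> = fe (tn A B) C p k (fe A B i j a b) c"
 by (rule alt_even) (simp add: q[symmetric] p[symmetric] algebra_simps)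
finally show "Map ?g n (fe A (tn B C) i q a (fe B C j k b c)) = fe (tn A B) C p k (fe A B i j a b) c" .
qed

lemma asc_iso:
assumes A: "A : Ob" and B: "B : Ob" and C: "C : Ob" shows "is_iso FC (asc A B C)"
proof -
obtain g where g: "g : hom (tn A (tn B C)) (tn (tn A B) C)"
 and ge: "\<And>i j k q p n a b c. a : A$i ==> b : B$j ==> c : C$k ==>
  j + k = q ==> i + q = n ==> i + j = p ==>
  Map g n (fe A (tn B C) i q a (fe B C j k b c)) = fe (tn A B) C p k (fe A B i j a b) c"
 using asc_inverse[OF A B C] by blast
note f = asc_hom[OF A B C] and BC = tn_Ob[OF B C] and AB = tn_Ob[OF A B]
show ?thesis
proof (rule isoI[OF f g])
 show "g \<star> asc A B C = Idt FC (tn (tn A B) C)"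
 proof (rule tri_ext[OF A B C cmpI[OF f g] idI[OF tn_Ob[OF AB C]]])
  fix i j k p n a b c assume p: "i + j = p" and n: "p + k = n"
   and a: "a : A$i" and b: "b : B$j" and c: "c : C$k"
  have n': "i + (j + k) = n" using n p by simp
  note x = fe_in[OF AB C n fe_in[OF A B p a b] c]
  show "Map (g \<star> asc A B C) n (fe (tn A B) C p k (fe A B i j a b) c) =
    Map (Idt FC (tn (tn A B) C)) n (fe (tn A B) C p k (fe A B i j a b) c)"
   unfolding cmp_map[OF f x] asc_fe[OF A B C p n refl a b c] ge[OF a b c refl n' p] Idt_map[OF x] ..
 qed
 show "asc A B C \<star> g = Idt FC (tn A (tn B C))"
 proof (rule tri_ext_right[OF A B C cmpI[OF g f] idI[OF tn_Ob[OF A BC]]])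
  fix i j k q n a b c assume q: "j + k = q" and n: "i + q = n"
   and a: "a : A$i" and b: "b : B$j" and c: "c : C$k"
  have n': "i + j + k = n" using n q by simp
  note x = fe_in[OF A BC n a fe_in[OF B C q b c]]
  show "Map (asc A B C \<star> g) n (fe A (tn B C) i q a (fe B C j k b c)) =
    Map (Idt FC (tn A (tn B C))) n (fe A (tn B C) i q a (fe B C j k b c))"
   unfolding cmp_map[OF g x] ge[OF a b c q n refl] asc_fe[OF A B C refl n' q a b c] Idt_map[OF x] ..
 qed
qed
qed

lemma lu_iso:
assumes A: "A : Ob" shows "is_iso FC (lu A)"
proof -
have A': "fcx A" using A by simp
let ?k = "%n a. fe I0 A 0 n (un \<one>) a"
let ?g = "mk_arr A (tn I0 A) ?k"
have n: "0 + n = n" "0 + (n+1) = n+1" "1 + n = n+1" for n :: int by auto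
note r = fe_rules[OF I0_Ob A n(1) un_in[OF one_closed]]
have g: "?g : hom A (tn I0 A)"
proof (rule mk_arr_hom[OF A tn_Ob[OF I0_Ob A]], rule fmapI)
 fix n a assume a: "a : A$n"
 show "?k n a : (tn I0 A)$n" by (rule r(1)[OF a])
 show "?k n (a +[A,n] b) = ?k n a +[tn I0 A,n] ?k n b" if "b : A$n" for b by (rule r(3)[OF a that])
 show "?k n (s *[A,n] a) = s *[tn I0 A,n] ?k n a" if "s : carrier R" for s by (rule r(5)[OF a that])
 have "fe I0 A 1 n 0[I0,1] a = 0[tn I0 A,n+1]" by (rule fe_zero(1)[OF I0_Ob A n(3) a])
 thus "Df (tn I0 A) n (?k n a) = ?k (n+1) (Df A n a)"
  using r(6)[OF a] r(1)[OF d_simps(1)[OF A' a]] A by (simp add: un_d)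
next
 fix p n a assume "a : Fl A p n"
 thus "?k n a : Fl (tn I0 A) p n" by (intro fe_Fl[OF I0_Ob A n(1) un_Fl[OF one_closed order.refl]]) auto
qed
show ?thesis
proof (rule isoI[OF lu_hom[OF A] g])
 show "?g \<star> lu A = Idt FC (tn I0 A)"
 proof (rule unit_ext[OF A cmpI[OF lu_hom[OF A] g] idI[OF tn_Ob[OF I0_Ob A]]])
  fix n s a assume s: "s : carrier R" and a: "a : A$n"
  note x = fe_in[OF I0_Ob A n(1) un_in[OF s] a]
  have "s *[tn I0 A,n] fe I0 A 0 n (un \<one>) a = fe I0 A 0 n (un s) a"
   using fe_smultl[OF I0_Ob A n(1) un_in[OF one_closed] a s] s by (simp add: un_smult)
  thus "Map (?g \<star> lu A) n (fe I0 A 0 n (un s) a) = Map (Idt FC (tn I0 A)) n (fe I0 A 0 n (un s) a)"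
   unfolding cmp_map[OF lu_hom[OF A] x] lu_fe[OF A s a] Idt_map[OF x] using A' s a r(5)[OF a s] by simp
 qed
 show "lu A \<star> ?g = Idt FC A"
  by (rule hom_ext[OF cmpI[OF g lu_hom[OF A]] idI[OF A] refl])
   (use A' in \<open>simp add: cmp_map[OF g] lu_fe[OF A one_closed]\<close>)
qed
qed

lemma iso_Cmp:
assumes f: "f : hom A B" "is_iso FC f" and g: "g : hom B C" "is_iso FC g" shows "is_iso FC (g \<star> f)"
proof -
interpret category FC by (rule category_FC)
note as = Cmp_assoc[unfolded FC_simps] and idl = Idt_Cmp[unfolded FC_simps]
obtain f' where f': "f' : hom B A" "f' \<star> f = Idt FC A" "f \<star> f' = Idt FC B"
 using f(2) unfolding is_iso_def FC_simps hom_src[OF f(1)] hom_tgt[OF f(1)] by blast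
obtain g' where g': "g' : hom C B" "g' \<star> g = Idt FC B" "g \<star> g' = Idt FC C"
 using g(2) unfolding is_iso_def FC_simps hom_src[OF g(1)] hom_tgt[OF g(1)] by blast
note gf = cmpI[OF f(1) g(1)] and fg = cmpI[OF g'(1) f'(1)]
show ?thesis
proof (rule isoI[OF gf fg])
 show "f' \<star> g' \<star> (g \<star> f) = Idt FC A"
  unfolding as[OF gf g'(1) f'(1), symmetric] as[OF f(1) g(1) g'(1)] g'(2) idl[OF f(1)] f'(2) ..
 show "g \<star> f \<star> (f' \<star> g') = Idt FC C"
  unfolding as[OF fg f(1) g(1), symmetric] as[OF g'(1) f'(1) f(1)] f'(3) idl[OF g'(1)] g'(3) ..
qed
qed

lemma br_iso: "A : Ob ==> B : Ob ==> is_iso FC (br A B)"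
by (rule isoI[OF br_hom br_hom]) (auto simp: br_br)

lemma br_nat:
assumes f: "f : hom A A'" and g: "g : hom B B'"
shows "br A' B' \<star> (f \<boxtimes> g) = (g \<boxtimes> f) \<star> br A B"
proof -
note A = hom_Ob[OF f] and B = hom_Ob[OF g]
note b = br_hom[OF A(1) B(1)] and b' = br_hom[OF A(2) B(2)] and t = tarrI[OF f g] and t' = tarrI[OF g f]
show ?thesis
proof (rule tn_ext[OF A(1) B(1) cmpI[OF t b'] cmpI[OF b t'] refl])
 fix i j n a b assume n: "i + j = n" and a: "a : A$i" and b: "b : B$j"
 have n': "j + i = n" using n by simp
 note x = fe_in[OF A(1) B(1) n a b]
 show "Map (br A' B' \<star> (f \<boxtimes> g)) n (fe A B i j a b) = Map ((g \<boxtimes> f) \<star> br A B) n (fe A B i j a b)"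
  unfolding cmp_map[OF t x] cmp_map[OF \<open>br A B : _\<close> x] tarr_fe[OF f g n a b] br_fe[OF A(1) B(1) n a b]
   map_alt[OF t' fe_in[OF B(1) A(1) n' b a]] tarr_fe[OF g f n' b a]
   br_fe[OF A(2) B(2) n map_simps(1)[OF f a] map_simps(1)[OF g b]] ..
qed
qed

theorem closed_symmetric_monoidal_FC: "closed_symmetric_monoidal_category FC"
proof (intro closed_symmetric_monoidal_category.intro closed_symmetric_monoidal_category_axioms.intro category_FC;
 unfold FC_simps FC_tensor)
fix X Y X' Y' X'' Y'' f g f' g'
show "X : Ob ==> Y : Ob ==> tn X Y : Ob" by (rule tn_Ob)
show "f : hom X X' ==> g : hom Y Y' ==> f \<boxtimes> g : hom (tn X Y) (tn X' Y')" by (rule tarrI)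
show "X : Ob ==> Y : Ob ==> Idt FC X \<boxtimes> Idt FC Y = Idt FC (tn X Y)" by (rule tarr_Idt)
show "f : hom X X' ==> f' : hom X' X'' ==> g : hom Y Y' ==> g' : hom Y' Y'' ==>
  (f' \<star> f) \<boxtimes> (g' \<star> g) = (f' \<boxtimes> g') \<star> (f \<boxtimes> g)" by (rule tarr_Cmp)
show "I0 : Ob" by (rule I0_Ob)
show "X : Ob ==> is_iso FC (lu X) \<and> lu X : hom (tn I0 X) X" by (simp add: lu_iso lu_hom)
show "X : Ob ==> is_iso FC (ru X) \<and> ru X : hom (tn X I0) X"
 using iso_Cmp[OF br_hom[of X I0] br_iso[of X I0] lu_hom lu_iso] ru_eq[of X] ru_hom[of X] by simp
show "X : Ob ==> Y : Ob ==> br X Y : hom (tn X Y) (tn Y X)" by (rule br_hom)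
show "f : hom X X' ==> g : hom Y Y' ==> br X' Y' \<star> (f \<boxtimes> g) = (g \<boxtimes> f) \<star> br X Y" by (rule br_nat)
show "X : Ob ==> Y : Ob ==> br Y X \<star> br X Y = Idt FC (tn X Y)" by (rule br_br)
show "X : Ob ==> Y : Ob ==> inn X Y : Ob \<and> ev X Y : hom (tn (inn X Y) X) Y" by (simp add: ev_hom)
show "X : Ob ==> Y : Ob ==> Z : Ob ==> f : hom (tn Z X) Y ==>
  \<exists>!g. g : hom Z (inn X Y) \<and> ev X Y \<star> (g \<boxtimes> Idt FC X) = f" for Z
 by (rule ex1I[of _ "transpose Z X Y f"]) (auto simp: transpose_hom ev_transpose transpose_unique)
next
fix f X Y assume f: "f : hom X Y"
note O = hom_Ob[OF f]
have n: "0 + n = n" for n :: int by simp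
note t = tarrI[OF idI[OF I0_Ob] f]
show l: "lu Y \<star> (Idt FC I0 \<boxtimes> f) = f \<star> lu X"
proof (rule unit_ext[OF O(1) cmpI[OF t lu_hom[OF O(2)]] cmpI[OF lu_hom[OF O(1)] f]])
 fix n s a assume s: "s : carrier R" and a: "a : X$n"
 note x = fe_in[OF I0_Ob O(1) n un_in[OF s] a]
 show "Map (lu Y \<star> (Idt FC I0 \<boxtimes> f)) n (fe I0 X 0 n (un s) a) = Map (f \<star> lu X) n (fe I0 X 0 n (un s) a)"
  unfolding cmp_map[OF t x] cmp_map[OF lu_hom[OF O(1)] x] lu_fe[OF O(1) s a]
   tarr_fe[OF idI[OF I0_Ob] f n un_in[OF s] a] Idt_map[OF un_in[OF s]]
   lu_fe[OF O(2) s map_simps(1)[OF f a]] map_simps(6)[OF f s a] ..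
qed
interpret category FC by (rule category_FC)
note as = Cmp_assoc[unfolded FC_simps]
note bX = br_hom[OF O(1) I0_Ob] and bY = br_hom[OF O(2) I0_Ob] and t' = tarrI[OF f idI[OF I0_Ob]]
show "ru Y \<star> (f \<boxtimes> Idt FC I0) = f \<star> ru X"
 unfolding ru_eq[OF O(1)] ru_eq[OF O(2)] as[OF t' bY lu_hom[OF O(2)], symmetric] br_nat[OF f idI[OF I0_Ob]]
  as[OF bX t lu_hom[OF O(2)]] l as[OF bX lu_hom[OF O(1)] f] ..
next
fix X Y assume O: "X : Ob" "Y : Ob"
note t1 = tarrI[OF idI[OF O(1)] lu_hom[OF O(2)]] and t2 = tarrI[OF ru_hom[OF O(1)] idI[OF O(2)]]
note al = asc_hom[OF O(1) I0_Ob O(2)]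
show "(Idt FC X \<boxtimes> lu Y) \<star> asc X I0 Y = ru X \<boxtimes> Idt FC Y"
proof (rule tri_ext[OF O(1) I0_Ob O(2) cmpI[OF al t1] t2])
 fix i j k p n a u c assume p: "i + j = p" and n: "p + k = n"
  and a: "a : X$i" and u: "u : I0$j" and c: "c : Y$k"
 note au = fe_in[OF O(1) I0_Ob p a u]
 note x = fe_in[OF tn_Ob[OF O(1) I0_Ob] O(2) n au c]
 show "Map ((Idt FC X \<boxtimes> lu Y) \<star> asc X I0 Y) n (fe (tn X I0) Y p k (fe X I0 i j a u) c) =
   Map (ru X \<boxtimes> Idt FC Y) n (fe (tn X I0) Y p k (fe X I0 i j a u) c)"
 proof (cases "j = 0")
  case True
  hence pi: "p = i" and n: "i + k = n" using p n by auto
  obtain s where s: "s : carrier R" "u = un s" using u True by (auto simp: I0_carrier)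
  note us = un_in[OF s(1)]
  have z: "i + 0 = i" "0 + k = k" by auto
  note x' = fe_in[OF tn_Ob[OF O(1) I0_Ob] O(2) n fe_in[OF O(1) I0_Ob z(1) a us] c]
  show ?thesis unfolding True pi s(2) cmp_map[OF al x'] asc_fe[OF O(1) I0_Ob O(2) z(1) n z(2) a us c]
    tarr_fe[OF idI[OF O(1)] lu_hom[OF O(2)] n a fe_in[OF I0_Ob O(2) z(2) us c]]
    tarr_fe[OF ru_hom[OF O(1)] idI[OF O(2)] n fe_in[OF O(1) I0_Ob z(1) a us] c]
    Idt_map[OF a] Idt_map[OF c] lu_fe[OF O(2) s(1) c] ru_fe[OF O(1) s(1) a]
    fe_smultl[OF O n a c s(1)] fe_smultr[OF O n a c s(1)] ..
 next
  case False
  hence "fe X I0 i j a u = 0[tn X I0,p]" using u fe_zero(2)[OF O(1) I0_Ob p a] by (simp add: I0_carrier)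
  hence "fe (tn X I0) Y p k (fe X I0 i j a u) c = 0[tn (tn X I0) Y,n]"
   using fe_zero(1)[OF tn_Ob[OF O(1) I0_Ob] O(2) n c] by simp
  thus ?thesis using map_simps(5)[OF cmpI[OF al t1]] map_simps(5)[OF t2] by simp
 qed
qed
next
fix X Y Z assume O: "X : Ob" "Y : Ob" "Z : Ob"
show "is_iso FC (asc X Y Z) \<and> asc X Y Z : hom (tn (tn X Y) Z) (tn X (tn Y Z))" using asc_iso[OF O] asc_hom[OF O] by blast
note a1 = asc_hom[OF O] and b1 = br_hom[OF O(1) tn_Ob[OF O(2,3)]] and a2 = asc_hom[OF O(2,3,1)]
note c1 = tarrI[OF br_hom[OF O(1,2)] idI[OF O(3)]] and c2 = asc_hom[OF O(2,1,3)]
 and c3 = tarrI[OF idI[OF O(2)] br_hom[OF O(1,3)]]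
show "asc Y Z X \<star> br X (tn Y Z) \<star> asc X Y Z =
  (Idt FC Y \<boxtimes> br X Z) \<star> asc Y X Z \<star> (br X Y \<boxtimes> Idt FC Z)"
proof (rule tri_ext[OF O cmpI[OF a1 cmpI[OF b1 a2]] cmpI[OF c1 cmpI[OF c2 c3]]])
 fix i j k p n a b c assume p: "i + j = p" and n: "p + k = n"
  and a: "a : X$i" and b: "b : Y$j" and c: "c : Z$k"
 have p': "j + i = p" and n1: "i + (j + k) = n" and n2: "j + k + i = n" and n3: "j + (i + k) = n" and ki: "k + i = i + k" using p n by auto
 note ab = fe_in[OF O(1,2) p a b] and bc = fe_in[OF O(2,3) refl b c] and ba = fe_in[OF O(2,1) p' b a]
  and ac = fe_in[OF O(1,3) refl a c] and ca = fe_in[OF O(3,1) ki c a]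
 note x = fe_in[OF tn_Ob[OF O(1,2)] O(3) n ab c] and y1 = fe_in[OF O(1) tn_Ob[OF O(2,3)] n1 a bc]
  and y2 = fe_in[OF tn_Ob[OF O(2,3)] O(1) n2 bc a] and z1 = fe_in[OF tn_Ob[OF O(2,1)] O(3) n ba c]
  and z2 = fe_in[OF O(2) tn_Ob[OF O(1,3)] n3 b ac] and z3 = fe_in[OF O(2) tn_Ob[OF O(3,1)] n3 b ca]
 have "Map (asc Y Z X \<star> br X (tn Y Z) \<star> asc X Y Z) n (fe (tn X Y) Z p k (fe X Y i j a b) c) =
   alt (Cx (tn Y (tn Z X)) n) (i * (j + k)) (fe Y (tn Z X) j (i + k) b (fe Z X k i c a))"
  unfolding cmp_map[OF a1 x] asc_fe[OF O p n refl a b c] cmp_map[OF b1 y1] br_fe[OF O(1) tn_Ob[OF O(2,3)] n1 a bc]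
   map_alt[OF a2 y2] asc_fe[OF O(2,3,1) refl n2 ki b c a] ..
 moreover have "Map ((Idt FC Y \<boxtimes> br X Z) \<star> asc Y X Z \<star> (br X Y \<boxtimes> Idt FC Z)) n (fe (tn X Y) Z p k (fe X Y i j a b) c) =
   alt (Cx (tn Y (tn Z X)) n) (i * j + i * k) (fe Y (tn Z X) j (i + k) b (fe Z X k i c a))"
  unfolding cmp_map[OF c1 x] tarr_fe[OF br_hom[OF O(1,2)] idI[OF O(3)] n ab c] br_fe[OF O(1,2) p a b] Idt_map[OF c]
   fe_alt(1)[OF tn_Ob[OF O(2,1)] O(3) n ba c] cmp_map[OF c2 cx_alt[OF Ob_fcx[OF hom_Ob(1)[OF c2]] z1]] map_alt[OF c2 z1]
   map_alt[OF c3 z2] asc_fe[OF O(2,1,3) p' n refl b a c] tarr_fe[OF idI[OF O(2)] br_hom[OF O(1,3)] n3 b ac] Idt_map[OF b]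
   br_fe[OF O(1,3) refl a c] fe_alt(2)[OF O(2) tn_Ob[OF O(3,1)] n3 b ca] cx_alt_alt[OF Ob_fcx[OF hom_Ob(2)[OF c3]] z3] ..
 ultimately show "Map (asc Y Z X \<star> br X (tn Y Z) \<star> asc X Y Z) n (fe (tn X Y) Z p k (fe X Y i j a b) c) =
   Map ((Idt FC Y \<boxtimes> br X Z) \<star> asc Y X Z \<star> (br X Y \<boxtimes> Idt FC Z)) n (fe (tn X Y) Z p k (fe X Y i j a b) c)"
  by (simp add: distrib_left)
qed
next
fix f X X' g Y Y' h Z Z' assume f: "f : hom X X'" and g: "g : hom Y Y'" and h: "h : hom Z Z'"
note O = hom_Ob(1)[OF f] hom_Ob(1)[OF g] hom_Ob(1)[OF h] and O' = hom_Ob(2)[OF f] hom_Ob(2)[OF g] hom_Ob(2)[OF h]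
note fg = tarrI[OF f g] and gh = tarrI[OF g h]
note t1 = tarrI[OF fg h] and t2 = tarrI[OF f gh]
show "asc X' Y' Z' \<star> ((f \<boxtimes> g) \<boxtimes> h) = (f \<boxtimes> (g \<boxtimes> h)) \<star> asc X Y Z"
proof (rule tri_ext[OF O cmpI[OF t1 asc_hom[OF O']] cmpI[OF asc_hom[OF O] t2]])
 fix i j k p n a b c assume p: "i + j = p" and n: "p + k = n"
  and a: "a : X$i" and b: "b : Y$j" and c: "c : Z$k"
 have n1: "i + (j + k) = n" using p n by auto
 note ab = fe_in[OF O(1,2) p a b] and bc = fe_in[OF O(2,3) refl b c]
 note x = fe_in[OF tn_Ob[OF O(1,2)] O(3) n ab c]
 show "Map (asc X' Y' Z' \<star> ((f \<boxtimes> g) \<boxtimes> h)) n (fe (tn X Y) Z p k (fe X Y i j a b) c) =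
   Map ((f \<boxtimes> (g \<boxtimes> h)) \<star> asc X Y Z) n (fe (tn X Y) Z p k (fe X Y i j a b) c)"
  unfolding cmp_map[OF t1 x] cmp_map[OF asc_hom[OF O] x] tarr_fe[OF fg h n ab c] tarr_fe[OF f g p a b]
   asc_fe[OF O p n refl a b c] tarr_fe[OF f gh n1 a bc] tarr_fe[OF g h refl b c]
   asc_fe[OF O' p n refl map_simps(1)[OF f a] map_simps(1)[OF g b] map_simps(1)[OF h c]] ..
qed
next
fix V X Y Z assume O: "V : Ob" "X : Ob" "Y : Ob" "Z : Ob"
note VX = tn_Ob[OF O(1,2)] and XY = tn_Ob[OF O(2,3)] and YZ = tn_Ob[OF O(3,4)]
note a1 = asc_hom[OF VX O(3,4)] and a2 = asc_hom[OF O(1,2) YZ]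
note b1 = tarrI[OF asc_hom[OF O(1,2,3)] idI[OF O(4)]] and b2 = asc_hom[OF O(1) XY O(4)]
 and b3 = tarrI[OF idI[OF O(1)] asc_hom[OF O(2,3,4)]]
show "asc V X (tn Y Z) \<star> asc (tn V X) Y Z =
  (Idt FC V \<boxtimes> asc X Y Z) \<star> asc V (tn X Y) Z \<star> (asc V X Y \<boxtimes> Idt FC Z)"
proof (rule quad_ext[OF O cmpI[OF a1 a2] cmpI[OF b1 cmpI[OF b2 b3]]])
 fix i j k l p q n a b c d assume p: "i + j = p" and q: "p + k = q" and n: "q + l = n"
  and a: "a : V$i" and b: "b : X$j" and c: "c : Y$k" and d: "d : Z$l"
 have n1: "p + (k + l) = n" and n2: "i + (j + k) = q" and n3: "j + k + l = j + (k + l)" and n4: "i + (j + (k + l)) = n" using p q n by auto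
 note ab = fe_in[OF O(1,2) p a b] and bc = fe_in[OF O(2,3) refl b c] and cd = fe_in[OF O(3,4) refl c d]
 note abc = fe_in[OF VX O(3) q ab c] and abc' = fe_in[OF O(1) XY n2 a bc]
 note bcd = fe_in[OF XY O(4) n3 bc d]
 note x = fe_in[OF tn_Ob[OF VX O(3)] O(4) n abc d]
  and z = fe_in[OF tn_Ob[OF O(1) XY] O(4) n abc' d]
 show "Map (asc V X (tn Y Z) \<star> asc (tn V X) Y Z) n (fe (tn (tn V X) Y) Z q l (fe (tn V X) Y p k (fe V X i j a b) c) d) =
  Map ((Idt FC V \<boxtimes> asc X Y Z) \<star> asc V (tn X Y) Z \<star> (asc V X Y \<boxtimes> Idt FC Z)) n
   (fe (tn (tn V X) Y) Z q l (fe (tn V X) Y p k (fe V X i j a b) c) d)"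
  unfolding cmp_map[OF a1 x] asc_fe[OF VX O(3,4) q n refl ab c d] asc_fe[OF O(1,2) YZ p n1 refl a b cd]
   cmp_map[OF b1 x] tarr_fe[OF asc_hom[OF O(1,2,3)] idI[OF O(4)] n abc d] asc_fe[OF O(1,2,3) p q refl a b c]
   Idt_map[OF d] cmp_map[OF b2 z] asc_fe[OF O(1) XY O(4) n2 n n3 a bc d]
   tarr_fe[OF idI[OF O(1)] asc_hom[OF O(2,3,4)] n4 a bcd] asc_fe[OF O(2,3,4) refl n3 refl b c d] Idt_map[OF a] ..
qed
qed

end

section \<open>Pushout-products and pullback-homs\<close>

context closed_symmetric_monoidal_category
begin

abbreviation H where "H \<equiv> homset C"
abbreviation ihom where "ihom \<equiv> inner_hom C"

lemma H_Obj: "f : H X Y ==> X : Obj C" "f : H X Y ==> Y : Obj C"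
unfolding homset_def using Dom_Obj Cod_Obj by auto

lemma tensor_split:
assumes f: "f : H A B" and g: "g : H X Y"
shows "(f \<otimes>\<^sub>a Idt C Y) \<cdot> (Idt C A \<otimes>\<^sub>a g) = f \<otimes>\<^sub>a g" "(Idt C B \<otimes>\<^sub>a g) \<cdot> (f \<otimes>\<^sub>a Idt C X) = f \<otimes>\<^sub>a g"
proof -
note I = Idt_hom[OF H_Obj(1)[OF f]] Idt_hom[OF H_Obj(2)[OF f]] Idt_hom[OF H_Obj(1)[OF g]] Idt_hom[OF H_Obj(2)[OF g]]
show "(f \<otimes>\<^sub>a Idt C Y) \<cdot> (Idt C A \<otimes>\<^sub>a g) = f \<otimes>\<^sub>a g"
 unfolding tensor_Cmp[OF I(1) f g I(4), symmetric] Cmp_Idt[OF f] Idt_Cmp[OF g] ..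
show "(Idt C B \<otimes>\<^sub>a g) \<cdot> (f \<otimes>\<^sub>a Idt C X) = f \<otimes>\<^sub>a g"
 unfolding tensor_Cmp[OF f I(2) I(3) g, symmetric] Idt_Cmp[OF f] Cmp_Idt[OF g] ..
qed

definition unc where "unc D E k = inner_eval C D E \<cdot> (k \<otimes>\<^sub>a Idt C D)"

lemma unc_hom: "k : H Z (ihom D E) ==> D : Obj C ==> E : Obj C ==> unc D E k : H (Z \<otimes>\<^sub>o D) E"
unfolding unc_def using closed(1) by (intro Cmp_hom[OF tensor_hom[OF _ Idt_hom]]) auto

lemma cur: "f : H (Z \<otimes>\<^sub>o D) E ==> Z : Obj C ==> D : Obj C ==> \<exists>k\<in>H Z (ihom D E). unc D E k = f"
unfolding unc_def using closed(2)[of D E Z f] H_Obj(2)[of f] by blast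

lemma unc_inj:
assumes "k : H Z (ihom D E)" "k' : H Z (ihom D E)" "D : Obj C" "E : Obj C" "unc D E k = unc D E k'"
shows "k = k'"
using closed(2)[OF assms(3,4) H_Obj(1)[OF assms(1)] unc_hom[OF assms(1,3,4)]] assms unfolding unc_def by metis

lemma unc_Cmp:
assumes u: "u : H X Z" and k: "k : H Z (ihom D E)" and D: "D : Obj C" and E: "E : Obj C"
shows "unc D E (k \<cdot> u) = unc D E k \<cdot> (u \<otimes>\<^sub>a Idt C D)"
proof -
note I = Idt_hom[OF D]
have "(k \<cdot> u) \<otimes>\<^sub>a Idt C D = (k \<otimes>\<^sub>a Idt C D) \<cdot> (u \<otimes>\<^sub>a Idt C D)" using tensor_Cmp[OF u k I I] Idt_Cmp[OF I] by simp
thus ?thesis unfolding unc_def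
 using Cmp_assoc[OF tensor_hom[OF u I] tensor_hom[OF k I] conjunct2[OF closed(1)[OF D E]]] by simp
qed

text \<open>\<open>post\<close> and the following \<open>pre\<close> are Hom(D, p) and Hom(g, E).
  They are fixed by their transposes, so no formula for the internal hom is needed in this abstract
  part.\<close>

definition post where "post D p = (SOME k. k : H (ihom D (Dom C p)) (ihom D (Cod C p)) \<and>
unc D (Cod C p) k = p \<cdot> inner_eval C D (Dom C p))"

definition pre where "pre g E = (SOME k. k : H (ihom (Cod C g) E) (ihom (Dom C g) E) \<and>
unc (Dom C g) E k = inner_eval C (Cod C g) E \<cdot> (Idt C (ihom (Cod C g) E) \<otimes>\<^sub>a g))"

lemma post:
assumes p: "p : H E F" and D: "D : Obj C"
shows post_hom: "post D p : H (ihom D E) (ihom D F)"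
 and unc_post: "k : H Z (ihom D E) ==> unc D F (post D p \<cdot> k) = p \<cdot> unc D E k"
proof -
have d: "Dom C p = E" "Cod C p = F" using p unfolding homset_def by auto
note EF = H_Obj[OF p] and e = conjunct1[OF closed(1)[OF D H_Obj(1)[OF p]]] conjunct2[OF closed(1)[OF D H_Obj(1)[OF p]]]
have "\<exists>k. k : H (ihom D E) (ihom D F) \<and> unc D F k = p \<cdot> inner_eval C D E"
 using cur[OF Cmp_hom[OF e(2) p] e(1) D] by blast
hence P: "post D p : H (ihom D E) (ihom D F) \<and> unc D F (post D p) = p \<cdot> inner_eval C D E"
 unfolding post_def d by (rule someI_ex)
thus "post D p : H (ihom D E) (ihom D F)" ..
assume k: "k : H Z (ihom D E)"
show "unc D F (post D p \<cdot> k) = p \<cdot> unc D E k"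
 unfolding unc_Cmp[OF k conjunct1[OF P] D EF(2)] conjunct2[OF P] Cmp_assoc[OF tensor_hom[OF k Idt_hom[OF D]] e(2) p, symmetric]
 unfolding unc_def ..
qed

lemma pre:
assumes g: "g : H X D" and E: "E : Obj C"
shows pre_hom: "pre g E : H (ihom D E) (ihom X E)"
 and unc_pre: "k : H Z (ihom D E) ==> unc X E (pre g E \<cdot> k) = unc D E k \<cdot> (Idt C Z \<otimes>\<^sub>a g)"
proof -
have d: "Dom C g = X" "Cod C g = D" using g unfolding homset_def by auto
note O = H_Obj[OF g] and e = conjunct1[OF closed(1)[OF H_Obj(2)[OF g] E]] conjunct2[OF closed(1)[OF H_Obj(2)[OF g] E]]
note Ig = tensor_hom[OF Idt_hom[OF e(1)] g]
have "\<exists>k. k : H (ihom D E) (ihom X E) \<and> unc X E k = inner_eval C D E \<cdot> (Idt C (ihom D E) \<otimes>\<^sub>a g)"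
 using cur[OF Cmp_hom[OF Ig e(2)] e(1) O(1)] by blast
hence P: "pre g E : H (ihom D E) (ihom X E) \<and> unc X E (pre g E) = inner_eval C D E \<cdot> (Idt C (ihom D E) \<otimes>\<^sub>a g)"
 unfolding pre_def d by (rule someI_ex)
thus "pre g E : H (ihom D E) (ihom X E)" ..
assume k: "k : H Z (ihom D E)"
note kX = tensor_hom[OF k Idt_hom[OF O(1)]] and kD = tensor_hom[OF k Idt_hom[OF O(2)]]
 and Zg = tensor_hom[OF Idt_hom[OF H_Obj(1)[OF k]] g]
show "unc X E (pre g E \<cdot> k) = unc D E k \<cdot> (Idt C Z \<otimes>\<^sub>a g)"
 unfolding unc_Cmp[OF k conjunct1[OF P] O(1) E] conjunct2[OF P] Cmp_assoc[OF kX Ig e(2), symmetric] tensor_split(2)[OF k g]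
  tensor_split(1)[OF k g, symmetric] Cmp_assoc[OF Zg kD e(2)]
 unfolding unc_def ..
qed

text \<open>Lifting of the pushout-product of f and g against p, with maps out of the pushout
  replaced by compatible pairs (a, b); no pushout has to be chosen.\<close>

definition pp where
"pp f g p \<longleftrightarrow> (\<forall>a\<in>H (Dom C f \<otimes>\<^sub>o Cod C g) (Dom C p). \<forall>b\<in>H (Cod C f \<otimes>\<^sub>o Dom C g) (Dom C p).
  \<forall>c\<in>H (Cod C f \<otimes>\<^sub>o Cod C g) (Cod C p).
  a \<cdot> (Idt C (Dom C f) \<otimes>\<^sub>a g) = b \<cdot> (f \<otimes>\<^sub>a Idt C (Dom C g)) --> p \<cdot> a = c \<cdot> (f \<otimes>\<^sub>a Idt C (Cod C g)) -->
  p \<cdot> b = c \<cdot> (Idt C (Cod C f) \<otimes>\<^sub>a g) -->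
  (\<exists>h\<in>H (Cod C f \<otimes>\<^sub>o Cod C g) (Dom C p). h \<cdot> (f \<otimes>\<^sub>a Idt C (Cod C g)) = a \<and>
   h \<cdot> (Idt C (Cod C f) \<otimes>\<^sub>a g) = b \<and> p \<cdot> h = c))"

text \<open>\<open>P\<close> is the pullback-hom of g and p: the map from Hom(D, E) to a pullback L
  of Hom(X, E) and Hom(D, F) over Hom(X, F), for g from X to D and p from E to F, with projections
  \<open>x\<close> and \<open>y\<close>.\<close>

definition pbhom where
"pbhom g p L x y P \<longleftrightarrow> x : H L (ihom (Dom C g) (Dom C p)) \<and> y : H L (ihom (Cod C g) (Cod C p)) \<and>
  P : H (ihom (Cod C g) (Dom C p)) L \<and> post (Dom C g) p \<cdot> x = pre g (Cod C p) \<cdot> y \<and>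
  x \<cdot> P = pre g (Dom C p) \<and> y \<cdot> P = post (Cod C g) p \<and>
  (\<forall>Z. \<forall>u\<in>H Z (ihom (Dom C g) (Dom C p)). \<forall>v\<in>H Z (ihom (Cod C g) (Cod C p)).
   post (Dom C g) p \<cdot> u = pre g (Cod C p) \<cdot> v --> (\<exists>!h. h : H Z L \<and> x \<cdot> h = u \<and> y \<cdot> h = v))"

text \<open>All data are transposed: a becomes the upper map into Hom(D, E), and the pair (b, c) the
  lower map into the pullback L. Maps into L are compared through their two projections.\<close>

lemma pp_lifts:
assumes f: "f : H A B" and g: "g : H X D" and p: "p : H E F" and pb: "pbhom g p L x y P"
shows "pp f g p \<longleftrightarrow> lifts C f P"
proof -
have d: "Dom C f = A" "Cod C f = B" "Dom C g = X" "Cod C g = D" "Dom C p = E" "Cod C p = F"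
 using f g p unfolding homset_def by auto
note O = H_Obj[OF f] H_Obj[OF g] H_Obj[OF p]
have x: "x : H L (ihom X E)" and y: "y : H L (ihom D F)" and P: "P : H (ihom D E) L"
 and xy: "post X p \<cdot> x = pre g F \<cdot> y" and xP: "x \<cdot> P = pre g E" and yP: "y \<cdot> P = post D p"
 and univ: "\<And>Z u v. u : H Z (ihom X E) ==> v : H Z (ihom D F) ==> post X p \<cdot> u = pre g F \<cdot> v ==>
  \<exists>!h. h : H Z L \<and> x \<cdot> h = u \<and> y \<cdot> h = v"
 using pb unfolding pbhom_def d by auto
have dP: "Dom C P = ihom D E" "Cod C P = L" using P unfolding homset_def by auto
note pX = post_hom[OF p O(3)] and pD = post_hom[OF p O(4)] and gE = pre_hom[OF g O(5)] and gF = pre_hom[OF g O(6)]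
have ext: "h = h'" if h: "h : H Z L" "h' : H Z L" "x \<cdot> h = x \<cdot> h'" "y \<cdot> h = y \<cdot> h'" for Z h h'
proof -
 have "post X p \<cdot> (x \<cdot> h) = pre g F \<cdot> (y \<cdot> h)"
  unfolding Cmp_assoc[OF h(1) x pX] Cmp_assoc[OF h(1) y gF] xy ..
 from univ[OF Cmp_hom[OF h(1) x] Cmp_hom[OF h(1) y] this] show ?thesis using h by metis
qed
show ?thesis
proof
 assume l: "lifts C f P"
 show "pp f g p" unfolding pp_def d
 proof (intro ballI impI)
  fix a b c assume a: "a : H (A \<otimes>\<^sub>o D) E" and b: "b : H (B \<otimes>\<^sub>o X) E" and c: "c : H (B \<otimes>\<^sub>o D) F"
   and ab: "a \<cdot> (Idt C A \<otimes>\<^sub>a g) = b \<cdot> (f \<otimes>\<^sub>a Idt C X)" and ac: "p \<cdot> a = c \<cdot> (f \<otimes>\<^sub>a Idt C D)"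
   and bc: "p \<cdot> b = c \<cdot> (Idt C B \<otimes>\<^sub>a g)"
  obtain a' where a': "a' : H A (ihom D E)" "unc D E a' = a" using cur[OF a O(1,4)] by blast
  obtain b' where b': "b' : H B (ihom X E)" "unc X E b' = b" using cur[OF b O(2,3)] by blast
  obtain c' where c': "c' : H B (ihom D F)" "unc D F c' = c" using cur[OF c O(2,4)] by blast
  have "post X p \<cdot> b' = pre g F \<cdot> c'"
   by (rule unc_inj[OF Cmp_hom[OF b'(1) pX] Cmp_hom[OF c'(1) gF] O(3,6)])
    (simp add: unc_post[OF p O(3) b'(1)] unc_pre[OF g O(6) c'(1)] b' c' bc)
  then obtain v where v: "v : H B L" "x \<cdot> v = b'" "y \<cdot> v = c'" using univ[OF b'(1) c'(1)] by blast
  have "P \<cdot> a' = v \<cdot> f"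
  proof (rule ext[OF Cmp_hom[OF a'(1) P] Cmp_hom[OF f v(1)]])
   show "x \<cdot> (P \<cdot> a') = x \<cdot> (v \<cdot> f)" unfolding Cmp_assoc[OF a'(1) P x] Cmp_assoc[OF f v(1) x] xP v(2)
    by (rule unc_inj[OF Cmp_hom[OF a'(1) gE] Cmp_hom[OF f b'(1)] O(3,5)])
     (simp add: unc_pre[OF g O(5) a'(1)] unc_Cmp[OF f b'(1) O(3,5)] a' b' ab)
   show "y \<cdot> (P \<cdot> a') = y \<cdot> (v \<cdot> f)" unfolding Cmp_assoc[OF a'(1) P y] Cmp_assoc[OF f v(1) y] yP v(3)
    by (rule unc_inj[OF Cmp_hom[OF a'(1) pD] Cmp_hom[OF f c'(1)] O(4,6)])
     (simp add: unc_post[OF p O(4) a'(1)] unc_Cmp[OF f c'(1) O(4,6)] a' c' ac)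
  qed
  then obtain h where h: "h : H B (ihom D E)" "h \<cdot> f = a'" "P \<cdot> h = v"
   using l a'(1) v(1) unfolding lifts_def d dP by blast
  have hx: "pre g E \<cdot> h = b'" and hy: "post D p \<cdot> h = c'"
   using Cmp_assoc[OF h(1) P x] Cmp_assoc[OF h(1) P y] h(3) v xP yP by auto
  have "unc D E h \<cdot> (f \<otimes>\<^sub>a Idt C D) = a" using unc_Cmp[OF f h(1) O(4,5)] h(2) a'(2) by simp
  moreover have "unc D E h \<cdot> (Idt C B \<otimes>\<^sub>a g) = b" using unc_pre[OF g O(5) h(1)] hx b'(2) by simp
  moreover have "p \<cdot> unc D E h = c" using unc_post[OF p O(4) h(1)] hy c'(2) by simp
  ultimately show "\<exists>h\<in>H (B \<otimes>\<^sub>o D) E. h \<cdot> (f \<otimes>\<^sub>a Idt C D) = a \<and> h \<cdot> (Idt C B \<otimes>\<^sub>a g) = b \<and> p \<cdot> h = c"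
   using unc_hom[OF h(1) O(4,5)] by blast
 qed
next
 assume *: "pp f g p"
 show "lifts C f P" unfolding lifts_def d dP
 proof (intro ballI impI)
  fix u v assume u: "u : H A (ihom D E)" and v: "v : H B L" and e: "P \<cdot> u = v \<cdot> f"
  note xv = Cmp_hom[OF v x] and yv = Cmp_hom[OF v y]
  have xe: "pre g E \<cdot> u = x \<cdot> v \<cdot> f" and ye: "post D p \<cdot> u = y \<cdot> v \<cdot> f"
   using Cmp_assoc[OF u P x] Cmp_assoc[OF u P y] Cmp_assoc[OF f v x] Cmp_assoc[OF f v y] e xP yP by auto
  have "unc D E u \<cdot> (Idt C A \<otimes>\<^sub>a g) = unc X E (x \<cdot> v) \<cdot> (f \<otimes>\<^sub>a Idt C X)"
   using unc_pre[OF g O(5) u] unc_Cmp[OF f xv O(3,5)] xe by simp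
  moreover have "p \<cdot> unc D E u = unc D F (y \<cdot> v) \<cdot> (f \<otimes>\<^sub>a Idt C D)"
   using unc_post[OF p O(4) u] unc_Cmp[OF f yv O(4,6)] ye by simp
  moreover have "post X p \<cdot> (x \<cdot> v) = pre g F \<cdot> (y \<cdot> v)"
   unfolding Cmp_assoc[OF v x pX] Cmp_assoc[OF v y gF] xy ..
  hence "p \<cdot> unc X E (x \<cdot> v) = unc D F (y \<cdot> v) \<cdot> (Idt C B \<otimes>\<^sub>a g)"
   using unc_post[OF p O(3) xv] unc_pre[OF g O(6) yv] by simp
  ultimately obtain h where h: "h : H (B \<otimes>\<^sub>o D) E" "h \<cdot> (f \<otimes>\<^sub>a Idt C D) = unc D E u"
   "h \<cdot> (Idt C B \<otimes>\<^sub>a g) = unc X E (x \<cdot> v)" "p \<cdot> h = unc D F (y \<cdot> v)"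
   using * unc_hom[OF u O(4,5)] unc_hom[OF xv O(3,5)] unc_hom[OF yv O(4,6)] unfolding pp_def d by blast
  obtain k where k: "k : H B (ihom D E)" "unc D E k = h" using cur[OF h(1) O(2,4)] by blast
  have "k \<cdot> f = u" by (rule unc_inj[OF Cmp_hom[OF f k(1)] u O(4,5)]) (simp add: unc_Cmp[OF f k(1) O(4,5)] k h)
  moreover have "P \<cdot> k = v"
  proof (rule ext[OF Cmp_hom[OF k(1) P] v])
   show "x \<cdot> (P \<cdot> k) = x \<cdot> v" unfolding Cmp_assoc[OF k(1) P x] xP
    by (rule unc_inj[OF Cmp_hom[OF k(1) gE] xv O(3,5)]) (simp add: unc_pre[OF g O(5) k(1)] k h)
   show "y \<cdot> (P \<cdot> k) = y \<cdot> v" unfolding Cmp_assoc[OF k(1) P y] yP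
    by (rule unc_inj[OF Cmp_hom[OF k(1) pD] yv O(4,6)]) (simp add: unc_post[OF p O(4) k(1)] k h)
  qed
  ultimately show "\<exists>h\<in>H B (ihom D E). h \<cdot> f = u \<and> P \<cdot> h = v" using k(1) by blast
 qed
qed
qed

text \<open>Conjugation by the braiding. With this symmetry either factor of a pushout-product can
  be the one tested on generators.\<close>

lemma pp_sym:
assumes f: "f : H A B" and g: "g : H X D" and p: "p : H E F" and *: "pp f g p"
shows "pp g f p"
proof -
have d: "Dom C f = A" "Cod C f = B" "Dom C g = X" "Cod C g = D" "Dom C p = E" "Cod C p = F"
 using f g p unfolding homset_def by auto
note O = H_Obj[OF f] H_Obj[OF g] and I = Idt_hom[OF H_Obj(1)[OF f]] Idt_hom[OF H_Obj(2)[OF f]] Idt_hom[OF H_Obj(1)[OF g]] Idt_hom[OF H_Obj(2)[OF g]]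
note s1 = braid_hom[OF O(1,4)] and s2 = braid_hom[OF O(2,3)] and s3 = braid_hom[OF O(2,4)] and s0 = braid_hom[OF O(1,3)] and t = braid_hom[OF O(4,2)]
show ?thesis unfolding pp_def d
proof (intro ballI impI)
 fix a b c assume a: "a : H (X \<otimes>\<^sub>o B) E" and b: "b : H (D \<otimes>\<^sub>o A) E" and c: "c : H (D \<otimes>\<^sub>o B) F"
  and ab: "a \<cdot> (Idt C X \<otimes>\<^sub>a f) = b \<cdot> (g \<otimes>\<^sub>a Idt C A)" and ac: "p \<cdot> a = c \<cdot> (g \<otimes>\<^sub>a Idt C B)"
  and bc: "p \<cdot> b = c \<cdot> (Idt C D \<otimes>\<^sub>a f)"
 have "b \<cdot> \<sigma> A D \<cdot> (Idt C A \<otimes>\<^sub>a g) = a \<cdot> \<sigma> B X \<cdot> (f \<otimes>\<^sub>a Idt C X)"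
  unfolding Cmp_assoc[OF tensor_hom[OF I(1) g] s1 b, symmetric] braid_nat[OF I(1) g] Cmp_assoc[OF s0 tensor_hom[OF g I(1)] b] ab[symmetric]
   Cmp_assoc[OF tensor_hom[OF f I(3)] s2 a, symmetric] braid_nat[OF f I(3)] Cmp_assoc[OF s0 tensor_hom[OF I(3) f] a] ..
 moreover have "p \<cdot> (b \<cdot> \<sigma> A D) = c \<cdot> \<sigma> B D \<cdot> (f \<otimes>\<^sub>a Idt C D)"
  unfolding Cmp_assoc[OF s1 b p] bc Cmp_assoc[OF tensor_hom[OF f I(4)] s3 c, symmetric] braid_nat[OF f I(4)]
   Cmp_assoc[OF s1 tensor_hom[OF I(4) f] c] ..
 moreover have "p \<cdot> (a \<cdot> \<sigma> B X) = c \<cdot> \<sigma> B D \<cdot> (Idt C B \<otimes>\<^sub>a g)"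
  unfolding Cmp_assoc[OF s2 a p] ac Cmp_assoc[OF tensor_hom[OF I(2) g] s3 c, symmetric] braid_nat[OF I(2) g]
   Cmp_assoc[OF s2 tensor_hom[OF g I(2)] c] ..
 ultimately obtain h where h: "h : H (B \<otimes>\<^sub>o D) E" "h \<cdot> (f \<otimes>\<^sub>a Idt C D) = b \<cdot> \<sigma> A D" "h \<cdot> (Idt C B \<otimes>\<^sub>a g) = a \<cdot> \<sigma> B X"
  "p \<cdot> h = c \<cdot> \<sigma> B D"
  using * Cmp_hom[OF s1 b] Cmp_hom[OF s2 a] Cmp_hom[OF s3 c] unfolding pp_def d by blast
 have undo: "z \<cdot> \<sigma> Y Z \<cdot> \<sigma> Z Y = z" if "z : H (Z \<otimes>\<^sub>o Y) G" "Y : Obj C" "Z : Obj C" for z Y Z G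
  unfolding Cmp_assoc[OF braid_hom[OF that(3,2)] braid_hom[OF that(2,3)] that(1), symmetric] symmetry[OF that(3,2)]
  by (rule Cmp_Idt[OF that(1)])
 have "h \<cdot> \<sigma> D B \<cdot> (g \<otimes>\<^sub>a Idt C B) = a"
  unfolding Cmp_assoc[OF tensor_hom[OF g I(2)] t h(1), symmetric] braid_nat[OF g I(2)] Cmp_assoc[OF braid_hom[OF O(3,2)] tensor_hom[OF I(2) g] h(1)] h(3)
  by (rule undo[OF a O(2,3)])
 moreover have "h \<cdot> \<sigma> D B \<cdot> (Idt C D \<otimes>\<^sub>a f) = b"
  unfolding Cmp_assoc[OF tensor_hom[OF I(4) f] t h(1), symmetric] braid_nat[OF I(4) f] Cmp_assoc[OF braid_hom[OF O(4,1)] tensor_hom[OF f I(4)] h(1)] h(2)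
  by (rule undo[OF b O(1,4)])
 moreover have "p \<cdot> (h \<cdot> \<sigma> D B) = c" unfolding Cmp_assoc[OF t h(1) p] h(4) by (rule undo[OF c O(2,4)])
 ultimately show "\<exists>h\<in>H (D \<otimes>\<^sub>o B) E. h \<cdot> (g \<otimes>\<^sub>a Idt C B) = a \<and> h \<cdot> (Idt C D \<otimes>\<^sub>a f) = b \<and> p \<cdot> h = c"
  using Cmp_hom[OF t h(1)] by blast
qed
qed

end

section \<open>Pullback-homs of filtered complexes and internal homs out of cells\<close>

context fc
begin

interpretation M: closed_symmetric_monoidal_category FC by (rule closed_symmetric_monoidal_FC)

lemma pullback_exists:
assumes u: "u : hom A D" and v: "v : hom B D"
shows "\<exists>L x y. x : hom L A \<and> y : hom L B \<and> u \<star> x = v \<star> y \<and>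
 (\<forall>Z. \<forall>a\<in>hom Z A. \<forall>b\<in>hom Z B. u \<star> a = v \<star> b -->
  (\<exists>!h. h : hom Z L \<and> x \<star> h = a \<and> y \<star> h = b))"
proof -
let ?D = "%i::nat. if i = 0 then A else if i = 1 then B else D"
note O = hom_Ob[OF u] hom_Ob[OF v]
interpret diagram U R "{0, 1, 2}" "{0, 1}" ?D "%k::nat. k" "%k. 2" "%k. if k = 0 then u else v"
 by unfold_locales (use u v O in \<open>auto intro: sm_finite\<close>)
obtain L p where g: "glimit FC {0, 1, 2} {0, 1} ?D (%k::nat. k) (%k. 2) (%k. if k = 0 then u else v) L p"
 using glimit_exists by blast
note g' = g[unfolded glimit_def FC_simps]
have p: "p 0 : hom L A" "p 1 : hom L B" "u \<star> p 0 = p 2" "v \<star> p 1 = p 2" using g' by auto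
have uni: "\<exists>!h. h : hom Z L \<and> p 0 \<star> h = a \<and> p 1 \<star> h = b"
 if a: "a : hom Z A" and b: "b : hom Z B" and ab: "u \<star> a = v \<star> b" for Z a b
proof -
 let ?x = "%i::nat. if i = 0 then a else if i = 1 then b else u \<star> a"
 have "\<exists>!h. h : hom Z L \<and> (\<forall>i\<in>{0, 1, 2}. p i \<star> h = ?x i)"
  using conjunct2[OF conjunct2[OF conjunct2[OF g']], rule_format, of Z ?x]
   hom_Ob(1)[OF a] a b ab cmpI[OF a u] by (simp add: ab)
 moreover have "(\<forall>i\<in>{0, 1, 2}. p i \<star> h = ?x i) \<longleftrightarrow> p 0 \<star> h = a \<and> p 1 \<star> h = b" if h: "h : hom Z L" for h
  using M.Cmp_assoc[unfolded FC_simps, OF h p(1) u] p(3) by auto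
 ultimately show ?thesis by (simp cong: conj_cong)
qed
show ?thesis
 by (rule exI[of _ L], rule exI[of _ "p 0"], rule exI[of _ "p 1"], intro conjI allI ballI impI uni) (use p in simp_all)
qed

lemma pbhom_exists:
assumes g: "g : hom X D" and p: "p : hom E F"
shows "\<exists>L x y P. M.pbhom g p L x y P"
proof -
let ?K = "M.ihom D E"
note O = hom_Ob[OF g] hom_Ob[OF p]
have O': "X : Obj FC" "D : Obj FC" "E : Obj FC" "F : Obj FC" using O by auto
have gp: "g : M.H X D" "p : M.H E F" using g p by auto
note h = M.post_hom[OF gp(2) O'(1), unfolded FC_simps] M.pre_hom[OF gp(1) O'(4), unfolded FC_simps]
 M.post_hom[OF gp(2) O'(2), unfolded FC_simps] M.pre_hom[OF gp(1) O'(3), unfolded FC_simps]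
obtain L x y where L: "x : hom L (M.ihom X E)" "y : hom L (M.ihom D F)" "M.post X p \<star> x = M.pre g F \<star> y"
 and univ: "\<And>Z a b. a : hom Z (M.ihom X E) ==> b : hom Z (M.ihom D F) ==> M.post X p \<star> a = M.pre g F \<star> b ==>
  \<exists>!h. h : hom Z L \<and> x \<star> h = a \<and> y \<star> h = b"
 using pullback_exists[OF h(1,2)] by blast
have "M.post X p \<star> M.pre g E = M.pre g F \<star> M.post D p"
proof (rule M.unc_inj[OF _ _ O'(1,4)], unfold FC_simps)
 show "M.post X p \<star> M.pre g E : hom ?K (M.ihom X F)" "M.pre g F \<star> M.post D p : hom ?K (M.ihom X F)"
  using cmpI[OF h(4,1)] cmpI[OF h(3,2)] by auto
 have i: "Idt FC ?K : M.H ?K ?K" using O by simp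
 note ci = M.Cmp_Idt[unfolded FC_simps]
 have I: "M.unc D E (Idt FC ?K) : hom (tn ?K D) E" using M.unc_hom[OF i O'(2,3)] by simp
 have "M.unc X E (M.pre g E) = M.unc D E (Idt FC ?K) \<star> (Idt FC ?K \<boxtimes> g)"
  "M.unc D F (M.post D p) = p \<star> M.unc D E (Idt FC ?K)"
  using M.unc_pre[OF gp(1) O'(3) i] M.unc_post[OF gp(2) O'(2) i] ci[OF h(4)] ci[OF h(3)] by auto
 thus "M.unc X F (M.post X p \<star> M.pre g E) = M.unc X F (M.pre g F \<star> M.post D p)"
  using M.unc_post[OF gp(2) O'(1), of "M.pre g E" "M.ihom D E"] M.unc_pre[OF gp(1) O'(4), of "M.post D p" "M.ihom D E"] h
   M.Cmp_assoc[unfolded FC_simps, OF tarrI[OF i[unfolded FC_simps] g] I p] by simp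
qed
then obtain P where "P : hom ?K L" "x \<star> P = M.pre g E" "y \<star> P = M.post D p"
 using univ[OF h(4,3)] by blast
hence "M.pbhom g p L x y P" unfolding M.pbhom_def FC_simps hom_src[OF g] hom_tgt[OF g] hom_src[OF p] hom_tgt[OF p]
 using L univ by blast
thus ?thesis by blast
qed

abbreviation Z0 :: "('r, 'u) fcomplex" where "Z0 \<equiv> cpy (ZC R)"

text \<open>Hom(0, E) is terminal because A (x) 0 is zero.\<close>

lemma to_ihom_zero:
assumes E: "E : Ob" and A: "A : Ob"
shows "\<exists>!f. f : hom A (M.ihom Z0 E)"
proof -
have Z: "Z0 : Ob" by (rule copy_Ob[OF zero_cpx])
note T = tn_Ob[OF A Z]
have eq: "f = g" if "f : hom (tn A Z0) E" "g : hom (tn A Z0) E" for f g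
proof (rule tn_ext[OF A Z that refl])
 fix i j n a b assume n: "i + j = n" and a: "a : A$i" and "b : Z0$j"
 hence "b = 0[Z0,j]" unfolding copy_car copy_zero by simp
 thus "Map f n (fe A Z0 i j a b) = Map g n (fe A Z0 i j a b)"
  using fe_zero(2)[OF A Z n a] that by simp
qed
have z: "mk_arr (tn A Z0) E (%n x. 0[E,n]) : hom (tn A Z0) E"
 using T E by (intro mk_arr_hom fmapI) auto
obtain k where k: "k : hom A (M.ihom Z0 E)" using M.cur[of _ A Z0 E, unfolded FC_simps FC_tensor, OF z A Z] by auto
have "f = k" if f: "f : hom A (M.ihom Z0 E)" for f
 using M.unc_inj[of f A Z0 E k] eq[of "M.unc Z0 E f" "M.unc Z0 E k"] M.unc_hom[of f A Z0 E] M.unc_hom[of k A Z0 E] f k Z E by simp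
thus ?thesis using k by blast
qed

text \<open>When g starts at the zero object, Hom(0, _) is terminal, so the pullback is Hom(D, F)
  itself and the pullback-hom is Hom(D, p).\<close>

lemma pp_zero:
assumes f: "f : hom A B" and g: "g : hom Z0 D" and p: "p : hom E F"
shows "M.pp f g p \<longleftrightarrow> lifts FC f (M.post D p)"
proof -
let ?K = "M.ihom D F"
have Z: "Z0 : Ob" by (rule copy_Ob[OF zero_cpx])
note O = hom_Ob[OF g] hom_Ob[OF p]
have O': "Z0 : Obj FC" "D : Obj FC" "E : Obj FC" "F : Obj FC" using O by auto
have gp: "g : M.H Z0 D" "p : M.H E F" using g p by auto
note h = M.post_hom[OF gp(2) O'(1), unfolded FC_simps] M.pre_hom[OF gp(1) O'(4), unfolded FC_simps]
 M.post_hom[OF gp(2) O'(2), unfolded FC_simps] M.pre_hom[OF gp(1) O'(3), unfolded FC_simps]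
have iF: "M.ihom D F : Ob" using hom_Ob(2)[OF h(3)] .
obtain x where x: "x : hom ?K (M.ihom Z0 E)" using to_ihom_zero[OF O(3) iF] by blast
note uni = to_ihom_zero[OF O(3) hom_Ob(1)] to_ihom_zero[OF O(4) hom_Ob(1)]
have "M.pbhom g p ?K x (Idt FC ?K) (M.post D p)"
 unfolding M.pbhom_def FC_simps hom_src[OF g] hom_tgt[OF g] hom_src[OF p] hom_tgt[OF p]
proof (intro conjI allI ballI impI x h(3) idI iF)
 have I: "Idt FC ?K : hom ?K ?K" using iF by simp
 show "M.post Z0 p \<star> x = M.pre g F \<star> Idt FC ?K"
  using to_ihom_zero[OF O(4) iF] cmpI[OF x h(1)] cmpI[OF I h(2)] by blast
 show "x \<star> M.post D p = M.pre g E"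
  using uni(1)[OF h(3)] cmpI[OF h(3) x] h(4) by blast
 show "Idt FC ?K \<star> M.post D p = M.post D p" using M.Idt_Cmp[unfolded FC_simps, OF h(3)] .
 fix Z u v assume u: "u : hom Z (M.ihom Z0 E)" and v: "v : hom Z ?K"
 have "x \<star> v = u" using uni(1)[OF u] cmpI[OF v x] u by blast
 thus "\<exists>!h. h : hom Z ?K \<and> x \<star> h = u \<and> Idt FC ?K \<star> h = v"
  using v M.Idt_Cmp[unfolded FC_simps] by metis
qed
from M.pp_lifts[unfolded FC_simps, OF f g p this] show ?thesis .
qed

subsection \<open>Maps out of a cell\<close>

abbreviation cl :: "nat => int => int => ('r, 'u) fcomplex" where "cl k q d \<equiv> cpy (cell R k q d)"

lemma cl_Ob [simp]: "cl k q d : Ob" by (rule copy_Ob[OF cell_cpx])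

lemma gen_car: "gen k q d : (cl k q d)$d" "Df (cl k q d) d (gen k q d) : (cl k q d)$(d+1)"
using cyc_in[OF gen_cycles] by auto

lemma cell_cases:
assumes "x : (cl k q d)$m"
shows "(\<exists>s\<in>carrier R. m = d \<and> x = s *[cl k q d,d] gen k q d) \<or>
 (\<exists>s\<in>carrier R. m = d+1 \<and> x = s *[cl k q d,d+1] Df (cl k q d) d (gen k q d)) \<or> x = 0[cl k q d,m]"
proof -
obtain c where c: "c : cellK d m" "x = cd (cell R k q d) m c" using assms unfolding copy_car by auto
have 1: "Df (cl k q d) d (gen k q d) = cd (cell R k q d) (d+1) \<one>" by (subst copy_d[OF cell_cpx]) simp_all
have e: "c : carrier R" "x = c *[cl k q d,m] cd (cell R k q d) m \<one>" if "m = d \<or> m = d+1"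
 using c copy_smult[OF cell_cpx, of \<one> k q d m c] that by (auto simp: cellK_def)
consider "m = d" | "m = d+1" | "m \<noteq> d" "m \<noteq> d+1" by blast
thus ?thesis
proof cases
 case 3
 thus ?thesis using c unfolding copy_zero by (simp add: cellK_def)
qed (use e 1 in auto)
qed

lemma cell_Fl_cases:
"x : Fl (cl k q d) p m ==> x = 0[cl k q d,m] \<or> m = d \<and> q \<le> p \<or> m = d+1 \<and> q - int k \<le> p"
unfolding copy_Fl copy_zero by (auto split: if_splits)

text \<open>Both degrees of a cell are free of rank one, on the generator and on its boundary, so a
  family of linear maps may take arbitrary values there; elements of the hom complex need not
  commute with d.\<close>

lemma HM_cell_ex:
assumes E: "E : Ob" and a: "a : E$(d + N)" and w: "w : E$(d+1 + N)"
shows "\<exists>f\<in>carrier (HM (cl k q d) E N). f d (gen k q d) = a \<and> f (d+1) (Df (cl k q d) d (gen k q d)) = w"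
proof -
have E': "fcx E" using E by simp
let ?k = "%m u. if m = d then dc (cell R k q d) m u *[E,m + N] a else
 if m = d+1 then dc (cell R k q d) m u *[E,m + N] w else 0[E,m + N]"
let ?f = "%m. \<lambda>u\<in>(cl k q d)$m. ?k m u"
note dcd = cpx_decode[OF cell_cpx, of _ k q d, simplified]
have 1: "Df (cl k q d) d (gen k q d) = cd (cell R k q d) (d+1) \<one>" by (subst copy_d[OF cell_cpx]) simp_all
have K: "u : (cl k q d)$m \<longleftrightarrow> (\<exists>c\<in>cellK d m. u = cd (cell R k q d) m c)" for u m
 unfolding copy_car by auto
note ops = copy_add[OF cell_cpx, of _ k q d, simplified] copy_smult[OF cell_cpx, of _ k q d, simplified]
have cK: "c \<oplus> c' : cellK d m" "s : carrier R ==> s \<otimes> c : cellK d m" if "c : cellK d m" "c' : cellK d m" for c c' s m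
 using that by (auto simp: cellK_def split: if_splits)
have "?f : carrier (HM (cl k q d) E N)"
proof (rule HM_I[OF Ob_fcx[OF cl_Ob]])
 fix m x y s assume x: "x : (cl k q d)$m"
 obtain c where c: "c : cellK d m" "x = cd (cell R k q d) m c" using x K by blast
 have cR: "c : carrier R" using c(1) cellK(3) by blast
 show "?k m x : E$(m + N)" using c cR a w E' by (auto simp: dcd)
 show "?k m (x +[cl k q d,m] y) = ?k m x +[E,m + N] ?k m y" if y: "y : (cl k q d)$m"
 proof -
  obtain c' where c': "c' : cellK d m" "y = cd (cell R k q d) m c'" using y K by blast
  have "c' : carrier R" using c'(1) cellK(3) by blast
  thus ?thesis using c c' cR a w E' cK(1)[OF c(1) c'(1)]
   by (cases "m = d"; cases "m = d+1"; simp add: dcd ops cx_smult)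
 qed
 show "?k m (s *[cl k q d,m] x) = s *[E,m + N] ?k m x" if s: "s : carrier R"
  using c cR a w E' s cK(2)[OF c(1) c(1) s]
  by (cases "m = d"; cases "m = d+1"; simp add: dcd ops cx_smult)
qed
moreover have "?f d (gen k q d) = a" using gen_car(1)[of k q d] a E' dcd[of \<one> d] by simp
moreover have "?f (d+1) (Df (cl k q d) d (gen k q d)) = w" using gen_car(2)[of k q d] w E' dcd[of \<one> "d+1"] unfolding 1 by simp
ultimately show ?thesis by (intro bexI[of _ ?f] conjI)
qed

text \<open>First coordinate a of an element of Hom(cell, E): its value on the generator, taken
  through evaluation so that the Leibniz rule for tensors applies. The index \<open>m\<close> is the
  degree N + d of this value.\<close>

definition e1 where "e1 k q d E N m z = Map (ev (cl k q d) E) m (fe (inn (cl k q d) E) (cl k q d) N d z (gen k q d))"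

text \<open>The sign makes the differential of \<open>inn (cl k q d) E\<close> read $(a, w) \mapsto (da - w, -dw)$.\<close>

definition e2 where "e2 k q d E N m z = alt (Cx E (m+1)) N
(Map (ev (cl k q d) E) (m+1) (fe (inn (cl k q d) E) (cl k q d) N (d+1) z (Df (cl k q d) d (gen k q d))))"

text \<open>All later computations in Hom(cell, E) run in the coordinates (a, w). The formulas for d
  are the Leibniz rule for evaluation at the generator and at its boundary; the filtration bounds
  reflect that the generator has filtration q and its boundary q - k.\<close>

lemma inn_cell:
assumes E: "E : Ob" and m: "N + d = m"
shows e_closed: "z : (inn (cl k q d) E)$N ==> e1 k q d E N m z : E$m"
  "z : (inn (cl k q d) E)$N ==> e2 k q d E N m z : E$(m+1)"
 and e_minus: "z : (inn (cl k q d) E)$N ==> z' : (inn (cl k q d) E)$N ==>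
   e1 k q d E N m (z -[inn (cl k q d) E,N] z') = e1 k q d E N m z -[E,m] e1 k q d E N m z'"
  "z : (inn (cl k q d) E)$N ==> z' : (inn (cl k q d) E)$N ==>
   e2 k q d E N m (z -[inn (cl k q d) E,N] z') = e2 k q d E N m z -[E,m+1] e2 k q d E N m z'"
 and e_d: "z : (inn (cl k q d) E)$N ==>
   e1 k q d E (N+1) (m+1) (Df (inn (cl k q d) E) N z) = Df E m (e1 k q d E N m z) -[E,m+1] e2 k q d E N m z"
  "z : (inn (cl k q d) E)$N ==>
   e2 k q d E (N+1) (m+1) (Df (inn (cl k q d) E) N z) = -[E,m+1+1] Df E (m+1) (e2 k q d E N m z)"
 and e_ex: "a : E$m ==> w : E$(m+1) ==>
   \<exists>z\<in>(inn (cl k q d) E)$N. e1 k q d E N m z = a \<and> e2 k q d E N m z = w"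
 and e_ext: "z : (inn (cl k q d) E)$N ==> z' : (inn (cl k q d) E)$N ==>
   e1 k q d E N m z = e1 k q d E N m z' ==> e2 k q d E N m z = e2 k q d E N m z' ==> z = z'"
 and e_Fl: "z : (inn (cl k q d) E)$N ==> z : Fl (inn (cl k q d) E) P N \<longleftrightarrow>
   e1 k q d E N m z : Fl E (P + q) m \<and> e2 k q d E N m z : Fl E (P + q - int k) (m+1)"
proof -
let ?L = "gen k q d"
let ?K = "cl k q d" and ?Z = "inn (cl k q d) E"
have K: "?K : Ob" by simp
have E': "fcx E" and K': "fcx ?K" and T': "fcx (tn ?Z ?K)" using E by auto
note Z = inn_Ob[OF K E] and e = ev_hom[OF K E]
have m1: "N + (d+1) = m+1" and m2: "N+1 + d = m+1" and m3: "N+1 + (d+1) = m+1+1"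
 and m4: "d + N = m" "d+1 + N = m+1" using m by auto
note g = gen_car[of k q d]
note c1 = fe_in[OF Z K m _ g(1)] and c2 = fe_in[OF Z K m1 _ g(2)]
note me = map_simps[OF e]
have aM: "module R (Cx E j)" for j using E' by simp
let ?e1 = "e1 k q d E N m" and ?e2 = "e2 k q d E N m"
show cl: "?e1 z : E$m" "?e2 z : E$(m+1)" if "z : ?Z$N" for z
 unfolding e1_def e2_def using me(1)[OF c1[OF that]] me(1)[OF c2[OF that]] E' by auto
show "?e1 (z -[?Z,N] z') = ?e1 z -[E,m] ?e1 z'" "?e2 (z -[?Z,N] z') = ?e2 z -[E,m+1] ?e2 z'"
 if z: "z : ?Z$N" "z' : ?Z$N" for z z'
 unfolding e1_def e2_def fe_minus(1)[OF Z K m z(1) g(1) z(2)] fe_minus(1)[OF Z K m1 z(1) g(2) z(2)]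
 using me(3)[OF c1[OF z(1)] c1[OF z(2)]] me(3)[OF c2[OF z(1)] c2[OF z(2)]]
  alt_minus[OF aM me(1)[OF c2[OF z(1)]] me(1)[OF c2[OF z(2)]]] by auto
show "e1 k q d E (N+1) (m+1) (Df ?Z N z) = Df E m (?e1 z) -[E,m+1] ?e2 z"
 "e2 k q d E (N+1) (m+1) (Df ?Z N z) = -[E,m+1+1] Df E (m+1) (?e2 z)" if z: "z : ?Z$N" for z
proof -
 interpret A: abelian_group "Cx E (m+1)" by (rule cx_ab[OF E'])
 have dz: "Df ?Z N z : ?Z$(N+1)" using z Z by simp
 note c3 = fe_in[OF Z K m2 dz g(1)] and c4 = fe_in[OF Z K m3 dz g(2)]
 note x = me(1)[OF c2[OF z]]
 have "Df E m (?e1 z) = e1 k q d E (N+1) (m+1) (Df ?Z N z) +[E,m+1] ?e2 z"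
  unfolding e1_def e2_def map_d[OF e c1[OF z], symmetric] fe_d[OF Z K m z g(1)]
   me(2)[OF c3 cx_alt[OF T' c2[OF z]]] map_alt[OF e c2[OF z]] ..
 thus "e1 k q d E (N+1) (m+1) (Df ?Z N z) = Df E m (?e1 z) -[E,m+1] ?e2 z"
  using cl[OF z] me(1)[OF c3] unfolding e1_def[of k q d E "N+1"] by (simp add: a_minus_def A.a_assoc A.r_neg)
 have dd: "Df ?K (d+1) (Df ?K d ?L) = 0[?K,d+1+1]" using g(1) K' by simp
 have m5: "N + (d+1+1) = m+1+1" using m by simp
 have "Df E (m+1) (Map (ev ?K E) (m+1) (fe ?Z ?K N (d+1) z (Df ?K d ?L))) =
   Map (ev ?K E) (m+1+1) (fe ?Z ?K (N+1) (d+1) (Df ?Z N z) (Df ?K d ?L))"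
  unfolding map_d[OF e c2[OF z], symmetric] fe_d[OF Z K m1 z g(2)] dd fe_zero(2)[OF Z K m5 z]
   alt_zero[OF cx_mod[OF T']] using c4 T' by simp
 thus "e2 k q d E (N+1) (m+1) (Df ?Z N z) = -[E,m+1+1] Df E (m+1) (?e2 z)"
  unfolding e2_def alt_lin[OF aM aM d_lin[OF E'] x] using alt_suc[OF aM me(1)[OF c4], of N] by simp
qed
have val: "\<exists>f\<in>carrier (HM ?K E N). z = cd (HC ?K E) N f \<and> ?e1 z = f d ?L \<and>
  ?e2 z = alt (Cx E (m+1)) N (f (d+1) (Df ?K d ?L))" if zc: "z : ?Z$N" for z
proof -
 obtain f where f: "f : carrier (HM ?K E N)" "z = cd (HC ?K E) N f" using zc unfolding finner_def copy_car by auto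
 show ?thesis using f ev_fe[OF K E m f(1) g(1)] ev_fe[OF K E m1 f(1) g(2)] unfolding e1_def e2_def by auto
qed
show "\<exists>z\<in>?Z$N. ?e1 z = a \<and> ?e2 z = w" if a: "a : E$m" and w: "w : E$(m+1)" for a w
proof -
 obtain f where f: "f : carrier (HM ?K E N)" "f d ?L = a" "f (d+1) (Df ?K d ?L) = alt (Cx E (m+1)) N w"
  using HM_cell_ex[OF E, of a d N "alt (Cx E (m+1)) N w" k q] a w E' unfolding m4 by auto
 have z: "cd (HC ?K E) N f : ?Z$N" unfolding finner_def using f(1) by simp
 have "?e1 (cd (HC ?K E) N f) = a" "?e2 (cd (HC ?K E) N f) = w"
  unfolding e1_def e2_def ev_fe[OF K E m f(1) g(1)] ev_fe[OF K E m1 f(1) g(2)] f using alt_twice[OF aM w] by auto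
 thus ?thesis using z by blast
qed
\<comment> \<open>Every element of the cell is 0 or a multiple of the generator or of its boundary,
  so membership in a submodule is tested there; for nonzero x the filtration of x gives the
  bounds.\<close>
have cc: "f j x : A j" if f: "f : carrier (HM ?K E N)" and x: "x : ?K$j"
 and sub: "submodule (A j) R (Cx E (j + N))" and 1: "j = d ==> x \<noteq> 0[?K,j] ==> f d ?L : A d"
 and 2: "j = d+1 ==> x \<noteq> 0[?K,j] ==> f (d+1) (Df ?K d ?L) : A (d+1)" for f j x A
proof (cases "x = 0[?K,j]")
 case True
 thus ?thesis using lin_zero[OF cx_mod[OF K'] aM HM_lin[OF f]] submodule_zero[OF sub] by simp
next
 case False
 with cell_cases[OF x] show ?thesis
  using 1 2 sub HM_smult[OF f _ g(1)] HM_smult[OF f _ g(2)] submodule_smult[of "A j" R "Cx E (j + N)"] by auto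
qed
show "z = z'" if z: "z : ?Z$N" "z' : ?Z$N" "?e1 z = ?e1 z'" "?e2 z = ?e2 z'" for z z'
proof -
 obtain f where f: "f : carrier (HM ?K E N)" "z = cd (HC ?K E) N f" "?e1 z = f d ?L"
  "?e2 z = alt (Cx E (m+1)) N (f (d+1) (Df ?K d ?L))" using val[OF z(1)] by blast
 obtain f' where f': "f' : carrier (HM ?K E N)" "z' = cd (HC ?K E) N f'" "?e1 z' = f' d ?L"
  "?e2 z' = alt (Cx E (m+1)) N (f' (d+1) (Df ?K d ?L))" using val[OF z(2)] by blast
 have v: "f (d+1) (Df ?K d ?L) : E$(m+1)" "f' (d+1) (Df ?K d ?L) : E$(m+1)"
  using HM_in[OF f(1) g(2)] HM_in[OF f'(1) g(2)] unfolding m4 .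
 have "f (d+1) (Df ?K d ?L) = f' (d+1) (Df ?K d ?L)"
  using z(4) unfolding f(4) f'(4) by (metis alt_twice[OF aM v(1), of N] alt_twice[OF aM v(2), of N])
 moreover have "f d ?L = f' d ?L" using z(3) unfolding f(3) f'(3) .
 ultimately have "f j x = f' j x" if x: "x : ?K$j" for j x
  using cell_cases[OF x] HM_smult[OF f(1) _ g(1)] HM_smult[OF f(1) _ g(2)] HM_smult[OF f'(1) _ g(1)] HM_smult[OF f'(1) _ g(2)]
   lin_zero[OF cx_mod[OF K'] aM HM_lin[OF f(1)]] lin_zero[OF cx_mod[OF K'] aM HM_lin[OF f'(1)]] by auto
 thus ?thesis unfolding f(2) f'(2) using HM_ext[OF f(1) f'(1)] by simp
qed
show "z : Fl ?Z P N \<longleftrightarrow> ?e1 z : Fl E (P + q) m \<and> ?e2 z : Fl E (P + q - int k) (m+1)" if z: "z : ?Z$N" for z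
proof
 have d1: "P + (q - int k) = P + q - int k" by simp
 assume "z : Fl ?Z P N"
 thus "?e1 z : Fl E (P + q) m \<and> ?e2 z : Fl E (P + q - int k) (m+1)" unfolding e1_def e2_def
  using map_Fl[OF e fe_Fl[OF Z K m _ cyclesD(1)[OF gen_cycles] refl]]
   cx_alt_Fl[OF E' map_Fl[OF e fe_Fl[OF Z K m1 _ cyclesD(2)[OF gen_cycles] d1]]] by blast
next
 assume *: "?e1 z : Fl E (P + q) m \<and> ?e2 z : Fl E (P + q - int k) (m+1)"
 obtain f where f: "f : carrier (HM ?K E N)" "z = cd (HC ?K E) N f" "?e1 z = f d ?L"
  "?e2 z = alt (Cx E (m+1)) N (f (d+1) (Df ?K d ?L))" using val[OF z] by blast
 have v: "f (d+1) (Df ?K d ?L) : E$(m+1)" using HM_in[OF f(1) g(2)] unfolding m4 .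
 have f2: "f (d+1) (Df ?K d ?L) : Fl E (P + q - int k) (m+1)"
  using cx_alt_Fl[OF E' conjunct2[OF *], of N] alt_twice[OF aM v, of N] unfolding f(4) by simp
 have "f : Fl (HC ?K E) P N" unfolding HC_Fl
 proof (intro conjI f(1) allI ballI)
  fix t j x assume x: "x : Fl ?K t j"
  show "f j x : Fl E (P + t) (j + N)"
  proof (rule cc[of f x j "%j. Fl E (P + t) (j + N)", OF f(1) Fl_car[OF x K']])
   show "submodule (Fl E (P + t) (j + N)) R (Cx E (j + N))" by (rule Fl_sub[OF E'])
   show "f d ?L : Fl E (P + t) (d + N)" if "j = d" "x \<noteq> 0[?K,j]"
    using cell_Fl_cases[OF x] that Fl_le[OF conjunct1[OF *] _ E', of "P + t"] unfolding f(3) m4 by auto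
   show "f (d+1) (Df ?K d ?L) : Fl E (P + t) (d+1 + N)" if "j = d+1" "x \<noteq> 0[?K,j]"
    using cell_Fl_cases[OF x] that Fl_le[OF f2 _ E', of "P + t"] unfolding m4 by auto
  qed
 qed
 thus "z : Fl ?Z P N" unfolding f(2) finner_def copy_Fl by blast
qed
qed

lemma post_cell:
assumes p: "p : hom E F" and m: "N + d = m" and z: "z : (inn (cl k q d) E)$N"
shows "e1 k q d F N m (Map (M.post (cl k q d) p) N z) = Map p m (e1 k q d E N m z)"
 "e2 k q d F N m (Map (M.post (cl k q d) p) N z) = Map p (m+1) (e2 k q d E N m z)"
proof -
let ?K = "cl k q d"
note O = hom_Ob[OF p] and K = cl_Ob[of k q d]
have m1: "N + (d+1) = m+1" using m by simp
have P: "M.post ?K p : hom (inn ?K E) (inn ?K F)" using M.post_hom[of p E F ?K] p by simp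
have I: "Idt FC (inn ?K E) : hom (inn ?K E) (inn ?K E)" using O by simp
note Z = inn_Ob[OF K O(1)] and i = M.Cmp_Idt[unfolded FC_simps, OF P] and t = tarrI[OF P idI[OF K]]
have "M.unc ?K F (M.post ?K p) = p \<star> ev ?K E"
 using M.unc_post[of p E F ?K "Idt FC (inn ?K E)" "inn ?K E"] p I i K O M.Cmp_Idt[unfolded FC_simps, OF ev_hom[OF K O(1)]]
 unfolding M.unc_def by (simp add: tarr_Idt)
hence u: "ev ?K F \<star> (M.post ?K p \<boxtimes> Idt FC ?K) = p \<star> ev ?K E" unfolding M.unc_def .
have "Map (ev ?K F) l (fe (inn ?K F) ?K N j (Map (M.post ?K p) N z) c) = Map p l (Map (ev ?K E) l (fe (inn ?K E) ?K N j z c))"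
 if l: "N + j = l" and c: "c : ?K$j" for j l c
 using cmp_map[OF t fe_in[OF Z K l z c], of "ev ?K F"] cmp_map[OF ev_hom[OF K O(1)] fe_in[OF Z K l z c], of p]
  tarr_fe[OF P idI[OF K] l z c] c unfolding u by simp
note v = this[OF m gen_car(1)] this[OF m1 gen_car(2)]
note c = map_simps(1)[OF ev_hom[OF K O(1)] fe_in[OF Z K m1 z gen_car(2)]]
show "e1 k q d F N m (Map (M.post ?K p) N z) = Map p m (e1 k q d E N m z)"
 "e2 k q d F N m (Map (M.post ?K p) N z) = Map p (m+1) (e2 k q d E N m z)"
 unfolding e1_def e2_def v map_alt[OF p c] by simp_all
qed

end

section \<open>Fibrations induced on internal homs, and the pushout-product axiom\<close>

context fcm
begin

interpretation M: closed_symmetric_monoidal_category FC by (rule closed_symmetric_monoidal_FC)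

lemma post_hom': "p : hom E F ==> D : Ob ==> M.post D p : hom (inn D E) (inn D F)"
using M.post_hom[of p E F D] by simp

text \<open>Let (b, u) be a k-cycle with b in \<open>F_Q\<close> and u in \<open>F_(Q-s)\<close>.
  Its cycle condition bounds db - u by \<open>F_(Q-k)\<close>; as k is at most s, u already lies
  there. So b and u are separately k-cycles and can be lifted independently along p.\<close>

lemma post_cell_lifts:
assumes p: "p : hom E F" and f: "\<And>P n y. y : cycles F k P n ==> \<exists>x\<in>cycles E k P n. Map p n x = y" and ks: "k \<le> s"
shows "lifts FC (zc k P N) (M.post (cl s q d) p)"
unfolding lifts_zc[OF post_hom'[OF p cl_Ob]]
proof
let ?X = "inn (cl s q d) E" and ?Y = "inn (cl s q d) F" and ?f = "M.post (cl s q d) p"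
fix y assume y: "y : cycles ?Y k P N"
let ?m = "N + d" and ?Q = "P + q"
note O = hom_Ob[OF p] and pc = post_cell[OF p refl] and E = inn_cell[OF hom_Ob(1)[OF p] refl] and F = inn_cell[OF hom_Ob(2)[OF p] refl]
have E': "fcx E" and F': "fcx F" using O by auto
have yc: "y : ?Y$N" and dyc: "Df ?Y N y : ?Y$(N+1)" using cyc_in[OF y] O by auto
let ?b = "e1 s q d F N ?m y" and ?u = "e2 s q d F N ?m y"
have m1: "N+1 + d = ?m+1" by simp
have i: "P - int k + q = ?Q - int k" "?Q - int k - int s = ?Q - int s - int k" by auto
note bu = F(1,2)[OF yc]
have bF: "?b : Fl F ?Q ?m" "?u : Fl F (?Q - int s) (?m+1)" using cyclesD(1)[OF y] F(9)[OF yc] by auto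
have e: "Df F ?m ?b -[F,?m+1] ?u : Fl F (?Q - int k) (?m+1)"
 "-[F,?m+1+1] Df F (?m+1) ?u : Fl F (?Q - int s - int k) (?m+1+1)"
 using cyclesD(2)[OF y] unfolding inn_cell(9)[OF O(2) m1 dyc] F(5,6)[OF yc] i by auto
have "?u : Fl F (?Q - int k) (?m+1)" by (rule Fl_le[OF bF(2) _ F']) (use ks in simp)
from Fl_add[OF F' e(1) this] have "Df F ?m ?b : Fl F (?Q - int k) (?m+1)" using bu F' by (simp add: ab_ids(1)[OF F'])
moreover have "Df F (?m+1) ?u : Fl F (?Q - int s - int k) (?m+1+1)" using e(2) Fl_neg_iff[OF F' d_simps(1)[OF F' bu(2)]] by blast
ultimately have "?b : cycles F k ?Q ?m" "?u : cycles F k (?Q - int s) (?m+1)" using bF by (auto intro!: cyclesI)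
then obtain a w where a: "a : cycles E k ?Q ?m" "Map p ?m a = ?b" and w: "w : cycles E k (?Q - int s) (?m+1)" "Map p (?m+1) w = ?u"
 using f by metis
have "w : Fl E (?Q - int k) (?m+1)" by (rule Fl_le[OF cyclesD(1)[OF w(1)] _ E']) (use ks in simp)
hence aw: "Df E ?m a -[E,?m+1] w : Fl E (?Q - int k) (?m+1)" using Fl_minus[OF E' cyclesD(2)[OF a(1)]] by blast
obtain z where z: "z : ?X$N" "e1 s q d E N ?m z = a" "e2 s q d E N ?m z = w"
 using E(7)[OF cyc_in[OF a(1) E'] cyc_in[OF w(1) E']] by blast
have dz: "Df ?X N z : ?X$(N+1)" using z(1) O by simp
have "z : cycles ?X k P N"
 using aw cyclesD(1)[OF a(1)] cyclesD(1)[OF w(1)] Fl_neg[OF E' cyclesD(2)[OF w(1)]]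
 by (intro cyclesI; unfold E(9)[OF z(1)] inn_cell(9)[OF O(1) m1 dz] E(5,6)[OF z(1)] z(2,3) i) auto
moreover have "Map ?f N z = y"
 by (rule F(8)[OF map_simps(1)[OF post_hom'[OF p cl_Ob] z(1)] yc]) (use pc[OF z(1)] z a w in simp_all)
ultimately show "\<exists>x\<in>cycles ?X k P N. Map ?f N x = y" by blast
qed

text \<open>The map $(a, w) \mapsto (0, -a)$ contracts the internal hom out of a cell.\<close>

lemma inn_cell_acyclic:
assumes E: "E : Ob" and s: "s \<le> r" and x: "x : cyc (inn (cl s q d) E) r P n"
shows "x : bnd (inn (cl s q d) E) r P n"
proof -
let ?Z = "inn (cl s q d) E"
have E': "fcx E" and Z: "fcx ?Z" using E by auto
have "x : cyc ?Z r P n --> x : bnd ?Z r P n" for x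
proof (rule int_Suc_cases[of _ n], rule impI)
 fix N x assume x: "x : cyc ?Z r P (N+1)"
 let ?m = "N + d" and ?Q = "P + q"
 have m1: "N+1 + d = ?m+1" and m2: "N+1+1 + d = ?m+1+1" by auto
 note E0 = inn_cell[OF E refl] and E1 = inn_cell[OF E m1]
 have xc: "x : ?Z$(N+1)" using cyc_in[OF x Z] .
 let ?A = "e1 s q d E (N+1) (?m+1) x" and ?c = "e2 s q d E (N+1) (?m+1) x"
 note Ac = E1(1,2)[OF xc]
 have A: "?A : Fl E ?Q (?m+1)" using cyclesD(1)[OF x] unfolding E1(9)[OF xc] by blast
 have dA: "Df E (?m+1) ?A -[E,?m+1+1] ?c : Fl E (P - int (Suc r) + q) (?m+1+1)"
  using cyclesD(2)[OF x] unfolding inn_cell(9)[OF E m2 d_simps(1)[OF Z xc]] E1(5,6)[OF xc] by blast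
 obtain z where z: "z : ?Z$N" "e1 s q d E N ?m z = 0[E,?m]" "e2 s q d E N ?m z = -[E,?m+1] ?A"
  using E0(7)[OF cx_closed(1)[OF E'] cx_closed(4)[OF E' Ac(1)]] by blast
 have zF: "z : Fl ?Z (P + int r) N" unfolding E0(9)[OF z(1)] z(2,3)
  using E' Fl_le[OF Fl_neg[OF E' A] _ E', of "P + int r + q - int s"] s by simp
 \<comment> \<open>With x = (A, c) and z = (0, -A) the difference x - dz is (0, c - dA). The cycle
   condition puts c - dA into filtration Q - r - 1, which is low enough because s is at most
   r.\<close>
 have "x -[?Z,N+1] Df ?Z N z : Fl ?Z (P - 1) (N+1)"
  unfolding E1(9)[OF cx_closed(3)[OF Z xc d_simps(1)[OF Z z(1)]]] E1(3,4)[OF xc d_simps(1)[OF Z z(1)]] E0(5,6)[OF z(1)] z(2,3)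
 proof
  show "?A -[E,?m+1] (Df E ?m 0[E,?m] -[E,?m+1] (-[E,?m+1] ?A)) : Fl E (P - 1 + q) (?m+1)" using Ac E' by simp
  interpret M: abelian_group "Cx E (?m+1+1)" by (rule cx_ab[OF E'])
  have "?c -[E,?m+1+1] Df E (?m+1) ?A = -[E,?m+1+1] (Df E (?m+1) ?A -[E,?m+1+1] ?c)"
   using Ac(2) d_simps(1)[OF E' Ac(1)] by algebra
  hence "?c -[E,?m+1+1] Df E (?m+1) ?A : Fl E (P - 1 + q - int s) (?m+1+1)"
   using Fl_le[OF Fl_neg[OF E' dA] _ E', of "P - 1 + q - int s"] s by simp
  thus "?c -[E,?m+1+1] (-[E,?m+1+1] Df E (?m+1) (-[E,?m+1] ?A)) : Fl E (P - 1 + q - int s) (?m+1+1)"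
   unfolding d_simps(4)[OF E' Ac(1)] cx_simps(5)[OF E' d_simps(1)[OF E' Ac(1)]] .
 qed
 note u = ilift_cycles[OF Z x zF this]
 have "x = Df ?Z N z +[?Z,N+1] (x -[?Z,N+1] Df ?Z N z)" using ab_add_diff[OF Z xc d_simps(1)[OF Z z(1)]] by simp
 thus "x : bnd ?Z r P (N+1)" unfolding bnd_iff[OF Z] using u by blast
qed
thus ?thesis using x by blast
qed

text \<open>For the cell of index r + 1 the problem decouples. With x = (A, c) and y = (b, u), the
  entry u has filtration Q - 1 and is invisible modulo \<open>F_(Q-1)\<close>; so there are two
  lifting problems for p, one for A over b at filtration Q and one for -c over u at filtration Q - r
  - 1. Their solutions v and w form the lift (v, w).\<close>

lemma post_Z_ilift:
assumes p: "p : hom E F" and l: "ilift E F p r"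
shows "ilift (inn (cl (Suc r) q d) E) (inn (cl (Suc r) q d) F) (M.post (cl (Suc r) q d) p) r"
unfolding ilift_def
proof (intro allI ballI impI)
let ?k = "Suc r"
let ?X = "inn (cl ?k q d) E" and ?Y = "inn (cl ?k q d) F" and ?f = "M.post (cl ?k q d) p"
fix P N x y assume x: "x : cycles ?X ?k P (N+1)" and y: "y : Fl ?Y (P + int r) N"
 and xy: "Map ?f (N+1) x -[?Y,N+1] Df ?Y N y : Fl ?Y (P - 1) (N+1)"
define m Q where "m = N + d" and "Q = P + q"
note O = hom_Ob[OF p]
have E': "fcx E" and F': "fcx F" and X': "fcx ?X" and Y': "fcx ?Y" using O by auto
have m0: "N + d = m" and m1: "N+1 + d = m+1" and m2: "N+1+1 + d = m+1+1" unfolding m_def by auto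
note E0 = inn_cell[OF O(1) m0] and F0 = inn_cell[OF O(2) m0] and E1 = inn_cell[OF O(1) m1] and F1 = inn_cell[OF O(2) m1]
note f = post_hom'[OF p cl_Ob]
have xc: "x : ?X$(N+1)" and yc: "y : ?Y$N" using cyc_in[OF x X'] Fl_car[OF y Y'] .
note dx = d_simps(1)[OF X' xc] and dy = d_simps(1)[OF Y' yc] and fx = map_simps(1)[OF f xc]
let ?A = "e1 ?k q d E (N+1) (m+1) x" and ?c = "e2 ?k q d E (N+1) (m+1) x"
let ?b = "e1 ?k q d F N m y" and ?u = "e2 ?k q d F N m y"
let ?M = "Cx E (m+1)" and ?N = "Cx F (m+1)" and ?M2 = "Cx E (m+1+1)" and ?N2 = "Cx F (m+1+1)"
have i: "P + q = Q" "P - int ?k + q = Q - int ?k" "P + int r + q = Q + int r" "P - 1 + q = Q - 1" "Q + int r - int ?k = Q - 1"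
 "Q - int ?k + int r = Q - 1" "Q - int ?k - 1 = Q - 1 - int ?k" unfolding Q_def by auto
have A: "?A : Fl E Q (m+1)" and c: "?c : Fl E (Q - int ?k) (m+1+1)" using cyclesD(1)[OF x] unfolding E1(9)[OF xc] i by auto
have 2: "Df E (m+1) ?A -[?M2] ?c : Fl E (Q - int ?k) (m+1+1)"
 "-[E,m+1+1+1] Df E (m+1+1) ?c : Fl E (Q - int ?k - int ?k) (m+1+1+1)"
 using cyclesD(2)[OF x] unfolding inn_cell(9)[OF O(1) m2 dx] E1(5,6)[OF xc] i by auto
have b: "?b : Fl F (Q + int r) m" and u: "?u : Fl F (Q - 1) (m+1)" using y unfolding F0(9)[OF yc] i by auto
have g: "Map p (m+1) ?A -[?N] (Df F m ?b -[?N] ?u) : Fl F (Q - 1) (m+1)"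
 and cu: "Map p (m+1+1) ?c -[?N2] (-[?N2] Df F (m+1) ?u) : Fl F (Q - 1 - int ?k) (m+1+1)"
 using xy unfolding F1(9)[OF cx_closed(3)[OF Y' fx dy]] F1(3,4)[OF fx dy] post_cell[OF p m1 xc] F0(5,6)[OF yc] i by auto
interpret M: abelian_group ?M by (rule cx_ab[OF E'])
interpret N: abelian_group ?N by (rule cx_ab[OF F'])
note Ac = E1(1,2)[OF xc] F0(1,2)[OF yc]
have pA: "Map p (m+1) ?A : carrier ?N" "Df F m ?b : carrier ?N" "Df F (m+1) ?u : carrier ?N2" "Map p (m+1+1) ?c : carrier ?N2"
  "Df E (m+1) ?A : carrier ?M2"
 using Ac p E' F' by auto
have "Df E (m+1) ?A : Fl E (Q - int ?k) (m+1+1)" using Fl_add[OF E' 2(1) c] ab_ids(1)[OF E' pA(5) Ac(2)] by simp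
hence Az: "?A : cycles E ?k Q (m+1)" using A by (intro cyclesI)
have "Map p (m+1) ?A -[?N] Df F m ?b = (Map p (m+1) ?A -[?N] (Df F m ?b -[?N] ?u)) -[?N] ?u" using Ac pA by algebra
hence "Map p (m+1) ?A -[?N] Df F m ?b : Fl F (Q - 1) (m+1)" using Fl_minus[OF F' g u] by simp
then obtain v where v: "v : Fl E (Q + int r) m" "Map p m v = ?b" "?A -[?M] Df E m v : Fl E (Q - 1) (m+1)"
 using l[unfolded ilift_def] Az b by blast
have cz: "-[?M2] ?c : cycles E ?k (Q - int ?k) (m+1+1)" using Fl_neg[OF E' c] 2(2) Ac E' by (intro cyclesI) simp_all
have "Map p (m+1+1) (-[?M2] ?c) -[?N2] Df F (m+1) ?u = -[?N2] (Map p (m+1+1) ?c -[?N2] (-[?N2] Df F (m+1) ?u))"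
proof -
 interpret N2: abelian_group ?N2 by (rule cx_ab[OF F'])
 show ?thesis unfolding map_simps(4)[OF p Ac(2)] using pA(3,4) by algebra
qed
hence "Map p (m+1+1) (-[?M2] ?c) -[?N2] Df F (m+1) ?u : Fl F (Q - int ?k - 1) (m+1+1)"
 using Fl_neg[OF F' cu] unfolding i by simp
then obtain w where w: "w : Fl E (Q - 1) (m+1)" "Map p (m+1) w = ?u"
 "-[?M2] ?c -[?M2] Df E (m+1) w : Fl E (Q - 1 - int ?k) (m+1+1)"
 using l[unfolded ilift_def, rule_format, OF cz, of ?u] u unfolding i by blast
have vc: "v : E$m" "w : carrier ?M" "Df E m v : carrier ?M" "Df E (m+1) w : carrier ?M2" using Fl_car[OF v(1) E'] Fl_car[OF w(1) E'] E' by auto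
have cw: "?c -[?M2] (-[?M2] Df E (m+1) w) : Fl E (Q - 1 - int ?k) (m+1+1)"
proof -
 interpret M2: abelian_group ?M2 by (rule cx_ab[OF E'])
 have "-[?M2] (-[?M2] ?c -[?M2] Df E (m+1) w) = ?c -[?M2] (-[?M2] Df E (m+1) w)" using Ac(2) vc(4) by algebra
 thus ?thesis using Fl_neg[OF E' w(3)] by simp
qed
have "?A -[?M] (Df E m v -[?M] w) = (?A -[?M] Df E m v) +[?M] w" using Ac vc by algebra
hence Av: "?A -[?M] (Df E m v -[?M] w) : Fl E (Q - 1) (m+1)" using Fl_add[OF E' v(3) w(1)] by simp
obtain z where z: "z : ?X$N" "e1 ?k q d E N m z = v" "e2 ?k q d E N m z = w" using E0(7)[OF vc(1,2)] by blast
note dz = d_simps(1)[OF X' z(1)]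
have "z : Fl ?X (P + int r) N" unfolding E0(9)[OF z(1)] z i using v(1) w(1) by blast
moreover have "Map ?f N z = y"
 by (rule F0(8)[OF map_simps(1)[OF f z(1)] yc]) (use post_cell[OF p m0 z(1)] z v w in simp_all)
moreover have "x -[?X,N+1] Df ?X N z : Fl ?X (P - 1) (N+1)"
 unfolding E1(9)[OF cx_closed(3)[OF X' xc dz]] E1(3,4)[OF xc dz] E0(5,6)[OF z(1)] z i using Av cw by blast
ultimately show "\<exists>u\<in>Fl ?X (P + int r) N. Map ?f N u = y \<and> x -[?X,N+1] Df ?X N u : Fl ?X (P - 1) (N+1)" by blast
qed

lemma llpI: "f : farrows R ==> (\<And>p. p : K ==> lifts FC f p) ==> f : llp FC K"
and llpD: "f : llp FC K ==> p : K ==> lifts FC f p" "f : llp FC K ==> f : hom (Src f) (Tgt f)"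
and rlpI: "p : farrows R ==> (\<And>f. f : K ==> lifts FC f p) ==> p : rlp FC K"
unfolding llp_def rlp_def using arr_hom by auto

lemma fib_hom: "p : Fib ==> p : hom (Src p) (Tgt p)"
using Fib_arr arr_hom by fastforce

text \<open>Lifting against the k-cell is direct when k is at most s. Otherwise s belongs to
  \<open>S\<close> and is at most k; symmetry of the pushout-product exchanges the two cells and
  leads back to the first case.\<close>

lemma post_J_Fib:
assumes p: "p : Fib" and s: "s : S \<or> s = Suc r"
shows "M.post (cl s q d) p : Fib"
unfolding fibrations_def
proof (rule rlpI[OF hom_arr[OF post_hom'[OF fib_hom[OF p] cl_Ob]]])
note ph = fib_hom[OF p] and f = p[unfolded Fib_iff[OF fib_hom[OF p]] fibE_def, rule_format]
fix j :: "('r, 'u) farrow" assume "j : gen_acyclic_cof R S"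
then obtain k P N where k: "k : S" and j: "j = zc k P N" unfolding gen_acyclic_cof_def gen_J_eq by blast
show "lifts FC j (M.post (cl s q d) p)" unfolding j
proof (cases "k \<le> s")
 case True
 show "lifts FC (zc k P N) (M.post (cl s q d) p)" by (rule post_cell_lifts[OF ph f[OF k] True])
next
 case False
 hence s: "s : S" "s \<le> k" using s sr[OF k] by auto
 have "lifts FC (zc s q d) (M.post (cl k P N) p)" by (rule post_cell_lifts[OF ph f[OF s(1)] s(2)])
 thus "lifts FC (zc k P N) (M.post (cl s q d) p)"
  using pp_zero[OF zc zc ph] M.pp_sym[unfolded FC_simps, OF zc zc ph] by blast
qed
qed

text \<open>Both internal homs have trivial page r + 1 by \<open>inn_cell_acyclic\<close>, so the
  fibration between them is trivially a weak equivalence.\<close>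

lemma post_J_TF:
assumes p: "p : Fib" and s: "s : S"
shows "M.post (cl s q d) p : TF"
proof -
note ph = fib_hom[OF p] and h = post_hom'[OF fib_hom[OF p] cl_Ob[of s q d]]
note O = hom_fcx[OF h] and a = inn_cell_acyclic[OF _ sr[OF s]]
have "wiso (inn (cl s q d) (Src p)) (inn (cl s q d) (Tgt p)) (M.post (cl s q d) p) r"
proof (rule wisoI)
 fix P n y assume y: "y : cycles (inn (cl s q d) (Tgt p)) (Suc r) P n"
 show "\<exists>x\<in>cycles (inn (cl s q d) (Src p)) (Suc r) P n. y -[inn (cl s q d) (Tgt p),n] Map (M.post (cl s q d) p) n x :
   bnd (inn (cl s q d) (Tgt p)) r P n"
  using a[OF hom_Ob(2)[OF ph] y] submodule_zero[OF cycles_sub[OF O(1)]] cyc_in[OF y O(2)] O(2) map_simps(5)[OF h]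
  by (intro bexI[of _ "0[inn (cl s q d) (Src p),n]"]) simp_all
qed (rule a[OF hom_Ob(1)[OF ph]])
thus ?thesis using post_J_Fib[OF p] s weak_iff[OF h] unfolding TF_eq by blast
qed

lemma Cof_eq: "Cof = llp FC TF" unfolding cofibrations_def ..

lemma gens_Cof: "i : gen_cof R r S ==> i : Cof"
using gens_arr(1) unfolding Cof_eq by (intro llpI) (auto simp: rlp_def)

lemma TF_Fib: "p : TF ==> p : Fib" unfolding TF_eq by blast

lemma pbhom_hom: "M.pbhom g p L x y P ==> P : hom (inn (Tgt g) (Src p)) L"
unfolding M.pbhom_def by simp

lemma pp_zc:
assumes f: "f : Cof" and p: "p : Fib" and s: "s : S"
shows "M.pp f (zc s q d) p"
using pp_zero[OF llpD(2)[OF f[unfolded Cof_eq]] zc fib_hom[OF p]] llpD(1)[OF f[unfolded Cof_eq] post_J_TF[OF p s]] by blast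

text \<open>Lifting a cell of \<open>J_S\<close> against \<open>P\<close> is, by symmetry, lifting
  the cofibration f against Hom(Z_s, p), which is an acyclic fibration.\<close>

lemma pbhom_Fib:
assumes f: "f : Cof" and p: "p : Fib" and P: "M.pbhom f p L x y P"
shows "P : Fib"
unfolding fibrations_def
proof (rule rlpI[OF hom_arr[OF pbhom_hom[OF P]]])
note fh = llpD(2)[OF f[unfolded Cof_eq]]
fix j :: "('r, 'u) farrow" assume "j : gen_acyclic_cof R S"
then obtain s q d where s: "s : S" and j: "j = zc s q d" unfolding gen_acyclic_cof_def gen_J_eq by blast
show "lifts FC j P" unfolding j
 using M.pp_lifts[unfolded FC_simps, OF zc fh fib_hom[OF p] P] M.pp_sym[unfolded FC_simps, OF fh zc fib_hom[OF p] pp_zc[OF f p s]] by blast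
qed

text \<open>The pullback-hom of f and p is a fibration by \<open>pbhom_Fib\<close>, and g lifts
  against all of these.\<close>

lemma pp_acyclic:
assumes f: "f : Cof" and g: "g : llp FC Fib" and p: "p : Fib"
shows "M.pp g f p" "M.pp f g p"
proof -
note fh = llpD(2)[OF f[unfolded Cof_eq]] and gh = llpD(2)[OF g]
obtain L x y P where P: "M.pbhom f p L x y P" using pbhom_exists[OF fh fib_hom[OF p]] by blast
show 1: "M.pp g f p"
 using M.pp_lifts[unfolded FC_simps, OF gh fh fib_hom[OF p] P] llpD(1)[OF g pbhom_Fib[OF f p P]] by blast
show "M.pp f g p" by (rule M.pp_sym[unfolded FC_simps, OF gh fh fib_hom[OF p] 1])
qed

lemma post_Z_TF:
assumes p: "p : TF"
shows "M.post (cl (Suc r) q d) p : TF"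
proof -
note ph = fib_hom[OF TF_Fib[OF p]]
note h = post_hom'[OF ph cl_Ob[of "Suc r" q d]]
show ?thesis using TF_iff[OF h] Fib_iff[OF h] post_J_Fib[OF TF_Fib[OF p], of "Suc r"] post_Z_ilift[OF ph] TF_iff[OF ph] p by blast
qed

text \<open>\<open>B_(r+1)\<close> is a sum of two cells of index r, and r belongs to
  \<open>S\<close>: a map out of it is a pair of r-cycles, on which fibrations are
  surjective.\<close>

lemma zero_bdc: "from_copy (ZC R) (cpy (bdc r p n)) (%m c. 0[cpy (bdc r p n),m]) : llp FC Fib"
proof (rule llpI)
let ?B = "cpy (bdc r p n)" and ?z = "from_copy (ZC R) (cpy (bdc r p n)) (%m c. 0[cpy (bdc r p n),m])"
have z: "?z : hom Z0 ?B" by (rule zero_hom[OF copy_Ob[OF bdc_cpx]])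
thus "?z : farrows R" by (rule hom_arr)
fix q :: "('r, 'u) farrow" assume q: "q : Fib"
note qh = fib_hom[OF q] note f = q[unfolded Fib_iff[OF qh] fibE_def]
show "lifts FC ?z q"
proof (rule FC.liftsI, unfold FC_simps, rule z, rule qh)
 fix u v assume u: "u : hom Z0 (Src q)" and v: "v : hom ?B (Tgt q)"
 obtain a where a: "a : cycles (Src q) r (p + int r) n" "Map q n a = Map v n (g1 r p n)" using f rS cycles_map[OF v g1_cycles] by blast
 obtain b where b: "b : cycles (Src q) r (p - 1) (n+1)" "Map q (n+1) b = Map v (n+1) (g2 r p n)" using f rS cycles_map[OF v g2_cycles] by blast
 obtain h where h: "h : hom ?B (Src q)" "Map h n (g1 r p n) = a" "Map h (n+1) (g2 r p n) = b"
  using bdc_hom[OF hom_Ob(1)[OF qh] a(1) b(1)] by blast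
 have "q \<star> h = v" by (rule bdc_ext[OF cmpI[OF h(1) qh] v])
  (use h a b in \<open>simp_all add: cmp_map[OF h(1) cyc_in[OF g1_cycles]] cmp_map[OF h(1) cyc_in[OF g2_cycles]] bdc_cpx\<close>)
 thus "\<exists>h\<in>hom ?B (Src q). h \<star> ?z = u \<and> q \<star> h = v"
  using h(1) zero_ext[OF cmpI[OF z h(1)] u] by blast
qed
qed

text \<open>The zero map into \<open>B_(r+1)\<close> lifts against all fibrations, so its
  pushout-product with a generating cofibration lifts against \<open>p\<close>; with
  \<open>pp_zero\<close> this is lifting against Hom(B, p).\<close>

lemma post_B_TF:
assumes p: "p : Fib"
shows "M.post (cpy (bdc r k n)) p : TF"
proof -
let ?z = "from_copy (ZC R) (cpy (bdc r k n)) (%m c. 0[cpy (bdc r k n),m])"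
note ph = fib_hom[OF p]
have z: "?z : hom Z0 (cpy (bdc r k n))" by (rule zero_hom[OF copy_Ob[OF bdc_cpx]])
show ?thesis
proof (rule rlpI[OF hom_arr[OF post_hom'[OF ph copy_Ob[OF bdc_cpx]]]])
 fix i :: "('r, 'u) farrow" assume "i : gen_cof R r S"
 from gens_Cof[OF this] have i: "i : Cof" .
 show "lifts FC i (M.post (cpy (bdc r k n)) p)"
  using pp_zero[OF llpD(2)[OF i[unfolded Cof_eq]] z ph] pp_acyclic(2)[OF i zero_bdc p] by blast
qed
qed

text \<open>\<open>P\<close> is already a fibration, so only the weak equivalence is at stake. The
  projection \<open>y\<close> is a base change of Hom(Z_(r+1), p), and \<open>y\<close> composed
  with \<open>P\<close> is Hom(B, p); both are acyclic fibrations, and two-out-of-three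
  applies.\<close>

lemma pbhom_phi_TF:
assumes p: "p : TF" and P: "M.pbhom (phi r k n) p L x y P"
shows "P : TF"
proof -
have phiC: "phi r k n : Cof" by (rule gens_Cof) (auto simp: gen_cof_def gen_I_eq)
define E F where "E = Src p" and "F = Tgt p"
have ph: "p : hom E F" using fib_hom[OF TF_Fib[OF p]] unfolding E_def F_def .
let ?Z = "cl (Suc r) k (n+1)" and ?B = "cpy (bdc r k n)"
have d: "Src (phi r k n) = ?Z" "Tgt (phi r k n) = ?B" "Src p = E" "Tgt p = F"
 using hom_src[OF phi(1)] hom_tgt[OF phi(1)] hom_src[OF ph] hom_tgt[OF ph] by auto
note P' = P[unfolded M.pbhom_def FC_simps d]
have x: "x : hom L (inn ?Z E)" and y: "y : hom L (inn ?B F)" and Ph: "P : hom (inn ?B E) L"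
 and sq: "M.post ?Z p \<star> x = M.pre (phi r k n) F \<star> y" and yP: "y \<star> P = M.post ?B p"
 and univ: "\<And>Z u v. u : hom Z (inn ?Z E) ==> v : hom Z (inn ?B F) ==> M.post ?Z p \<star> u = M.pre (phi r k n) F \<star> v ==>
  \<exists>!h. h : hom Z L \<and> x \<star> h = u \<and> y \<star> h = v"
 using P' by auto
have pF: "M.pre (phi r k n) F : hom (inn ?B F) (inn ?Z F)" using M.pre_hom[of "phi r k n" ?Z ?B F] phi(1) hom_Ob(2)[OF ph] by simp
note pZ = post_hom'[OF ph cl_Ob[of "Suc r" k "n+1"]]
\<comment> \<open>Acyclic fibrations are stable under base change: the lift is found for
  Hom(Z_(r+1), p) and carried into L by the pullback property.\<close>
have "y : TF"
proof (rule rlpI[OF hom_arr[OF y]])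
 fix i :: "('r, 'u) farrow" assume "i : gen_cof R r S"
 from gens_Cof[OF this] have i: "i : llp FC TF" unfolding Cof_eq .
 note ih = llpD(2)[OF i]
 show "lifts FC i y"
 proof (rule FC.liftsI, unfold FC_simps, rule ih, rule y)
  fix u v assume u: "u : hom (Src i) L" and v: "v : hom (Tgt i) (inn ?B F)" and uv: "y \<star> u = v \<star> i"
  note as = FC.Cmp_assoc[unfolded FC_simps]
  have e: "M.post ?Z p \<star> (x \<star> u) = (M.pre (phi r k n) F \<star> v) \<star> i"
   unfolding as[OF u x pZ] sq as[OF u y pF, symmetric] uv as[OF ih v pF] ..
  obtain h where h: "h : hom (Tgt i) (inn ?Z E)" "h \<star> i = x \<star> u" "M.post ?Z p \<star> h = M.pre (phi r k n) F \<star> v"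
   using FC.liftsD[unfolded FC_simps, OF llpD(1)[OF i post_Z_TF[OF p]] ih pZ cmpI[OF u x] cmpI[OF v pF] e] by blast
  obtain w where w: "w : hom (Tgt i) L" "x \<star> w = h" "y \<star> w = v" using univ[OF h(1) v h(3)] by blast
  have "M.post ?Z p \<star> (x \<star> u) = M.pre (phi r k n) F \<star> (v \<star> i)" unfolding e as[OF ih v pF] ..
  from univ[OF cmpI[OF u x] cmpI[OF ih v] this]
  have "w \<star> i = u"
   using cmpI[OF ih w(1)] u uv as[OF ih w(1) x] as[OF ih w(1) y] w h(2) by metis
  thus "\<exists>h\<in>hom (Tgt i) L. h \<star> i = u \<and> y \<star> h = v" using w by blast
 qed
qed
hence "wiso L (inn ?B F) y r" using weak_iff[OF y] unfolding TF_eq by blast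
moreover have "wiso (inn ?B E) (inn ?B F) (y \<star> P) r" unfolding yP
 using post_B_TF[OF TF_Fib[OF p], of k n] weak_iff[OF post_hom'[OF ph copy_Ob[OF bdc_cpx, of r k n]]] unfolding TF_eq by blast
ultimately have "P : W" using wiso_cancel_right[OF Ph y] weak_iff[OF Ph] by blast
thus ?thesis using pbhom_Fib[OF phiC TF_Fib[OF p] P] unfolding TF_eq by blast
qed

text \<open>The pullback-hom \<open>P\<close> of f and p is tested on generators. By symmetry a
  generator tested against it becomes f tested against the pullback-hom of the generator, known from
  \<open>pbhom_phi_TF\<close> and \<open>pp_zc\<close>.\<close>

lemma pp_Cof:
assumes f: "f : Cof" and g: "g : Cof" and p: "p : TF"
shows "M.pp g f p"
proof -
note fh = llpD(2)[OF f[unfolded Cof_eq]] and gh = llpD(2)[OF g[unfolded Cof_eq]] and ph = fib_hom[OF TF_Fib[OF p]]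
obtain L x y P where P: "M.pbhom f p L x y P" using pbhom_exists[OF fh ph] by blast
have "P : TF"
proof (rule rlpI[OF hom_arr[OF pbhom_hom[OF P]]])
 fix i :: "('r, 'u) farrow" assume i: "i : gen_cof R r S"
 have "M.pp f i p"
 proof (cases "i : gen_I R r")
  case True
  then obtain k n where i: "i = phi r k n" unfolding gen_I_eq by blast
  obtain L x y P where P: "M.pbhom (phi r k n) p L x y P" using pbhom_exists[OF phi(1) ph] by blast
  show ?thesis unfolding i
   using M.pp_lifts[unfolded FC_simps, OF fh phi(1) ph P] llpD(1)[OF f[unfolded Cof_eq] pbhom_phi_TF[OF p P]] by blast
 next
  case False
  then obtain s q d where "s : S" "i = zc s q d" using i unfolding gen_cof_def gen_J_eq by blast
  thus ?thesis using pp_zc[OF f TF_Fib[OF p]] by blast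
 qed
 from M.pp_sym[unfolded FC_simps, OF fh llpD(2)[OF gens_Cof[OF i, unfolded Cof_eq]] ph this]
 show "lifts FC i P" using M.pp_lifts[unfolded FC_simps, OF llpD(2)[OF gens_Cof[OF i, unfolded Cof_eq]] fh ph P] by blast
qed
thus ?thesis
 using M.pp_lifts[unfolded FC_simps, OF gh fh ph P] llpD(1)[OF g[unfolded Cof_eq]] by blast
qed

lemma pushout_product:
assumes f: "f : Cof" and g: "g : Cof"
 and po: "is_pushout FC (Idt FC (Dom FC f) \<boxtimes> g) (f \<boxtimes> Idt FC (Dom FC g)) i j"
 and h: "h : homset FC (Cod FC i) (Cod FC f \<otimes>\<^sub>o\<^bsub>FC\<^esub> Cod FC g)"
 and hi: "h \<star> i = f \<boxtimes> Idt FC (Cod FC g)" and hj: "h \<star> j = Idt FC (Cod FC f) \<boxtimes> g"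
shows "h : Cof \<and> (f : W \<or> g : W --> h : W)"
proof -
note fh = llpD(2)[OF f[unfolded Cof_eq]] and gh = llpD(2)[OF g[unfolded Cof_eq]]
define A B X D where "A = Src f" and "B = Tgt f" and "X = Src g" and "D = Tgt g"
note ABXD = A_def[symmetric] B_def[symmetric] X_def[symmetric] D_def[symmetric]
have fh: "f : hom A B" and gh: "g : hom X D" using fh gh unfolding ABXD .
note O = hom_Ob[OF fh] hom_Ob[OF gh]
have t: "Idt FC A \<boxtimes> g : hom (tn A X) (tn A D)" "f \<boxtimes> Idt FC X : hom (tn A X) (tn B X)"
 "f \<boxtimes> Idt FC D : hom (tn A D) (tn B D)" "Idt FC B \<boxtimes> g : hom (tn B X) (tn B D)"
 using fh gh O by (auto intro!: tarrI)
define L where "L = Tgt i"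
note P = po[unfolded is_pushout_def FC_simps ABXD hom_tgt[OF t(1)] hom_tgt[OF t(2)]]
have po': "i : farrows R" "j : farrows R" "Src i = tn A D" "Src j = tn B X" "Tgt i = Tgt j"
 "i \<star> (Idt FC A \<boxtimes> g) = j \<star> (f \<boxtimes> Idt FC X)"
 using P by simp_all
have univ: "\<exists>!h. h : hom L Y \<and> h \<star> i = u \<and> h \<star> j = v"
 if "u : hom (tn A D) Y" "v : hom (tn B X) Y" "u \<star> (Idt FC A \<boxtimes> g) = v \<star> (f \<boxtimes> Idt FC X)" for Y u v
 unfolding L_def using P that by blast
have ih: "i : hom (tn A D) L" and jh: "j : hom (tn B X) L" using po'(1-5) arr_hom[of i] arr_hom[of j] unfolding L_def by auto
have h: "h : hom L (tn B D)" and hi: "h \<star> i = f \<boxtimes> Idt FC D" and hj: "h \<star> j = Idt FC B \<boxtimes> g"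
 using h hi hj unfolding FC_simps FC_tensor ABXD L_def by auto
note as = FC.Cmp_assoc[unfolded FC_simps]
\<comment> \<open>A lift k found on B (x) D extends u because both k h and u are determined by their
  restrictions along \<open>i\<close> and \<open>j\<close>.\<close>
have lift: "lifts FC h p" if p: "p : hom E F" and pp: "M.pp f g p" for p E F
proof (rule FC.liftsI, unfold FC_simps, rule h, rule p)
 fix u v assume u: "u : hom L E" and v: "v : hom (tn B D) F" and uv: "p \<star> u = v \<star> h"
 have e: "u \<star> i \<star> (Idt FC A \<boxtimes> g) = u \<star> j \<star> (f \<boxtimes> Idt FC X)"
  unfolding as[OF t(1) ih u, symmetric] as[OF t(2) jh u, symmetric] po'(6) ..
 moreover have "p \<star> (u \<star> i) = v \<star> (f \<boxtimes> Idt FC D)"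
  unfolding as[OF ih u p] uv as[OF ih h v, symmetric] hi ..
 moreover have "p \<star> (u \<star> j) = v \<star> (Idt FC B \<boxtimes> g)"
  unfolding as[OF jh u p] uv as[OF jh h v, symmetric] hj ..
 ultimately obtain k where k: "k : hom (tn B D) E" "k \<star> (f \<boxtimes> Idt FC D) = u \<star> i"
  "k \<star> (Idt FC B \<boxtimes> g) = u \<star> j" "p \<star> k = v"
  using pp v cmpI[OF ih u] cmpI[OF jh u]
  unfolding M.pp_def FC_simps FC_tensor ABXD hom_src[OF p] hom_tgt[OF p] by blast
 have "k \<star> h = u"
  using univ[OF cmpI[OF ih u] cmpI[OF jh u] e] cmpI[OF h k(1)] u
   as[OF ih h k(1)] as[OF jh h k(1)] k(2,3) hi hj by metis
 thus "\<exists>k\<in>hom (tn B D) E. k \<star> h = u \<and> p \<star> k = v" using k by blast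
qed
have "h : Cof" unfolding Cof_eq
 by (rule llpI[OF hom_arr[OF h]], rule lift[OF fib_hom[OF TF_Fib]]) (auto intro: pp_Cof[OF g f])
moreover have "h : W" if "f : W \<or> g : W"
proof -
 have "M.pp f g p" if p: "p : Fib" for p
  using \<open>f : W \<or> g : W\<close> pp_acyclic(1)[OF g _ p, of f] pp_acyclic(2)[OF f _ p, of g] f g unfolding Cof_W[symmetric] by blast
 hence "h : llp FC Fib" using lift[OF fib_hom] by (intro llpI[OF hom_arr[OF h]]) blast
 thus ?thesis using llp_Fib_W by blast
qed
ultimately show ?thesis by blast
qed

end

section \<open>The unit axiom\<close>

definition unit_T where "unit_T n = (if n = 0 \<or> n = (1::int) then UNIV else {} :: nat set)"

definition unit_F where
"unit_F r p n = {k. n = (0::int) \<and> - int k \<le> p \<or> n = 1 \<and> - int r - 1 - int k \<le> p}"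

text \<open>
A cofibrant replacement of the unit: generators $u_k \in F_{-k}$ in degree $0$ and
$x_k \in F_{-r-1-k}$ in degree $1$ with $du_k = x_k - x_{k-1}$; an element
$\sum_k c_k u_k$ is represented by its coefficient sequence.
\<close>

definition unit_cx :: "('r, 'm) ring_scheme => nat => ('r, nat => 'r) fcomplex" where
"unit_cx R r = \<lparr>Cx = (%n. FM R (unit_T n)),
  Df = (%n. \<lambda>c\<in>carrier (FM R (unit_T n)). if n = 0 then (%k. c k \<ominus>\<^bsub>R\<^esub> c (Suc k)) else (%k. \<zero>\<^bsub>R\<^esub>)),
  Fl = (%p n. carrier (FM R (unit_F r p n)))\<rparr>"

context fc
begin

text \<open>A version of \<open>tn_lift\<close> in one degree, without differentials or filtrations:
  the homotopy on a tensor product is linear but not a chain map.\<close>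

lemma tn_lin:
assumes A: "A : Ob" and B: "B : Ob" and N: "module R N"
 and g: "\<And>i j a b. i + j = n ==> a : A$i ==> b : B$j ==> g i j a b : carrier N"
  "\<And>i j a a' b. i + j = n ==> a : A$i ==> a' : A$i ==> b : B$j ==>
   g i j (a +[A,i] a') b = g i j a b +[N] g i j a' b"
  "\<And>i j a b b'. i + j = n ==> a : A$i ==> b : B$j ==> b' : B$j ==>
   g i j a (b +[B,j] b') = g i j a b +[N] g i j a b'"
  "\<And>i j s a b. i + j = n ==> s : carrier R ==> a : A$i ==> b : B$j ==>
   g i j (s *[A,i] a) b = s *[N] g i j a b"
  "\<And>i j s a b. i + j = n ==> s : carrier R ==> a : A$i ==> b : B$j ==>
   g i j a (s *[B,j] b) = s *[N] g i j a b"
shows "\<exists>h\<in>lin R (Cx (tn A B) n) N. \<forall>i j. \<forall>a\<in>A$i. \<forall>b\<in>B$j. i + j = n --> h (fe A B i j a b) = g i j a b"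
proof -
interpret T: tensor U R A B by (rule tensorI[OF A B])
note K = T.TC_cpx
obtain k where k: "k : lin R (T.TM n) N"
 "\<And>i j a b. i + j = n ==> a : A$i ==> b : B$j ==> k (elem_tensor R A B i j a b) = g i j a b"
 using T.TM_lin[of N n g, OF N g] by blast
have d: "restrict (dc T.TC n) ((tn A B)$n) : lin R (Cx (tn A B) n) (T.TM n)"
 using fmap_dc[OF K] unfolding ften_def fmap_def by (intro lin_restrictI[OF copy_module_module[OF K]]) simp_all
have "Cx (tn A B) n = Cx (cpy T.TC) n" unfolding ften_def ..
hence "(\<lambda>u\<in>(tn A B)$n. k (restrict (dc T.TC n) ((tn A B)$n) u)) (fe A B i j a b) = g i j a b"
 if "i + j = n" "a : A$i" "b : B$j" for i j a b
 using k(2)[OF that] fe_in[OF A B that] cpx_decode[OF K, of "elem_tensor R A B i j a b" n] T.et_closed[OF that]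
 unfolding fe_eq[OF A B that(1)] by simp
thus ?thesis using lin_comp[OF cx_mod[OF Ob_fcx[OF tn_Ob[OF A B]]] d k(1)] by blast
qed

text \<open>The contraction data of \<open>q\<close> are tensored with X: the section becomes e(1)
  (x) x and the homotopy h (x) 1. An error of filtration s - 1 on the left factor gives one of
  filtration p - 1 on tensors of filtration p, so \<open>wiso_contract\<close> applies again for
  arbitrary X.\<close>

lemma unit_tensor:
assumes q: "q : hom Q I0" and X: "X : Ob"
 and e: "\<And>n. e n : lin R (Cx I0 n) (Cx Q n)" and eF: "\<And>p n y. y : Fl I0 p n ==> e n y : Fl Q p n"
 and qe: "\<And>n y. y : I0$n ==> Map q n (e n y) = y"
 and de: "\<And>p n y. y : Fl I0 p n ==> Df Q n (e n y) -[Q,n+1] e (n+1) (Df I0 n y) : Fl Q (p - int (Suc r)) (n+1)"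
 and h: "\<And>n. h n : lin R (Cx Q (n+1)) (Cx Q n)" and hF: "\<And>p n t. t : Fl Q p (n+1) ==> h n t : Fl Q (p + int r) n"
 and c: "\<And>p n t. t : Fl Q p (n+1) ==> t -[Q,n+1] ((Df Q n (h n t) +[Q,n+1] h (n+1) (Df Q (n+1) t))
  +[Q,n+1] e (n+1) (Map q (n+1) t)) : Fl Q (p - 1) (n+1)"
shows "wiso (tn Q X) X (lu X \<star> (q \<boxtimes> Idt FC X)) r"
proof -
have Q: "Q : Ob" using hom_Ob(1)[OF q] .
have Q': "fcx Q" and X': "fcx X" and T': "fcx (tn Q X)" using Q X by auto
let ?f = "lu X \<star> (q \<boxtimes> Idt FC X)" and ?u = "e 0 (un \<one>)" and ?T = "tn Q X"
note t = tarrI[OF q idI[OF X]] and f = cmpI[OF tarrI[OF q idI[OF X]] lu_hom[OF X]]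
have u1: "un \<one> : I0$0" by (simp add: un_in)
have uF: "?u : Fl Q 0 0" by (rule eF[OF un_Fl]) simp_all
note uc = Fl_car[OF uF Q']
have z: "0 + n = n" for n :: int by simp
have e0: "e n 0[I0,n] = 0[Q,n]" for n by (rule lin_zero[OF _ _ e]) (simp_all add: Q')
have duF: "Df Q 0 ?u : Fl Q (- int (Suc r)) 1"
 using de[OF un_Fl[OF one_closed order.refl]] e0[of 1] uc Q' d_simps(1)[OF Q' uc] by (simp add: un_d)
define e' where "e' n x = fe Q X 0 n ?u x" for n x
have fe': "Map ?f n (fe Q X i j a x) = (if i = 0 then decode (carrier R) (Map q i a) *[X,j] x else 0[X,n])"
 if n: "i + j = n" and a: "a : Q$i" and x: "x : X$j" for i j n a x
proof -
 have v: "Map ?f n (fe Q X i j a x) = Map (lu X) n (fe I0 X i j (Map q i a) x)"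
  using cmp_map[OF t fe_in[OF Q X n a x]] tarr_fe[OF q idI[OF X] n a x] x by simp
 note qa = map_simps(1)[OF q a]
 show ?thesis
 proof (cases "i = 0")
  case True
  then obtain s where s: "s : carrier R" "Map q i a = un s" using qa I0_carrier(1) by auto
  show ?thesis using True n lu_fe[OF X s(1) x] un_decode[OF s(1)] unfolding v s(2) by simp
 next
  case False
  hence "Map q i a = 0[I0,i]" using qa I0_carrier(2) by simp
  thus ?thesis using False fe_zero(1)[OF I0_Ob X n x] map_simps(5)[OF lu_hom[OF X], of n] unfolding v by simp
 qed
qed
\<comment> \<open>In degree i = 0 the value q a is a scalar and moves across the tensor sign; in
  other degrees both sides vanish.\<close>
have ee: "e' n (Map ?f n (fe Q X i j a x)) = fe Q X i j (e i (Map q i a)) x"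
 if n: "i + j = n" and a: "a : Q$i" and x: "x : X$j" for i j n a x
proof (cases "i = 0")
 case True
 hence j: "j = n" using n by simp
 obtain s where s: "s : carrier R" "Map q i a = un s" using map_simps(1)[OF q a] I0_carrier(1) True by auto
 have "e 0 (un s) = s *[Q,0] ?u" using lin_smult[OF e s(1) u1] un_smult[OF one_closed s(1)] s(1) by simp
 thus ?thesis using fe'[OF n a x] s un_decode[OF s(1)] True x
  by (simp add: j e'_def fe_smultl[OF Q X z uc] fe_smultr[OF Q X z uc])
next
 case False
 hence "Map q i a = 0[I0,i]" using map_simps(1)[OF q a] I0_carrier(2) by simp
 thus ?thesis using False fe'[OF n a x] fe_zero(2)[OF Q X z uc] fe_zero(1)[OF Q X n x] e0[of i] by (simp add: e'_def)
qed
\<comment> \<open>The homotopy acts on the left factor, so it needs no sign.\<close>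
have "\<exists>k\<in>lin R (Cx ?T (n+1)) (Cx ?T n). \<forall>i j. \<forall>a\<in>Q$i. \<forall>b\<in>X$j.
  i + j = n+1 --> k (fe Q X i j a b) = fe Q X (i - 1) j (h (i - 1) a) b" for n
proof (rule tn_lin[OF Q X cx_mod[OF T']])
 fix i j a b assume ij: "i + j = n+1" and a: "a : Q$i" and b: "b : X$j"
 have n: "i - 1 + j = n" using ij by simp
 note h' = h[of "i - 1", simplified]
 note ha = lin_in[OF h' a]
 note r = fe_rules[OF Q X n ha b]
 show "fe Q X (i - 1) j (h (i - 1) a) b : ?T$n" by (rule r(1))
 show "fe Q X (i - 1) j (h (i - 1) (a +[Q,i] a')) b = fe Q X (i - 1) j (h (i - 1) a) b +[?T,n] fe Q X (i - 1) j (h (i - 1) a') b"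
  if "a' : Q$i" for a' unfolding lin_add[OF h' a that] by (rule r(2)[OF lin_in[OF h' that]])
 show "fe Q X (i - 1) j (h (i - 1) a) (b +[X,j] b') = fe Q X (i - 1) j (h (i - 1) a) b +[?T,n] fe Q X (i - 1) j (h (i - 1) a) b'"
  if "b' : X$j" for b' by (rule r(3)[OF that])
 show "fe Q X (i - 1) j (h (i - 1) (s *[Q,i] a)) b = s *[?T,n] fe Q X (i - 1) j (h (i - 1) a) b"
  if "s : carrier R" for s unfolding lin_smult[OF h' that a] by (rule r(4)[OF that])
 show "fe Q X (i - 1) j (h (i - 1) a) (s *[X,j] b) = s *[?T,n] fe Q X (i - 1) j (h (i - 1) a) b"
  if "s : carrier R" for s by (rule r(5)[OF that])
qed
then obtain k where k: "\<And>n. k n : lin R (Cx ?T (n+1)) (Cx ?T n)"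
 and kf': "\<And>n i j a b. i + j = n+1 ==> a : Q$i ==> b : X$j ==>
  k n (fe Q X i j a b) = fe Q X (i - 1) j (h (i - 1) a) b" by metis
have kf: "k n (fe Q X (i+1) j a b) = fe Q X i j (h i a) b"
 if "i + j = n" "a : Q$(i+1)" "b : X$j" for n i j a b
 using kf'[of "i+1" j n a b] that by simp
let ?M = "%n. Cx ?T (n+1)"
let ?p = "%n t. t -[?M n] ((Df ?T n (k n t) +[?M n] k (n+1) (Df ?T (n+1) t)) +[?M n] e' (n+1) (Map ?f (n+1) t))"
have e'c: "x : X$n ==> e' n x : ?T$n" for x n
 unfolding e'_def by (rule fe_in[OF Q X z uc])
have e'a: "x : X$n ==> y : X$n ==> e' n (x +[X,n] y) = e' n x +[?T,n] e' n y"
 "s : carrier R ==> x : X$n ==> e' n (s *[X,n] x) = s *[?T,n] e' n x" for x y s n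
 unfolding e'_def using fe_addr[OF Q X z uc] fe_smultr[OF Q X z uc] by auto
note kl = lin_in[OF k] lin_add[OF k] lin_smult[OF k]
have pl: "restrict (?p n) (carrier (?M n)) : lin R (?M n) (?M n)" for n
proof (rule lin_restrictI[OF cx_mod[OF T']])
 interpret M: module R "?M n" using T' by simp
 fix x assume x: "x : carrier (?M n)"
 note cx = kl(1)[OF x] d_simps(1)[OF T' kl(1)[OF x]] d_simps(1)[OF T' x] kl(1)[OF d_simps(1)[OF T' x]]
  map_simps(1)[OF f x] e'c[OF map_simps(1)[OF f x]]
 show "?p n x : carrier (?M n)" using x cx by simp
 show "?p n (s *[?M n] x) = s *[?M n] ?p n x" if s: "s : carrier R" for s
  unfolding kl(3)[OF s x] d_simps(5)[OF T' cx(1) s] d_simps(5)[OF T' x s] kl(3)[OF s cx(3)] map_simps(6)[OF f s x] e'a(2)[OF s cx(5)]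
  using s x cx by (simp add: a_minus_def M.smult_r_distr M.smult_r_minus)
 fix y assume y: "y : carrier (?M n)"
 note cy = kl(1)[OF y] d_simps(1)[OF T' kl(1)[OF y]] d_simps(1)[OF T' y] kl(1)[OF d_simps(1)[OF T' y]]
  map_simps(1)[OF f y] e'c[OF map_simps(1)[OF f y]]
 show "?p n (x +[?M n] y) = ?p n x +[?M n] ?p n y"
  unfolding kl(2)[OF x y] d_simps(2)[OF T' cx(1) cy(1)] d_simps(2)[OF T' x y] kl(2)[OF cx(3) cy(3)] map_simps(2)[OF f x y] e'a(1)[OF cx(5) cy(5)]
  using x y cx(2,4,6) cy(2,4,6) by (simp add: a_minus_def M.minus_add M.a_ac)
qed
\<comment> \<open>The terms h a (x) db occur with signs (-1)^i and (-1)^(i+1) and cancel, so the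
  error on the tensor is the error of h tensored with b.\<close>
have pf: "?p n (fe Q X (i+1) j a b) = fe Q X (i+1) j
  (a -[Q,i+1] ((Df Q i (h i a) +[Q,i+1] h (i+1) (Df Q (i+1) a)) +[Q,i+1] e (i+1) (Map q (i+1) a))) b"
 if n: "i + j = n" and a: "a : Q$(i+1)" and b: "b : X$j" for n i j a b
proof -
 interpret M: abelian_group "?M n" by (rule cx_ab[OF T'])
 have n1: "i+1 + j = n+1" and n2: "i + (j+1) = n+1" and n3: "i+1+1 + j = n+1+1" and n4: "i+1 + (j+1) = n+1+1" using n by auto
 note ha = lin_in[OF h a] and da = d_simps(1)[OF Q' a] and db = d_simps(1)[OF X' b] and ea = lin_in[OF e map_simps(1)[OF q a]]
 note hda = lin_in[OF h da] and dha = d_simps(1)[OF Q' ha]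
 let ?y = "fe Q X i (j+1) (h i a) (Df X j b)"
 note y = fe_in[OF Q X n2 ha db] and c1 = fe_in[OF Q X n1 dha b] and c2 = fe_in[OF Q X n1 hda b]
  and c3 = fe_in[OF Q X n3 da b] and c4 = fe_in[OF Q X n4 a db]
 have 1: "Df ?T n (k n (fe Q X (i+1) j a b)) = fe Q X (i+1) j (Df Q i (h i a)) b +[?M n] alt (?M n) i ?y"
  unfolding kf[OF n a b] fe_d[OF Q X n ha b] ..
 have 2: "k (n+1) (Df ?T (n+1) (fe Q X (i+1) j a b)) = fe Q X (i+1) j (h (i+1) (Df Q (i+1) a)) b +[?M n] alt (?M n) (i+1) ?y"
  unfolding fe_d[OF Q X n1 a b] kl(2)[OF c3 cx_alt[OF T' c4]] alt_lin[OF cx_mod[OF T'] cx_mod[OF T'] k c4] kf[OF n1 da b] kf[OF n2 a db] ..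
 have 3: "Df ?T n (k n (fe Q X (i+1) j a b)) +[?M n] k (n+1) (Df ?T (n+1) (fe Q X (i+1) j a b)) =
   fe Q X (i+1) j (Df Q i (h i a)) b +[?M n] fe Q X (i+1) j (h (i+1) (Df Q (i+1) a)) b"
  unfolding 1 2 alt_suc[OF cx_mod[OF T'] y] using c1 c2 cx_alt[OF T' y, of i]
  by (simp add: M.a_assoc M.a_lcomm[of "alt (?M n) i ?y"] M.r_neg)
 show ?thesis unfolding 3 ee[OF n1 a b]
  using fe_minus(1)[OF Q X n1 a b] fe_addl[OF Q X n1] dha hda ea b Q' by simp
qed
show ?thesis
proof (rule wiso_contract[OF f, where e = e' and h = k])
 show "y : Fl X p n ==> e' n y : Fl ?T p n" for p n y
  unfolding e'_def by (rule fe_Fl[OF Q X z uF]) auto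
 show "Map ?f n (e' n y) = y" if "y : X$n" for n y
  unfolding e'_def fe'[OF z uc that] using qe[OF u1] that X' by (simp add: un_decode)
 show "Df ?T n (e' n y) -[?T,n+1] e' (n+1) (Df X n y) : Fl ?T (p - int (Suc r)) (n+1)" if y: "y : Fl X p n" for p n y
 proof -
  note yc = Fl_car[OF y X']
  have z1: "1 + n = n+1" and pr: "- int (Suc r) + p = p - int (Suc r)" by auto
  have c1: "fe Q X 1 n (Df Q 0 ?u) y : ?T$(n+1)" using fe_in[OF Q X z1 Fl_car[OF duF Q'] yc] .
  have "Df ?T n (e' n y) = fe Q X 1 n (Df Q 0 ?u) y +[?T,n+1] e' (n+1) (Df X n y)"
   using fe_d[OF Q X z uc yc] unfolding e'_def by simp
  thus ?thesis using ab_ids(2)[OF T' c1 e'c[OF d_simps(1)[OF X' yc]]] fe_Fl[OF Q X z1 duF y pr] by simp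
 qed
 show "k n t : Fl ?T (p + int r) n" if tF: "t : Fl ?T p (n+1)" for p n t
 proof -
  have "Fl ?T p (n+1) \<subseteq> {x : carrier (?M n). k n x : Fl ?T (p + int r) n}"
  proof (rule tn_Fl_least[OF Q X sub_preim[OF cx_mod[OF T'] cx_mod[OF T'] k Fl_sub[OF T']]])
   fix i j a b s assume ij: "i + j = n+1" and a: "a : Fl Q s i" and b: "b : Fl X (p - s) j"
   have n: "i - 1 + j = n" and pr: "s + int r + (p - s) = p + int r" using ij by auto
   have "h (i - 1) a : Fl Q (s + int r) (i - 1)" by (rule hF) (use a in simp)
   from fe_Fl[OF Q X n this b pr] show "fe Q X i j a b : {x : carrier (?M n). k n x : Fl ?T (p + int r) n}"
    using kf'[OF ij Fl_car[OF a Q'] Fl_car[OF b X']] fe_in[OF Q X ij Fl_car[OF a Q'] Fl_car[OF b X']] by simp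
  qed
  thus ?thesis using tF by blast
 qed
 show "?p n t : Fl ?T (p - 1) (n+1)" if tF: "t : Fl ?T p (n+1)" for p n t
 proof -
  have "Fl ?T p (n+1) \<subseteq> {x : carrier (?M n). restrict (?p n) (carrier (?M n)) x : Fl ?T (p - 1) (n+1)}"
  proof (rule tn_Fl_least[OF Q X sub_preim[OF cx_mod[OF T'] cx_mod[OF T'] pl Fl_sub[OF T']]])
   fix i j a b s assume ij: "i + j = n+1" and a: "a : Fl Q s i" and b: "b : Fl X (p - s) j"
   obtain i' where i': "i = i'+1" by (metis diff_add_cancel)
   have n: "i' + j = n" and pr: "s - 1 + (p - s) = p - 1" using ij i' by auto
   note ac = Fl_car[OF a[unfolded i'] Q'] and bc = Fl_car[OF b X']
   have "fe Q X i j a b : carrier (?M n)" using fe_in[OF Q X ij Fl_car[OF a Q'] bc] .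
   thus "fe Q X i j a b : {x : carrier (?M n). restrict (?p n) (carrier (?M n)) x : Fl ?T (p - 1) (n+1)}"
    using fe_Fl[OF Q X ij[unfolded i'] c[OF a[unfolded i']] b pr] pf[OF n ac bc] unfolding i' by simp
  qed
  thus ?thesis using tF Fl_car[OF tF T'] by fastforce
 qed
qed (rule e'a(1))
qed

lemma unit_sel [simp]: "Cx (unit_cx R k) n = FM R (unit_T n)"
"c : carrier (FM R (unit_T n)) ==> Df (unit_cx R k) n c = (if n = 0 then (%k. c k \<ominus> c (Suc k)) else (%k. \<zero>))"
"Fl (unit_cx R k) p n = carrier (FM R (unit_F k p n))"
unfolding unit_cx_def by simp_all

lemma free_sub: "T \<subseteq> T' ==> c : carrier (FM R T) \<longleftrightarrow> c : carrier (FM R T') \<and> (\<forall>t. c t \<noteq> \<zero> --> t : T)"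
unfolding free_car by auto

lemma unit_FT: "unit_F k p n \<subseteq> unit_T n" unfolding unit_F_def unit_T_def by auto

text \<open>On coefficient sequences of the telescope, the first map is the differential (the
  coefficient of \<open>x_k\<close> in the boundary is c_k - c_(k+1)) and the second is the homotopy
  \<open>x_j\<close> -> -\<open>u_(j+1)\<close>.\<close>

lemma free_shift:
assumes c: "c : carrier (FM R (UNIV :: nat set))"
shows "(%k. c k \<ominus> c (Suc k)) : carrier (FM R (UNIV :: nat set))"
 "(%k. case k of 0 => \<zero> | Suc j => \<ominus> c j) : carrier (FM R (UNIV :: nat set))"
proof -
have v: "c k : carrier R" for k using free_val[OF c] .
have fin: "finite {k. c k \<noteq> \<zero>}" using c unfolding free_car by simp
have "{k. c k \<ominus> c (Suc k) \<noteq> \<zero>} \<subseteq> {k. c k \<noteq> \<zero>} \<union> Suc -` {k. c k \<noteq> \<zero>}"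
 by (auto simp: minus_eq)
moreover have "finite (Suc -` {k. c k \<noteq> \<zero>})" using fin by (rule finite_vimageI) simp
ultimately have "finite {k. c k \<ominus> c (Suc k) \<noteq> \<zero>}" using fin finite_subset by blast
thus "(%k. c k \<ominus> c (Suc k)) : carrier (FM R (UNIV :: nat set))"
 unfolding free_car using v by simp
let ?s = "%k. case k of 0 => \<zero> | Suc j => \<ominus> c j"
have s: "?s k : carrier R" "?s k \<noteq> \<zero> ==> k : Suc ` {k. c k \<noteq> \<zero>}" for k using v by (cases k; auto)+
hence "finite {k. ?s k \<noteq> \<zero>}" by (intro finite_subset[OF _ finite_imageI[OF fin, of Suc]]) blast
thus "?s : carrier (FM R (UNIV :: nat set))" unfolding free_car using s(1) by blast
qed

lemma unit_cpx: "cpx (unit_cx R k)"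
proof (rule cpxI)
show "fcx (unit_cx R k)"
proof (rule filtered_complex.intro)
 fix n p :: int
 show "module R (Cx (unit_cx R k) n)" using mod_free by simp
 have z: "(%k. \<zero>) : carrier (FM R T)" for T :: "nat set" unfolding free_car by simp
 have dc: "Df (unit_cx R k) n c : carrier (FM R (unit_T (n+1)))" if "c : carrier (FM R (unit_T n))" for c
  using that z free_shift(1) by (auto simp: unit_T_def)
 show "Df (unit_cx R k) n : lin R (Cx (unit_cx R k) n) (Cx (unit_cx R k) (n+1))"
 proof (rule lin_mapsI)
  interpret M: module R "FM R (unit_T n)" by (rule mod_free)
  fix x assume x: "x : (unit_cx R k)$n"
  hence x': "x : carrier (FM R (unit_T n))" by simp
  thus "Df (unit_cx R k) n x : (unit_cx R k)$(n+1)" using dc by simp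
  note v = free_val[OF x']
  show "Df (unit_cx R k) n (x +[unit_cx R k,n] y) = Df (unit_cx R k) n x +[unit_cx R k,n+1] Df (unit_cx R k) n y"
   if "y : (unit_cx R k)$n" for y
   using x' that M.a_closed[OF x', of y] v free_val[of y "unit_T n"] by (auto simp: minus_eq minus_add a_ac)
  show "Df (unit_cx R k) n (s *[unit_cx R k,n] x) = s *[unit_cx R k,n+1] Df (unit_cx R k) n x"
   if "s : carrier R" for s
   using x' that M.smult_closed[OF that x'] v by (auto simp: minus_eq r_distr r_minus)
 qed (simp add: unit_cx_def)
 show "submodule (Fl (unit_cx R k) p n) R (Cx (unit_cx R k) n)"
 proof (rule submoduleI')
  interpret F: module R "FM R (unit_F k p n)" by (rule mod_free)
  show "Fl (unit_cx R k) p n \<subseteq> (unit_cx R k)$n" using free_sub[OF unit_FT] by auto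
  show "x : Fl (unit_cx R k) p n ==> y : Fl (unit_cx R k) p n ==> x +[unit_cx R k,n] y : Fl (unit_cx R k) p n" for x y
   using F.a_closed by simp
  show "s : carrier R ==> x : Fl (unit_cx R k) p n ==> s *[unit_cx R k,n] x : Fl (unit_cx R k) p n" for s x
   using F.smult_closed by simp
 qed (use z mod_free in simp_all)
 show "Df (unit_cx R k) n ` Fl (unit_cx R k) p n \<subseteq> Fl (unit_cx R k) p (n+1)"
 proof safe
  fix c assume c: "c : Fl (unit_cx R k) p n"
  hence c': "c : carrier (FM R (unit_T n))" "\<And>t. c t \<noteq> \<zero> ==> t : unit_F k p n" using free_sub[OF unit_FT] by auto
  have "t : unit_F k p (n+1)" if "Df (unit_cx R k) n c t \<noteq> \<zero>" for t
  proof -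
   have n: "n = 0" "c t \<ominus> c (Suc t) \<noteq> \<zero>" using that c' by (auto split: if_splits)
   hence "c t \<noteq> \<zero> \<or> c (Suc t) \<noteq> \<zero>" by (auto simp: minus_eq)
   thus ?thesis using c'(2)[of t] c'(2)[of "Suc t"] n(1) unfolding unit_F_def by auto
  qed
  thus "Df (unit_cx R k) n c : Fl (unit_cx R k) p (n+1)" using dc[OF c'(1)] free_sub[OF unit_FT] by simp
 qed
 show "Fl (unit_cx R k) p n \<subseteq> Fl (unit_cx R k) (p+1) n"
 proof -
  have "unit_F k p n \<subseteq> unit_F k (p+1) n" unfolding unit_F_def by auto
  from free_sub[OF this] show ?thesis by auto
 qed
 show "Df (unit_cx R k) (n+1) (Df (unit_cx R k) n x) = 0[unit_cx R k,n+1+1]" if "x : (unit_cx R k)$n" for x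
  using dc[of x] that by (auto simp: minus_eq)
qed
show "sm ((unit_cx R k)$n)" for n
 by (rule sm_fun[of UNIV "%_. carrier R", OF sm_nat smR]) (auto simp: free_val)
qed

lemma free_minus:
assumes x: "x : carrier (FM R T)" and y: "y : carrier (FM R T)"
shows "x -[FM R T] y = (%t. x t \<ominus> y t)"
proof -
interpret F: module R "FM R T" by (rule mod_free)
have "-[FM R T] y = (\<ominus> \<one>) *[FM R T] y" using y by (simp add: F.smult_l_minus del: free_ops)
also have "\<dots> = (%t. \<ominus> y t)" using free_val[OF y] by (simp add: l_minus)
finally show ?thesis by (simp add: a_minus_def)
qed

lemma free_lin_mem:
assumes c: "c : carrier (FM R T)" and T: "T \<subseteq> T'" and N: "module R N" and H: "submodule H R N"
 and h: "h : lin R (FM R T') N" and b: "\<And>t. t : T ==> h (bas R t) : H"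
shows "h c : H"
using c
proof (induction rule: free_induct)
case zero
show ?case using lin_zero[OF mod_free N h] submodule_zero[OF H] by simp
next
case (add x y)
hence "x : carrier (FM R T')" "y : carrier (FM R T')" using free_sub[OF T] by blast+
from lin_add[OF h this] show ?case using submodule_add[OF H add(3,4)] by simp
next
case (basis s t)
have "t : T'" using basis(2) T by blast
from lin_smult[OF h basis(1) bas_in[OF this]] show ?case using submodule_smult[OF H basis(1) b[OF basis(2)]] by simp
qed

abbreviation Qu :: "nat => ('r, 'u) fcomplex" where "Qu k \<equiv> cpy (unit_cx R k)"

lemma Qu_ext:
assumes f: "f : hom (Qu k) X" and g: "g : hom (Qu k) X"
 and eq: "\<And>n t. n = 0 \<or> n = 1 ==> Map f n (cd (unit_cx R k) n (bas R t)) = Map g n (cd (unit_cx R k) n (bas R t))"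
shows "f = g"
proof (rule hom_ext_copy[OF f g refl])
fix n c assume "c : (unit_cx R k)$n"
note K = unit_cpx[of k]
note zero' = copy_zero[of "unit_cx R k" n, symmetric, simplified]
note add' = copy_add[OF K, of _ n, symmetric, unfolded unit_sel]
note smult' = copy_smult[OF K, of _ n, symmetric, unfolded unit_sel]
have in': "x : carrier (FM R (unit_T n)) ==> cd (unit_cx R k) n x : (Qu k)$n" for x using cd_in[of x "unit_cx R k" n] by simp
from \<open>c : _\<close> have "c : carrier (FM R (unit_T n))" by simp
thus "Map f n (cd (unit_cx R k) n c) = Map g n (cd (unit_cx R k) n c)"
proof (induction rule: free_induct)
 case zero
 show ?case unfolding zero' map_simps(5)[OF f] map_simps(5)[OF g] ..
next
 case (add x y)
 show ?case unfolding add'[OF add(1,2)] map_simps(2)[OF f in'[OF add(1)] in'[OF add(2)]] map_simps(2)[OF g in'[OF add(1)] in'[OF add(2)]] add(3,4) ..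
next
 case (basis s t)
 have n: "n = 0 \<or> n = 1" using basis(2) unfolding unit_T_def by (auto split: if_splits)
 note b = bas_in[OF basis(2)]
 show ?case unfolding smult'[OF b] map_simps(6)[OF f basis(1) in'[OF b]] map_simps(6)[OF g basis(1) in'[OF b]] eq[OF n] ..
qed
qed

text \<open>The projection sends \<open>u_0\<close> to 1 and all other generators to 0, the section
  sends 1 to \<open>u_0\<close>, and the homotopy sends \<open>x_j\<close> to
  -\<open>u_(j+1)\<close>, which raises the filtration by exactly \<open>k\<close>. The section
  fails to be a chain map only by \<open>x_0\<close>, of filtration -k - 1.\<close>

lemma unit_replacement:
"\<exists>q\<in>hom (Qu k) I0. wiso (Qu k) I0 q k \<and> (\<forall>X\<in>Ob. wiso (tn (Qu k) X) X (lu X \<star> (q \<boxtimes> Idt FC X)) k)"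
proof -
note K = unit_cpx[of k]
let ?K = "unit_cx R k"
let ?V = "carrier (FM R (UNIV :: nat set))"
have K': "fcx ?K" and Q: "Qu k : Ob" and Q': "fcx (Qu k)" using K by auto
have V: "?K$n = (if n = 0 \<or> n = 1 then ?V else {%_. \<zero>})" for n
 unfolding unit_sel unit_T_def by (auto simp: free_car)
have z: "(%_. \<zero>) : ?K$n" for n unfolding V by (simp add: free_car)
have zQ: "0[Qu k,n] = cd ?K n (%_. \<zero>)" for n unfolding copy_zero by simp
have FlK: "c : Fl ?K p n \<longleftrightarrow> c : ?K$n \<and> (\<forall>t. c t \<noteq> \<zero> --> t : unit_F k p n)" for c p n
 using free_sub[OF unit_FT[of k p n]] by simp
have v: "c j : carrier R" if "c : ?K$n" for c j n using that free_val[of c "unit_T n"] unfolding unit_sel by blast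
define i0 where "i0 s = (%j::nat. if j = 0 then s else \<zero>)" for s
define sh where "sh c j = (case j of 0 => \<zero> | Suc i => \<ominus> c i)" for c and j :: nat
define q where "q = from_copy ?K I0 (%n c. if n = 0 then un (c 0) else 0[I0,n])"
define ek where "ek n c = (if n = (0::int) then i0 (c 0) else (%_. \<zero>))" for n and c :: "nat => _"
define e where "e n = (\<lambda>u\<in>I0$n. cd ?K n (if n = 0 then i0 (decode (carrier R) u) else (%_. \<zero>)))" for n
define hk where "hk n c = (if n = (0::int) then sh c else (%_. \<zero>))" for n c
define h where "h n = (\<lambda>u\<in>(Qu k)$(n+1). cd ?K n (hk n (dc ?K (n+1) u)))" for n
have i0V: "i0 s : ?V" if "s : carrier R" for s
 using that unfolding free_car i0_def by (auto intro: finite_subset[of _ "{0}"])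
have shV: "sh c : ?V" if "c : ?V" for c using free_shift(2)[OF that] unfolding sh_def .
have uz: "un \<zero> = 0[I0,0]" unfolding funit_def copy_zero by simp
have "fmap R ?K I0 (%n c. if n = 0 then un (c 0) else 0[I0,n])"
proof (rule fmapI)
 fix n p c assume c: "c : Fl ?K p n"
 show "(if n = 0 then un (c 0) else 0[I0,n]) : Fl I0 p n"
 proof (cases "n = 0 \<and> c 0 \<noteq> \<zero>")
  case True
  hence "0 \<le> p" using c unfolding FlK unit_F_def by auto
  thus ?thesis using True un_Fl v[of c n 0] c unfolding FlK by simp
 qed (use uz in auto)
next
 fix n c assume c: "c : ?K$n"
 show "Df I0 n (if n = 0 then un (c 0) else 0[I0,n]) = (if n+1 = 0 then un (Df ?K n c 0) else 0[I0,n+1])"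
 proof (cases "n = 0")
  case True
  thus ?thesis using un_d[OF v[OF c, of 0]] by simp
 next
  case False
  thus ?thesis using uz c by auto
 qed
qed (use v un_in un_add un_smult in auto)
hence q: "q : hom (Qu k) I0" unfolding q_def by (rule from_copy_hom[OF K I0_Ob])
have qm: "Map q n (cd ?K n c) = (if n = 0 then un (c 0) else 0[I0,n])" if "c : ?K$n" for n c
 unfolding q_def from_copy_map[OF K that] ..
have I: "\<exists>s\<in>carrier R. y = un s" if "y : I0$0" for y using that unfolding I0_carrier(1) by blast
have I': "y = 0[I0,n]" if "y : I0$n" "n \<noteq> 0" for y n using that I0_carrier(2)[of n] by simp
have e0: "e 0 (un s) = cd ?K 0 (i0 s)" if "s : carrier R" for s
 unfolding e_def using un_in[OF that] un_decode[OF that] by simp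
have en: "e n y = 0[Qu k,n]" if "y : I0$n" "n \<noteq> 0" for n y
 unfolding e_def zQ using that by simp
have e: "e n : lin R (Cx I0 n) (Cx (Qu k) n)" for n
proof (cases "n = 0")
 case True
 have iK: "s : carrier R ==> i0 s : ?K$0" for s unfolding V using i0V by simp
 show ?thesis unfolding True
 proof (rule lin_mapsI)
  fix x y a assume "x : I0$0"
  then obtain s where s: "s : carrier R" "x = un s" using I by blast
  show "e 0 x : (Qu k)$0" using e0 s iK by simp
  show "e 0 (x +[I0,0] y) = e 0 x +[Qu k,0] e 0 y" if "y : I0$0"
  proof -
   obtain t where t: "t : carrier R" "y = un t" using I \<open>y : _\<close> by blast
   have "i0 (s \<oplus> t) = i0 s +[?K,0] i0 t" unfolding i0_def by auto
   thus ?thesis using copy_add[OF K iK[OF s(1)] iK[OF t(1)]] s t by (simp add: un_add e0)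
  qed
  show "e 0 (a *[I0,0] x) = a *[Qu k,0] e 0 x" if "a : carrier R"
  proof -
   have "i0 (a \<otimes> s) = a *[?K,0] i0 s" unfolding i0_def using \<open>a : _\<close> by auto
   thus ?thesis using copy_smult[OF K iK[OF s(1)]] s \<open>a : _\<close> by (simp add: un_smult e0)
  qed
 qed (simp add: e_def)
next
 case False
 show ?thesis
 proof (rule lin_mapsI)
  note n = en[OF _ False]
  fix x assume x: "x : I0$n"
  show "e n x : (Qu k)$n" using n[OF x] Q' by simp
  show "e n (x +[I0,n] y) = e n x +[Qu k,n] e n y" if "y : I0$n" for y
   using n x that Q' by simp
  show "e n (a *[I0,n] x) = a *[Qu k,n] e n x" if "a : carrier R" for a
   using n x that Q' by simp
 qed (simp add: e_def)
qed
have hc: "h n (cd ?K (n+1) c) = cd ?K n (hk n c)" if "c : ?K$(n+1)" for n c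
 unfolding h_def using that cd_in[OF that] cpx_decode[OF K that] by simp
have hkV: "hk n c : ?K$n" if "c : ?K$(n+1)" for n c
 using that shV z[of n] unfolding V hk_def by (auto split: if_splits)
have h: "h n : lin R (Cx (Qu k) (n+1)) (Cx (Qu k) n)" for n
proof (rule lin_mapsI)
 fix x assume "x : (Qu k)$(n+1)"
 then obtain c where c: "c : ?K$(n+1)" "x = cd ?K (n+1) c" unfolding copy_car by blast
 note vc = v[OF c(1)]
 show "h n x : (Qu k)$n" unfolding c(2) hc[OF c(1)] by (rule cd_in[OF hkV[OF c(1)]])
 show "h n (x +[Qu k,n+1] y) = h n x +[Qu k,n] h n y" if y: "y : (Qu k)$(n+1)" for y
 proof -
  obtain b where b: "b : ?K$(n+1)" "y = cd ?K (n+1) b" using y unfolding copy_car by blast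
  have "sh (c +[?K,n+1] b) j = sh c j \<oplus> sh b j" for j
   using vc v[OF b(1)] unfolding sh_def by (cases j) (simp_all add: minus_add)
  hence "hk n (c +[?K,n+1] b) = hk n c +[?K,n] hk n b" unfolding hk_def by auto
  thus ?thesis unfolding c(2) b(2) copy_add[OF K c(1) b(1)] hc[OF c(1)] hc[OF b(1)] hc[OF cx_closed(2)[OF K' c(1) b(1)]]
    copy_add[OF K hkV[OF c(1)] hkV[OF b(1)]] by simp
 qed
 show "h n (s *[Qu k,n+1] x) = s *[Qu k,n] h n x" if s: "s : carrier R" for s
 proof -
  have "sh (s *[?K,n+1] c) j = s \<otimes> sh c j" for j using vc s unfolding sh_def by (cases j) (simp_all add: r_minus)
  hence "hk n (s *[?K,n+1] c) = s *[?K,n] hk n c" unfolding hk_def using s by auto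
  thus ?thesis unfolding c(2) copy_smult[OF K c(1)] hc[OF c(1)] hc[OF cx_closed(5)[OF K' s c(1)]]
    copy_smult[OF K hkV[OF c(1)]] by simp
 qed
qed (simp add: h_def)
have eF: "e n y : Fl (Qu k) p n" if y: "y : Fl I0 p n" for p n y
proof (cases "n = 0 \<and> y \<noteq> 0[I0,n]")
 case True
 hence p: "0 \<le> p" using I0_Fl[OF y] by blast
 obtain s where s: "s : carrier R" "y = un s" using I Fl_car[OF y] True by auto
 have "i0 s : Fl ?K p 0" unfolding FlK V using i0V[OF s(1)] p by (auto simp: i0_def unit_F_def split: if_splits)
 thus ?thesis using True e0[OF s(1)] s(2) unfolding copy_Fl by auto
next
 case False
 hence "y = 0[I0,n]" using I' Fl_car[OF y] by auto
 thus ?thesis using lin_zero[OF _ _ e, of n] Q' by simp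
qed
have qe: "Map q n (e n y) = y" if y: "y : I0$n" for n y
proof (cases "n = 0")
 case True
 then obtain s where s: "s : carrier R" "y = un s" using I y by auto
 have "i0 s : ?K$0" unfolding V using i0V[OF s(1)] by simp
 from qm[OF this] show ?thesis using True s e0 by (simp add: i0_def)
next
 case False
 thus ?thesis using en[OF y] I'[OF y] map_simps(5)[OF q] by simp
qed
have de: "Df (Qu k) n (e n y) -[Qu k,n+1] e (n+1) (Df I0 n y) : Fl (Qu k) (p - int (Suc k)) (n+1)"
 if y: "y : Fl I0 p n" for p n y
proof (cases "y = 0[I0,n]")
 case True
 thus ?thesis using lin_zero[OF _ _ e, of n] lin_zero[OF _ _ e, of "n+1"] Q' by simp
next
 case False
 have yc: "y : I0$n" using Fl_car[OF y] by simp
 have n: "n = 0" and p: "0 \<le> p" using False I'[OF yc] I0_Fl[OF y] by auto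
 obtain s where s: "s : carrier R" "y = un s" using I yc n by auto
 have i: "i0 s : ?K$0" unfolding V using i0V[OF s(1)] by simp
 have "Df ?K 0 (i0 s) : Fl ?K (p - int (Suc k)) 1"
  unfolding FlK using d_simps(1)[OF K' i] i p s(1) by (auto simp: i0_def unit_F_def minus_eq split: if_splits)
 hence "Df (Qu k) 0 (e 0 y) : Fl (Qu k) (p - int (Suc k)) 1"
  using e0[OF s(1)] copy_d[OF K i] s(2) unfolding copy_Fl by auto
 thus ?thesis using un_d[OF s(1)] lin_zero[OF _ _ e, of 1] Q' n s(2) Fl_car[OF \<open>Df (Qu k) 0 (e 0 y) : _\<close> Q'] by simp
qed
have hF: "h n t : Fl (Qu k) (p + int k) n" if t: "t : Fl (Qu k) p (n+1)" for p n t
proof -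
 obtain c where c: "c : Fl ?K p (n+1)" "t = cd ?K (n+1) c" using t unfolding copy_Fl by blast
 note cc = Fl_car[OF c(1) K']
 have "j : unit_F k (p + int k) n" if "hk n c j \<noteq> \<zero>" for j
 proof -
  have n: "n = 0" "sh c j \<noteq> \<zero>" using that unfolding hk_def by (auto split: if_splits)
  then obtain i where i: "j = Suc i" "c i \<noteq> \<zero>" unfolding sh_def by (cases j) (auto, metis neg_zero)
  hence "i : unit_F k p (n+1)" using c(1) unfolding FlK by blast
  thus ?thesis using n i unfolding unit_F_def by auto
 qed
 hence "hk n c : Fl ?K (p + int k) n" unfolding FlK using hkV[OF cc] by blast
 thus ?thesis unfolding c(2) hc[OF cc] copy_Fl by blast
qed
have c: "t -[Qu k,n+1] ((Df (Qu k) n (h n t) +[Qu k,n+1] h (n+1) (Df (Qu k) (n+1) t))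
  +[Qu k,n+1] e (n+1) (Map q (n+1) t)) : Fl (Qu k) (p - 1) (n+1)"
 if t: "t : Fl (Qu k) p (n+1)" for p n t
proof -
 obtain c where c: "c : Fl ?K p (n+1)" "t = cd ?K (n+1) c" using t unfolding copy_Fl by blast
 note cc = Fl_car[OF c(1) K'] and vc = v[OF Fl_car[OF c(1) K']]
 note dc = d_simps(1)[OF K' cc] and dh = d_simps(1)[OF K' hkV[OF cc]]
 note hd = hkV[OF d_simps(1)[OF K' cc]]
 have ekV: "ek (n+1) c : ?K$(n+1)" using i0V[OF vc] z[of "n+1"] unfolding ek_def V by auto
 have eq: "e (n+1) (Map q (n+1) t) = cd ?K (n+1) (ek (n+1) c)"
 proof (cases "n+1 = 0")
  case True
  show ?thesis using qm[OF cc] e0[OF vc] unfolding c(2) ek_def True by simp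
 next
  case False
  show ?thesis using qm[OF cc] en[OF _ False, of "0[I0,n+1]"] False unfolding c(2) ek_def zQ by simp
 qed
 let ?d = "Df ?K n (hk n c)" and ?h = "hk (n+1) (Df ?K (n+1) c)" and ?e = "ek (n+1) c"
 note s1 = cx_closed(2)[OF K' dh hd]
 note s2 = cx_closed(2)[OF K' cx_closed(2)[OF K' dh hd] ekV]
 have tot: "t -[Qu k,n+1] ((Df (Qu k) n (h n t) +[Qu k,n+1] h (n+1) (Df (Qu k) (n+1) t))
   +[Qu k,n+1] e (n+1) (Map q (n+1) t)) = cd ?K (n+1) (c -[?K,n+1] ((?d +[?K,n+1] ?h) +[?K,n+1] ?e))"
  unfolding eq unfolding c(2) hc[OF cc] copy_d[OF K cc] copy_d[OF K hkV[OF cc]] hc[OF dc] copy_add[OF K dh hd] copy_add[OF K s1 ekV]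
   copy_minus[OF K cc s2] ..
 let ?w = "%j. c j \<ominus> ((?d j \<oplus> ?h j) \<oplus> ?e j)"
 have w: "c -[?K,n+1] ((?d +[?K,n+1] ?h) +[?K,n+1] ?e) = ?w"
  using free_minus[of c "unit_T (n+1)", OF _ s2[unfolded unit_sel]] cc by simp
 \<comment> \<open>The error of the homotopy is the shift of indices by one on both families of
   generators; it lowers the filtration by 1, which is exactly what \<open>wiso_contract\<close>
   allows.\<close>
 have pw: "?w j = (case j of 0 => \<zero> | Suc i => c i)" for j
 proof -
  have "n \<noteq> 0 \<and> n+1 \<noteq> 0 ==> c = (%_. \<zero>)" using cc unfolding V by simp
  then consider (m) "n = -1" | (z) "n = 0" | (o) "n \<noteq> 0" "n+1 \<noteq> 0" "c = (%_. \<zero>)" by fastforce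
  thus ?thesis
  proof cases
   case m
   have "?d = (%_. \<zero>)" "Df ?K 0 c = (%k. c k \<ominus> c (Suc k))" using m hkV[OF cc] cc by auto
   thus ?thesis using vc m unfolding hk_def ek_def i0_def sh_def
    by (cases j) (simp_all add: minus_eq minus_add a_ac r_neg1 r_neg2 r_neg)
  next
   case z
   have "?d = (%k. sh c k \<ominus> sh c (Suc k))" using z hkV[OF cc] unfolding hk_def by simp
   thus ?thesis using vc z unfolding hk_def ek_def sh_def
    by (cases j) (simp_all add: minus_eq minus_add a_ac r_neg1 r_neg2 r_neg)
  next
   case o
   have "?d = (%_. \<zero>)" using o hkV[OF cc] by simp
   thus ?thesis using o unfolding hk_def ek_def by (cases j) (simp_all add: minus_eq)
  qed
 qed
 have "?w : Fl ?K (p - 1) (n+1)" unfolding FlK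
 proof (intro conjI allI impI)
  show "?w : ?K$(n+1)" using cx_closed(3)[OF K' cc s2] unfolding w .
  fix j assume "?w j \<noteq> \<zero>"
  then obtain i where i: "j = Suc i" "c i \<noteq> \<zero>" unfolding pw by (cases j) auto
  hence "i : unit_F k p (n+1)" using c(1) unfolding FlK by blast
  thus "j : unit_F k (p - 1) (n+1)" using i(1) unfolding unit_F_def by auto
 qed
 thus ?thesis unfolding tot w copy_Fl by blast
qed
have "wiso (Qu k) I0 q k"
 using lin_add[OF e] by (intro wiso_contract[OF q eF _ qe de hF c]) auto
thus ?thesis using unit_tensor[OF q _ e eF qe de h hF c] q by blast
qed

end

section \<open>Cofibrancy of the telescope and conclusion\<close>

context fcm
begin

text \<open>Not the generators but the partial sums \<open>u_0 + ... + u_j\<close> are lifted, since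
  their boundary is the single generator \<open>x_j\<close>. The first lift \<open>s_0\<close> comes
  from surjectivity on (r+1)-cycles; \<open>ilift\<close> then corrects \<open>s_j\<close> to
  \<open>s_(j+1)\<close> by an element of filtration -1 - j, and the differences of consecutive
  \<open>s_j\<close> lift the \<open>u_j\<close>.\<close>

lemma Qu_lift:
assumes p: "p : TF" "p : hom E F" and v: "v : hom (Qu r) F"
shows "\<exists>h\<in>hom (Qu r) E. p \<star> h = v"
proof -
let ?K = "unit_cx R r"
note K = unit_cpx[of r] and O = hom_Ob[OF p(2)]
have K': "fcx ?K" and E: "fcx E" and F: "fcx F" and Q': "fcx (Qu r)" using K O by auto
have f: "fibE E F p" "ilift E F p r" "wiso E F p r" using p TF_iff[OF p(2)] weak_iff[OF p(2)] unfolding TF_eq by auto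
define u x where "u j = cd ?K 0 (bas R j)" and "x j = cd ?K 1 (bas R j)" for j
have bK: "bas R j : Fl ?K (- int j) 0" "bas R j : Fl ?K (- int r - 1 - int j) 1" for j
 by (simp_all add: bas_in unit_F_def)
have uF: "u j : Fl (Qu r) (- int j) 0" and xF: "x j : Fl (Qu r) (- int r - 1 - int j) 1" for j
 unfolding u_def x_def copy_Fl using bK by blast+
note bc = Fl_car[OF bK(1) K'] Fl_car[OF bK(2) K']
note uc = Fl_car[OF uF Q'] and xc = Fl_car[OF xF Q']
have dK0: "Df ?K 0 (bas R 0) = bas R 0"
 using bc(1)[of 0] by (auto simp: basis_elt_def minus_eq)
have dKS: "Df ?K 0 (bas R (Suc j)) = bas R (Suc j) -[?K,1] bas R j" for j
 using bc(1)[of "Suc j"] bc(2) by (auto simp: free_minus basis_elt_def)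
have du0: "Df (Qu r) 0 (u 0) = x 0" using copy_d[OF K bc(1)] dK0 unfolding u_def x_def by simp
have duS: "Df (Qu r) 0 (u (Suc j)) = x (Suc j) -[Qu r,1] x j" for j
 using copy_d[OF K bc(1)] dKS copy_minus[OF K bc(2) bc(2)] unfolding u_def x_def by simp
define w y where "w j = Map v 0 (u j)" and "y j = Map v 1 (x j)" for j
have wF: "w j : Fl F (- int j) 0" and yF: "y j : Fl F (- int r - 1 - int j) 1" for j
 unfolding w_def y_def using map_Fl[OF v] uF xF by blast+
note wc = Fl_car[OF wF F] and yc = Fl_car[OF yF F]
have dw0: "Df F 0 (w 0) = y 0" using map_d[OF v uc, of 0] du0 unfolding w_def y_def by simp
have dwS: "Df F 0 (w (Suc j)) = y (Suc j) -[F,1] y j" for j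
 using map_d[OF v uc, of "Suc j"] duS map_simps(3)[OF v xc xc] unfolding w_def y_def by simp
\<comment> \<open>Images under v of the partial sums; their boundaries telescope to y_j.\<close>
define \<tau> where "\<tau> = rec_nat (w 0) (%j a. a +[F,0] w (Suc j))"
have t: "\<tau> 0 = w 0" "\<tau> (Suc j) = \<tau> j +[F,0] w (Suc j)" for j unfolding \<tau>_def by simp_all
have td: "\<tau> j : F$0 \<and> Df F 0 (\<tau> j) = y j" for j
proof (induction j)
 case 0
 show ?case unfolding t using wc dw0 by blast
next
 case (Suc j)
 thus ?case using d_simps(2)[OF F, of "\<tau> j" 0 "w (Suc j)"] wc[of "Suc j"] dwS[of j] ab_add_diff[OF F yc yc] F unfolding t by simp
qed
let ?P = "%j s. s : Fl E 0 0 \<and> Df E 0 s : Fl E (- int r - 1 - int j) 1 \<and> Map p 0 s = \<tau> j"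
have "\<exists>s. \<forall>j. ?P j (s j) \<and> s (Suc j) -[E,0] s j : Fl E (- 1 - int j) 0"
proof (rule dependent_nat_choice)
 have r1: "- int r - 1 = - 1 - int r" by simp
 have "w 0 : cyc F r 0 0" using wF[of 0] yF[of 0] dw0 by (intro cyclesI) (simp_all add: r1)
 from fib_wiso_surj[OF p(2) f(1,3) this] obtain s where "s : cyc E r 0 0" "Map p 0 s = w 0" by blast
 thus "\<exists>s. ?P 0 s" using cyclesD[of s E "Suc r" 0 0] unfolding t by (intro exI[of _ s]) (simp add: r1)
next
 fix s j assume s: "?P j s"
 let ?p = "- int r - 1 - int j"
 note sc = Fl_car[OF conjunct1[OF s] E]
 \<comment> \<open>The lifting property is applied to the boundary of s_j at filtration -r - 1 - j,
   with -w_(j+1) as the second datum: p(ds_j) - d(-w_(j+1)) equals y_(j+1), one filtration step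
   lower. Subtracting the resulting a from s_j gives s_(j+1).\<close>
 have x: "Df E 0 s : cyc E r ?p (0+1)" using s d_simps(6)[OF E sc] E by (intro cyclesI) simp_all
 have pr: "?p + int r = - 1 - int j" by simp
 have y': "-[F,0] w (Suc j) : Fl F (?p + int r) 0" unfolding pr using Fl_neg[OF F wF[of "Suc j"]] by simp
 have "Map p 1 (Df E 0 s) = y j" using map_d[OF p(2) sc] s td by simp
 hence "Map p (0+1) (Df E 0 s) -[F,0+1] Df F 0 (-[F,0] w (Suc j)) = y (Suc j)"
  using d_simps(4)[OF F wc] dwS ab_add_diff[OF F yc yc] F yc by (simp add: a_minus_def)
 hence "Map p (0+1) (Df E 0 s) -[F,0+1] Df F 0 (-[F,0] w (Suc j)) : Fl F (?p - 1) (0+1)"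
  using yF[of "Suc j"] by (simp add: algebra_simps)
 then obtain a where a: "a : Fl E (?p + int r) 0" "Map p 0 a = -[F,0] w (Suc j)" "Df E 0 s -[E,0+1] Df E 0 a : Fl E (?p - 1) (0+1)"
  using f(2) x y' unfolding ilift_def by blast
 note ac = Fl_car[OF a(1) E]
 have "?P (Suc j) (s -[E,0] a)"
 proof (intro conjI)
  show "s -[E,0] a : Fl E 0 0" by (rule Fl_minus[OF E conjunct1[OF s] Fl_le[OF a(1) _ E]]) simp
  show "Df E 0 (s -[E,0] a) : Fl E (- int r - 1 - int (Suc j)) 1"
   using a(3) d_simps(3)[OF E sc ac] by (simp add: algebra_simps)
  show "Map p 0 (s -[E,0] a) = \<tau> (Suc j)" using map_simps(3)[OF p(2) sc ac] a(2) s wc F unfolding t by (simp add: a_minus_def)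
 qed
 moreover have "(s -[E,0] a) -[E,0] s = -[E,0] a"
 proof -
  interpret A: abelian_group "Cx E 0" by (rule cx_ab[OF E])
  show ?thesis using sc ac by (simp add: A.minus_eq A.a_assoc A.a_lcomm[of s "-[E,0] a"] A.r_neg)
 qed
 ultimately show "\<exists>s'. ?P (Suc j) s' \<and> s' -[E,0] s : Fl E (- 1 - int j) 0"
  using Fl_neg[OF E a(1)] by (intro exI[of _ "s -[E,0] a"]) simp
qed
then obtain s where s: "\<And>j. s j : Fl E 0 0" "\<And>j. Df E 0 (s j) : Fl E (- int r - 1 - int j) 1" "\<And>j. Map p 0 (s j) = \<tau> j"
 "\<And>j. s (Suc j) -[E,0] s j : Fl E (- 1 - int j) 0" by blast
note sc = Fl_car[OF s(1) E]
\<comment> \<open>The lift of \<open>u_j\<close>. Each correction has filtration -j, as required for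
  \<open>u_j\<close>, although s_j itself stays only in \<open>F_0\<close>.\<close>
define a where "a j = (case j of 0 => s 0 | Suc i => s j -[E,0] s i)" for j
have aF: "a j : Fl E (- int j) 0" for j using s(1)[of 0] s(4) unfolding a_def by (cases j) (simp_all add: algebra_simps)
note ac = Fl_car[OF aF E] and dsc = Fl_car[OF s(2) E]
have pa: "Map p 0 (a j) = w j" for j
proof (cases j)
 case (Suc i)
 interpret A: abelian_group "Cx F 0" by (rule cx_ab[OF F])
 show ?thesis unfolding a_def Suc using map_simps(3)[OF p(2) sc sc] s(3) td[of i] wc[of "Suc i"]
  by (simp add: t A.minus_eq A.a_assoc A.a_lcomm[of "\<tau> i" "w (Suc i)"] A.r_neg)
qed (simp add: a_def s(3) t)
have pd: "Map p 1 (Df E 0 (s j)) = y j" for j using map_d[OF p(2) sc] s(3) td by simp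
let ?V = "FM R (UNIV :: nat set)"
obtain g0 where g0: "g0 : lin R ?V (Cx E 0)" "\<And>j. g0 (bas R j) = a j"
 using free_lin[OF cx_mod[OF E], of UNIV a 0] ac by blast
obtain g1 where g1: "g1 : lin R ?V (Cx E 1)" "\<And>j. g1 (bas R j) = Df E 0 (s j)"
 using free_lin[OF cx_mod[OF E], of UNIV "%j. Df E 0 (s j)" 1] dsc by blast
have T: "unit_T 0 = UNIV" "unit_T 1 = UNIV" "n \<noteq> 0 ==> n \<noteq> 1 ==> unit_T n = {}" for n unfolding unit_T_def by auto
have CK: "Cx ?K 0 = ?V" "Cx ?K 1 = ?V" using T by simp_all
have g: "Df E 0 (g0 c) = g1 (Df ?K 0 c)" if c: "c : carrier ?V" for c
 using c
proof (induction rule: free_induct)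
 case zero
 show ?case using lin_zero[OF mod_free cx_mod[OF E] g0(1)] lin_zero[OF mod_free cx_mod[OF E] g1(1)] d_zero[OF K', of 0] E CK by simp
next
 case (add b c)
 note l = d_simps(2)[OF K', of b 0 c, unfolded CK, OF add(1,2)] and dc = d_simps(1)[OF K', of _ 0, unfolded CK]
 show ?case unfolding lin_add[OF g0(1) add(1,2)] d_simps(2)[OF E lin_in[OF g0(1) add(1)] lin_in[OF g0(1) add(2)]] l add(3,4)
  using lin_add[OF g1(1), of "Df ?K 0 b" "Df ?K 0 c"] dc[OF add(1)] dc[OF add(2)] CK by simp
next
 case (basis z j)
 have bj: "bas R j : carrier ?V" for j by (rule bas_in) simp
 have "Df E 0 (a j) = g1 (Df ?K 0 (bas R j))"
 proof (cases j)
  case 0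
  show ?thesis unfolding 0 dK0 g1(2) by (simp add: a_def)
 next
  case (Suc i)
  show ?thesis unfolding Suc dKS CK lin_minus[OF mod_free cx_mod[OF E] g1(1) bj bj] g1(2)
   using d_simps(3)[OF E sc sc] by (simp add: a_def)
 qed
 moreover have "Df ?K 0 (z *[?V] bas R j) = z *[?V] Df ?K 0 (bas R j)"
  using d_simps(5)[OF K' bc(1) basis(1), of j] CK by simp
 moreover have "Df ?K 0 (bas R j) : carrier ?V" using d_simps(1)[OF K' bc(1), of j] CK by simp
 ultimately show ?case using lin_smult[OF g0(1) basis(1) bj] lin_smult[OF g1(1) basis(1)] d_simps(5)[OF E ac basis(1)] g0(2) by simp
qed
let ?m = "%n c. if n = 0 then g0 c else if n = 1 then g1 c else 0[E,n]"
note lc = lin_in[OF g0(1)] lin_in[OF g1(1)] and la = lin_add[OF g0(1)] lin_add[OF g1(1)]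
 and ls = lin_smult[OF g0(1)] lin_smult[OF g1(1)]
have m: "fmap R ?K E ?m"
proof (rule fmapI)
 fix n c assume c: "c : ?K$n"
 show "?m n c : E$n" using lc c T E by auto
 show "?m n (c +[?K,n] b) = ?m n c +[E,n] ?m n b" if "b : ?K$n" for b
  using la c that T E by (auto simp del: free_ops)
 show "?m n (z *[?K,n] c) = z *[E,n] ?m n c" if "z : carrier R" for z
  using ls c that T E by (auto simp del: free_ops)
 show "Df E n (?m n c) = ?m (n+1) (Df ?K n c)"
 proof -
  consider "n = 0" | "n = 1" | "n = -1" | "n \<noteq> 0" "n \<noteq> 1" "n+1 \<noteq> 0" "n+1 \<noteq> 1" by linarith
  thus ?thesis
  proof cases
   case 1
   thus ?thesis using g c T by simp
  next
   case 2
   have "c = \<one> *[?V] c" using module.smult_one[OF mod_free, of c UNIV] c T 2 by simp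
   have "Df E 1 (g1 c) = 0[E,2]"
   proof -
    have H: "submodule {y : E$1. Df E 1 y : {0[E,2]}} R (Cx E 1)"
     using sub_preim[OF cx_mod[OF E] cx_mod[OF E] d_lin[OF E, of 1], of "{0[E,2]}"]
      submoduleI'[OF cx_mod[OF E, of 2], of "{0[E,2]}"] E by simp
    have c': "c : carrier (FM R UNIV)" using c T 2 by simp
    show ?thesis using free_lin_mem[OF c' subset_UNIV cx_mod[OF E] H g1(1)] g1(2) d_simps(6)[OF E sc] dsc by simp
   qed
   thus ?thesis using 2 c by simp
  next
   case 3
   thus ?thesis using c T lin_zero[OF mod_free cx_mod[OF E] g0(1)] E by simp
  next
   case 4
   thus ?thesis using E by simp
  qed
 qed
next
 fix q n c assume "c : Fl ?K q n"
 hence c: "c : carrier (FM R (unit_F r q n))" by simp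
 have b: "b : Fl E q n" if "b : Fl E k n" "k \<le> q" for b k by (rule Fl_le[OF that E])
 consider "n = 0" | "n = 1" | "n \<noteq> 0" "n \<noteq> 1" by blast
 thus "?m n c : Fl E q n"
 proof cases
  case 1
  have "g0 (bas R t) : Fl E q 0" if "t : unit_F r q 0" for t
   using b[of "a t" "- int t"] aF[of t] that 1 unfolding g0(2) unit_F_def by simp
  from free_lin_mem[OF c[unfolded 1] subset_UNIV cx_mod[OF E] Fl_sub[OF E] g0(1) this] show ?thesis using 1 by simp
 next
  case 2
  have "g1 (bas R t) : Fl E q 1" if "t : unit_F r q 1" for t
   using b[of "Df E 0 (s t)" "- int r - 1 - int t"] s(2)[of t] that 2 unfolding g1(2) unit_F_def by simp
  from free_lin_mem[OF c[unfolded 2] subset_UNIV cx_mod[OF E] Fl_sub[OF E] g1(1) this] show ?thesis using 2 by simp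
 next
  case 3
  thus ?thesis using E by simp
 qed
qed
let ?h = "from_copy ?K E ?m"
have h: "?h : hom (Qu r) E" by (rule from_copy_hom[OF K O(1) m])
have "p \<star> ?h = v"
proof (rule Qu_ext[OF cmpI[OF h p(2)] v])
 fix n :: int and t assume n: "n = 0 \<or> n = 1"
 have b: "bas R t : ?K$n" using n bc by blast
 show "Map (p \<star> ?h) n (cd ?K n (bas R t)) = Map v n (cd ?K n (bas R t))"
  unfolding cmp_map[OF h cd_in[OF b]] from_copy_map[OF K b] using n pa[of t] pd[of t]
  unfolding w_def y_def u_def x_def by (auto simp: g0(2) g1(2))
qed
thus ?thesis using h by blast
qed

lemma Qu_cofibrant: "cofibrant FC Cof (Qu r)"
proof -
let ?i = "from_copy (ZC R) (Qu r) (%m c. 0[Qu r,m])"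
have i: "?i : hom (cpy (ZC R)) (Qu r)" by (rule zero_hom[OF copy_Ob[OF unit_cpx]])
have "?i : Cof" unfolding Cof_eq
proof (rule llpI[OF hom_arr[OF i]])
 fix p :: "('r, 'u) farrow" assume p: "p : TF"
 note ph = fib_hom[OF TF_Fib[OF p]]
 show "lifts FC ?i p"
 proof (rule FC.liftsI, unfold FC_simps, rule i, rule ph)
  fix u v assume u: "u : hom (cpy (ZC R)) (Src p)" and v: "v : hom (Qu r) (Tgt p)"
  obtain h where h: "h : hom (Qu r) (Src p)" "p \<star> h = v" using Qu_lift[OF p ph v] by blast
  have "h \<star> ?i = u" by (rule zero_ext[OF cmpI[OF i h(1)] u])
  thus "\<exists>h\<in>hom (Qu r) (Src p). h \<star> ?i = u \<and> p \<star> h = v" using h by blast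
 qed
qed
thus ?thesis unfolding cofibrant_def FC_simps using zero_initial i by blast
qed

lemma monoidal_model_FC: "monoidal_model_category (small_in U) FC W Cof Fib"
proof (intro monoidal_model_category.intro model_category_FC closed_symmetric_monoidal_FC monoidal_model_category_axioms.intro)
fix f g i j h
assume "f : Cof" "g : Cof" "is_pushout FC (Idt FC (Dom FC f) \<boxtimes> g) (f \<boxtimes> Idt FC (Dom FC g)) i j"
 "h : homset FC (Cod FC i) (Cod FC f \<otimes>\<^sub>o\<^bsub>FC\<^esub> Cod FC g)"
 "h \<star> i = f \<boxtimes> Idt FC (Cod FC g)" "h \<star> j = Idt FC (Cod FC f) \<boxtimes> g"
thus "h : Cof \<and> (f : W \<or> g : W --> h : W)" by (rule pushout_product)
next
obtain q where q: "q : hom (Qu r) I0" "wiso (Qu r) I0 q r"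
 "\<And>X. X : Ob ==> wiso (tn (Qu r) X) X (lu X \<star> (q \<boxtimes> Idt FC X)) r" using unit_replacement by blast
have "lu X \<star> (q \<boxtimes> Idt FC X) : W" if X: "X : Ob" for X
 using weak_iff[OF cmpI[OF tarrI[OF q(1) idI[OF X]] lu_hom[OF X]]] q(3)[OF X] by blast
moreover have "q : W" using weak_iff[OF q(1)] q(2) by blast
moreover have "Qu r : Obj FC" using unit_cpx by simp
moreover have "q : homset FC (Qu r) \<I>\<^bsub>FC\<^esub>" using q(1) unfolding FC_tensor FC_simps .
ultimately show "\<exists>Q\<in>Obj FC. \<exists>q\<in>homset FC Q \<I>\<^bsub>FC\<^esub>. cofibrant FC Cof Q \<and> q : W \<and>
  (\<forall>X\<in>Obj FC. cofibrant FC Cof X --> \<l>\<^bsub>FC\<^esub> X \<star> (q \<boxtimes> Idt FC X) : W)"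
 using Qu_cofibrant unfolding FC_simps by blast
qed

end

theorem theorem2:
  fixes R :: "('r, 'm) ring_scheme" and r :: nat and S :: "nat set"
  assumes "cring R"
    and "universe TYPE('u)" and "small_in TYPE('u) (carrier R)"
    and "S \<subseteq> {0..r}" and "r \<in> S"
  shows "monoidal_model_category (small_in TYPE('u) :: 'u set \<Rightarrow> bool)
    (filtered_category R :: (('r, 'u) fcomplex, ('r, 'u) farrow) monoidal_cat)
    (weak_equivalences R r) (cofibrations R r S) (fibrations R S)"
proof -
interpret cring R by fact
interpret fcm "TYPE('u)" R r S by unfold_locales (use assms in auto)
show ?thesis by (rule monoidal_model_FC)
qed

end
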